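(* Let $G$ be a locally compact group, $\mathcal{H}$ a Hilbert space and $\pi:G\to\mathcal{U}(\mathcal{H})$ a strongly continuous unitary representation. If $\mu\in\mathrm{M}(G)$, then $$\Gamma_\pi(\mu)=\int_G\pi(s)\otimes\pi(s)^*\,d\mu(s)$$ defines an element of $\mathcal{B}(\mathcal{H})\otimes^{eh}\mathcal{B}(\mathcal{H})$, where the integral converges in the weak* topology, i.e. for each $x\in\mathcal{B}(\mathcal{H})_*\otimes^h\mathcal{B}(\mathcal{H})_*$, $$\langle\Gamma_\pi(\mu),x\rangle=\int_G\langle\pi(s)\otimes\pi(s)^*,x\rangle\,d\mu(s).$$ Moreover: (i) $\Gamma_\pi:\mathrm{M}(G)\to\mathcal{B}(\mathcal{H})\otimes^{eh}\mathcal{B}(\mathcal{H})$ is a contractive algebra homomorphism whose range is contained in the algebra $\mathrm{M}^*_\pi\otimes^{eh}\mathrm{M}^*_\pi$. (ii) $\Gamma_\pi(\mathrm{L}^1(G))\subset\mathrm{C}^*_\pi\otimes^{eh}\mathrm{C}^*_\pi$. (iii) $\Gamma_\pi(\ell^1(G))\subset\mathrm{D}^*_\pi\otimes^h\mathrm{D}^*_\pi$. (iv) If $\pi$ is norm continuous, then $\Gamma_\pi(\mathrm{M}(G))\subset\mathrm{D}^*_\pi\otimes^h\mathrm{D}^*_\pi$.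
   Context: $\mathcal{U}(\mathcal{H})$ is the unitary group of $\mathcal{B}(\mathcal{H})$; $\pi$ is norm continuous if it is continuous for the operator norm topology on $\mathcal{U}(\mathcal{H})$. $\mathrm{M}(G)$ is the Banach algebra (under convolution, with total variation norm) of bounded complex regular Borel measures on $G$, i.e. the dual of $\mathcal{C}_0(G)$; $\mathrm{L}^1(G)$ is identified with the ideal of measures absolutely continuous with respect to left Haar measure, and $\ell^1(G)$ with the closed subspace generated by the Dirac measures $\delta_s$, $s\in G$. For $\mu\in\mathrm{M}(G)$, $\pi_1(\mu)=\int_G\pi(s)\,d\mu(s)\in\mathcal{B}(\mathcal{H})$ (weak* convergent integral). $\mathrm{M}^*_\pi$, $\mathrm{C}^*_\pi$, $\mathrm{D}^*_\pi$ denote the norm closures in $\mathcal{B}(\mathcal{H})$ of $\pi_1(\mathrm{M}(G))$, $\pi_1(\mathrm{L}^1(G))$, $\pi_1(\ell^1(G))$ respectively; these are C*-algebras. For closed subspaces $\mathcal{V},\mathcal{W}$ of $\mathcal{B}(\mathcal{H})$, the extended Haagerup tensor product $\mathcal{V}\otimes^{eh}\mathcal{W}$ is the space of formal series $T=\sum_{i\in I}v_i\otimes w_i$ with $v_i\in\mathcal{V}$, $w_i\in\mathcal{W}$, such that $\sum_i v_iv_i^*$ and $\sum_i w_i^*w_i$ converge weak* in $\mathcal{B}(\mathcal{H})$; two series are identified if they define the same map $x\mapsto\sum_i v_ixw_i$ on $\mathcal{B}(\mathcal{H})$. Norm: $\|T\|_{eh}=\inf\|\sum_i v_iv_i^*\|^{1/2}\|\sum_i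 w_i^*w_i\|^{1/2}$ over all representations of $T$. Elements are identified with the maps $x\mapsto\sum_i v_ixw_i$; in this way $\mathcal{B}(\mathcal{H})\otimes^{eh}\mathcal{B}(\mathcal{H})$ is identified isometrically with the space of normal completely bounded maps on $\mathcal{B}(\mathcal{H})$, and it is a Banach algebra under composition, $(a\otimes b)\circ(c\otimes d)=ac\otimes db$. The Haagerup tensor product $\mathcal{V}\otimes^h\mathcal{W}$ is the set of $T\in\mathcal{V}\otimes^{eh}\mathcal{W}$ admitting a representation $T=\sum_i v_i\otimes w_i$ ($v_i\in\mathcal{V}$, $w_i\in\mathcal{W}$) for which $\sum_i v_iv_i^*$ and $\sum_i w_i^*w_i$ converge in norm. The weak* topology on $\mathcal{B}(\mathcal{H})\otimes^{eh}\mathcal{B}(\mathcal{H})$ comes from the (standard) identification $\mathcal{B}(\mathcal{H})\otimes^{eh}\mathcal{B}(\mathcal{H})\cong(\mathcal{B}(\mathcal{H})_*\otimes^h\mathcal{B}(\mathcal{H})_* )^*$, where $\mathcal{B}(\mathcal{H})_*$ is the operator space predual and $\otimes^h$ is the operator space Haagerup tensor product, with pairing $\langle\sum_i v_i\otimes w_i,\omega\otimes\nu\rangle=\sum_i\omega(v_i)\nu(w_i)$. *)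

theory Defs
  imports "HOL-Analysis.Analysis"
begin

section \<open>Complex Hilbert spaces and bounded operators\<close>

text \<open>The inner product is linear in the first argument. The last axiom contains positivity and
  definiteness; completeness comes from the class \<^class>\<open>banach\<close>.\<close>

class complex_hilbert = banach +
  fixes scaleC :: "complex \<Rightarrow> 'a \<Rightarrow> 'a"
    and cinner :: "'a \<Rightarrow> 'a \<Rightarrow> complex"
  assumes scaleC_add_right: "scaleC c (x + y) = scaleC c x + scaleC c y"
    and scaleC_add_left: "scaleC (c + d) x = scaleC c x + scaleC d x"
    and scaleC_scaleC: "scaleC c (scaleC d x) = scaleC (c * d) x"
    and scaleC_of_real: "scaleC (complex_of_real r) x = scaleR r x"
    and cinner_add_left: "cinner (x + y) z = cinner x z + cinner y z"
    and cinner_scaleC_left: "cinner (scaleC c x) y = c * cinner x y"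
    and cinner_commute: "cinner y x = cnj (cinner x y)"
    and cinner_self: "cinner x x = complex_of_real ((norm x)\<^sup>2)"

instantiation complex :: complex_hilbert
begin

definition scaleC_complex :: "complex \<Rightarrow> complex \<Rightarrow> complex"
  where "scaleC_complex = (*)"

definition cinner_complex :: "complex \<Rightarrow> complex \<Rightarrow> complex"
  where "cinner_complex x y = x * cnj y"

instance
  by standard
    (simp_all add: scaleC_complex_def cinner_complex_def algebra_simps scaleR_conv_of_real
      flip: complex_norm_square)

end

lemma linear_scaleC: "linear (scaleC c :: 'h::complex_hilbert \<Rightarrow> 'h)"
  by (rule linearI)
    (simp_all add: scaleC_add_right scaleC_scaleC mult.commute flip: scaleC_of_real)

lemma norm_scaleC: "norm (scaleC c x) = norm c * norm (x :: 'h::complex_hilbert)"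
proof -
  have "complex_of_real ((norm (scaleC c x))\<^sup>2) = c * cinner x (scaleC c x)"
    by (metis cinner_self cinner_scaleC_left)
  also have "\<dots> = c * cnj (c * cinner x x)"
    by (metis cinner_commute cinner_scaleC_left)
  also have "\<dots> = complex_of_real ((norm c * norm x)\<^sup>2)"
    by (simp add: cinner_self power_mult_distrib complex_norm_square[symmetric] flip: mult.assoc)
  finally have "(norm (scaleC c x))\<^sup>2 = (norm c * norm x)\<^sup>2"
    using of_real_eq_iff by blast
  then show ?thesis
    by (simp add: power2_eq_iff_nonneg)
qed

lemma bounded_linear_scaleC: "bounded_linear (scaleC c :: 'h::complex_hilbert \<Rightarrow> 'h)"
  by (rule bounded_linear_intro[where K = "norm c"])
    (simp_all add: scaleC_add_right linear_scale[OF linear_scaleC] norm_scaleC mult.commute)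

text \<open>Elements of \<open>B(H)\<close> are the complex-linear elements of the library's type of bounded
  real-linear maps, with the operator norm inherited from there.\<close>

typedef (overloaded) 'h bop =
  "{T :: 'h::complex_hilbert \<Rightarrow>\<^sub>L 'h. \<forall>c x. blinfun_apply T (scaleC c x) = scaleC c (blinfun_apply T x)}"
  morphisms blinfun_of_bop bop_of_blinfun
  by (rule exI[of _ id_blinfun]) simp

setup_lifting type_definition_bop

lift_definition app :: "'h::complex_hilbert bop \<Rightarrow> 'h \<Rightarrow> 'h" is blinfun_apply .

instantiation bop :: (complex_hilbert) real_normed_algebra
begin

lift_definition zero_bop :: "'a bop" is 0
  by (simp add: linear_0[OF linear_scaleC])

lift_definition plus_bop :: "'a bop \<Rightarrow> 'a bop \<Rightarrow> 'a bop" is "(+)"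
  by (simp add: blinfun.add_left scaleC_add_right)

lift_definition minus_bop :: "'a bop \<Rightarrow> 'a bop \<Rightarrow> 'a bop" is "(-)"
  by (simp add: blinfun.diff_left linear_diff[OF linear_scaleC])

lift_definition uminus_bop :: "'a bop \<Rightarrow> 'a bop" is uminus
  by (simp add: blinfun.minus_left linear_neg[OF linear_scaleC])

lift_definition scaleR_bop :: "real \<Rightarrow> 'a bop \<Rightarrow> 'a bop" is scaleR
  by (simp add: blinfun.scaleR_left linear_scale[OF linear_scaleC])

lift_definition times_bop :: "'a bop \<Rightarrow> 'a bop \<Rightarrow> 'a bop" is blinfun_compose
  by simp

lift_definition norm_bop :: "'a bop \<Rightarrow> real" is norm .

definition dist_bop :: "'a bop \<Rightarrow> 'a bop \<Rightarrow> real"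
  where "dist_bop S T = norm (S - T)"

definition sgn_bop :: "'a bop \<Rightarrow> 'a bop"
  where "sgn_bop T = inverse (norm T) *\<^sub>R T"

definition uniformity_bop :: "('a bop \<times> 'a bop) filter"
  where "uniformity_bop = (INF e\<in>{0<..}. principal {(S, T). dist S T < e})"

definition open_bop :: "'a bop set \<Rightarrow> bool"
  where "open_bop U = (\<forall>S\<in>U. eventually (\<lambda>(S', T). S' = S \<longrightarrow> T \<in> U) uniformity)"

instance
proof
  fix a b c :: "'a bop" and r s :: real
  show "a + b + c = a + (b + c)" by transfer simp
  show "a + b = b + a" by transfer simp
  show "0 + a = a" by transfer simp
  show "- a + a = 0" by transfer simp
  show "a - b = a + - b" by transfer simp
  show "r *\<^sub>R (a + b) = r *\<^sub>R a + r *\<^sub>R b" by transfer (simp add: scaleR_add_right)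
  show "(r + s) *\<^sub>R a = r *\<^sub>R a + s *\<^sub>R a" by transfer (simp add: scaleR_add_left)
  show "r *\<^sub>R s *\<^sub>R a = (r * s) *\<^sub>R a" by transfer simp
  show "1 *\<^sub>R a = a" by transfer simp
  show "dist a b = norm (a - b)" by (rule dist_bop_def)
  show "sgn a = inverse (norm a) *\<^sub>R a" by (rule sgn_bop_def)
  show "uniformity = (INF e\<in>{0<..}. principal {(S, T :: 'a bop). dist S T < e})"
    by (rule uniformity_bop_def)
  show "open U = (\<forall>x\<in>U. \<forall>\<^sub>F (x', y) in uniformity. x' = x \<longrightarrow> y \<in> U)" for U :: "'a bop set"
    by (rule open_bop_def)
  show "(norm a = 0) = (a = 0)" by transfer simp
  show "norm (a + b) \<le> norm a + norm b" by transfer (rule norm_triangle_ineq)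
  show "norm (r *\<^sub>R a) = \<bar>r\<bar> * norm a" by transfer simp
  show "a * b * c = a * (b * c)" by transfer (auto intro: blinfun_eqI)
  show "(a + b) * c = a * c + b * c" by transfer (auto intro: blinfun_eqI simp: blinfun.add_left)
  show "a * (b + c) = a * b + a * c"
    by transfer (auto intro: blinfun_eqI simp: blinfun.add_left blinfun.add_right)
  show "r *\<^sub>R a * b = r *\<^sub>R (a * b)"
    by transfer (auto intro: blinfun_eqI simp: blinfun.scaleR_left)
  show "a * r *\<^sub>R b = r *\<^sub>R (a * b)"
    by transfer (auto intro: blinfun_eqI simp: blinfun.scaleR_left blinfun.scaleR_right)
  show "norm (a * b) \<le> norm a * norm b" by transfer (rule norm_blinfun_compose)
qed

end

text \<open>No \<open>ring_1\<close> instance is possible, since \<open>H = 0\<close> is allowed.\<close>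

instantiation bop :: (complex_hilbert) monoid_mult
begin

lift_definition one_bop :: "'a bop" is id_blinfun
  by simp

instance
proof
  fix a :: "'a bop"
  show "1 * a = a" by transfer (auto intro: blinfun_eqI)
  show "a * 1 = a" by transfer (auto intro: blinfun_eqI)
qed

end

lift_definition scaleC_bop :: "complex \<Rightarrow> 'h::complex_hilbert bop \<Rightarrow> 'h bop"
  is "\<lambda>c T. Blinfun (scaleC c) o\<^sub>L T"
  by (simp add: bounded_linear_Blinfun_apply[OF bounded_linear_scaleC] scaleC_scaleC mult.commute)

definition adj :: "'h::complex_hilbert bop \<Rightarrow> 'h bop"
  where "adj T = (THE S. \<forall>x y. cinner (app S x) y = cinner x (app T y))"

definition unitaries :: "'h::complex_hilbert bop set"
  where "unitaries = {U. adj U * U = 1 \<and> U * adj U = 1}"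


section \<open>The predual of \<open>B(H)\<close> and weak* convergent sums\<close>

definition predual :: "('h::complex_hilbert bop \<Rightarrow> complex) set"
  where "predual = {\<omega>. \<exists>\<xi> \<eta> :: nat \<Rightarrow> 'h.
    summable (\<lambda>n. (norm (\<xi> n))\<^sup>2) \<and> summable (\<lambda>n. (norm (\<eta> n))\<^sup>2) \<and>
    \<omega> = (\<lambda>T. \<Sum>n. cinner (app T (\<xi> n)) (\<eta> n))}"

definition weakstar_has_sum :: "('i \<Rightarrow> 'h::complex_hilbert bop) \<Rightarrow> 'h bop \<Rightarrow> 'i set \<Rightarrow> bool"
  where "weakstar_has_sum f a I \<longleftrightarrow> (\<forall>\<omega>\<in>predual. ((\<lambda>i. \<omega> (f i)) has_sum \<omega> a) I)"


section \<open>The (extended) Haagerup tensor product of subspaces of \<open>B(H)\<close>\<close>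

text \<open>A formal series \<open>\<Sum>i\<in>I. v i \<otimes> w i\<close> is identified with the map it defines on \<open>B(H)\<close>; the
  operators \<open>a\<close> and \<open>b\<close> are the sums of \<open>v i v i\<^sup>*\<close> and of \<open>w i\<^sup>* w i\<close>.

  Index sets are subsets of the type of vectors. This is no restriction: if the sum of the
  \<open>v i v i\<^sup>*\<close> converges weak*, then for each vector \<open>x\<close> at most countably many of the
  \<open>v i\<^sup>* x\<close> are nonzero, so that (if \<open>H \<noteq> 0\<close>) at most \<open>|H|\<close> of the \<open>v i\<close> are nonzero, and the
  other terms can be dropped without changing the sums.\<close>

definition eh_rep ::
  "'h::complex_hilbert bop set \<Rightarrow> 'h bop set \<Rightarrow> 'h set \<Rightarrow> ('h \<Rightarrow> 'h bop) \<Rightarrow> ('h \<Rightarrow> 'h bop) \<Rightarrow>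
    'h bop \<Rightarrow> 'h bop \<Rightarrow> ('h bop \<Rightarrow> 'h bop) \<Rightarrow> bool"
  where "eh_rep V W I v w a b T \<longleftrightarrow>
    (\<forall>i\<in>I. v i \<in> V \<and> w i \<in> W) \<and>
    weakstar_has_sum (\<lambda>i. v i * adj (v i)) a I \<and>
    weakstar_has_sum (\<lambda>i. adj (w i) * w i) b I \<and>
    (\<forall>x. weakstar_has_sum (\<lambda>i. v i * x * w i) (T x) I)"

definition ext_haagerup ::
  "'h::complex_hilbert bop set \<Rightarrow> 'h bop set \<Rightarrow> ('h bop \<Rightarrow> 'h bop) set"  (infixr "\<otimes>eh" 70)
  where "V \<otimes>eh W = {T. \<exists>I v w a b. eh_rep V W I v w a b T}"

definition haagerup ::
  "'h::complex_hilbert bop set \<Rightarrow> 'h bop set \<Rightarrow> ('h bop \<Rightarrow> 'h bop) set"  (infixr "\<otimes>h" 70)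
  where "V \<otimes>h W = {T. \<exists>I v w a b. eh_rep V W I v w a b T \<and>
    (\<lambda>i. v i * adj (v i)) summable_on I \<and> (\<lambda>i. adj (w i) * w i) summable_on I}"

definition eh_norm ::
  "'h::complex_hilbert bop set \<Rightarrow> 'h bop set \<Rightarrow> ('h bop \<Rightarrow> 'h bop) \<Rightarrow> real"
  where "eh_norm V W T =
    Inf {sqrt (norm a) * sqrt (norm b) | I v w a b. eh_rep V W I v w a b T}"

definition elem_tensor :: "'h::complex_hilbert bop \<Rightarrow> 'h bop \<Rightarrow> 'h bop \<Rightarrow> 'h bop"
  where "elem_tensor a b = (\<lambda>x. a * x * b)"


section \<open>The Haagerup tensor product of the operator space predual with itself\<close>

text \<open>The norm of the matrix \<open>a\<close> of operators \<open>X \<rightarrow> Y\<close>, acting from the \<open>\<ell>\<^sup>2\<close>-sum of copies of \<open>X\<close>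
  indexed by \<open>B\<close> to the \<open>\<ell>\<^sup>2\<close>-sum of copies of \<open>Y\<close> indexed by \<open>A\<close>.\<close>

definition mat_opnorm ::
  "'i set \<Rightarrow> 'j set \<Rightarrow> ('i \<Rightarrow> 'j \<Rightarrow> 'x::real_normed_vector \<Rightarrow> 'y::real_normed_vector) \<Rightarrow> real"
  where "mat_opnorm A B a =
    (SUP z\<in>{z. (\<Sum>j\<in>B. (norm (z j))\<^sup>2) \<le> 1}. sqrt (\<Sum>i\<in>A. (norm (\<Sum>j\<in>B. a i j (z j)))\<^sup>2))"

text \<open>The operator space structure of the predual: the norm of a matrix \<open>\<omega>\<close> of functionals with
  rows \<open>P\<close> and columns \<open>Q\<close> is the completely bounded norm of the map \<open>T \<mapsto> (\<omega> p q T)\<close> from \<open>B(H)\<close>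
  to the scalar \<open>P \<times> Q\<close>-matrices, that is, the supremum over \<open>m\<close> of the norms of its
  amplifications to \<open>m \<times> m\<close>-matrices over \<open>B(H)\<close>.\<close>

definition predual_mat_norm ::
  "'p set \<Rightarrow> 'q set \<Rightarrow> ('p \<Rightarrow> 'q \<Rightarrow> 'h::complex_hilbert bop \<Rightarrow> complex) \<Rightarrow> real"
  where "predual_mat_norm P Q \<omega> =
    (SUP (m, T)\<in>{(m :: nat, T :: nat \<Rightarrow> nat \<Rightarrow> 'h bop).
        mat_opnorm {..<m} {..<m} (\<lambda>i j. app (T i j)) \<le> 1}.
      mat_opnorm ({..<m} \<times> P) ({..<m} \<times> Q) (\<lambda>(i, p) (j, q) (z :: complex). \<omega> p q (T i j) * z))"

text \<open>An element of the algebraic tensor product \<open>B(H)\<^sub>* \<otimes> B(H)\<^sub>*\<close> is identified with the bilinear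
  form on \<open>B(H)\<close> that it defines (this is faithful since \<open>B(H)\<close> separates the points of the
  predual).\<close>

definition tensor_form ::
  "nat \<Rightarrow> (nat \<Rightarrow> 'h::complex_hilbert bop \<Rightarrow> complex) \<Rightarrow> (nat \<Rightarrow> 'h bop \<Rightarrow> complex) \<Rightarrow>
    'h bop \<Rightarrow> 'h bop \<Rightarrow> complex"
  where "tensor_form n \<omega> \<nu> = (\<lambda>S T. \<Sum>k<n. \<omega> k S * \<nu> k T)"

definition predual_tensors :: "('h::complex_hilbert bop \<Rightarrow> 'h bop \<Rightarrow> complex) set"
  where "predual_tensors =
    {tensor_form n \<omega> \<nu> | n \<omega> \<nu>. \<forall>k<n. \<omega> k \<in> predual \<and> \<nu> k \<in> predual}"

definition predual_haagerup_norm :: "('h::complex_hilbert bop \<Rightarrow> 'h bop \<Rightarrow> complex) \<Rightarrow> real"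
  where "predual_haagerup_norm u =
    Inf {predual_mat_norm {()} {..<n} (\<lambda>_ k. \<omega> k) * predual_mat_norm {..<n} {()} (\<lambda>k _. \<nu> k)
      | n \<omega> \<nu>. (\<forall>k<n. \<omega> k \<in> predual \<and> \<nu> k \<in> predual) \<and> u = tensor_form n \<omega> \<nu>}"

text \<open>The completion \<open>B(H)\<^sub>* \<otimes>\<^sup>h B(H)\<^sub>*\<close>: its elements are represented by the Cauchy sequences of
  algebraic tensors. Distinct sequences may represent the same element.\<close>

definition predual_haagerup :: "(nat \<Rightarrow> 'h::complex_hilbert bop \<Rightarrow> 'h bop \<Rightarrow> complex) set"
  where "predual_haagerup = {X. (\<forall>n. X n \<in> predual_tensors) \<and>
    (\<forall>e>0. \<exists>N. \<forall>m\<ge>N. \<forall>n\<ge>N. predual_haagerup_norm (\<lambda>S T. X m S T - X n S T) < e)}"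

text \<open>For \<open>u = \<Sum>k. \<omega> k \<otimes> \<nu> k\<close> the sum of the \<open>u (v i) (w i)\<close> is the sum over \<open>k\<close> and \<open>i\<close> of the
  \<open>\<omega> k (v i) \<nu> k (w i)\<close>. It does not depend on the representation of \<open>T\<close>.\<close>

definition tensor_pairing ::
  "('h::complex_hilbert bop \<Rightarrow> 'h bop) \<Rightarrow> ('h bop \<Rightarrow> 'h bop \<Rightarrow> complex) \<Rightarrow> complex"
  where "tensor_pairing T u =
    (THE z. \<exists>I v w a b. eh_rep UNIV UNIV I v w a b T \<and> ((\<lambda>i. u (v i) (w i)) has_sum z) I)"

text \<open>The extension by continuity to the completion.\<close>

definition eh_pairing ::
  "('h::complex_hilbert bop \<Rightarrow> 'h bop) \<Rightarrow> (nat \<Rightarrow> 'h bop \<Rightarrow> 'h bop \<Rightarrow> complex) \<Rightarrow> complex"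
  where "eh_pairing T X = lim (\<lambda>n. tensor_pairing T (X n))"


section \<open>Complex measures on a locally compact group\<close>

text \<open>Groups are written additively in order to use the library's topological groups; commutativity
  is not part of the class \<^class>\<open>topological_group_add\<close>.

  A complex Borel measure is a set function that vanishes, by convention, on the sets that are not
  Borel; hence equal measures are equal functions.\<close>

definition total_variation :: "('g::topological_space set \<Rightarrow> complex) \<Rightarrow> 'g set \<Rightarrow> ennreal"
  where "total_variation \<mu> E =
    (SUP P\<in>{P. finite P \<and> disjoint P \<and> P \<subseteq> sets borel \<and> \<Union>P = E}. \<Sum>A\<in>P. ennreal (norm (\<mu> A)))"

definition complex_measures :: "('g::topological_space set \<Rightarrow> complex) set"
  where "complex_measures = {\<mu>.
    (\<forall>E. E \<notin> sets borel \<longrightarrow> \<mu> E = 0) \<and>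
    (\<forall>A :: nat \<Rightarrow> 'g set. range A \<subseteq> sets borel \<longrightarrow> disjoint_family A \<longrightarrow>
      (\<lambda>n. \<mu> (A n)) sums \<mu> (\<Union>n. A n)) \<and>
    total_variation \<mu> UNIV < \<infinity> \<and>
    (\<forall>E\<in>sets borel. \<forall>e>0. \<exists>K U. compact K \<and> open U \<and> K \<subseteq> E \<and> E \<subseteq> U \<and>
      total_variation \<mu> (U - K) < ennreal e)}"

definition cm_norm :: "('g::topological_space set \<Rightarrow> complex) \<Rightarrow> real"
  where "cm_norm \<mu> = enn2real (total_variation \<mu> UNIV)"

text \<open>The positive part of the Jordan decomposition of a signed measure; the negative part is the
  positive part of \<open>- \<nu>\<close>.\<close>

definition pos_part :: "('g::topological_space set \<Rightarrow> real) \<Rightarrow> 'g measure"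
  where "pos_part \<nu> =
    measure_of UNIV (sets borel) (\<lambda>E. SUP F\<in>{F\<in>sets borel. F \<subseteq> E}. ennreal (\<nu> F))"

definition cm_integrable ::
  "('g::topological_space set \<Rightarrow> complex) \<Rightarrow> ('g \<Rightarrow> complex) \<Rightarrow> bool"
  where "cm_integrable \<mu> f \<longleftrightarrow>
    integrable (pos_part (\<lambda>E. Re (\<mu> E))) f \<and> integrable (pos_part (\<lambda>E. - Re (\<mu> E))) f \<and>
    integrable (pos_part (\<lambda>E. Im (\<mu> E))) f \<and> integrable (pos_part (\<lambda>E. - Im (\<mu> E))) f"

definition cm_integral ::
  "('g::topological_space set \<Rightarrow> complex) \<Rightarrow> ('g \<Rightarrow> complex) \<Rightarrow> complex"
  where "cm_integral \<mu> f =
    integral\<^sup>L (pos_part (\<lambda>E. Re (\<mu> E))) f - integral\<^sup>L (pos_part (\<lambda>E. - Re (\<mu> E))) f +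
    \<i> * (integral\<^sup>L (pos_part (\<lambda>E. Im (\<mu> E))) f - integral\<^sup>L (pos_part (\<lambda>E. - Im (\<mu> E))) f)"

definition has_cm_integral ::
  "('g::topological_space set \<Rightarrow> complex) \<Rightarrow> ('g \<Rightarrow> complex) \<Rightarrow> complex \<Rightarrow> bool"
  where "has_cm_integral \<mu> f z \<longleftrightarrow> cm_integrable \<mu> f \<and> cm_integral \<mu> f = z"

text \<open>\<open>(\<mu> * \<nu>)(E) = \<integral> \<nu>(s\<^sup>-\<^sup>1 E) d\<mu>(s)\<close>, the iterated integral of the indicator of \<open>E\<close> at \<open>s + t\<close>.
  The product of the Borel \<open>\<sigma>\<close>-algebras is avoided, since in general it is smaller than the Borel
  \<open>\<sigma>\<close>-algebra of the product.\<close>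

definition convolution ::
  "('g::topological_group_add set \<Rightarrow> complex) \<Rightarrow> ('g set \<Rightarrow> complex) \<Rightarrow> 'g set \<Rightarrow> complex"
  where "convolution \<mu> \<nu> E =
    (if E \<in> sets borel then cm_integral \<mu> (\<lambda>s. \<nu> {t. s + t \<in> E}) else 0)"

definition dirac :: "'g::topological_space \<Rightarrow> 'g set \<Rightarrow> complex"
  where "dirac s E = (if E \<in> sets borel \<and> s \<in> E then 1 else 0)"

definition left_haar :: "'g::topological_group_add measure \<Rightarrow> bool"
  where "left_haar h \<longleftrightarrow>
    sets h = sets borel \<and> emeasure h UNIV \<noteq> 0 \<and>
    (\<forall>s. \<forall>E\<in>sets borel. emeasure h ((+) s ` E) = emeasure h E) \<and>
    (\<forall>K. compact K \<longrightarrow> emeasure h K < \<infinity>) \<and>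
    (\<forall>E\<in>sets borel. emeasure h E = (INF U\<in>{U. open U \<and> E \<subseteq> U}. emeasure h U)) \<and>
    (\<forall>U. open U \<longrightarrow> emeasure h U = (SUP K\<in>{K. compact K \<and> K \<subseteq> U}. emeasure h K))"

text \<open>The choice of the left Haar measure is immaterial, by uniqueness up to a positive factor.\<close>

definition L1_measures :: "('g::topological_group_add set \<Rightarrow> complex) set"
  where "L1_measures = {\<mu>\<in>complex_measures.
    \<exists>h. left_haar h \<and> (\<forall>E\<in>sets borel. emeasure h E = 0 \<longrightarrow> \<mu> E = 0)}"

definition l1_measures :: "('g::topological_space set \<Rightarrow> complex) set"
  where "l1_measures = {\<mu>\<in>complex_measures. \<forall>e>0. \<exists>F (c :: 'g \<Rightarrow> complex). finite F \<and>
    cm_norm (\<lambda>E. \<mu> E - (\<Sum>s\<in>F. c s * dirac s E)) < e}"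


section \<open>Unitary representations\<close>

definition unitary_rep :: "('g::topological_group_add \<Rightarrow> 'h::complex_hilbert bop) \<Rightarrow> bool"
  where "unitary_rep \<pi> \<longleftrightarrow> range \<pi> \<subseteq> unitaries \<and> (\<forall>s t. \<pi> (s + t) = \<pi> s * \<pi> t)"

definition strongly_continuous :: "('g::topological_space \<Rightarrow> 'h::complex_hilbert bop) \<Rightarrow> bool"
  where "strongly_continuous \<pi> \<longleftrightarrow> (\<forall>x. continuous_on UNIV (\<lambda>s. app (\<pi> s) x))"

definition integrated_rep ::
  "('g::topological_space \<Rightarrow> 'h::complex_hilbert bop) \<Rightarrow> ('g set \<Rightarrow> complex) \<Rightarrow> 'h bop"
  where "integrated_rep \<pi> \<mu> =
    (THE T. \<forall>\<omega>\<in>predual. has_cm_integral \<mu> (\<lambda>s. \<omega> (\<pi> s)) (\<omega> T))"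

definition Mstar :: "('g::topological_group_add \<Rightarrow> 'h::complex_hilbert bop) \<Rightarrow> 'h bop set"
  where "Mstar \<pi> = closure (integrated_rep \<pi> ` complex_measures)"

definition Cstar :: "('g::topological_group_add \<Rightarrow> 'h::complex_hilbert bop) \<Rightarrow> 'h bop set"
  where "Cstar \<pi> = closure (integrated_rep \<pi> ` L1_measures)"

definition Dstar :: "('g::topological_group_add \<Rightarrow> 'h::complex_hilbert bop) \<Rightarrow> 'h bop set"
  where "Dstar \<pi> = closure (integrated_rep \<pi> ` l1_measures)"

text \<open>\<open>T\<close> is the weak* integral of \<open>\<pi>(s) \<otimes> \<pi>(s)\<^sup>*\<close> with respect to \<open>\<mu>\<close>.\<close>

definition is_Gamma_rep ::
  "('g::topological_group_add \<Rightarrow> 'h::complex_hilbert bop) \<Rightarrow> ('g set \<Rightarrow> complex) \<Rightarrow>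
    ('h bop \<Rightarrow> 'h bop) \<Rightarrow> bool"
  where "is_Gamma_rep \<pi> \<mu> T \<longleftrightarrow> T \<in> UNIV \<otimes>eh UNIV \<and>
    (\<forall>X\<in>predual_haagerup.
      has_cm_integral \<mu> (\<lambda>s. eh_pairing (elem_tensor (\<pi> s) (adj (\<pi> s))) X) (eh_pairing T X))"

definition Gamma_rep ::
  "('g::topological_group_add \<Rightarrow> 'h::complex_hilbert bop) \<Rightarrow> ('g set \<Rightarrow> complex) \<Rightarrow>
    'h bop \<Rightarrow> 'h bop"
  where "Gamma_rep \<pi> \<mu> = (THE T. is_Gamma_rep \<pi> \<mu> T)"

end

theory Submission
  imports Defs
begin

text \<open>Let \<open>\<tau>\<close> be the total variation of \<open>\<mu>\<close> and \<open>d\<mu> = h d\<tau>\<close> with \<open>|h| \<le> 1\<close>. For an orthonormal basis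
  \<open>E\<close> of \<open>L\<^sup>2(\<tau>)\<close>, Parseval's identity for the functions \<open>s \<mapsto> \<pi>(s)\<^sup>* \<xi>\<close> gives
  \<open>\<integral> \<pi>(s) x \<pi>(s)\<^sup>* d\<mu>(s) = \<Sum>e\<in>E. v e x w e\<close> with \<open>v e = \<integral> e(s) h(s) \<pi>(s) d\<tau>(s)\<close> and
  \<open>w e = \<integral> cnj (e(s)) \<pi>(s)\<^sup>* d\<tau>(s)\<close>, and the sums of \<open>v e (v e)\<^sup>*\<close> and of \<open>(w e)\<^sup>* w e\<close> are scalars
  \<open>\<le> \<parallel>\<mu>\<parallel>\<close>. Regularity of \<open>\<tau>\<close> is needed here, since \<open>H\<close> need not be separable. The operators \<open>v e\<close> and
  \<open>w e\<close> are integrals of \<open>\<pi>\<close> against measures that are absolutely continuous with respect to \<open>\<tau>\<close> and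
  to its image under inversion; inversion preserves the Haar null sets, which settles the case of
  \<open>L\<^sup>1(G)\<close>. If \<open>\<pi>\<close> is, in norm and off a set of small measure, close to a function with finitely many
  values \<open>\<pi>(y)\<close>, then \<open>v e\<close> and \<open>w e\<close> are norm limits of finite combinations of the \<open>\<pi>(y)\<close>, and both
  sums of squares converge in norm. This applies to \<open>\<mu>\<close> in \<open>\<ell>\<^sup>1(G)\<close>, and to every \<open>\<mu>\<close> if \<open>\<pi>\<close> is norm
  continuous.\<close>

text \<open>\<open>Gamma_rep\<close> is given by a definite description, so every claim passes
  through two facts: the map \<open>gamma_op \<mu>\<close>, defined by its sesquilinear forms, has
  the required pairings, and an element of the extended Haagerup tensor product is determined by its
  pairings, already by those that give its values at rank one operators. Linearity and
  multiplicativity are then read off from the forms, where no series occurs; the series over the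
  basis serves for the norm bound and for locating the factors. Parseval's identity takes from
  regularity only compact sets that carry almost all of \<tau>. This property,
  \<open>cm_tight\<close>, passes to sums, multiples and convolutions by short estimates, so
  \<open>Gamma_rep\<close> can be evaluated on them. Borel sets of the product of G with itself need
  not belong to the product \<sigma>-algebra, so Fubini's theorem is out of reach. It is replaced by
  semicontinuity, by induction over bounded Borel functions and, for Haar measure, by finite
  partitions. For the same kind of reason, vector-valued functions are integrated only
  weakly.\<close>

section \<open>Hilbert space and bounded operators\<close>

lemma cinner_add_right: "cinner x (y + z) = cinner x y + cinner (x :: 'h::complex_hilbert) z"
  by (metis cinner_add_left cinner_commute complex_cnj_add)

lemma cinner_scaleC_right: "cinner x (scaleC c y) = cnj c * cinner (x :: 'h::complex_hilbert) y"
  by (metis cinner_scaleC_left cinner_commute complex_cnj_mult)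

lemma cinner_scaleR_left: "cinner (r *\<^sub>R x) y = r *\<^sub>R cinner (x :: 'h::complex_hilbert) y"
  by (metis cinner_scaleC_left scaleC_of_real scaleR_conv_of_real)

lemma cinner_scaleR_right: "cinner x (r *\<^sub>R y) = r *\<^sub>R cinner (x :: 'h::complex_hilbert) y"
  by (metis cinner_scaleC_right scaleC_of_real scaleR_conv_of_real complex_cnj_complex_of_real)

lemma cinner_zero_left [simp]: "cinner 0 (y :: 'h::complex_hilbert) = 0"
  by (metis cinner_scaleR_left scaleR_zero_left)

lemma cinner_minus_left: "cinner (- x) y = - cinner (x :: 'h::complex_hilbert) y"
  using cinner_scaleR_left[of "-1" x y] by simp

lemma norm_add_sq:
  "(norm (x + y))\<^sup>2 = (norm x)\<^sup>2 + 2 * Re (cinner x y) + (norm (y :: 'h::complex_hilbert))\<^sup>2"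
proof -
  have "complex_of_real ((norm (x + y))\<^sup>2) = cinner x x + cinner x y + cnj (cinner x y) + cinner y y"
    by (metis (no_types, opaque_lifting) add.assoc cinner_self cinner_add_left cinner_add_right cinner_commute)
  then have "(norm (x + y))\<^sup>2 = Re (cinner x x + cinner x y + cnj (cinner x y) + cinner y y)"
    by (metis Re_complex_of_real)
  then show ?thesis
    by (simp add: cinner_self del: of_real_power)
qed

lemma cinner_cauchy_schwarz: "norm (cinner x y) \<le> norm x * norm (y :: 'h::complex_hilbert)"
proof (cases "y = 0")
  case True
  then show ?thesis
    by (metis cinner_zero_left cinner_commute complex_cnj_zero mult_zero_right norm_zero order_refl)
next
  case False
  \<comment> \<open>The vector \<open>scaleC t y\<close> is the orthogonal projection of
    \<open>x\<close> to the line of \<open>y\<close>.\<close>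
  define t where "t = cinner x y / complex_of_real ((norm y)\<^sup>2)"
  have "0 \<le> (norm (x + scaleC (- t) y))\<^sup>2" by simp
  also have "\<dots> = (norm x)\<^sup>2 + 2 * Re (cinner x (scaleC (- t) y)) + (norm (scaleC (- t) y))\<^sup>2"
    by (rule norm_add_sq)
  also have "(norm (scaleC (- t) y))\<^sup>2 = (norm (cinner x y))\<^sup>2 / (norm y)\<^sup>2"
    using False by (simp add: norm_scaleC t_def norm_divide power_mult_distrib power_divide
        norm_power power2_eq_square norm_mult)
  also have "cinner x (scaleC (- t) y) = - complex_of_real ((norm (cinner x y))\<^sup>2 / (norm y)\<^sup>2)"
    using complex_norm_square[of "cinner x y"]
    by (simp add: cinner_scaleC_right t_def mult.commute)
  finally have "(norm (cinner x y))\<^sup>2 / (norm y)\<^sup>2 \<le> (norm x)\<^sup>2"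
    by simp
  then have "(norm (cinner x y))\<^sup>2 \<le> (norm x * norm y)\<^sup>2"
    using False by (simp add: divide_le_eq power_mult_distrib)
  then show ?thesis
    by (meson mult_nonneg_nonneg norm_ge_zero power2_le_imp_le)
qed

interpretation cinner: bounded_bilinear "cinner :: 'h::complex_hilbert \<Rightarrow> 'h \<Rightarrow> complex"
  by standard
    (auto simp: cinner_add_left cinner_add_right cinner_scaleR_left cinner_scaleR_right
      intro!: exI[of _ 1] cinner_cauchy_schwarz)

interpretation scaleC: bounded_bilinear "scaleC :: complex \<Rightarrow> 'h::complex_hilbert \<Rightarrow> 'h"
proof
  fix r :: real and a :: complex and b :: 'h
  show "scaleC (r *\<^sub>R a) b = r *\<^sub>R scaleC a b"
    by (simp add: scaleR_conv_of_real scaleC_scaleC flip: scaleC_of_real)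
  show "\<exists>K. \<forall>a (b :: 'h). norm (scaleC a b) \<le> norm a * norm b * K"
    by (rule exI[of _ 1]) (simp add: norm_scaleC)
qed (simp_all add: scaleC_add_left scaleC_add_right linear_scale[OF linear_scaleC])

declare cinner.zero_right [simp] scaleC.zero_left [simp] scaleC.zero_right [simp]

lemma scaleC_one [simp]: "scaleC 1 x = (x :: 'h::complex_hilbert)"
  by (metis of_real_1 scaleC_of_real scaleR_one)

lemma cinner_ext: "(\<And>z. cinner x z = cinner y z) \<Longrightarrow> x = (y :: 'h::complex_hilbert)"
proof -
  assume a: "\<And>z. cinner x z = cinner y z"
  have "cinner (x - y) (x - y) = 0" by (simp add: cinner.diff_left a)
  then show "x = y" by (simp add: cinner_self)
qed

lemma norm_diff_sq:
  "(norm (x - y))\<^sup>2 = (norm x)\<^sup>2 - 2 * Re (cinner x y) + (norm (y :: 'h::complex_hilbert))\<^sup>2"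
  using norm_add_sq[of x "- y"] by (simp add: cinner.minus_right)

lemma norm_add_sq_le:
  "(norm (x + y))\<^sup>2 \<le> 2 * (norm x)\<^sup>2 + 2 * (norm (y :: 'a::real_normed_vector))\<^sup>2"
proof -
  have "(norm (x + y))\<^sup>2 \<le> (norm x + norm y)\<^sup>2"
    by (simp add: norm_triangle_ineq power_mono)
  also have "\<dots> \<le> 2 * (norm x)\<^sup>2 + 2 * (norm y)\<^sup>2"
    using sum_squares_bound[of "norm x" "norm y"] by (simp add: power2_sum)
  finally show ?thesis .
qed

text \<open>Testing with \<open>y = x\<close> bounds the square of the norm by
  \<open>C * norm x\<close>.\<close>

lemma norm_leI_cinner:
  assumes "\<And>y. norm (cinner x y) \<le> C * norm y" and "0 \<le> C"
  shows "norm (x :: 'h::complex_hilbert) \<le> C"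
proof (cases "x = 0")
  case False
  have "(norm x)\<^sup>2 \<le> C * norm x"
    using assms(1)[of x] by (simp add: cinner_self norm_power)
  then show ?thesis
    using False by (simp add: power2_eq_square)
qed (use assms in simp)

text \<open>The quadratic vanishes at 0, so 0 is a minimum and the derivative there is zero.\<close>

lemma real_quadratic_nonneg_imp_zero:
  fixes a b :: real
  assumes "\<And>t. 0 \<le> a * t\<^sup>2 + b * t" and "0 \<le> a"
  shows "b = 0"
proof (rule ccontr)
  assume "b \<noteq> 0"
  \<comment> \<open>The value at this \<open>t\<close> is \<open>- t\<^sup>2\<close>. The
    denominator \<open>a + 1\<close>, in place of \<open>2 * a\<close>, covers the case
    \<open>a = 0\<close>.\<close>
  define t where "t = - b / (a + 1)"
  have b: "b = - ((a + 1) * t)"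
    using \<open>0 \<le> a\<close> by (simp add: t_def)
  then have "t \<noteq> 0" using \<open>b \<noteq> 0\<close> by auto
  have "a * t\<^sup>2 + b * t = - (t\<^sup>2)"
    by (simp add: b power2_eq_square algebra_simps)
  then show False
    using assms(1)[of t] \<open>t \<noteq> 0\<close> by simp
qed

text \<open>The representing vector minimizes \<open>\<parallel>y\<parallel>\<^sup>2 - 2 Re (\<phi> y)\<close>; minimizing sequences are Cauchy by
  the parallelogram law.\<close>

lemma riesz_representation:
  fixes \<phi> :: "'h::complex_hilbert \<Rightarrow> complex"
  assumes add: "\<And>x y. \<phi> (x + y) = \<phi> x + \<phi> y"
    and scale: "\<And>c x. \<phi> (scaleC c x) = c * \<phi> x"
    and bound: "\<And>x. norm (\<phi> x) \<le> C * norm x"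
  obtains y where "\<And>x. \<phi> x = cinner x y"
proof -
  have scR: "\<phi> (r *\<^sub>R x) = r *\<^sub>R \<phi> x" for r x
    by (metis scale scaleC_of_real scaleR_conv_of_real)
  interpret bounded_linear \<phi>
    by (rule bounded_linear_intro[where K = C]) (auto simp: add scR bound mult.commute)
  define J where "J y = (norm y)\<^sup>2 - 2 * Re (\<phi> y)" for y
  have J_lower: "- C\<^sup>2 \<le> J y" for y
  proof -
    have "Re (\<phi> y) \<le> C * norm y"
      using bound[of y] complex_Re_le_cmod order_trans by blast
    moreover have "0 \<le> (norm y - C)\<^sup>2" by simp
    ultimately show ?thesis
      by (simp add: J_def power2_diff mult.commute)
  qed
  then have bdd: "bdd_below (range J)"
    by (auto intro!: bdd_belowI)
  define m where "m = (INF y. J y)"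
  have m_le: "m \<le> J y" for y
    unfolding m_def by (rule cINF_lower[OF bdd]) simp
  have "\<exists>y. J y < m + inverse (real (Suc n))" for n
    using cInf_lessD[of "range J" "m + inverse (real (Suc n))"] by (auto simp: m_def)
  then obtain Y where Y: "\<And>n. J (Y n) < m + inverse (real (Suc n))"
    by metis
  have par: "(norm (y - z))\<^sup>2 \<le> 2 * (J y - m) + 2 * (J z - m)" for y z
  proof -
    have "Re (\<phi> ((1/2) *\<^sub>R (y + z))) = (Re (\<phi> y) + Re (\<phi> z)) / 2"
      unfolding scR add by simp
    moreover have "(norm ((1/2) *\<^sub>R (y + z)))\<^sup>2 = (norm (y + z))\<^sup>2 / 4"
      by (simp add: power_divide del: scaleR_add_right)
    ultimately have "4 * J ((1/2) *\<^sub>R (y + z)) + (norm (y - z))\<^sup>2 = 2 * J y + 2 * J z"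
      unfolding J_def norm_diff_sq norm_add_sq by argo
    then show ?thesis
      using m_le[of "(1/2) *\<^sub>R (y + z)"] by simp
  qed
  have "Cauchy Y"
  proof (rule metric_CauchyI)
    fix e :: real assume "0 < e"
    obtain N where N: "inverse (real (Suc N)) < e\<^sup>2 / 4"
      using reals_Archimedean[of "e\<^sup>2 / 4"] \<open>0 < e\<close> by auto
    have *: "J (Y n) - m < e\<^sup>2 / 4" if "N \<le> n" for n
    proof -
      have "inverse (real (Suc n)) \<le> inverse (real (Suc N))"
        using that by (intro le_imp_inverse_le) auto
      then show ?thesis using Y[of n] N by linarith
    qed
    have "dist (Y i) (Y j) < e" if "N \<le> i" "N \<le> j" for i j
    proof -
      have "(norm (Y i - Y j))\<^sup>2 < e\<^sup>2"
        using par[of "Y i" "Y j"] *[OF that(1)] *[OF that(2)] by argo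
      then show ?thesis
        using \<open>0 < e\<close> by (simp add: dist_norm power_less_imp_less_base)
    qed
    then show "\<exists>M. \<forall>i\<ge>M. \<forall>j\<ge>M. dist (Y i) (Y j) < e" by blast
  qed
  then obtain y where y: "Y \<longlonglongrightarrow> y"
    using Cauchy_convergent_iff convergent_def by blast
  have "(\<lambda>n. J (Y n)) \<longlonglongrightarrow> J y"
    unfolding J_def by (intro tendsto_diff tendsto_mult tendsto_power tendsto_norm tendsto_Re tendsto_const tendsto y)
  moreover have "(\<lambda>n. m + inverse (real (Suc n))) \<longlonglongrightarrow> m + 0"
    by (intro tendsto_add tendsto_const LIMSEQ_inverse_real_of_nat)
  ultimately have "J y \<le> m + 0"
    by (rule LIMSEQ_le) (use Y less_imp_le in blast)
  then have min: "J y \<le> J z" for z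
    using m_le[of z] by linarith
  \<comment> \<open>First variation of \<open>J\<close> at its minimum \<open>y\<close> in the
    direction \<open>x\<close>. Only real multiples of \<open>x\<close> are used, which yields the
    real parts.\<close>
  have re: "Re (cinner x y) = Re (\<phi> x)" for x
  proof -
    have "0 \<le> (norm x)\<^sup>2 * t\<^sup>2 + (2 * Re (cinner x y) - 2 * Re (\<phi> x)) * t" for t
    proof -
      have "J (t *\<^sub>R x + y) = (norm x)\<^sup>2 * t\<^sup>2 + (2 * Re (cinner x y) - 2 * Re (\<phi> x)) * t + J y"
        unfolding J_def norm_add_sq
        by (simp add: power_mult_distrib add scR cinner_scaleR_left algebra_simps)
      then show ?thesis using min[of "t *\<^sub>R x + y"] by linarith
    qed
    then have "2 * Re (cinner x y) - 2 * Re (\<phi> x) = 0"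
      by (rule real_quadratic_nonneg_imp_zero) simp
    then show ?thesis by simp
  qed
  \<comment> \<open>The imaginary part at \<open>x\<close> is, up to sign, the real part at
    \<open>scaleC \<i> x\<close>.\<close>
  have "Im (cinner x y) = Im (\<phi> x)" for x
    using re[of "scaleC \<i> x"] by (simp add: assms(2) cinner_scaleC_left)
  then have "\<phi> x = cinner x y" for x
    by (simp add: complex_eq_iff re)
  then show thesis by (rule that)
qed

section \<open>Bounded operators and their adjoints\<close>

interpretation app: bounded_bilinear "app :: 'h::complex_hilbert bop \<Rightarrow> 'h \<Rightarrow> 'h"
proof
  show "\<exists>K. \<forall>T (x :: 'h). norm (app T x) \<le> norm T * norm x * K"
    by (rule exI[of _ 1], transfer) (simp add: norm_blinfun)
qed (transfer; simp add: blinfun.bilinear_simps)+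

declare app.zero_left [simp] app.zero_right [simp]

lemma norm_app: "norm (app T x) \<le> norm T * norm x"
  by transfer (rule norm_blinfun)

lemma app_scaleC [simp]: "app T (scaleC c x) = scaleC c (app T x)"
  by transfer simp

lemma app_times [simp]: "app (S * T) x = app S (app T x)"
  by transfer simp

lemma app_one [simp]: "app 1 x = x"
  by transfer simp

lemma app_scaleC_bop [simp]: "app (scaleC_bop c T) x = scaleC c (app T x)"
  by transfer (simp add: bounded_linear_Blinfun_apply[OF bounded_linear_scaleC])

lemma bop_eqI: "(\<And>x. app S x = app T x) \<Longrightarrow> S = T"
  by transfer (rule blinfun_eqI)

lemma bop_eqI_cinner: "(\<And>x y. cinner (app S x) y = cinner (app T x) y) \<Longrightarrow> S = T"
  by (rule bop_eqI, rule cinner_ext)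

lemma norm_bop_leI: "0 \<le> C \<Longrightarrow> (\<And>x. norm (app T x) \<le> C * norm x) \<Longrightarrow> norm T \<le> C"
  by transfer (rule norm_blinfun_bound)

lemma ex_bop:
  assumes "\<And>x y. f (x + y) = f x + f y" "\<And>c x. f (scaleC c x) = scaleC c (f x)"
    and "\<And>x. norm (f x) \<le> C * norm x"
  shows "\<exists>T. app T = (f :: 'h::complex_hilbert \<Rightarrow> 'h)"
proof -
  have "bounded_linear f"
    by (rule bounded_linear_intro[where K = C])
      (use assms in \<open>simp_all add: mult.commute flip: scaleC_of_real\<close>)
  then have "app (bop_of_blinfun (Blinfun f)) = f"
    unfolding app.rep_eq
    by (subst bop_of_blinfun_inverse) (auto simp: bounded_linear_Blinfun_apply assms(2))
  then show ?thesis by blast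
qed

text \<open>For fixed \<open>x\<close> the conjugate of \<open>B x\<close> is a bounded linear
  functional, represented by a vector that depends linearly on \<open>x\<close>. Adjoints and the
  operators \<open>gamma_op\<close> are obtained in this way.\<close>

lemma ex_bop_sesquilinear:
  fixes B :: "'h::complex_hilbert \<Rightarrow> 'h \<Rightarrow> complex"
  assumes "\<And>x x' y. B (x + x') y = B x y + B x' y" "\<And>c x y. B (scaleC c x) y = c * B x y"
    and "\<And>x y y'. B x (y + y') = B x y + B x y'" "\<And>c x y. B x (scaleC c y) = cnj c * B x y"
    and bound: "\<And>x y. norm (B x y) \<le> C * norm x * norm y" and "0 \<le> C"
  obtains T where "\<And>x y. cinner (app T x) y = B x y" "norm T \<le> C"
proof -
  have "\<exists>z. \<forall>y. cinner z y = B x y" for x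
  proof -
    obtain z where "\<And>y. cnj (B x y) = cinner y z"
      by (rule riesz_representation[of "\<lambda>y. cnj (B x y)" "C * norm x"]) (auto simp: assms)
    then have "\<forall>y. cinner z y = B x y"
      by (metis cinner_commute complex_cnj_cnj)
    then show ?thesis by blast
  qed
  then obtain f where f: "\<And>x y. cinner (f x) y = B x y" by metis
  have nf: "norm (f x) \<le> C * norm x" for x
    by (rule norm_leI_cinner) (auto simp: f bound \<open>0 \<le> C\<close>)
  have "\<exists>T. app T = f"
    by (rule ex_bop[OF _ _ nf]; rule cinner_ext)
      (simp_all add: f assms cinner_add_left cinner_scaleC_left)
  then obtain T where "app T = f" by blast
  then show thesis
    using that[of T] f nf norm_bop_leI[OF \<open>0 \<le> C\<close>, of T] by auto
qed

lemma cinner_adj_left: "cinner (app (adj T) x) y = cinner x (app T y)"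
proof -
  obtain S where S: "\<And>x y. cinner (app S x) y = cinner x (app T y)"
  proof (rule ex_bop_sesquilinear[of "\<lambda>x y. cinner x (app T y)" "norm T"])
    show "norm (cinner x (app T y)) \<le> norm T * norm x * norm y" for x y
      using cinner_cauchy_schwarz[of x "app T y"] mult_left_mono[OF norm_app[of T y], of "norm x"]
      by (simp add: mult_ac)
  qed (auto simp: cinner_add_left cinner_add_right cinner_scaleC_left cinner_scaleC_right app.add_right)
  have "adj T = S"
    unfolding adj_def
    by (rule the_equality) (auto intro!: bop_eqI_cinner simp: S)
  then show ?thesis using S by simp
qed

lemma cinner_adj_right: "cinner x (app (adj T) y) = cinner (app T x) y"
  using cinner_adj_left[of T y x] cinner_commute[of "app (adj T) y" x] cinner_commute[of y "app T x"]
  by simp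

lemma adj_eqI: "(\<And>x y. cinner (app S x) y = cinner x (app T y)) \<Longrightarrow> adj T = S"
  by (intro bop_eqI_cinner) (simp add: cinner_adj_left)

lemma adj_adj [simp]: "adj (adj T) = T"
  by (rule adj_eqI) (simp add: cinner_adj_right)

lemma adj_zero [simp]: "adj 0 = 0"
  by (rule adj_eqI) simp

lemma ex_rank_one: "\<exists>T. \<forall>z. app T z = scaleC (cinner z y) (x :: 'h::complex_hilbert)"
proof -
  have "\<exists>T. app T = (\<lambda>z. scaleC (cinner z y) x)"
  proof (rule ex_bop)
    show "norm (scaleC (cinner z y) x) \<le> (norm y * norm x) * norm z" for z
      using mult_right_mono[OF cinner_cauchy_schwarz[of z y], of "norm x"]
      by (simp add: norm_scaleC mult_ac)
  qed (simp_all add: cinner_add_left scaleC_add_left cinner_scaleC_left scaleC_scaleC)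
  then show ?thesis by (metis)
qed

definition rank_one :: "'h::complex_hilbert \<Rightarrow> 'h \<Rightarrow> 'h bop"
  where "rank_one x y = (SOME T. \<forall>z. app T z = scaleC (cinner z y) x)"

lemma app_rank_one [simp]: "app (rank_one x y) z = scaleC (cinner z y) x"
  unfolding rank_one_def using someI_ex[OF ex_rank_one[of y x], THEN spec] .

section \<open>Finite orthonormal systems and projections\<close>

definition orthonormal :: "'h::complex_hilbert set \<Rightarrow> bool"
  where "orthonormal E \<longleftrightarrow> (\<forall>e\<in>E. \<forall>f\<in>E. cinner e f = (if e = f then 1 else 0))"

definition proj :: "'h::complex_hilbert set \<Rightarrow> 'h \<Rightarrow> 'h"
  where "proj E x = (\<Sum>e\<in>E. scaleC (cinner x e) e)"

lemma proj_diff: "proj E (x - y) = proj E x - proj E y"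
  by (simp add: proj_def cinner.diff_left scaleC.diff_left sum_subtractf)

lemma cinner_proj:
  assumes "finite E" "orthonormal E" "e \<in> E"
  shows "cinner (proj E x) e = cinner x e"
proof -
  have "cinner (proj E x) e = (\<Sum>f\<in>E. cinner x f * cinner f e)"
    by (simp add: proj_def cinner.sum_left cinner_scaleC_left)
  also have "\<dots> = (\<Sum>f\<in>E. if f = e then cinner x f else 0)"
    using assms by (intro sum.cong) (auto simp: orthonormal_def)
  finally show ?thesis using assms by simp
qed

text \<open>The difference is orthogonal to \<open>proj E x\<close>, so Pythagoras applies.\<close>

lemma norm_diff_proj_le:
  assumes "finite E" "orthonormal E"
  shows "norm (x - proj E x) \<le> norm x"
proof -
  have "cinner (x - proj E x) (proj E x) = 0"
    by (subst (2) proj_def)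
      (simp add: cinner.sum_right cinner_scaleC_right cinner.diff_left cinner_proj[OF assms])
  then have "(norm ((x - proj E x) + proj E x))\<^sup>2 = (norm (x - proj E x))\<^sup>2 + (norm (proj E x))\<^sup>2"
    unfolding norm_add_sq by simp
  then have "(norm (x - proj E x))\<^sup>2 \<le> (norm x)\<^sup>2" by simp
  then show ?thesis by (rule power2_le_imp_le) simp
qed

text \<open>Gram-Schmidt. The equation \<open>proj E x = x\<close> expresses that \<open>x\<close>
  lies in the span of \<open>E\<close>.\<close>

lemma ex_orthonormal_span:
  assumes "finite S"
  shows "\<exists>E. finite E \<and> orthonormal E \<and> (\<forall>x\<in>S. proj E x = (x :: 'h::complex_hilbert))"
  using assms
proof (induction S)
  case empty
  show ?case by (rule exI[of _ "{}"]) (simp add: orthonormal_def)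
next
  case (insert x S)
  then obtain E where E: "finite E" "orthonormal E" "\<forall>x\<in>S. proj E x = x" by blast
  \<comment> \<open>The component of \<open>x\<close> orthogonal to \<open>E\<close>; if it is
    nonzero, its normalization is the new vector.\<close>
  define r where "r = x - proj E x"
  show ?case
  proof (cases "r = 0")
    case True
    then show ?thesis using E by (intro exI[of _ E]) (simp add: r_def)
  next
    case False
    define u where "u = scaleR (inverse (norm r)) r"
    have r0: "cinner r e = 0" if "e \<in> E" for e
      using that by (simp add: r_def cinner.diff_left cinner_proj[OF E(1,2)])
    then have u0: "cinner u e = 0" if "e \<in> E" for e
      using that by (simp add: u_def cinner_scaleR_left)
    have u0': "cinner e u = 0" if "e \<in> E" for e
      by (subst cinner_commute) (simp add: u0 that)
    have uu: "cinner u u = 1"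
      using False by (simp add: u_def cinner_self)
    have "u \<notin> E" using u0 uu by auto
    have p: "proj (insert u E) y = scaleC (cinner y u) u + proj E y" for y
      using \<open>u \<notin> E\<close> E(1) by (simp add: proj_def)
    have yu: "cinner y u = 0" if "y \<in> S" for y
    proof -
      have "cinner (proj E y) u = 0"
        by (simp add: proj_def cinner.sum_left cinner_scaleC_left u0')
      then show ?thesis using E(3) that by simp
    qed
    have S: "proj (insert u E) y = y" if "y \<in> S" for y
      using that E(3) by (simp add: p yu)
    have "cinner (proj E x) u = 0"
      by (simp add: proj_def cinner.sum_left cinner_scaleC_left u0')
    then have "cinner x u = cinner r u"
      by (simp add: r_def cinner.diff_left)
    also have "\<dots> = norm r"
      using False by (simp add: u_def cinner_scaleR_right cinner_self scaleR_conv_of_real power2_eq_square)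
    finally have "scaleC (cinner x u) u = r"
      using False by (simp add: scaleC_of_real u_def)
    then have "proj (insert u E) x = x"
      by (simp add: p r_def)
    moreover have "orthonormal (insert u E)"
      unfolding orthonormal_def
      using E(2)[unfolded orthonormal_def] u0 u0' uu \<open>u \<notin> E\<close> by force
    ultimately show ?thesis
      using S E(1) by (intro exI[of _ "insert u E"]) auto
  qed
qed

section \<open>Weak* sums\<close>

text \<open>The summable bounds \<open>c k\<close> make the double family absolutely summable over
  the product, so both iterated sums equal the sum over the product. In the applications
  \<open>k\<close> runs through the vectors that represent normal functionals.\<close>

lemma has_sum_interchange:
  fixes g :: "'i \<Rightarrow> 'k \<Rightarrow> complex"
  assumes bound: "\<And>F k. finite F \<Longrightarrow> F \<subseteq> I \<Longrightarrow> k \<in> K \<Longrightarrow> (\<Sum>i\<in>F. norm (g i k)) \<le> c k"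
    and c: "c summable_on K"
    and col: "\<And>k. k \<in> K \<Longrightarrow> ((\<lambda>i. g i k) has_sum G k) I"
    and row: "\<And>i. i \<in> I \<Longrightarrow> ((\<lambda>k. g i k) has_sum H i) K"
  obtains S where "(H has_sum S) I" "(G has_sum S) K"
proof -
  have col_abs: "(\<lambda>i. norm (g i k)) summable_on I" if "k \<in> K" for k
    unfolding abs_summable_iff_bdd_above
    by (rule bdd_aboveI2[where M = "c k"]) (use bound that in auto)
  have "(\<lambda>k. norm (infsum (\<lambda>i. norm (g i k)) I)) summable_on K"
  proof (rule Infinite_Sum.abs_summable_on_comparison_test'[OF c])
    fix k assume k: "k \<in> K"
    have "infsum (\<lambda>i. norm (g i k)) I \<le> c k"
      by (rule infsum_le_finite_sums[OF col_abs[OF k]]) (use bound k in auto)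
    moreover have "0 \<le> infsum (\<lambda>i. norm (g i k)) I"
      by (rule infsum_nonneg) simp
    ultimately show "norm (infsum (\<lambda>i. norm (g i k)) I) \<le> c k" by simp
  qed
  then have "(\<lambda>p. norm ((\<lambda>(k, i). g i k) p)) summable_on (K \<times> I)"
    by (subst Infinite_Sum.abs_summable_on_Sigma_iff) (use col_abs in simp)
  then have sm: "(\<lambda>(k, i). g i k) summable_on (K \<times> I)"
    by (rule abs_summable_summable)
  define S where "S = infsum (\<lambda>(k, i). g i k) (K \<times> I)"
  have S: "((\<lambda>(k, i). g i k) has_sum S) (K \<times> I)"
    unfolding S_def using sm by (rule has_sum_infsum)
  have 1: "(G has_sum S) K"
    by (rule has_sum_SigmaD[OF S]) (simp add: col)
  have "((\<lambda>(i, k). g i k) has_sum S) (I \<times> K)"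
    using S by (subst (asm) has_sum_swap) (simp add: case_prod_unfold)
  then have "(H has_sum S) I"
    by (rule has_sum_SigmaD) (simp add: row)
  then show thesis using 1 by (rule that)
qed

text \<open>From the two square summable sequences only the summability of the products of the norms
  is retained; all later estimates use the sequences in this form, with unordered sums.\<close>

definition predual_data :: "('h::complex_hilbert bop \<Rightarrow> complex) \<Rightarrow> (nat \<Rightarrow> 'h) \<Rightarrow> (nat \<Rightarrow> 'h) \<Rightarrow> bool"
  where "predual_data \<omega> \<xi> \<eta> \<longleftrightarrow> (\<lambda>n. norm (\<xi> n) * norm (\<eta> n)) summable_on UNIV \<and>
    (\<forall>T. ((\<lambda>n. cinner (app T (\<xi> n)) (\<eta> n)) has_sum \<omega> T) UNIV)"

lemma norm_cinner_app_le: "norm (cinner (app T x) y) \<le> norm T * (norm x * norm y)"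
proof -
  have "norm (cinner (app T x) y) \<le> norm (app T x) * norm y"
    by (rule cinner_cauchy_schwarz)
  also have "\<dots> \<le> (norm T * norm x) * norm y"
    by (intro mult_right_mono norm_app) simp
  finally show ?thesis by (simp add: mult.assoc)
qed

lemma summable_norm_mult:
  fixes \<xi> \<eta> :: "nat \<Rightarrow> 'a::real_normed_vector"
  assumes "summable (\<lambda>n. (norm (\<xi> n))\<^sup>2)" "summable (\<lambda>n. (norm (\<eta> n))\<^sup>2)"
  shows "summable (\<lambda>n. norm (\<xi> n) * norm (\<eta> n))"
proof (rule summable_comparison_test[OF _ summable_add[OF assms]])
  have "norm (\<xi> n) * norm (\<eta> n) \<le> (norm (\<xi> n))\<^sup>2 + (norm (\<eta> n))\<^sup>2" for n
    using sum_squares_bound[of "norm (\<xi> n)" "norm (\<eta> n)"]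
      mult_nonneg_nonneg[of "norm (\<xi> n)" "norm (\<eta> n)"] by (simp del: mult_nonneg_nonneg)
  then show "\<exists>N. \<forall>n\<ge>N. norm (norm (\<xi> n) * norm (\<eta> n)) \<le> (norm (\<xi> n))\<^sup>2 + (norm (\<eta> n))\<^sup>2"
    by simp
qed

lemma predual_norm_summable:
  assumes "summable (\<lambda>n. (norm (\<xi> n))\<^sup>2)" "summable (\<lambda>n. (norm (\<eta> n))\<^sup>2)"
  shows "summable (\<lambda>n. norm (cinner (app T (\<xi> n)) (\<eta> n)))"
  by (rule summable_comparison_test[OF _ summable_mult[OF summable_norm_mult[OF assms], of "norm T"]])
    (auto intro: norm_cinner_app_le)

lemma predual_summable:
  assumes "summable (\<lambda>n. (norm (\<xi> n))\<^sup>2)" "summable (\<lambda>n. (norm (\<eta> n))\<^sup>2)"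
  shows "summable (\<lambda>n. cinner (app T (\<xi> n)) (\<eta> n))"
  by (rule summable_norm_cancel[OF predual_norm_summable[OF assms]])

lemma predual_dataE:
  assumes "\<omega> \<in> predual"
  obtains \<xi> \<eta> where "predual_data \<omega> \<xi> \<eta>"
proof -
  obtain \<xi> \<eta> :: "nat \<Rightarrow> 'a" where s: "summable (\<lambda>n. (norm (\<xi> n))\<^sup>2)" "summable (\<lambda>n. (norm (\<eta> n))\<^sup>2)"
    and \<omega>: "\<omega> = (\<lambda>T. \<Sum>n. cinner (app T (\<xi> n)) (\<eta> n))"
    using assms unfolding predual_def by blast
  have "((\<lambda>n. cinner (app T (\<xi> n)) (\<eta> n)) has_sum \<omega> T) UNIV" for T
    unfolding \<omega>
    by (rule norm_summable_imp_has_sum[OF predual_norm_summable[OF s]])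
      (rule summable_sums[OF predual_summable[OF s]])
  moreover have "(\<lambda>n. norm (\<xi> n) * norm (\<eta> n)) summable_on UNIV"
    using summable_norm_mult[OF s] by (rule summable_nonneg_imp_summable_on) simp
  ultimately show thesis
    by (intro that[of \<xi> \<eta>]) (simp add: predual_data_def)
qed

text \<open>The sequence \<open>x, 0, 0, ...\<close> turns a vector functional into a functional of
  the form required by \<open>predual\<close>.\<close>

definition at0 :: "'a::zero \<Rightarrow> nat \<Rightarrow> 'a"
  where "at0 x = (\<lambda>n. if n = 0 then x else 0)"

lemma vector_functional:
  shows vector_functional_in_predual: "(\<lambda>T. cinner (app T x) y) \<in> predual"
    and vector_functional_data: "predual_data (\<lambda>T. cinner (app T x) y) (at0 x) (at0 y)"
proof -
  have 1: "cinner (app T x) y = (\<Sum>n. cinner (app T (at0 x n)) (at0 y n))" for T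
    by (subst suminf_finite[of "{0}"]) (auto simp: at0_def)
  have 2: "summable (\<lambda>n. (norm (at0 z n))\<^sup>2)" for z :: 'a
    by (rule summable_finite[of "{0}"]) (auto simp: at0_def)
  show "(\<lambda>T. cinner (app T x) y) \<in> predual"
    unfolding predual_def using 1 2 by blast
  have "((\<lambda>n. cinner (app T (at0 x n)) (at0 y n)) has_sum cinner (app T x) y) UNIV" for T
    by (rule has_sum_finite_neutralI[of "{0}"]) (auto simp: at0_def)
  moreover have "(\<lambda>n. norm (at0 x n) * norm (at0 y n)) summable_on UNIV"
    by (rule finite_nonzero_values_imp_summable_on, rule finite_subset[of _ "{0}"]) (auto simp: at0_def)
  ultimately show "predual_data (\<lambda>T. cinner (app T x) y) (at0 x) (at0 y)"
    by (simp add: predual_data_def)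
qed

lemma predual_scaleR:
  assumes "\<omega> \<in> predual"
  shows "\<omega> (r *\<^sub>R T) = r *\<^sub>R \<omega> T"
proof -
  obtain \<xi> \<eta> where "predual_data \<omega> \<xi> \<eta>"
    using assms by (rule predual_dataE)
  then have d: "((\<lambda>n. cinner (app T (\<xi> n)) (\<eta> n)) has_sum \<omega> T) UNIV" for T
    by (simp add: predual_data_def)
  show "\<omega> (r *\<^sub>R T) = r *\<^sub>R \<omega> T"
    using has_sum_unique[OF d[of "r *\<^sub>R T"]] has_sum_scaleR[OF d[of T], of r]
    by (simp add: app.scaleR_left cinner_scaleR_left)
qed

text \<open>A normal functional is an absolutely convergent series of vector functionals, and
  \<open>bound\<close> permits the interchange of this series with the sum over
  \<open>I\<close>.\<close>

lemma weakstar_has_sumI: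
  fixes f :: "'i \<Rightarrow> 'h::complex_hilbert bop"
  assumes sum: "\<And>x y. ((\<lambda>i. cinner (app (f i) x) y) has_sum cinner (app a x) y) I"
    and bound: "\<And>F x y. finite F \<Longrightarrow> F \<subseteq> I \<Longrightarrow>
      (\<Sum>i\<in>F. norm (cinner (app (f i) x) y)) \<le> C * (norm x * norm y)"
  shows "weakstar_has_sum f a I"
  unfolding weakstar_has_sum_def
proof
  fix \<omega> :: "'h bop \<Rightarrow> complex" assume "\<omega> \<in> predual"
  then obtain \<xi> \<eta> where d: "predual_data \<omega> \<xi> \<eta>" by (rule predual_dataE)
  then have s: "(\<lambda>n. C * (norm (\<xi> n) * norm (\<eta> n))) summable_on UNIV"
    and h: "\<And>T. ((\<lambda>n. cinner (app T (\<xi> n)) (\<eta> n)) has_sum \<omega> T) UNIV"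
    by (auto simp: predual_data_def intro: summable_on_cmult_right)
  obtain S where "((\<lambda>i. \<omega> (f i)) has_sum S) I"
    and "((\<lambda>n. cinner (app a (\<xi> n)) (\<eta> n)) has_sum S) UNIV"
    by (rule has_sum_interchange[where g = "\<lambda>i n. cinner (app (f i) (\<xi> n)) (\<eta> n)", OF _ s])
      (auto intro: bound sum h)
  then show "((\<lambda>i. \<omega> (f i)) has_sum \<omega> a) I"
    using has_sum_unique h by blast
qed

lemma weakstar_has_sum_cinner:
  "weakstar_has_sum f a I \<Longrightarrow> ((\<lambda>i. cinner (app (f i) x) y) has_sum cinner (app a x) y) I"
  unfolding weakstar_has_sum_def
  using vector_functional_in_predual[of x y] by (rule bspec[rotated])

section \<open>Representations of elements of the extended Haagerup tensor product\<close>

text \<open>In operator terms: the column with entries \<open>u i\<close>, an operator from H to a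
  sum of copies of H, has norm at most \<open>sqrt A\<close>.\<close>

definition sq_bounded :: "('i \<Rightarrow> 'h::complex_hilbert bop) \<Rightarrow> 'i set \<Rightarrow> real \<Rightarrow> bool"
  where "sq_bounded u I A \<longleftrightarrow> (\<forall>F x. finite F \<longrightarrow> F \<subseteq> I \<longrightarrow>
    (\<Sum>i\<in>F. (norm (app (u i) x))\<^sup>2) \<le> A * (norm x)\<^sup>2)"

lemma sq_bounded_summable:
  "sq_bounded u I A \<Longrightarrow> (\<lambda>i. (norm (app (u i) x))\<^sup>2) summable_on I"
  by (rule nonneg_bdd_above_summable_on, simp, rule bdd_aboveI2[where M = "A * (norm x)\<^sup>2"])
    (auto simp: sq_bounded_def)

lemma sum_norm_mult_le_sqrt:
  assumes "(\<Sum>i\<in>F. (norm (f i))\<^sup>2) \<le> a" "(\<Sum>i\<in>F. (norm (g i))\<^sup>2) \<le> b"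
  shows "(\<Sum>i\<in>F. norm (f i) * norm (g i)) \<le> sqrt a * sqrt b"
proof -
  have "(\<Sum>i\<in>F. norm (f i) * norm (g i)) \<le> L2_set (\<lambda>i. norm (f i)) F * L2_set (\<lambda>i. norm (g i)) F"
    using L2_set_mult_ineq[of "\<lambda>i. norm (f i)" "\<lambda>i. norm (g i)" F] by simp
  also have "\<dots> \<le> sqrt a * sqrt b"
    unfolding L2_set_def using assms by (intro mult_mono real_sqrt_le_mono)
      (auto intro: real_sqrt_ge_zero sum_nonneg order_trans[OF sum_nonneg assms(1)])
  finally show ?thesis .
qed

lemma sq_bounded_pair:
  fixes v w :: "'i \<Rightarrow> 'h::complex_hilbert bop"
  assumes v: "sq_bounded (\<lambda>i. adj (v i)) I A" and w: "sq_bounded w I B"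
    and F: "finite F" "F \<subseteq> I"
  shows "(\<Sum>i\<in>F. norm (app (w i) x) * norm (app (adj (v i)) y)) \<le> sqrt A * sqrt B * (norm x * norm y)"
proof -
  have "(\<Sum>i\<in>F. norm (app (w i) x) * norm (app (adj (v i)) y))
      \<le> sqrt (B * (norm x)\<^sup>2) * sqrt (A * (norm y)\<^sup>2)"
    using assms by (intro sum_norm_mult_le_sqrt) (auto simp: sq_bounded_def)
  then show ?thesis by (simp add: real_sqrt_mult mult_ac)
qed

text \<open>Moving \<open>v i\<close> to the other side as \<open>adj (v i)\<close> leaves a sum of
  products to which Cauchy-Schwarz over \<open>i\<close> applies. The result has the shape of the
  bound in \<open>weakstar_has_sumI\<close>.\<close>

lemma sq_bounded_sandwich:
  fixes v w :: "'i \<Rightarrow> 'h::complex_hilbert bop"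
  assumes v: "sq_bounded (\<lambda>i. adj (v i)) I A" and w: "sq_bounded w I B"
    and F: "finite F" "F \<subseteq> I"
  shows "(\<Sum>i\<in>F. norm (cinner (app (v i * z * w i) x) y))
    \<le> (norm z * (sqrt A * sqrt B)) * (norm x * norm y)"
proof -
  have "norm (cinner (app (v i * z * w i) x) y) \<le> norm z * (norm (app (w i) x) * norm (app (adj (v i)) y))" for i
    using norm_cinner_app_le[of z "app (w i) x" "app (adj (v i)) y"]
    by (simp add: cinner_adj_right)
  then have "(\<Sum>i\<in>F. norm (cinner (app (v i * z * w i) x) y))
      \<le> (\<Sum>i\<in>F. norm z * (norm (app (w i) x) * norm (app (adj (v i)) y)))"
    by (intro sum_mono)
  also have "\<dots> \<le> norm z * (sqrt A * sqrt B * (norm x * norm y))"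
    unfolding sum_distrib_left[symmetric] by (intro mult_left_mono sq_bounded_pair[OF v w F]) simp
  finally show ?thesis by (simp add: mult_ac)
qed

text \<open>As \<open>eh_rep\<close>, but with an arbitrary index type, so that series may be indexed by an
  orthonormal basis of \<open>L\<^sup>2\<close>.\<close>

definition eh_family ::
  "'h::complex_hilbert bop set \<Rightarrow> 'h bop set \<Rightarrow> 'i set \<Rightarrow> ('i \<Rightarrow> 'h bop) \<Rightarrow> ('i \<Rightarrow> 'h bop) \<Rightarrow>
    'h bop \<Rightarrow> 'h bop \<Rightarrow> ('h bop \<Rightarrow> 'h bop) \<Rightarrow> bool"
  where "eh_family V W I v w a b T \<longleftrightarrow>
    (\<forall>i\<in>I. v i \<in> V \<and> w i \<in> W) \<and>
    weakstar_has_sum (\<lambda>i. v i * adj (v i)) a I \<and>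
    weakstar_has_sum (\<lambda>i. adj (w i) * w i) b I \<and>
    (\<forall>x. weakstar_has_sum (\<lambda>i. v i * x * w i) (T x) I)"

text \<open>All three weak* sums are instances of one estimate: in
  \<open>sq_bounded_sandwich\<close> the two sides may come from \<open>v\<close> and
  \<open>w\<close>, or both from \<open>v\<close>, or both from \<open>w\<close>.\<close>

lemma eh_familyI:
  fixes v w :: "'i \<Rightarrow> 'h::complex_hilbert bop"
  assumes "\<And>i. i \<in> I \<Longrightarrow> v i \<in> V" "\<And>i. i \<in> I \<Longrightarrow> w i \<in> W"
    and v: "sq_bounded (\<lambda>i. adj (v i)) I A" and w: "sq_bounded w I B"
    and a: "\<And>x y. ((\<lambda>i. cinner (app (adj (v i)) x) (app (adj (v i)) y)) has_sum cinner (app a x) y) I"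
    and b: "\<And>x y. ((\<lambda>i. cinner (app (w i) x) (app (w i) y)) has_sum cinner (app b x) y) I"
    and T: "\<And>z x y. ((\<lambda>i. cinner (app z (app (w i) x)) (app (adj (v i)) y)) has_sum cinner (app (T z) x) y) I"
  shows "eh_family V W I v w a b T"
  unfolding eh_family_def
proof (intro conjI ballI allI)
  show "weakstar_has_sum (\<lambda>i. v i * adj (v i)) a I"
  proof (rule weakstar_has_sumI)
    show "((\<lambda>i. cinner (app (v i * adj (v i)) x) y) has_sum cinner (app a x) y) I" for x y
      using a[of x y] by (simp add: cinner_adj_right)
    \<comment> \<open>The factor \<open>norm 1\<close> stands as it is, because it equals 0 if H =
      0.\<close>
    show "(\<Sum>i\<in>F. norm (cinner (app (v i * adj (v i)) x) y)) \<le> norm (1 :: 'h bop) * (sqrt A * sqrt A) * (norm x * norm y)"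
      if "finite F" "F \<subseteq> I" for F x y
      using sq_bounded_sandwich[OF v v that, of 1 x y] by simp
  qed
  show "weakstar_has_sum (\<lambda>i. adj (w i) * w i) b I"
  proof (rule weakstar_has_sumI)
    show "((\<lambda>i. cinner (app (adj (w i) * w i) x) y) has_sum cinner (app b x) y) I" for x y
      using b[of x y] by (simp add: cinner_adj_left)
    show "(\<Sum>i\<in>F. norm (cinner (app (adj (w i) * w i) x) y)) \<le> norm (1 :: 'h bop) * (sqrt B * sqrt B) * (norm x * norm y)"
      if "finite F" "F \<subseteq> I" for F x y
      using sq_bounded_sandwich[OF _ w that, of "\<lambda>i. adj (w i)" B 1 x y] w by simp
  qed
  show "weakstar_has_sum (\<lambda>i. v i * z * w i) (T z) I" for z
  proof (rule weakstar_has_sumI)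
    show "((\<lambda>i. cinner (app (v i * z * w i) x) y) has_sum cinner (app (T z) x) y) I" for x y
      using T[of z x y] by (simp add: cinner_adj_right)
  qed (rule sq_bounded_sandwich[OF v w])
qed (use assms in auto)

text \<open>At the vector functional of a single vector \<open>x\<close> the weak* sum of the
  \<open>adj (u i) * u i\<close> becomes the sum of the squares of the
  \<open>norm (app (u i) x)\<close>, whose partial sums are bounded by the total.\<close>

lemma eh_familyD:
  fixes v w :: "'i \<Rightarrow> 'h::complex_hilbert bop"
  assumes "eh_family V W I v w a b T"
  shows eh_family_sq_bounded_left: "sq_bounded (\<lambda>i. adj (v i)) I (norm a)"
    and eh_family_sq_bounded_right: "sq_bounded w I (norm b)"
    and eh_family_cinner: "((\<lambda>i. cinner (app z (app (w i) x)) (app (adj (v i)) y)) has_sum cinner (app (T z) x) y) I"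
proof -
  have gen: "sq_bounded u I (norm c)" if "weakstar_has_sum (\<lambda>i. adj (u i) * u i) c I"
    for u :: "'i \<Rightarrow> 'h bop" and c
    unfolding sq_bounded_def
  proof (intro allI impI)
    fix F x assume F: "finite F" "F \<subseteq> I"
    have "((\<lambda>i. complex_of_real ((norm (app (u i) x))\<^sup>2)) has_sum cinner (app c x) x) I"
      using weakstar_has_sum_cinner[OF that, of x x] by (simp add: cinner_adj_left cinner_self)
    then have "((\<lambda>i. Re (complex_of_real ((norm (app (u i) x))\<^sup>2))) has_sum Re (cinner (app c x) x)) I"
      by (rule has_sum_Re)
    then have "((\<lambda>i. (norm (app (u i) x))\<^sup>2) has_sum Re (cinner (app c x) x)) I"
      by (simp del: of_real_power)
    then have "(\<Sum>i\<in>F. (norm (app (u i) x))\<^sup>2) \<le> Re (cinner (app c x) x)"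
      by (rule finite_sum_le_has_sum) (use F in auto)
    also have "\<dots> \<le> norm (cinner (app c x) x)"
      by (rule complex_Re_le_cmod)
    also have "\<dots> \<le> norm c * (norm x)\<^sup>2"
      using norm_cinner_app_le[of c x x] by (simp add: power2_eq_square)
    finally show "(\<Sum>i\<in>F. (norm (app (u i) x))\<^sup>2) \<le> norm c * (norm x)\<^sup>2" .
  qed
  show "sq_bounded (\<lambda>i. adj (v i)) I (norm a)" "sq_bounded w I (norm b)"
    using assms by (auto simp: eh_family_def intro: gen)
  show "((\<lambda>i. cinner (app z (app (w i) x)) (app (adj (v i)) y)) has_sum cinner (app (T z) x) y) I"
    using weakstar_has_sum_cinner[of "\<lambda>i. v i * z * w i" "T z" I x y] assms
    by (auto simp: eh_family_def cinner_adj_right)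
qed

lemma eh_rep_iff_eh_family: "eh_rep V W I v w a b T \<longleftrightarrow> eh_family V W I v w a b T"
  unfolding eh_rep_def eh_family_def ..

text \<open>For each vector \<open>x\<close> only countably many indices have
  \<open>app (adj (v i)) x\<close> or \<open>app (w i) x\<close> nonzero. These countable sets
  \<open>N x\<close> cover all indices in question, and there are as many of them as vectors. A
  nonzero operator forces H to be infinite, so their union has at most the cardinality of H.\<close>

lemma eh_family_index_card:
  fixes v w :: "'i \<Rightarrow> 'h::complex_hilbert bop"
  assumes v: "sq_bounded (\<lambda>i. adj (v i)) I A" and w: "sq_bounded w I B"
  shows "\<exists>f :: 'i \<Rightarrow> 'h. inj_on f {i\<in>I. v i \<noteq> 0 \<or> w i \<noteq> 0}"
proof -
  define J where "J = {i\<in>I. v i \<noteq> 0 \<or> w i \<noteq> 0}"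
  define N where "N x = {i\<in>I. app (adj (v i)) x \<noteq> 0} \<union> {i\<in>I. app (w i) x \<noteq> 0}" for x
  have cn: "countable {i\<in>I. app (u i) x \<noteq> 0}" if "sq_bounded u I C" for u :: "'i \<Rightarrow> 'h bop" and C x
    using summable_countable_real[OF sq_bounded_summable[OF that, of x]] by simp
  have "countable (N x)" for x
    unfolding N_def using cn[OF v] cn[OF w] by simp
  have JN: "J \<subseteq> (\<Union>x. N x)"
  proof
    fix i assume i: "i \<in> J"
    have "\<exists>x. app (adj (v i)) x \<noteq> 0 \<or> app (w i) x \<noteq> 0"
    proof (rule ccontr)
      assume "\<not> ?thesis"
      then have "adj (v i) = 0" "w i = 0" by (auto intro: bop_eqI)
      then have "v i = 0" "w i = 0" using adj_adj[of "v i"] by auto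
      then show False using i by (simp add: J_def)
    qed
    then show "i \<in> (\<Union>x. N x)" using i by (auto simp: N_def J_def)
  qed
  have "\<exists>f :: 'i \<Rightarrow> 'h. inj_on f J"
  proof (cases "J = {}")
    case False
    then obtain i where "v i \<noteq> 0 \<or> w i \<noteq> 0" by (auto simp: J_def)
    then obtain T :: "'h bop" where "T \<noteq> 0" by blast
    then obtain x :: 'h where "x \<noteq> 0"
      by (metis app.zero_right bop_eqI)
    \<comment> \<open>The real line through a nonzero vector shows that H is infinite.\<close>
    have "inj (\<lambda>r :: real. r *\<^sub>R x)"
      using \<open>x \<noteq> 0\<close> by (auto intro!: injI)
    then have inf: "infinite (UNIV :: 'h set)"
      using finite_imageD[of "\<lambda>r :: real. r *\<^sub>R x" UNIV] infinite_UNIV_char_0[where 'a = real]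
        finite_subset[OF subset_UNIV] by blast
    have "(card_of (N x), card_of (UNIV :: 'h set)) \<in> ordLeq" for x
    proof -
      have "(card_of (N x), card_of (UNIV :: nat set)) \<in> ordLeq"
        using \<open>countable (N x)\<close> by (auto simp: countable_def intro: card_of_ordLeqI)
      moreover have "(card_of (UNIV :: nat set), card_of (UNIV :: 'h set)) \<in> ordLeq"
        using inf infinite_iff_card_of_nat by blast
      ultimately show ?thesis by (rule ordLeq_transitive)
    qed
    then have "(card_of (\<Union>x\<in>UNIV. N x), card_of (UNIV :: 'h set)) \<in> ordLeq"
      by (intro card_of_UNION_ordLeq_infinite[OF inf]) (simp_all add: card_of_refl ordIso_imp_ordLeq)
    then have "(card_of J, card_of (UNIV :: 'h set)) \<in> ordLeq"
      by (rule ordLeq_transitive[OF card_of_mono1[OF JN]])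
    then show ?thesis
      using card_of_ordLeq[of J "UNIV :: 'h set"] by auto
  qed simp
  then show ?thesis by (simp add: J_def)
qed

text \<open>Return to the index type of \<open>eh_rep\<close>: indices with
  \<open>v i = w i = 0\<close> are dropped, the others are carried into H by an injection, and no
  sum changes, neither a weak* sum nor a norm convergent one.\<close>

lemma eh_family_reindex:
  fixes v w :: "'i \<Rightarrow> 'h::complex_hilbert bop"
  assumes "eh_family V W I v w a b T"
  obtains I' v' w' where "eh_rep V W (I' :: 'h set) v' w' a b T"
    and "(\<lambda>i. v i * adj (v i)) summable_on I \<Longrightarrow> (\<lambda>i. v' i * adj (v' i)) summable_on I'"
    and "(\<lambda>i. adj (w i) * w i) summable_on I \<Longrightarrow> (\<lambda>i. adj (w' i) * w' i) summable_on I'"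
proof -
  define J where "J = {i\<in>I. v i \<noteq> 0 \<or> w i \<noteq> 0}"
  obtain f :: "'i \<Rightarrow> 'h" where f: "inj_on f J"
    using eh_family_index_card[OF eh_familyD(1,2)[OF assms]] by (auto simp: J_def)
  define v' w' where "v' = v \<circ> inv_into J f" and "w' = w \<circ> inv_into J f"
  have re: "(\<lambda>x. (g (v' x) (w' x))) \<circ> f = (\<lambda>i. if i \<in> J then g (v i) (w i) else g (v' (f i)) (w' (f i)))" for g :: "'h bop \<Rightarrow> 'h bop \<Rightarrow> 'c"
    using f by (auto simp: v'_def w'_def fun_eq_iff)
  have hs: "((\<lambda>x. g (v' x) (w' x)) has_sum s) (f ` J) \<longleftrightarrow> ((\<lambda>i. g (v i) (w i)) has_sum s) I"
    if "g 0 0 = 0" for g :: "'h bop \<Rightarrow> 'h bop \<Rightarrow> 'c::topological_comm_monoid_add" and s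
  proof -
    have "((\<lambda>x. g (v' x) (w' x)) has_sum s) (f ` J) \<longleftrightarrow> ((\<lambda>i. g (v i) (w i)) has_sum s) J"
      unfolding has_sum_reindex[OF f] re by (rule has_sum_cong) simp
    also have "\<dots> \<longleftrightarrow> ((\<lambda>i. g (v i) (w i)) has_sum s) I"
      by (rule has_sum_cong_neutral) (auto simp: J_def that)
    finally show ?thesis .
  qed
  have ws: "weakstar_has_sum (\<lambda>x. g (v' x) (w' x)) s (f ` J)"
    if "weakstar_has_sum (\<lambda>i. g (v i) (w i)) s I" "g 0 0 = 0" for g :: "'h bop \<Rightarrow> 'h bop \<Rightarrow> 'h bop" and s
    unfolding weakstar_has_sum_def
  proof
    fix \<omega> :: "'h bop \<Rightarrow> complex" assume \<omega>: "\<omega> \<in> predual"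
    have "\<omega> 0 = 0"
      using predual_scaleR[OF \<omega>, of 0 0] by simp
    then show "((\<lambda>x. \<omega> (g (v' x) (w' x))) has_sum \<omega> s) (f ` J)"
      using hs[of "\<lambda>p q. \<omega> (g p q)" "\<omega> s"] that \<omega> by (simp add: weakstar_has_sum_def)
  qed
  have "eh_rep V W (f ` J) v' w' a b T"
    unfolding eh_rep_def
  proof (intro conjI allI ballI)
    show "v' x \<in> V" "w' x \<in> W" if "x \<in> f ` J" for x
      using assms that f by (auto simp: v'_def w'_def eh_family_def J_def)
    show "weakstar_has_sum (\<lambda>x. v' x * adj (v' x)) a (f ` J)"
      using assms by (intro ws[of "\<lambda>p q. p * adj p"]) (auto simp: eh_family_def)
    show "weakstar_has_sum (\<lambda>x. adj (w' x) * w' x) b (f ` J)"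
      using assms by (intro ws[of "\<lambda>p q. adj q * q"]) (auto simp: eh_family_def)
    show "weakstar_has_sum (\<lambda>x. v' x * z * w' x) (T z) (f ` J)" for z
      using assms by (intro ws[of "\<lambda>p q. p * z * q"]) (auto simp: eh_family_def)
  qed
  moreover have "(\<lambda>i. v i * adj (v i)) summable_on I \<Longrightarrow> (\<lambda>i. v' i * adj (v' i)) summable_on (f ` J)"
    using hs[of "\<lambda>p q. p * adj p"] by (auto simp: summable_on_def)
  moreover have "(\<lambda>i. adj (w i) * w i) summable_on I \<Longrightarrow> (\<lambda>i. adj (w' i) * w' i) summable_on (f ` J)"
    using hs[of "\<lambda>p q. adj q * q"] by (auto simp: summable_on_def)
  ultimately show thesis by (rule that)
qed

section \<open>The pairing with tensors of normal functionals\<close>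

lemma summable_on_product_nonneg:
  fixes c :: "'a \<Rightarrow> real" and d :: "'b \<Rightarrow> real"
  assumes "c summable_on A" "d summable_on B" "\<And>x. 0 \<le> c x" "\<And>y. 0 \<le> d y"
  shows "(\<lambda>(x, y). c x * d y) summable_on (A \<times> B)"
proof -
  have "(\<lambda>p. norm ((\<lambda>(x, y). c x * d y) p)) summable_on (A \<times> B)"
  proof (subst Infinite_Sum.abs_summable_on_Sigma_iff, intro conjI ballI)
    show "(\<lambda>y. norm (case (x, y) of (x, y) \<Rightarrow> c x * d y)) summable_on B" for x
      using summable_on_cmult_right[OF assms(2), of "c x"] assms(3,4) by simp
    have "(\<Sum>\<^sub>\<infinity>y\<in>B. norm (case (x, y) of (x, y) \<Rightarrow> c x * d y)) = c x * infsum d B" for x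
      using assms(3,4) by (simp add: infsum_cmult_right[OF assms(2)])
    moreover have "0 \<le> infsum d B"
      by (rule infsum_nonneg) (rule assms(4))
    ultimately show "(\<lambda>x. norm (\<Sum>\<^sub>\<infinity>y\<in>B. norm (case (x, y) of (x, y) \<Rightarrow> c x * d y))) summable_on A"
      using summable_on_cmult_left[OF assms(1), of "infsum d B"] assms(3) by simp
  qed
  then show ?thesis
    by (rule abs_summable_summable)
qed

lemma has_sum_product_complex:
  fixes A :: "'a \<Rightarrow> complex" and B :: "'b \<Rightarrow> complex"
  assumes "(A has_sum a) I" "(B has_sum b) J"
  shows "((\<lambda>(x, y). A x * B y) has_sum (a * b)) (I \<times> J)"
proof (rule has_sum_SigmaI)
  have "(\<lambda>x. norm (A x)) summable_on I" "(\<lambda>y. norm (B y)) summable_on J"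
    using has_sum_imp_summable[OF assms(1)] has_sum_imp_summable[OF assms(2)]
    by (simp_all add: summable_on_iff_abs_summable_on_complex)
  then have "(\<lambda>(x, y). norm (A x) * norm (B y)) summable_on (I \<times> J)"
    by (rule summable_on_product_nonneg) auto
  then have "(\<lambda>p. norm ((\<lambda>(x, y). A x * B y) p)) summable_on (I \<times> J)"
    by (simp add: case_prod_unfold norm_mult)
  then show "(\<lambda>(x, y). A x * B y) summable_on (I \<times> J)"
    by (rule abs_summable_summable)
  show "((\<lambda>y. case (x, y) of (x, y) \<Rightarrow> A x * B y) has_sum A x * b) J" for x
    using has_sum_cmult_right[OF assms(2), of "A x"] by simp
  show "((\<lambda>x. A x * b) has_sum (a * b)) I"
    using has_sum_cmult_left[OF assms(1), of b] by simp
qed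

lemma has_sum_finite_sum:
  fixes f :: "'k \<Rightarrow> 'i \<Rightarrow> 'a::topological_comm_monoid_add"
  assumes "\<And>k. k \<in> K \<Longrightarrow> (f k has_sum s k) I"
  shows "((\<lambda>i. \<Sum>k\<in>K. f k i) has_sum (\<Sum>k\<in>K. s k)) I"
  using assms
  by (induction K rule: infinite_finite_induct) (auto intro: has_sum_add)

text \<open>The value depends on the map \<open>T\<close> only, through its values at rank one operators.\<close>

lemma pairing_has_sum:
  fixes v w :: "'i \<Rightarrow> 'h::complex_hilbert bop"
  assumes T: "eh_family UNIV UNIV I v w a b T"
    and \<omega>: "predual_data \<omega> \<xi> \<eta>" and \<nu>: "predual_data \<nu> \<xi>' \<eta>'"
  obtains S where "((\<lambda>i. \<omega> (v i) * \<nu> (w i)) has_sum S) I"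
    and "((\<lambda>p. cinner (app (T (rank_one (\<xi> (fst p)) (\<eta>' (snd p)))) (\<xi>' (snd p))) (\<eta> (fst p))) has_sum S) (UNIV \<times> UNIV)"
proof -
  define g where "g i p = cinner (app (v i) (\<xi> (fst p))) (\<eta> (fst p)) * cinner (app (w i) (\<xi>' (snd p))) (\<eta>' (snd p))"
    for i and p :: "nat \<times> nat"
  define C where "C = sqrt (norm a) * sqrt (norm b)"
  define c where "c p = C * ((norm (\<xi> (fst p)) * norm (\<eta> (fst p))) * (norm (\<xi>' (snd p)) * norm (\<eta>' (snd p))))"
    for p :: "nat \<times> nat"
  note fam = eh_familyD[OF T]
  have "(\<lambda>(n, m). (norm (\<xi> n) * norm (\<eta> n)) * (norm (\<xi>' m) * norm (\<eta>' m))) summable_on (UNIV \<times> UNIV)"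
    using \<omega> \<nu> by (intro summable_on_product_nonneg) (simp_all add: predual_data_def)
  then have c: "c summable_on (UNIV \<times> UNIV)"
    unfolding c_def by (intro summable_on_cmult_right) (simp add: case_prod_unfold)
  obtain S where S: "((\<lambda>i. \<omega> (v i) * \<nu> (w i)) has_sum S) I"
    "((\<lambda>p. cinner (app (T (rank_one (\<xi> (fst p)) (\<eta>' (snd p)))) (\<xi>' (snd p))) (\<eta> (fst p))) has_sum S) (UNIV \<times> UNIV)"
  proof (rule has_sum_interchange[where g = g, OF _ c])
    fix F :: "'i set" and p :: "nat \<times> nat" assume F: "finite F" "F \<subseteq> I"
    define n m where "n = fst p" and "m = snd p"
    \<comment> \<open>The factors depending on \<open>i\<close> are rearranged into
      \<open>app (w i)\<close> and \<open>app (adj (v i))\<close> at fixed vectors, the form that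
      \<open>sq_bounded_pair\<close> sums over \<open>i\<close>.\<close>
    have "norm (g i p) \<le> (norm (\<xi> n) * norm (\<eta>' m)) * (norm (app (w i) (\<xi>' m)) * norm (app (adj (v i)) (\<eta> n)))" for i
    proof -
      have "norm (cinner (app (v i) (\<xi> n)) (\<eta> n)) \<le> norm (\<xi> n) * norm (app (adj (v i)) (\<eta> n))"
        using cinner_cauchy_schwarz[of "\<xi> n" "app (adj (v i)) (\<eta> n)"] by (simp add: cinner_adj_right)
      moreover have "norm (cinner (app (w i) (\<xi>' m)) (\<eta>' m)) \<le> norm (app (w i) (\<xi>' m)) * norm (\<eta>' m)"
        by (rule cinner_cauchy_schwarz)
      ultimately have "norm (g i p) \<le> (norm (\<xi> n) * norm (app (adj (v i)) (\<eta> n))) * (norm (app (w i) (\<xi>' m)) * norm (\<eta>' m))"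
        unfolding g_def norm_mult n_def m_def by (intro mult_mono) auto
      then show ?thesis by (simp add: mult_ac)
    qed
    then have "(\<Sum>i\<in>F. norm (g i p)) \<le> (\<Sum>i\<in>F. (norm (\<xi> n) * norm (\<eta>' m)) * (norm (app (w i) (\<xi>' m)) * norm (app (adj (v i)) (\<eta> n))))"
      by (intro sum_mono)
    also have "\<dots> \<le> (norm (\<xi> n) * norm (\<eta>' m)) * (C * (norm (\<xi>' m) * norm (\<eta> n)))"
      unfolding sum_distrib_left[symmetric] C_def
      by (intro mult_left_mono sq_bounded_pair[OF fam(1,2) F]) simp
    finally show "(\<Sum>i\<in>F. norm (g i p)) \<le> c p"
      by (simp add: c_def n_def m_def mult_ac)
  next
    fix p :: "nat \<times> nat"
    \<comment> \<open>With a rank one operator in the middle, the matrix coefficient of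
      \<open>v i * z * w i\<close> splits into a product of one coefficient of \<open>v i\<close>
      and one of \<open>w i\<close>.\<close>
    show "((\<lambda>i. g i p) has_sum cinner (app (T (rank_one (\<xi> (fst p)) (\<eta>' (snd p)))) (\<xi>' (snd p))) (\<eta> (fst p))) I"
      using fam(3)[of "rank_one (\<xi> (fst p)) (\<eta>' (snd p))" "\<xi>' (snd p)" "\<eta> (fst p)"]
      by (simp add: g_def cinner_scaleC_left cinner_adj_right mult.commute)
  next
    fix i
    show "(g i has_sum \<omega> (v i) * \<nu> (w i)) (UNIV \<times> UNIV)"
      using has_sum_product_complex[where A = "\<lambda>n. cinner (app (v i) (\<xi> n)) (\<eta> n)"
          and a = "\<omega> (v i)" and I = UNIV and B = "\<lambda>m. cinner (app (w i) (\<xi>' m)) (\<eta>' m)"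
          and b = "\<nu> (w i)" and J = UNIV] \<omega> \<nu>
      by (simp add: predual_data_def g_def[abs_def] case_prod_unfold)
  qed (rule that)
  then show thesis by (rule that)
qed

text \<open>Well-definedness of \<open>tensor_pairing\<close>. For each simple summand of
  \<open>u\<close> the value is given by \<open>pairing_has_sum\<close> as a double series in
  \<open>T\<close> alone, so it is common to all representations; a map without representations
  leaves nothing to prove.\<close>

lemma ex_tensor_pairing_value:
  fixes T :: "'h::complex_hilbert bop \<Rightarrow> 'h bop"
  assumes u: "u \<in> predual_tensors"
  shows "\<exists>z. \<forall>(I :: 'h set) v w a b. eh_rep UNIV UNIV I v w a b T \<longrightarrow> ((\<lambda>i. u (v i) (w i)) has_sum z) I"
proof (cases "\<exists>(I :: 'h set) v w a b. eh_rep UNIV UNIV I v w a b T")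
  case True
  then obtain I0 :: "'h set" and v0 w0 a0 b0 where 0: "eh_family UNIV UNIV I0 v0 w0 a0 b0 T"
    unfolding eh_rep_iff_eh_family by (elim exE) (rule that)
  obtain n \<omega> \<nu> where un: "u = tensor_form n \<omega> \<nu>" and pre: "\<And>k. k < n \<Longrightarrow> \<omega> k \<in> predual \<and> \<nu> k \<in> predual"
    using u by (auto simp: predual_tensors_def)
  have "\<exists>z. \<forall>(I :: 'h set) v w a b. eh_rep UNIV UNIV I v w a b T \<longrightarrow> ((\<lambda>i. \<omega> k (v i) * \<nu> k (w i)) has_sum z) I"
    if k: "k < n" for k
  proof -
    obtain \<xi> \<eta> where d: "predual_data (\<omega> k) \<xi> \<eta>"
      using conjunct1[OF pre[OF k]] by (rule predual_dataE)
    obtain \<xi>' \<eta>' where d': "predual_data (\<nu> k) \<xi>' \<eta>'"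
      using conjunct2[OF pre[OF k]] by (rule predual_dataE)
    obtain S where S: "((\<lambda>p. cinner (app (T (rank_one (\<xi> (fst p)) (\<eta>' (snd p)))) (\<xi>' (snd p))) (\<eta> (fst p))) has_sum S) (UNIV \<times> UNIV)"
      by (rule pairing_has_sum[OF 0 d d'])
    have "((\<lambda>i. \<omega> k (v i) * \<nu> k (w i)) has_sum S) I" if rep: "eh_rep UNIV UNIV I v w a b T" for I :: "'h set" and v w a b
    proof -
      obtain S' where S': "((\<lambda>i. \<omega> k (v i) * \<nu> k (w i)) has_sum S') I"
        "((\<lambda>p. cinner (app (T (rank_one (\<xi> (fst p)) (\<eta>' (snd p)))) (\<xi>' (snd p))) (\<eta> (fst p))) has_sum S') (UNIV \<times> UNIV)"
        by (rule pairing_has_sum[OF rep[unfolded eh_rep_iff_eh_family] d d'])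
      then show ?thesis
        using has_sum_unique[OF S] by simp
    qed
    then show ?thesis by (intro exI[of _ S] allI impI)
  qed
  then have "\<forall>k. \<exists>z. k < n \<longrightarrow> (\<forall>(I :: 'h set) v w a b. eh_rep UNIV UNIV I v w a b T
      \<longrightarrow> ((\<lambda>i. \<omega> k (v i) * \<nu> k (w i)) has_sum z) I)"
    by simp
  from choice[OF this] obtain z where z: "\<forall>k. k < n \<longrightarrow> (\<forall>(I :: 'h set) v w a b. eh_rep UNIV UNIV I v w a b T
      \<longrightarrow> ((\<lambda>i. \<omega> k (v i) * \<nu> k (w i)) has_sum z k) I)" ..
  have "((\<lambda>i. u (v i) (w i)) has_sum (\<Sum>k<n. z k)) I" if "eh_rep UNIV UNIV I v w a b T" for I :: "'h set" and v w a b
    unfolding un tensor_form_def by (rule has_sum_finite_sum) (use z[rule_format, OF _ that] in auto)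
  then show ?thesis by (intro exI[of _ "\<Sum>k<n. z k"] allI impI)
qed simp

lemma tensor_pairing_has_sum:
  assumes T: "eh_rep UNIV UNIV I v w a b T" and u: "u \<in> predual_tensors"
  shows "((\<lambda>i. u (v i) (w i)) has_sum tensor_pairing T u) I"
proof -
  obtain z where z: "\<And>(I :: 'a set) v w a b. eh_rep UNIV UNIV I v w a b T \<Longrightarrow> ((\<lambda>i. u (v i) (w i)) has_sum z) I"
    using ex_tensor_pairing_value[OF u, of T] by blast
  have "tensor_pairing T u = z"
    unfolding tensor_pairing_def
  proof (rule the_equality)
    show "\<exists>I v w a b. eh_rep UNIV UNIV I v w a b T \<and> ((\<lambda>i. u (v i) (w i)) has_sum z) I"
      using T z[OF T] by blast
    show "z' = z" if "\<exists>I v w a b. eh_rep UNIV UNIV I v w a b T \<and> ((\<lambda>i. u (v i) (w i)) has_sum z') I" for z'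
      using that z has_sum_unique by blast
  qed
  then show ?thesis using z[OF T] by simp
qed

lemma eh_rep_of_eh:
  fixes T :: "'h::complex_hilbert bop \<Rightarrow> 'h bop"
  assumes "T \<in> V \<otimes>eh W"
  obtains I v w a b where "eh_rep V W I v w a b T"
  using assms unfolding ext_haagerup_def by (elim CollectE exE) (rule that)

definition simple_tensor :: "('h::complex_hilbert bop \<Rightarrow> complex) \<Rightarrow> ('h bop \<Rightarrow> complex) \<Rightarrow> 'h bop \<Rightarrow> 'h bop \<Rightarrow> complex"
  where "simple_tensor \<omega> \<nu> = (\<lambda>S R. \<omega> S * \<nu> R)"

lemma simple_tensor_in: "\<omega> \<in> predual \<Longrightarrow> \<nu> \<in> predual \<Longrightarrow> simple_tensor \<omega> \<nu> \<in> predual_tensors"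
  unfolding predual_tensors_def simple_tensor_def
  by (intro CollectI exI[of _ "1 :: nat"] exI[of _ "\<lambda>_. \<omega>"] exI[of _ "\<lambda>_. \<nu>"]) (simp add: tensor_form_def)

text \<open>A formula for the pairing that is free of \<open>v\<close> and \<open>w\<close>; through
  it the pairings of different maps can be compared.\<close>

lemma tensor_pairing_simple:
  assumes T: "T \<in> UNIV \<otimes>eh UNIV" and "\<omega> \<in> predual" "\<nu> \<in> predual"
    and \<omega>: "predual_data \<omega> \<xi> \<eta>" and \<nu>: "predual_data \<nu> \<xi>' \<eta>'"
  shows "((\<lambda>p. cinner (app (T (rank_one (\<xi> (fst p)) (\<eta>' (snd p)))) (\<xi>' (snd p))) (\<eta> (fst p)))
    has_sum tensor_pairing T (simple_tensor \<omega> \<nu>)) (UNIV \<times> UNIV)"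
proof -
  obtain I v w a b where r: "eh_rep UNIV UNIV I v w a b T"
    using T by (rule eh_rep_of_eh)
  obtain S where "((\<lambda>i. \<omega> (v i) * \<nu> (w i)) has_sum S) I"
    "((\<lambda>p. cinner (app (T (rank_one (\<xi> (fst p)) (\<eta>' (snd p)))) (\<xi>' (snd p))) (\<eta> (fst p))) has_sum S) (UNIV \<times> UNIV)"
    by (rule pairing_has_sum[OF r[unfolded eh_rep_iff_eh_family] \<omega> \<nu>])
  then show ?thesis
    using has_sum_unique[OF tensor_pairing_has_sum[OF r simple_tensor_in[OF assms(2,3)]]]
    by (simp add: simple_tensor_def)
qed

lemma tensor_pairing_tensor_form:
  assumes T: "T \<in> UNIV \<otimes>eh UNIV" and pre: "\<And>k. k < n \<Longrightarrow> \<omega> k \<in> predual \<and> \<nu> k \<in> predual"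
  shows "tensor_pairing T (tensor_form n \<omega> \<nu>) = (\<Sum>k<n. tensor_pairing T (simple_tensor (\<omega> k) (\<nu> k)))"
proof -
  obtain I v w a b where r: "eh_rep UNIV UNIV I v w a b T"
    using T by (rule eh_rep_of_eh)
  have "((\<lambda>i. \<Sum>k<n. simple_tensor (\<omega> k) (\<nu> k) (v i) (w i)) has_sum (\<Sum>k<n. tensor_pairing T (simple_tensor (\<omega> k) (\<nu> k)))) I"
    by (rule has_sum_finite_sum) (use pre in \<open>auto intro!: tensor_pairing_has_sum[OF r] simple_tensor_in\<close>)
  moreover have "tensor_form n \<omega> \<nu> \<in> predual_tensors"
    using pre by (auto simp: predual_tensors_def)
  ultimately show ?thesis
    using has_sum_unique[OF tensor_pairing_has_sum[OF r, of "tensor_form n \<omega> \<nu>"]]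
    by (simp add: tensor_form_def simple_tensor_def)
qed

lemma predual_uminus:
  fixes \<omega> :: "'h::complex_hilbert bop \<Rightarrow> complex"
  assumes "\<omega> \<in> predual"
  shows "(\<lambda>T. - \<omega> T) \<in> predual"
proof -
  obtain \<xi> \<eta> :: "nat \<Rightarrow> 'h" where s: "summable (\<lambda>n. (norm (\<xi> n))\<^sup>2)" "summable (\<lambda>n. (norm (\<eta> n))\<^sup>2)"
    and \<omega>: "\<omega> = (\<lambda>T. \<Sum>n. cinner (app T (\<xi> n)) (\<eta> n))"
    using assms unfolding predual_def by blast
  have "(\<lambda>T. - \<omega> T) = (\<lambda>T. \<Sum>n. cinner (app T (- \<xi> n)) (\<eta> n))"
  proof
    fix T
    have "summable (\<lambda>n. cinner (app T (\<xi> n)) (\<eta> n))"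
      by (rule predual_summable[OF s])
    then show "- \<omega> T = (\<Sum>n. cinner (app T (- \<xi> n)) (\<eta> n))"
      unfolding \<omega> by (simp add: app.minus_right cinner_minus_left suminf_minus)
  qed
  then show ?thesis
    unfolding predual_def using s by (intro CollectI exI[of _ "\<lambda>n. - \<xi> n"] exI[of _ \<eta>]) simp
qed

lemma predual_tensors_diff:
  fixes u u' :: "'h::complex_hilbert bop \<Rightarrow> 'h bop \<Rightarrow> complex"
  assumes "u \<in> predual_tensors" "u' \<in> predual_tensors"
  shows "(\<lambda>S T. u S T - u' S T) \<in> predual_tensors"
proof -
  obtain n \<omega> \<nu> where u: "u = tensor_form n \<omega> \<nu>" and p: "\<And>k. k < n \<Longrightarrow> \<omega> k \<in> predual \<and> \<nu> k \<in> predual"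
    using assms(1) by (auto simp: predual_tensors_def)
  obtain n' \<omega>' \<nu>' where u': "u' = tensor_form n' \<omega>' \<nu>'" and p': "\<And>k. k < n' \<Longrightarrow> \<omega>' k \<in> predual \<and> \<nu>' k \<in> predual"
    using assms(2) by (auto simp: predual_tensors_def)
  \<comment> \<open>The terms of \<open>u'\<close> are appended to those of \<open>u\<close>, with
    the sign put into the first factors.\<close>
  define \<omega>2 where "\<omega>2 k = (if k < n then \<omega> k else (\<lambda>T. - \<omega>' (k - n) T))" for k
  define \<nu>2 where "\<nu>2 k = (if k < n then \<nu> k else \<nu>' (k - n))" for k
  have "(\<lambda>S T. u S T - u' S T) = tensor_form (n + n') \<omega>2 \<nu>2"
  proof (intro ext)
    fix S T
    have "(\<Sum>k<n + n'. \<omega>2 k S * \<nu>2 k T) = (\<Sum>k<n. \<omega>2 k S * \<nu>2 k T) + (\<Sum>k<n'. \<omega>2 (n + k) S * \<nu>2 (n + k) T)"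
      by (induction n') (simp_all add: algebra_simps)
    then show "u S T - u' S T = tensor_form (n + n') \<omega>2 \<nu>2 S T"
      by (simp add: u u' tensor_form_def \<omega>2_def \<nu>2_def sum_negf)
  qed
  moreover have "\<forall>k < n + n'. \<omega>2 k \<in> predual \<and> \<nu>2 k \<in> predual"
    using p p'[of "_ - n"] by (auto simp: \<omega>2_def \<nu>2_def intro!: predual_uminus)
  ultimately show ?thesis
    unfolding predual_tensors_def by blast
qed

lemma tensor_pairing_diff:
  assumes T: "T \<in> UNIV \<otimes>eh UNIV" and u: "u \<in> predual_tensors" "u' \<in> predual_tensors"
  shows "tensor_pairing T (\<lambda>S R. u S R - u' S R) = tensor_pairing T u - tensor_pairing T u'"
proof -
  obtain I v w a b where r: "eh_rep UNIV UNIV I v w a b T"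
    using T by (rule eh_rep_of_eh)
  have "((\<lambda>i. u (v i) (w i) - u' (v i) (w i)) has_sum tensor_pairing T u - tensor_pairing T u') I"
    using has_sum_add[OF tensor_pairing_has_sum[OF r u(1)]
        has_sum_uminusI[OF tensor_pairing_has_sum[OF r u(2)]]] by simp
  then show ?thesis
    using has_sum_unique[OF tensor_pairing_has_sum[OF r predual_tensors_diff[OF u]]] by simp
qed

lemma eh_family_elem_tensor:
  "eh_family UNIV UNIV {0 :: 'i::zero} (\<lambda>_. a) (\<lambda>_. b) (a * adj a) (adj b * b) (elem_tensor a b)"
  by (auto simp: eh_family_def weakstar_has_sum_def elem_tensor_def intro!: has_sum_finiteI)

lemma elem_tensor_in_eh: "elem_tensor a (b :: 'h::complex_hilbert bop) \<in> UNIV \<otimes>eh UNIV"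
  unfolding ext_haagerup_def
  by (intro CollectI exI, unfold eh_rep_iff_eh_family, rule eh_family_elem_tensor)

lemma tensor_pairing_elem_tensor:
  assumes "u \<in> predual_tensors"
  shows "tensor_pairing (elem_tensor a b) u = u a b"
proof -
  have "((\<lambda>i. u a b) has_sum tensor_pairing (elem_tensor a b) u) {0 :: 'a}"
    by (rule tensor_pairing_has_sum[OF _ assms]) (use eh_family_elem_tensor in \<open>auto simp: eh_rep_iff_eh_family\<close>)
  moreover have "((\<lambda>i. u a b) has_sum u a b) {0 :: 'a}"
    by (rule has_sum_finiteI) auto
  ultimately show ?thesis by (rule has_sum_unique)
qed

text \<open>An element of the extended Haagerup tensor product is normal, hence determined by its values at
  rank one operators.\<close>

lemma eh_add:
  assumes "eh_family V W I v w a b T"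
  shows "T (x + y) = T x + T y"
proof (rule bop_eqI_cinner)
  fix \<xi> \<eta>
  note h = eh_familyD(3)[OF assms, of _ \<xi> \<eta>]
  have "((\<lambda>i. cinner (app (x + y) (app (w i) \<xi>)) (app (adj (v i)) \<eta>)) has_sum
      (cinner (app (T x) \<xi>) \<eta> + cinner (app (T y) \<xi>) \<eta>)) I"
    using has_sum_add[OF h[of x] h[of y]] by (simp add: app.add_left cinner_add_left)
  then show "cinner (app (T (x + y)) \<xi>) \<eta> = cinner (app (T x + T y) \<xi>) \<eta>"
    using has_sum_unique[OF h[of "x + y"]] by (simp add: app.add_left cinner_add_left)
qed

lemma eh_sum:
  assumes "eh_family V W I v w a b T" "finite E"
  shows "T (\<Sum>e\<in>E. x e) = (\<Sum>e\<in>E. T (x e))"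
proof -
  have T0: "T 0 = 0" using eh_add[OF assms(1), of 0 0] by simp
  show ?thesis
    using assms(2) by (induction E rule: finite_induct) (auto simp: T0 eh_add[OF assms(1)])
qed

lemma eh_finite_rank_approx:
  fixes v w :: "'i \<Rightarrow> 'h::complex_hilbert bop"
  assumes T: "eh_family V W I v w a b T" and "0 < e"
  obtains S where "finite S"
    and "\<forall>E. finite E \<and> orthonormal E \<and> (\<forall>s\<in>S. proj E s = s) \<longrightarrow>
      norm (cinner (app (T x) \<xi>) \<eta> - cinner (app (T (\<Sum>e\<in>E. rank_one (app x e) e)) \<xi>) \<eta>) \<le> e"
proof -
  note fam = eh_familyD[OF T]
  define h where "h i = norm (app (w i) \<xi>) * norm (app (adj (v i)) \<eta>)" for i
  have hs: "h summable_on I"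
    by (rule nonneg_bdd_above_summable_on) (auto simp: h_def intro!: bdd_aboveI2 sq_bounded_pair[OF fam(1,2)])
  \<comment> \<open>The tail of the series is multiplied by \<open>norm x\<close>; the summand 1
    covers \<open>x = 0\<close>.\<close>
  define d where "d = e / (norm x + 1)"
  have "0 < d" using \<open>0 < e\<close> norm_ge_zero[of x] by (simp add: d_def add_nonneg_pos)
  obtain F where F: "finite F" "F \<subseteq> I" "dist (sum h F) (infsum h I) \<le> d"
    using infsum_finite_approximation[OF hs \<open>0 < d\<close>] by blast
  show thesis
  proof (rule that[of "(\<lambda>i. app (w i) \<xi>) ` F"], use F in simp, intro allI impI)
    fix E assume "finite E \<and> orthonormal E \<and> (\<forall>s\<in>(\<lambda>i. app (w i) \<xi>) ` F. proj E s = s)"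
    then have E: "finite E" "orthonormal E" "\<forall>s\<in>(\<lambda>i. app (w i) \<xi>) ` F. proj E s = s" by auto
    define y where "y = (\<Sum>e\<in>E. rank_one (app x e) e)"
    have y: "app y z = app x (proj E z)" for z
      by (simp add: y_def proj_def app.sum_left app.sum_right)
    \<comment> \<open>The difference of the terms of index \<open>i\<close> for \<open>x\<close> and
      for its finite rank approximation; it vanishes for \<open>i\<close> in
      \<open>F\<close>.\<close>
    define t where "t i = cinner (app x (app (w i) \<xi> - proj E (app (w i) \<xi>))) (app (adj (v i)) \<eta>)" for i
    have ts: "(t has_sum (cinner (app (T x) \<xi>) \<eta> - cinner (app (T y) \<xi>) \<eta>)) I"
      using has_sum_add[OF fam(3)[of x \<xi> \<eta>] has_sum_uminusI[OF fam(3)[of y \<xi> \<eta>]]]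
      by (simp add: t_def[abs_def] y app.diff_right cinner.diff_left)
    define g where "g i = (if i \<in> F then 0 else norm x * h i)" for i
    have tg: "norm (t i) \<le> g i" if "i \<in> I" for i
    proof (cases "i \<in> F")
      case True
      then show ?thesis using E(3) by (simp add: t_def g_def)
    next
      case False
      have "norm (t i) \<le> norm x * (norm (app (w i) \<xi> - proj E (app (w i) \<xi>)) * norm (app (adj (v i)) \<eta>))"
        unfolding t_def by (rule norm_cinner_app_le)
      also have "\<dots> \<le> norm x * h i"
        unfolding h_def by (intro mult_left_mono mult_right_mono norm_diff_proj_le E) auto
      finally show ?thesis using False by (simp add: g_def)
    qed
    have "(h has_sum (infsum h I - sum h F)) (I - F)"
    proof -
      have "(h has_sum infsum h I) I" using hs by (rule has_sum_infsum)
      moreover have "(h has_sum sum h F) F" using F(1) by (rule has_sum_finite)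
      ultimately show ?thesis using F(2) by (rule has_sum_Diff)
    qed
    then have "((\<lambda>i. norm x * h i) has_sum norm x * (infsum h I - sum h F)) (I - F)"
      by (rule has_sum_cmult_right)
    then have "(g has_sum norm x * (infsum h I - sum h F)) I"
      by (subst has_sum_cong_neutral[where T = "I - F" and g = "\<lambda>i. norm x * h i"]) (auto simp: g_def)
    then have "norm (cinner (app (T x) \<xi>) \<eta> - cinner (app (T y) \<xi>) \<eta>) \<le> norm x * (infsum h I - sum h F)"
      by (rule norm_infsum_le[OF ts]) (rule tg)
    also have "\<dots> \<le> norm x * d"
      using F(3) by (intro mult_left_mono) (auto simp: dist_real_def)
    also have "\<dots> \<le> (norm x + 1) * d"
      using \<open>0 < d\<close> by (intro mult_right_mono) auto
    also have "(norm x + 1) * d = e"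
      using norm_ge_zero[of x] by (simp add: d_def add_nonneg_eq_0_iff)
    finally show "norm (cinner (app (T x) \<xi>) \<eta> - cinner (app (T (\<Sum>e\<in>E. rank_one (app x e) e)) \<xi>) \<eta>) \<le> e"
      by (simp add: y_def)
  qed
qed

lemma eh_ext:
  assumes T: "T \<in> V \<otimes>eh W" and T': "T' \<in> V' \<otimes>eh W'"
    and eq: "\<And>x y. T (rank_one x y) = T' (rank_one x y)"
  shows "T = T'"
proof (rule ext, rule bop_eqI_cinner)
  fix x \<xi> \<eta>
  obtain I v w a b where r0: "eh_rep V W I v w a b T"
    using T by (rule eh_rep_of_eh)
  obtain I' v' w' a' b' where r0': "eh_rep V' W' I' v' w' a' b' T'"
    using T' by (rule eh_rep_of_eh)
  note r = r0[unfolded eh_rep_iff_eh_family] and r' = r0'[unfolded eh_rep_iff_eh_family]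
  have "norm (cinner (app (T x) \<xi>) \<eta> - cinner (app (T' x) \<xi>) \<eta>) \<le> 0 + e" if e: "0 < e" for e
  proof -
    have "0 < e / 2" using e by simp
    obtain S where S: "finite S" "\<forall>E. finite E \<and> orthonormal E \<and> (\<forall>s\<in>S. proj E s = s) \<longrightarrow>
      norm (cinner (app (T x) \<xi>) \<eta> - cinner (app (T (\<Sum>e\<in>E. rank_one (app x e) e)) \<xi>) \<eta>) \<le> e / 2"
      by (rule eh_finite_rank_approx[OF r \<open>0 < e / 2\<close>, of x \<xi> \<eta>])
    obtain S' where S': "finite S'" "\<forall>E. finite E \<and> orthonormal E \<and> (\<forall>s\<in>S'. proj E s = s) \<longrightarrow>
      norm (cinner (app (T' x) \<xi>) \<eta> - cinner (app (T' (\<Sum>e\<in>E. rank_one (app x e) e)) \<xi>) \<eta>) \<le> e / 2"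
      by (rule eh_finite_rank_approx[OF r' \<open>0 < e / 2\<close>, of x \<xi> \<eta>])
    \<comment> \<open>One projection fixes the critical vectors of both maps, hence both are
      compared at the same sum of rank one operators.\<close>
    obtain E where E: "finite E" "orthonormal E" "\<forall>s\<in>S \<union> S'. proj E s = s"
      using ex_orthonormal_span[OF finite_UnI[OF S(1) S'(1)]] by (elim exE conjE)
    have TT: "T (\<Sum>e\<in>E. rank_one (app x e) e) = T' (\<Sum>e\<in>E. rank_one (app x e) e)"
      by (simp add: eh_sum[OF r E(1)] eh_sum[OF r' E(1)] eq)
    have "norm (cinner (app (T x) \<xi>) \<eta> - cinner (app (T' x) \<xi>) \<eta>) \<le> e / 2 + e / 2"
      using norm_triangle_le_diff[of "cinner (app (T x) \<xi>) \<eta> - cinner (app (T (\<Sum>e\<in>E. rank_one (app x e) e)) \<xi>) \<eta>"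
          "cinner (app (T' x) \<xi>) \<eta> - cinner (app (T' (\<Sum>e\<in>E. rank_one (app x e) e)) \<xi>) \<eta>" "e / 2 + e / 2"]
        add_mono[OF S(2)[rule_format, of E] S'(2)[rule_format, of E]] E TT by simp
    then show ?thesis by simp
  qed
  then have "norm (cinner (app (T x) \<xi>) \<eta> - cinner (app (T' x) \<xi>) \<eta>) \<le> 0"
    by (rule field_le_epsilon)
  then show "cinner (app (T x) \<xi>) \<eta> = cinner (app (T' x) \<xi>) \<eta>" by simp
qed

text \<open>The values at rank one operators, which determine the map by \<open>eh_ext\<close>, are
  pairings with tensors of vector functionals.\<close>

lemma tensor_pairing_vector:
  assumes T: "T \<in> UNIV \<otimes>eh UNIV"
  shows "tensor_pairing T (simple_tensor (\<lambda>S. cinner (app S x) z) (\<lambda>R. cinner (app R x') y))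
    = cinner (app (T (rank_one x y)) x') z"
proof -
  have "((\<lambda>p. cinner (app (T (rank_one (at0 x (fst p)) (at0 y (snd p)))) (at0 x' (snd p))) (at0 z (fst p)))
    has_sum tensor_pairing T (simple_tensor (\<lambda>S. cinner (app S x) z) (\<lambda>R. cinner (app R x') y))) (UNIV \<times> UNIV)"
    by (rule tensor_pairing_simple[OF T vector_functional_in_predual vector_functional_in_predual
          vector_functional_data vector_functional_data])
  moreover have "((\<lambda>p. cinner (app (T (rank_one (at0 x (fst p)) (at0 y (snd p)))) (at0 x' (snd p))) (at0 z (fst p)))
    has_sum cinner (app (T (rank_one x y)) x') z) (UNIV \<times> UNIV)"
    by (rule has_sum_finite_neutralI[of "{(0, 0)}"]) (auto simp: at0_def split: if_splits)
  ultimately show ?thesis by (rule has_sum_unique)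
qed

section \<open>Boundedness of the pairing for the Haagerup norm of the predual\<close>

lemma mat_opnorm_le:
  assumes "\<And>z. (\<Sum>j\<in>B. (norm (z j))\<^sup>2) \<le> 1 \<Longrightarrow> (\<Sum>i\<in>A. (norm (\<Sum>j\<in>B. a i j (z j)))\<^sup>2) \<le> c\<^sup>2"
    and "0 \<le> c"
  shows "mat_opnorm A B a \<le> c"
  unfolding mat_opnorm_def
proof (rule cSUP_least)
  show "{z. (\<Sum>j\<in>B. (norm (z j))\<^sup>2) \<le> 1} \<noteq> {}"
    by (rule ex_in_conv[THEN iffD1], rule exI[of _ "\<lambda>_. 0"]) simp
qed (use assms in \<open>auto intro: real_le_lsqrt\<close>)

text \<open>The supremum in \<open>mat_opnorm\<close> is a supremum of reals and bounds its members
  only if the set is bounded. A crude bound by the entries is enough for finite matrices.\<close>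

lemma mat_opnorm_bdd:
  fixes a :: "'i \<Rightarrow> 'j \<Rightarrow> 'x::real_normed_vector \<Rightarrow> 'y::real_normed_vector"
  assumes fin: "finite A" "finite B"
    and K: "\<And>i j z. i \<in> A \<Longrightarrow> j \<in> B \<Longrightarrow> norm (a i j z) \<le> K i j * norm z"
    and K0: "\<And>i j. i \<in> A \<Longrightarrow> j \<in> B \<Longrightarrow> 0 \<le> K i j"
  shows "bdd_above ((\<lambda>z. sqrt (\<Sum>i\<in>A. (norm (\<Sum>j\<in>B. a i j (z j)))\<^sup>2)) ` {z. (\<Sum>j\<in>B. (norm (z j))\<^sup>2) \<le> 1})"
proof (rule bdd_aboveI2[where M = "sqrt (\<Sum>i\<in>A. (\<Sum>j\<in>B. K i j)\<^sup>2)"])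
  fix z :: "'j \<Rightarrow> 'x" assume z: "z \<in> {z. (\<Sum>j\<in>B. (norm (z j))\<^sup>2) \<le> 1}"
  have "norm (z j) \<le> 1" if "j \<in> B" for j
  proof -
    have "(norm (z j))\<^sup>2 \<le> (\<Sum>j\<in>B. (norm (z j))\<^sup>2)"
      using fin that by (intro member_le_sum) auto
    then have "(norm (z j))\<^sup>2 \<le> 1\<^sup>2" using z by simp
    then show ?thesis by (rule power2_le_imp_le) simp
  qed
  then have "norm (a i j (z j)) \<le> K i j" if "i \<in> A" "j \<in> B" for i j
    using K[OF that, of "z j"] K0[OF that] mult_left_mono[of "norm (z j)" 1 "K i j"] that by force
  then show "sqrt (\<Sum>i\<in>A. (norm (\<Sum>j\<in>B. a i j (z j)))\<^sup>2) \<le> sqrt (\<Sum>i\<in>A. (\<Sum>j\<in>B. K i j)\<^sup>2)"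
    by (intro real_sqrt_le_mono sum_mono power_mono sum_norm_le) auto
qed

lemma mat_opnorm_ge:
  fixes a :: "'i \<Rightarrow> 'j \<Rightarrow> 'x::real_normed_vector \<Rightarrow> 'y::real_normed_vector"
  assumes fin: "finite A" "finite B"
    and K: "\<And>i j z. i \<in> A \<Longrightarrow> j \<in> B \<Longrightarrow> norm (a i j z) \<le> K i j * norm z"
    and K0: "\<And>i j. i \<in> A \<Longrightarrow> j \<in> B \<Longrightarrow> 0 \<le> K i j"
    and z: "(\<Sum>j\<in>B. (norm (z j))\<^sup>2) \<le> 1"
  shows "sqrt (\<Sum>i\<in>A. (norm (\<Sum>j\<in>B. a i j (z j)))\<^sup>2) \<le> mat_opnorm A B a"
  unfolding mat_opnorm_def
  by (rule cSUP_upper[OF _ mat_opnorm_bdd[OF fin K K0]]) (use z in auto)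

text \<open>Homogeneity extends the estimate from the unit ball to all \<open>z\<close>.\<close>

lemma mat_opnorm_bop_ge:
  fixes T :: "'i \<Rightarrow> 'j \<Rightarrow> 'h::complex_hilbert bop"
  assumes fin: "finite A" "finite B" and le: "mat_opnorm A B (\<lambda>i j. app (T i j)) \<le> 1"
  shows "(\<Sum>i\<in>A. (norm (\<Sum>j\<in>B. app (T i j) (z j)))\<^sup>2) \<le> (\<Sum>j\<in>B. (norm (z j))\<^sup>2)"
proof -
  define N where "N = sqrt (\<Sum>j\<in>B. (norm (z j))\<^sup>2)"
  have N2: "N\<^sup>2 = (\<Sum>j\<in>B. (norm (z j))\<^sup>2)"
    by (simp add: N_def sum_nonneg)
  show ?thesis
  proof (cases "N = 0")
    case True
    then have "z j = 0" if "j \<in> B" for j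
      using N2 fin(2) that sum_nonneg_eq_0_iff[of B "\<lambda>j. (norm (z j))\<^sup>2"] by auto
    then show ?thesis by (simp add: sum_nonneg)
  next
    case False
    define y where "y j = (1 / N) *\<^sub>R z j" for j
    have "(\<Sum>j\<in>B. (norm (y j))\<^sup>2) = (\<Sum>j\<in>B. (norm (z j))\<^sup>2) / N\<^sup>2"
      by (simp add: y_def power_divide sum_divide_distrib)
    also have "\<dots> = 1" using False by (simp flip: N2)
    finally have "sqrt (\<Sum>i\<in>A. (norm (\<Sum>j\<in>B. app (T i j) (y j)))\<^sup>2) \<le> mat_opnorm A B (\<lambda>i j. app (T i j))"
      by (intro mat_opnorm_ge[where K = "\<lambda>i j. norm (T i j)"] fin norm_app) auto
    then have "(\<Sum>i\<in>A. (norm (\<Sum>j\<in>B. app (T i j) (y j)))\<^sup>2) \<le> 1"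
      using le by (meson order_trans real_sqrt_le_1_iff)
    moreover have "(\<Sum>j\<in>B. app (T i j) (y j)) = (1 / N) *\<^sub>R (\<Sum>j\<in>B. app (T i j) (z j))" for i
      by (simp add: y_def app.scaleR_right scaleR_sum_right)
    ultimately have "(\<Sum>i\<in>A. (norm (\<Sum>j\<in>B. app (T i j) (z j)))\<^sup>2) / N\<^sup>2 \<le> 1"
      by (simp add: power_divide sum_divide_distrib)
    then show ?thesis
      using False by (simp add: divide_le_eq_1 flip: N2)
  qed
qed

text \<open>A normal functional is completely bounded, with norm at most the sum of the products
  \<open>norm (\<xi> n) * norm (\<eta> n)\<close>, uniformly in the size \<open>m\<close>. Expanding
  the functional into vector functionals leaves, for each \<open>n\<close>, the matrix
  \<open>T\<close> applied to the vectors \<open>scaleC (z j) (\<xi> n)\<close>.\<close>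

lemma predual_data_matrix_bound:
  fixes T :: "nat \<Rightarrow> nat \<Rightarrow> 'h::complex_hilbert bop"
  assumes d: "predual_data \<omega> \<xi> \<eta>"
    and T: "\<And>z. (\<Sum>i<m. (norm (\<Sum>j<m. app (T i j) (z j)))\<^sup>2) \<le> (\<Sum>j<m. (norm (z j))\<^sup>2)"
  shows "(\<Sum>i<m. (norm (\<Sum>j<m. \<omega> (T i j) * z j))\<^sup>2)
    \<le> (\<Sum>\<^sub>\<infinity>n. norm (\<xi> n) * norm (\<eta> n))\<^sup>2 * (\<Sum>j<m. (norm (z j))\<^sup>2)"
proof -
  define C where "C = (\<Sum>\<^sub>\<infinity>n. norm (\<xi> n) * norm (\<eta> n))"
  define y where "y i = (\<Sum>j<m. \<omega> (T i j) * z j)" for i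
  define u where "u i n = (\<Sum>j<m. app (T i j) (scaleC (z j) (\<xi> n)))" for i n
  define Y Z where "Y = sqrt (\<Sum>i<m. (norm (y i))\<^sup>2)" and "Z = sqrt (\<Sum>j<m. (norm (z j))\<^sup>2)"
  have Y2: "Y\<^sup>2 = (\<Sum>i<m. (norm (y i))\<^sup>2)" and Z2: "Z\<^sup>2 = (\<Sum>j<m. (norm (z j))\<^sup>2)" and YZ: "0 \<le> Y" "0 \<le> Z"
    by (simp_all add: Y_def Z_def sum_nonneg)
  have C: "((\<lambda>n. norm (\<xi> n) * norm (\<eta> n)) has_sum C) UNIV"
    using d by (auto simp: C_def predual_data_def)
  have C0: "0 \<le> C" unfolding C_def by (rule infsum_nonneg) simp
  have "((\<lambda>n. \<Sum>j<m. z j * cinner (app (T i j) (\<xi> n)) (\<eta> n)) has_sum (\<Sum>j<m. z j * \<omega> (T i j))) UNIV" for i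
    using d by (intro has_sum_finite_sum has_sum_cmult_right) (simp add: predual_data_def)
  then have "((\<lambda>n. cinner (u i n) (\<eta> n)) has_sum y i) UNIV" for i
    by (simp add: u_def y_def cinner.sum_left cinner_scaleC_left mult.commute)
  \<comment> \<open>The image vector \<open>y\<close> is paired with itself; estimating the terms
    gives \<open>Y * Y \<le> Y * (Z * C)\<close>, from which one factor \<open>Y\<close>
    cancels.\<close>
  then have "((\<lambda>n. \<Sum>i<m. cnj (y i) * cinner (u i n) (\<eta> n)) has_sum (\<Sum>i<m. cnj (y i) * y i)) UNIV"
    by (intro has_sum_finite_sum has_sum_cmult_right)
  moreover have "(\<Sum>i<m. cnj (y i) * y i) = complex_of_real (Y\<^sup>2)"
    unfolding Y2 of_real_sum by (rule sum.cong[OF refl]) (simp only: complex_norm_square mult.commute)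
  ultimately have hs: "((\<lambda>n. \<Sum>i<m. cnj (y i) * cinner (u i n) (\<eta> n)) has_sum complex_of_real (Y\<^sup>2)) UNIV"
    by simp
  have "norm (complex_of_real (Y\<^sup>2)) \<le> (Y * Z) * C"
  proof (rule norm_infsum_le[OF hs has_sum_cmult_right[OF C]])
    fix n
    have "(\<Sum>i<m. (norm (u i n))\<^sup>2) \<le> (\<Sum>j<m. (norm (scaleC (z j) (\<xi> n)))\<^sup>2)"
      unfolding u_def by (rule T)
    also have "\<dots> = Z\<^sup>2 * (norm (\<xi> n))\<^sup>2"
      unfolding Z2 by (simp add: norm_scaleC power_mult_distrib sum_distrib_right)
    finally have un: "(\<Sum>i<m. (norm (u i n))\<^sup>2) \<le> Z\<^sup>2 * (norm (\<xi> n))\<^sup>2" .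
    have "norm (\<Sum>i<m. cnj (y i) * cinner (u i n) (\<eta> n)) \<le> (\<Sum>i<m. norm (y i) * (norm (u i n) * norm (\<eta> n)))"
      by (intro sum_norm_le) (auto simp: norm_mult intro: mult_left_mono cinner_cauchy_schwarz)
    also have "\<dots> = (\<Sum>i<m. norm (y i) * norm (u i n)) * norm (\<eta> n)"
      by (simp add: sum_distrib_right mult.assoc)
    also have "\<dots> \<le> (sqrt (Y\<^sup>2) * sqrt (Z\<^sup>2 * (norm (\<xi> n))\<^sup>2)) * norm (\<eta> n)"
      by (intro mult_right_mono sum_norm_mult_le_sqrt un) (simp_all add: Y2)
    also have "\<dots> = Y * Z * (norm (\<xi> n) * norm (\<eta> n))"
      using YZ by (simp add: real_sqrt_mult)
    finally show "norm (\<Sum>i<m. cnj (y i) * cinner (u i n) (\<eta> n)) \<le> Y * Z * (norm (\<xi> n) * norm (\<eta> n))" .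
  qed
  then have "Y * Y \<le> Y * (Z * C)"
    by (simp add: power2_eq_square norm_mult mult.assoc)
  then have "Y \<le> Z * C"
    using YZ C0 by (cases "Y = 0") auto
  then have "Y\<^sup>2 \<le> (Z * C)\<^sup>2"
    using YZ by (intro power_mono)
  then show ?thesis
    unfolding Y2 power_mult_distrib Z2 by (simp add: y_def C_def mult.commute)
qed

abbreviation amplification_norms ::
  "'p set \<Rightarrow> 'q set \<Rightarrow> ('p \<Rightarrow> 'q \<Rightarrow> 'h::complex_hilbert bop \<Rightarrow> complex) \<Rightarrow> nat \<times> (nat \<Rightarrow> nat \<Rightarrow> 'h bop) \<Rightarrow> real"
  where "amplification_norms P Q \<omega> \<equiv> \<lambda>(m, T).
    mat_opnorm ({..<m} \<times> P) ({..<m} \<times> Q) (\<lambda>(i, p) (j, q) (z :: complex). \<omega> p q (T i j) * z)"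

lemma amplification_norms_ge:
  fixes \<omega> :: "'p \<Rightarrow> 'q \<Rightarrow> 'h::complex_hilbert bop \<Rightarrow> complex" and m :: nat
  assumes "finite P" "finite Q" "(\<Sum>y\<in>{..<m} \<times> Q. (norm (z y))\<^sup>2) \<le> 1"
  shows "sqrt (\<Sum>x\<in>{..<m} \<times> P. (norm (\<Sum>y\<in>{..<m} \<times> Q. \<omega> (snd x) (snd y) (T (fst x) (fst y)) * z y))\<^sup>2)
    \<le> amplification_norms P Q \<omega> (m, T)"
proof -
  have "sqrt (\<Sum>x\<in>{..<m} \<times> P. (norm (\<Sum>y\<in>{..<m} \<times> Q. (\<lambda>(i, p) (j, q) (z :: complex). \<omega> p q (T i j) * z) x y (z y)))\<^sup>2)
    \<le> amplification_norms P Q \<omega> (m, T)"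
    unfolding prod.case using assms
    by (intro mat_opnorm_ge[where K = "\<lambda>x y. norm (\<omega> (snd x) (snd y) (T (fst x) (fst y)))"])
      (auto simp: norm_mult)
  then show ?thesis by (simp add: case_prod_unfold)
qed

text \<open>The supremum over all amplifications is finite: each entry is completely bounded by a
  constant independent of \<open>m\<close>, and finitely many entries combine to one
  constant.\<close>

lemma predual_mat_norm_bdd:
  fixes \<omega> :: "'p \<Rightarrow> 'q \<Rightarrow> 'h::complex_hilbert bop \<Rightarrow> complex"
  assumes fin: "finite P" "finite Q" and pre: "\<And>p q. p \<in> P \<Longrightarrow> q \<in> Q \<Longrightarrow> \<omega> p q \<in> predual"
  shows "bdd_above (amplification_norms P Q \<omega> `
    {(m, T). mat_opnorm {..<m} {..<m} (\<lambda>i j. app (T i j)) \<le> 1})"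
proof -
  have "\<exists>C. \<forall>(m :: nat) T z. mat_opnorm {..<m} {..<m} (\<lambda>i j. app (T i j)) \<le> 1 \<longrightarrow>
      (\<Sum>i<m. (norm (\<Sum>j<m. \<omega> p q (T i j) * z j))\<^sup>2) \<le> C\<^sup>2 * (\<Sum>j<m. (norm (z j))\<^sup>2)"
    if pq: "p \<in> P" "q \<in> Q" for p q
  proof -
    obtain \<xi> \<eta> where d: "predual_data (\<omega> p q) \<xi> \<eta>"
      using pre[OF pq] by (rule predual_dataE)
    show ?thesis
      by (rule exI[of _ "\<Sum>\<^sub>\<infinity>n. norm (\<xi> n) * norm (\<eta> n)"], intro allI impI,
          rule predual_data_matrix_bound[OF d], rule mat_opnorm_bop_ge) auto
  qed
  then have "\<forall>p q. \<exists>C. p \<in> P \<and> q \<in> Q \<longrightarrow> (\<forall>(m :: nat) T z. mat_opnorm {..<m} {..<m} (\<lambda>i j. app (T i j)) \<le> 1 \<longrightarrow>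
      (\<Sum>i<m. (norm (\<Sum>j<m. \<omega> p q (T i j) * z j))\<^sup>2) \<le> C\<^sup>2 * (\<Sum>j<m. (norm (z j))\<^sup>2))"
    by simp
  then have "\<exists>C. \<forall>p q. p \<in> P \<and> q \<in> Q \<longrightarrow> (\<forall>(m :: nat) T z. mat_opnorm {..<m} {..<m} (\<lambda>i j. app (T i j)) \<le> 1 \<longrightarrow>
      (\<Sum>i<m. (norm (\<Sum>j<m. \<omega> p q (T i j) * z j))\<^sup>2) \<le> (C p q)\<^sup>2 * (\<Sum>j<m. (norm (z j))\<^sup>2))"
    unfolding choice_iff .
  then obtain C where C: "\<forall>p q. p \<in> P \<and> q \<in> Q \<longrightarrow> (\<forall>(m :: nat) T z. mat_opnorm {..<m} {..<m} (\<lambda>i j. app (T i j)) \<le> 1 \<longrightarrow>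
      (\<Sum>i<m. (norm (\<Sum>j<m. \<omega> p q (T i j) * z j))\<^sup>2) \<le> (C p q)\<^sup>2 * (\<Sum>j<m. (norm (z j))\<^sup>2))" ..
  \<comment> \<open>The factor \<open>card Q\<close> comes from Cauchy-Schwarz for the sum over the
    columns.\<close>
  define K where "K = sqrt (\<Sum>p\<in>P. (\<Sum>q\<in>Q. (C p q)\<^sup>2) * card Q)"
  have K0: "0 \<le> K" and K2: "K\<^sup>2 = (\<Sum>p\<in>P. (\<Sum>q\<in>Q. (C p q)\<^sup>2) * card Q)"
    by (simp_all add: K_def sum_nonneg)
  show ?thesis
  proof (rule bdd_aboveI2[where M = K], clarify)
    fix m :: nat and T :: "nat \<Rightarrow> nat \<Rightarrow> 'h bop"
    assume T: "mat_opnorm {..<m} {..<m} (\<lambda>i j. app (T i j)) \<le> 1"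
    show "mat_opnorm ({..<m} \<times> P) ({..<m} \<times> Q) (\<lambda>(i, p) (j, q) (z :: complex). \<omega> p q (T i j) * z) \<le> K"
    proof (rule mat_opnorm_le[OF _ K0])
      fix z :: "nat \<times> 'q \<Rightarrow> complex"
      assume z: "(\<Sum>y\<in>{..<m} \<times> Q. (norm (z y))\<^sup>2) \<le> 1"
      have zq: "(\<Sum>j<m. (norm (z (j, q)))\<^sup>2) \<le> 1" if "q \<in> Q" for q
      proof -
        have "(\<Sum>j<m. (norm (z (j, q)))\<^sup>2) \<le> (\<Sum>q\<in>Q. \<Sum>j<m. (norm (z (j, q)))\<^sup>2)"
          using that fin(2) by (intro member_le_sum[where f = "\<lambda>q. \<Sum>j<m. (norm (z (j, q)))\<^sup>2"]) (auto intro: sum_nonneg)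
        also have "\<dots> = (\<Sum>y\<in>{..<m} \<times> Q. (norm (z y))\<^sup>2)"
          by (subst sum.swap) (simp add: sum.cartesian_product case_prod_unfold)
        finally show ?thesis using z by simp
      qed
      define Y where "Y i p q = (\<Sum>j<m. \<omega> p q (T i j) * z (j, q))" for i p q
      have Y: "(\<Sum>i<m. (norm (Y i p q))\<^sup>2) \<le> (C p q)\<^sup>2" if "p \<in> P" "q \<in> Q" for p q
        using C[rule_format, OF conjI[OF that] T, of "\<lambda>j. z (j, q)"] mult_left_mono[OF zq[OF that(2)], of "(C p q)\<^sup>2"]
        by (simp add: Y_def)
      have sq: "(norm (\<Sum>q\<in>Q. Y i p q))\<^sup>2 \<le> (\<Sum>q\<in>Q. (norm (Y i p q))\<^sup>2) * card Q" for i p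
      proof -
        have "(norm (\<Sum>q\<in>Q. Y i p q))\<^sup>2 \<le> (\<Sum>q\<in>Q. norm (Y i p q))\<^sup>2"
          by (intro power_mono norm_sum) simp
        also have "\<dots> \<le> (\<Sum>q\<in>Q. (norm (Y i p q))\<^sup>2) * card Q"
          by (rule sum_squared_le_sum_of_squares)
        finally show ?thesis .
      qed
      have Yexp: "(\<Sum>y\<in>{..<m} \<times> Q. (\<lambda>(i, p) (j, q) (z :: complex). \<omega> p q (T i j) * z) x y (z y)) = (\<Sum>q\<in>Q. Y (fst x) (snd x) q)" for x
        unfolding Y_def by (subst sum.swap) (simp add: sum.cartesian_product case_prod_unfold)
      have "(\<Sum>x\<in>{..<m} \<times> P. (norm (\<Sum>y\<in>{..<m} \<times> Q. (\<lambda>(i, p) (j, q) (z :: complex). \<omega> p q (T i j) * z) x y (z y)))\<^sup>2)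
          = (\<Sum>p\<in>P. \<Sum>i<m. (norm (\<Sum>q\<in>Q. Y i p q))\<^sup>2)"
        unfolding Yexp by (subst sum.swap) (simp add: sum.cartesian_product case_prod_unfold)
      also have "\<dots> \<le> (\<Sum>p\<in>P. \<Sum>i<m. (\<Sum>q\<in>Q. (norm (Y i p q))\<^sup>2) * card Q)"
        by (intro sum_mono sq)
      also have "\<dots> = (\<Sum>p\<in>P. (\<Sum>q\<in>Q. \<Sum>i<m. (norm (Y i p q))\<^sup>2) * card Q)"
        by (subst sum.swap) (simp add: sum_distrib_right)
      also have "\<dots> \<le> K\<^sup>2"
        unfolding K2 by (intro sum_mono mult_right_mono Y) auto
      finally show "(\<Sum>x\<in>{..<m} \<times> P. (norm (\<Sum>y\<in>{..<m} \<times> Q. (\<lambda>(i, p) (j, q) (z :: complex). \<omega> p q (T i j) * z) x y (z y)))\<^sup>2) \<le> K\<^sup>2" .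
    qed
  qed
qed

lemma predual_mat_norm_ge:
  fixes \<omega> :: "'p \<Rightarrow> 'q \<Rightarrow> 'h::complex_hilbert bop \<Rightarrow> complex" and m :: nat
  assumes fin: "finite P" "finite Q" and pre: "\<And>p q. p \<in> P \<Longrightarrow> q \<in> Q \<Longrightarrow> \<omega> p q \<in> predual"
    and T: "mat_opnorm {..<m} {..<m} (\<lambda>i j. app (T i j)) \<le> 1"
    and z: "(\<Sum>y\<in>{..<m} \<times> Q. (norm (z y))\<^sup>2) \<le> 1"
  shows "sqrt (\<Sum>x\<in>{..<m} \<times> P. (norm (\<Sum>y\<in>{..<m} \<times> Q. \<omega> (snd x) (snd y) (T (fst x) (fst y)) * z y))\<^sup>2)
    \<le> predual_mat_norm P Q \<omega>"
proof -
  have "amplification_norms P Q \<omega> (m, T) \<le> predual_mat_norm P Q \<omega>"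
    unfolding predual_mat_norm_def
    by (rule cSUP_upper[OF _ predual_mat_norm_bdd[OF fin pre]]) (use T in auto)
  then show ?thesis
    using amplification_norms_ge[OF fin z, of \<omega> T] by linarith
qed

lemma predual_mat_norm_nonneg:
  fixes \<omega> :: "'p \<Rightarrow> 'q \<Rightarrow> 'h::complex_hilbert bop \<Rightarrow> complex"
  assumes "finite P" "finite Q" and "\<And>p q. p \<in> P \<Longrightarrow> q \<in> Q \<Longrightarrow> \<omega> p q \<in> predual"
  shows "0 \<le> predual_mat_norm P Q \<omega>"
proof -
  \<comment> \<open>The empty amplification, \<open>m = 0\<close>, belongs to the family and bounds
    the supremum below by 0.\<close>
  have "mat_opnorm {..<0::nat} {..<0::nat} (\<lambda>_ _. app (0 :: 'h bop)) \<le> 1"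
    by (rule mat_opnorm_le) auto
  then show ?thesis
    using predual_mat_norm_ge[OF assms(1,2), of \<omega> 0 "\<lambda>_ _. 0" "\<lambda>_. 0"] assms(3) by simp
qed

text \<open>The row with entries \<open>v j\<close> is the adjoint of the column with entries
  \<open>adj (v j)\<close>, so both have the same norm.\<close>

lemma norm_row_combination_le:
  fixes v :: "nat \<Rightarrow> 'h::complex_hilbert bop"
  assumes v: "\<And>y. (\<Sum>j<m. (norm (app (adj (v j)) y))\<^sup>2) \<le> R\<^sup>2 * (norm y)\<^sup>2" and "0 < R"
  shows "(norm (\<Sum>j<m. app (v j) (z j)))\<^sup>2 \<le> R\<^sup>2 * (\<Sum>j<m. (norm (z j))\<^sup>2)"
proof -
  define y where "y = (\<Sum>j<m. app (v j) (z j))"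
  define Z where "Z = (\<Sum>j<m. (norm (z j))\<^sup>2)"
  have "complex_of_real ((norm y)\<^sup>2) = (\<Sum>j<m. cinner (z j) (app (adj (v j)) y))"
    by (subst cinner_self[symmetric], subst (1) y_def) (simp add: cinner.sum_left cinner_adj_right)
  then have "(norm y)\<^sup>2 = norm (\<Sum>j<m. cinner (z j) (app (adj (v j)) y))"
    by (metis norm_of_real abs_power2)
  also have "\<dots> \<le> (\<Sum>j<m. norm (z j) * norm (app (adj (v j)) y))"
    by (intro sum_norm_le cinner_cauchy_schwarz)
  also have "\<dots> \<le> sqrt Z * sqrt (R\<^sup>2 * (norm y)\<^sup>2)"
    by (intro sum_norm_mult_le_sqrt v) (simp add: Z_def)
  also have "\<dots> = (sqrt Z * R) * norm y"
    using \<open>0 < R\<close> by (simp add: real_sqrt_mult)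
  finally have "norm y \<le> sqrt Z * R"
    by (cases "norm y = 0") (use \<open>0 < R\<close> in \<open>auto simp: power2_eq_square Z_def sum_nonneg\<close>)
  then have "(norm y)\<^sup>2 \<le> (sqrt Z * R)\<^sup>2"
    by (intro power_mono) auto
  then show ?thesis
    by (simp add: y_def power_mult_distrib Z_def sum_nonneg mult.commute)
qed

text \<open>The scalars \<open>\<omega> k (v j)\<close> form one row of the amplification of the row
  of the \<omega> at a matrix that contains the \<open>v j / R\<close> as a row. The norm of a
  scalar row is the square root of its sum of squares, attained at its normalized conjugate.\<close>

lemma predual_row_bound:
  fixes v :: "nat \<Rightarrow> 'h::complex_hilbert bop" and \<omega> :: "nat \<Rightarrow> 'h bop \<Rightarrow> complex"
  assumes pre: "\<And>k. k < n \<Longrightarrow> \<omega> k \<in> predual"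
    and v: "\<And>y. (\<Sum>j<m. (norm (app (adj (v j)) y))\<^sup>2) \<le> R\<^sup>2 * (norm y)\<^sup>2" and R: "0 < R"
  shows "sqrt (\<Sum>j<m. \<Sum>k<n. (norm (\<omega> k (v j)))\<^sup>2) \<le> predual_mat_norm {()} {..<n} (\<lambda>_ k. \<omega> k) * R"
proof -
  define N where "N = sqrt (\<Sum>j<m. \<Sum>k<n. (norm (\<omega> k (v j)))\<^sup>2)"
  have N2: "N\<^sup>2 = (\<Sum>j<m. \<Sum>k<n. (norm (\<omega> k (v j)))\<^sup>2)" and N0: "0 \<le> N"
    by (simp_all add: N_def sum_nonneg)
  have nn: "0 \<le> predual_mat_norm {()} {..<n} (\<lambda>_ k. \<omega> k)"
    by (rule predual_mat_norm_nonneg) (use pre in auto)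
  show ?thesis
  proof (cases "N = 0")
    case True
    then show ?thesis using nn R by (simp add: N_def)
  next
    case False
    have "m \<noteq> 0"
    proof
      assume "m = 0"
      then show False using False by (simp add: N_def)
    qed
    define T where "T i j = (if i = 0 then (1 / R) *\<^sub>R v j else 0)" for i j :: nat
    have T: "mat_opnorm {..<m} {..<m} (\<lambda>i j. app (T i j)) \<le> 1"
    proof (rule mat_opnorm_le)
      fix z :: "nat \<Rightarrow> 'h" assume z: "(\<Sum>j<m. (norm (z j))\<^sup>2) \<le> 1"
      have "(\<Sum>i<m. (norm (\<Sum>j<m. app (T i j) (z j)))\<^sup>2)
          = (\<Sum>i<m. if i = 0 then (norm ((1 / R) *\<^sub>R (\<Sum>j<m. app (v j) (z j))))\<^sup>2 else 0)"
        by (intro sum.cong) (auto simp: T_def app.scaleR_left scaleR_sum_right)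
      also have "\<dots> = (norm (\<Sum>j<m. app (v j) (z j)))\<^sup>2 / R\<^sup>2"
        using \<open>m \<noteq> 0\<close> by (simp add: power_divide)
      also have "\<dots> \<le> R\<^sup>2 * 1 / R\<^sup>2"
        using norm_row_combination_le[OF v R, of z] mult_left_mono[OF z, of "R\<^sup>2"]
        by (intro divide_right_mono) (auto elim: order_trans)
      also have "\<dots> \<le> 1" by simp
      finally show "(\<Sum>i<m. (norm (\<Sum>j<m. app (T i j) (z j)))\<^sup>2) \<le> 1\<^sup>2" by simp
    qed simp
    \<comment> \<open>The unit vector at which the scalar row attains its norm.\<close>
    define z where "z y = cnj (\<omega> (snd y) (v (fst y))) / N" for y
    have "(\<Sum>y\<in>{..<m} \<times> {..<n}. (norm (z y))\<^sup>2) = (\<Sum>j<m. \<Sum>k<n. (norm (\<omega> k (v j)))\<^sup>2 / N\<^sup>2)"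
      by (simp add: sum.cartesian_product z_def norm_divide power_divide case_prod_unfold)
    also have "\<dots> = N\<^sup>2 / N\<^sup>2"
      by (simp only: sum_divide_distrib[symmetric] N2[symmetric])
    finally have z1: "(\<Sum>y\<in>{..<m} \<times> {..<n}. (norm (z y))\<^sup>2) = 1"
      using False by simp
    define S where "S = (\<Sum>y\<in>{..<m} \<times> {..<n}. \<omega> (snd y) (T 0 (fst y)) * z y)"
    have "S = (\<Sum>y\<in>{..<m} \<times> {..<n}. complex_of_real ((norm (\<omega> (snd y) (v (fst y))))\<^sup>2 / (R * N)))"
      unfolding S_def
    proof (rule sum.cong[OF refl])
      fix y assume y: "y \<in> {..<m} \<times> {..<n}"
      then have "\<omega> (snd y) (T 0 (fst y)) = (1 / R) *\<^sub>R \<omega> (snd y) (v (fst y))"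
        using predual_scaleR[OF pre] by (auto simp: T_def)
      then show "\<omega> (snd y) (T 0 (fst y)) * z y = complex_of_real ((norm (\<omega> (snd y) (v (fst y))))\<^sup>2 / (R * N))"
        using complex_norm_square[of "\<omega> (snd y) (v (fst y))"]
        by (simp add: z_def scaleR_conv_of_real)
    qed
    also have "\<dots> = complex_of_real (N\<^sup>2 / (R * N))"
      unfolding N2 by (simp add: sum_divide_distrib sum.cartesian_product case_prod_unfold)
    also have "N\<^sup>2 / (R * N) = N / R"
      using False by (simp add: power2_eq_square)
    finally have S: "norm S = N / R"
      using N0 R by (simp add: norm_divide)
    have "norm S = sqrt ((norm S)\<^sup>2)" by simp
    also have "\<dots> \<le> sqrt (\<Sum>x\<in>{..<m} \<times> {()}. (norm (\<Sum>y\<in>{..<m} \<times> {..<n}. \<omega> (snd y) (T (fst x) (fst y)) * z y))\<^sup>2)"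
      unfolding S_def
      using \<open>m \<noteq> 0\<close> member_le_sum[of "(0, ())" "{..<m} \<times> {()}"
          "\<lambda>x. (norm (\<Sum>y\<in>{..<m} \<times> {..<n}. \<omega> (snd y) (T (fst x) (fst y)) * z y))\<^sup>2"] by (intro real_sqrt_le_mono) auto
    also have "\<dots> \<le> predual_mat_norm {()} {..<n} (\<lambda>_ k. \<omega> k)"
      using predual_mat_norm_ge[of "{()}" "{..<n}" "\<lambda>_ k. \<omega> k" m T z] pre T z1 by simp
    finally have "N / R \<le> predual_mat_norm {()} {..<n} (\<lambda>_ k. \<omega> k)"
      unfolding S .
    then show ?thesis
      using R by (simp add: N_def divide_le_eq)
  qed
qed

text \<open>Dual to the row estimate: the \<open>w i / R\<close> are placed in the first column, and
  a scalar column attains its norm at the first unit vector.\<close>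

lemma predual_column_bound:
  fixes w :: "nat \<Rightarrow> 'h::complex_hilbert bop" and \<nu> :: "nat \<Rightarrow> 'h bop \<Rightarrow> complex"
  assumes pre: "\<And>k. k < n \<Longrightarrow> \<nu> k \<in> predual"
    and w: "\<And>y. (\<Sum>j<m. (norm (app (w j) y))\<^sup>2) \<le> R\<^sup>2 * (norm y)\<^sup>2" and R: "0 < R"
  shows "sqrt (\<Sum>j<m. \<Sum>k<n. (norm (\<nu> k (w j)))\<^sup>2) \<le> predual_mat_norm {..<n} {()} (\<lambda>k _. \<nu> k) * R"
proof (cases "m = 0")
  case True
  have "0 \<le> predual_mat_norm {..<n} {()} (\<lambda>k _. \<nu> k)"
    by (rule predual_mat_norm_nonneg) (use pre in auto)
  then show ?thesis using True R by simp
next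
  case False
  define T where "T i j = (if j = 0 then (1 / R) *\<^sub>R w i else 0)" for i j :: nat
  have delta: "(\<Sum>j<m. if j = 0 then f j else 0) = f 0" for f :: "nat \<Rightarrow> 'z::comm_monoid_add"
    using False by simp
  have T: "mat_opnorm {..<m} {..<m} (\<lambda>i j. app (T i j)) \<le> 1"
  proof (rule mat_opnorm_le)
    fix z :: "nat \<Rightarrow> 'h" assume z: "(\<Sum>j<m. (norm (z j))\<^sup>2) \<le> 1"
    have "(\<Sum>j<m. app (T i j) (z j)) = (\<Sum>j<m. if j = 0 then (1 / R) *\<^sub>R app (w i) (z j) else 0)" for i
      by (intro sum.cong) (auto simp: T_def app.scaleR_left)
    then have "(\<Sum>i<m. (norm (\<Sum>j<m. app (T i j) (z j)))\<^sup>2) = (\<Sum>i<m. (norm (app (w i) (z 0)))\<^sup>2) / R\<^sup>2"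
      by (simp add: delta power_divide sum_divide_distrib)
    also have "\<dots> \<le> (norm (z 0))\<^sup>2"
      using w[of "z 0"] R by (simp add: divide_le_eq mult.commute)
    also have "\<dots> \<le> (\<Sum>j<m. (norm (z j))\<^sup>2)"
      using False by (intro member_le_sum[where f = "\<lambda>j. (norm (z j))\<^sup>2"]) auto
    finally show "(\<Sum>i<m. (norm (\<Sum>j<m. app (T i j) (z j)))\<^sup>2) \<le> 1\<^sup>2" using z by simp
  qed simp
  define z where "z y = (if fst y = 0 then 1 else 0 :: complex)" for y :: "nat \<times> unit"
  have z1: "(\<Sum>y\<in>{..<m} \<times> {()}. (norm (z y))\<^sup>2) = 1"
  proof -
    have "(\<Sum>y\<in>{..<m} \<times> {()}. (norm (z y))\<^sup>2) = (\<Sum>j<m. \<Sum>u\<in>{()}. (norm (z (j, u)))\<^sup>2)"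
      by (simp only: sum.cartesian_product case_prod_unfold prod.collapse)
    also have "\<dots> = (\<Sum>j<m. if j = 0 then 1 else 0)"
      by (intro sum.cong) (auto simp: z_def)
    finally show ?thesis by (simp add: delta)
  qed
  have inner: "(\<Sum>y\<in>{..<m} \<times> {()}. \<nu> (snd x) (T (fst x) (fst y)) * z y) = (1 / R) *\<^sub>R \<nu> (snd x) (w (fst x))"
    if "x \<in> {..<m} \<times> {..<n}" for x
  proof -
    have "(\<Sum>y\<in>{..<m} \<times> {()}. \<nu> (snd x) (T (fst x) (fst y)) * z y)
        = (\<Sum>j<m. \<Sum>u\<in>{()}. \<nu> (snd x) (T (fst x) j) * z (j, u))"
      by (simp only: sum.cartesian_product case_prod_unfold prod.collapse)
    also have "\<dots> = (\<Sum>j<m. if j = 0 then \<nu> (snd x) (T (fst x) j) else 0)"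
      by (intro sum.cong) (auto simp: z_def)
    also have "\<dots> = (1 / R) *\<^sub>R \<nu> (snd x) (w (fst x))"
      using that predual_scaleR[OF pre] by (auto simp: delta T_def)
    finally show ?thesis .
  qed
  have "sqrt (\<Sum>x\<in>{..<m} \<times> {..<n}. (norm (\<Sum>y\<in>{..<m} \<times> {()}. \<nu> (snd x) (T (fst x) (fst y)) * z y))\<^sup>2)
      \<le> predual_mat_norm {..<n} {()} (\<lambda>k _. \<nu> k)"
    using predual_mat_norm_ge[of "{..<n}" "{()}" "\<lambda>k _. \<nu> k" m T z] pre T z1 by simp
  moreover have "(\<Sum>x\<in>{..<m} \<times> {..<n}. (norm (\<Sum>y\<in>{..<m} \<times> {()}. \<nu> (snd x) (T (fst x) (fst y)) * z y))\<^sup>2)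
      = (\<Sum>j<m. \<Sum>k<n. (norm (\<nu> k (w j)))\<^sup>2) / R\<^sup>2"
    by (simp add: inner sum.cartesian_product case_prod_unfold power_divide sum_divide_distrib cong: sum.cong)
  ultimately have "sqrt (\<Sum>j<m. \<Sum>k<n. (norm (\<nu> k (w j)))\<^sup>2) / R \<le> predual_mat_norm {..<n} {()} (\<lambda>k _. \<nu> k)"
    using R by (simp add: real_sqrt_divide)
  then show ?thesis using R by (simp add: divide_le_eq)
qed

lemma predual_haagerup_products_nonneg:
  fixes \<omega> \<nu> :: "nat \<Rightarrow> 'h::complex_hilbert bop \<Rightarrow> complex"
  assumes "\<And>k. k < n \<Longrightarrow> \<omega> k \<in> predual \<and> \<nu> k \<in> predual"
  shows "0 \<le> predual_mat_norm {()} {..<n} (\<lambda>_ k. \<omega> k) * predual_mat_norm {..<n} {()} (\<lambda>k _. \<nu> k)"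
  using assms by (intro mult_nonneg_nonneg predual_mat_norm_nonneg) auto

text \<open>The empty representation, \<open>n = 0\<close>, gives the product 0. With this bound
  constant sequences are Cauchy, so algebraic tensors embed into the completion.\<close>

lemma predual_haagerup_norm_zero:
  "predual_haagerup_norm (\<lambda>(S :: 'h bop) (T :: 'h::complex_hilbert bop). 0) \<le> 0"
proof -
  have "predual_mat_norm {()} {..<0 :: nat} (\<lambda>_ k. (\<lambda>_. 0) :: 'h::complex_hilbert bop \<Rightarrow> complex) = 0"
  proof -
    have 1: "mat_opnorm {..<0::nat} {..<0::nat} (\<lambda>_ _. app (0 :: 'h bop)) \<le> 1"
      by (rule mat_opnorm_le) auto
    have 2: "amplification_norms {()} {..<0 :: nat} (\<lambda>_ k. (\<lambda>_. 0) :: 'h bop \<Rightarrow> complex) x = 0" for x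
      by (cases x) (simp add: mat_opnorm_def)
    show ?thesis
      unfolding predual_mat_norm_def 2
      by (rule cSUP_const, rule ex_in_conv[THEN iffD1], rule exI[of _ "(0, \<lambda>_ _. 0)"]) (use 1 in simp)
  qed
  moreover have "predual_haagerup_norm (\<lambda>(S :: 'h bop) (T :: 'h bop). 0)
      \<le> predual_mat_norm {()} {..<0 :: nat} (\<lambda>_ k. (\<lambda>_. 0) :: 'h bop \<Rightarrow> complex) * predual_mat_norm {..<0 :: nat} {()} (\<lambda>k _. (\<lambda>_. 0) :: 'h bop \<Rightarrow> complex)"
    unfolding predual_haagerup_norm_def
  proof (rule cInf_lower)
    show "predual_mat_norm {()} {..<0 :: nat} (\<lambda>_ k. (\<lambda>_. 0) :: 'h bop \<Rightarrow> complex) * predual_mat_norm {..<0 :: nat} {()} (\<lambda>k _. (\<lambda>_. 0) :: 'h bop \<Rightarrow> complex)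
      \<in> {predual_mat_norm {()} {..<n} (\<lambda>_ k. \<omega> k) * predual_mat_norm {..<n} {()} (\<lambda>k _. \<nu> k)
      | n (\<omega> :: nat \<Rightarrow> 'h bop \<Rightarrow> complex) (\<nu> :: nat \<Rightarrow> 'h bop \<Rightarrow> complex).
        (\<forall>k<n. \<omega> k \<in> predual \<and> \<nu> k \<in> predual) \<and> (\<lambda>S T. 0) = tensor_form n \<omega> \<nu>}"
      by (intro CollectI exI[of _ "0 :: nat"] exI[of _ "\<lambda>_ _. 0"]) (simp add: tensor_form_def)
  qed (auto intro!: bdd_belowI[where m = 0] predual_haagerup_products_nonneg)
  ultimately show ?thesis by simp
qed

text \<open>For a finite set of terms of \<open>T\<close> and a representation of \<open>u\<close>,
  Cauchy-Schwarz over all pairs of indices separates the first from the second factors; the row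
  estimate bounds the former, the column estimate the latter. This is the duality between the two
  Haagerup tensor products in the direction that is used.\<close>

lemma tensor_pairing_bound:
  assumes T: "eh_rep UNIV UNIV I v w a b T"
    and v: "sq_bounded (\<lambda>i. adj (v i)) I (R\<^sup>2)" and w: "sq_bounded w I (R'\<^sup>2)"
    and R: "0 < R" "0 < R'" and u: "u \<in> predual_tensors"
  shows "norm (tensor_pairing T u) \<le> R * R' * predual_haagerup_norm u"
proof -
  have main: "norm (tensor_pairing T u) \<le> R * R' *
      (predual_mat_norm {()} {..<n} (\<lambda>_ k. \<omega> k) * predual_mat_norm {..<n} {()} (\<lambda>k _. \<nu> k))"
    if un: "u = tensor_form n \<omega> \<nu>" and pre: "\<And>k. k < n \<Longrightarrow> \<omega> k \<in> predual \<and> \<nu> k \<in> predual" for n \<omega> \<nu>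
  proof -
    define A where "A = predual_mat_norm {()} {..<n} (\<lambda>_ k. \<omega> k)"
    define B where "B = predual_mat_norm {..<n} {()} (\<lambda>k _. \<nu> k)"
    have fin: "norm (\<Sum>i\<in>F. u (v i) (w i)) \<le> R * R' * (A * B)" if F: "finite F" "F \<subseteq> I" for F
    proof -
      obtain f where f: "bij_betw f {0..<card F} F"
        using ex_bij_betw_nat_finite[OF F(1)] by blast
      define m where "m = card F"
      have f: "bij_betw f {..<m} F"
        using f by (simp add: m_def lessThan_atLeast0)
      have re: "(\<Sum>i\<in>F. g i) = (\<Sum>j<m. g (f j))" for g :: "'a \<Rightarrow> 'z::comm_monoid_add"
        using sum.reindex_bij_betw[OF f, of g] by simp
      have vv: "(\<Sum>j<m. (norm (app (adj (v (f j))) y))\<^sup>2) \<le> R\<^sup>2 * (norm y)\<^sup>2" for y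
        unfolding re[symmetric, of "\<lambda>i. (norm (app (adj (v i)) y))\<^sup>2"] using v F by (simp add: sq_bounded_def)
      have ww: "(\<Sum>j<m. (norm (app (w (f j)) y))\<^sup>2) \<le> R'\<^sup>2 * (norm y)\<^sup>2" for y
        unfolding re[symmetric, of "\<lambda>i. (norm (app (w i) y))\<^sup>2"] using w F by (simp add: sq_bounded_def)
      have 1: "sqrt (\<Sum>j<m. \<Sum>k<n. (norm (\<omega> k (v (f j))))\<^sup>2) \<le> A * R"
        unfolding A_def by (rule predual_row_bound[OF _ vv R(1)]) (use pre in auto)
      have 2: "sqrt (\<Sum>j<m. \<Sum>k<n. (norm (\<nu> k (w (f j))))\<^sup>2) \<le> B * R'"
        unfolding B_def by (rule predual_column_bound[OF _ ww R(2)]) (use pre in auto)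
      have "(\<Sum>i\<in>F. u (v i) (w i)) = (\<Sum>y\<in>{..<m} \<times> {..<n}. \<omega> (snd y) (v (f (fst y))) * \<nu> (snd y) (w (f (fst y))))"
        unfolding re un tensor_form_def by (simp add: sum.cartesian_product case_prod_unfold)
      also have "norm \<dots> \<le> (\<Sum>y\<in>{..<m} \<times> {..<n}. norm (\<omega> (snd y) (v (f (fst y)))) * norm (\<nu> (snd y) (w (f (fst y)))))"
        by (intro sum_norm_le) (simp add: norm_mult)
      also have "\<dots> \<le> sqrt (\<Sum>y\<in>{..<m} \<times> {..<n}. (norm (\<omega> (snd y) (v (f (fst y)))))\<^sup>2)
          * sqrt (\<Sum>y\<in>{..<m} \<times> {..<n}. (norm (\<nu> (snd y) (w (f (fst y)))))\<^sup>2)"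
        by (rule sum_norm_mult_le_sqrt) auto
      also have "\<dots> = sqrt (\<Sum>j<m. \<Sum>k<n. (norm (\<omega> k (v (f j))))\<^sup>2) * sqrt (\<Sum>j<m. \<Sum>k<n. (norm (\<nu> k (w (f j))))\<^sup>2)"
        by (simp add: sum.cartesian_product case_prod_unfold)
      also have "\<dots> \<le> (A * R) * (B * R')"
        by (rule mult_mono[OF 1 2]) (auto intro!: order_trans[OF _ 1] real_sqrt_ge_zero sum_nonneg)
      finally show ?thesis by (simp add: mult_ac)
    qed
    have "((\<lambda>i. u (v i) (w i)) has_sum tensor_pairing T u) I"
      by (rule tensor_pairing_has_sum[OF T u])
    then have "((\<lambda>F. norm (\<Sum>i\<in>F. u (v i) (w i))) \<longlongrightarrow> norm (tensor_pairing T u)) (finite_subsets_at_top I)"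
      unfolding has_sum_def by (rule tendsto_norm)
    then show ?thesis
      unfolding A_def[symmetric] B_def[symmetric]
      by (rule tendsto_upperbound) (auto intro: fin eventually_finite_subsets_at_top_weakI)
  qed
  \<comment> \<open>Dividing by the positive constants first allows the passage to the infimum over
    the representations of \<open>u\<close>.\<close>
  have "norm (tensor_pairing T u) / (R * R') \<le> predual_haagerup_norm u"
    unfolding predual_haagerup_norm_def
  proof (rule cInf_greatest)
    show "{predual_mat_norm {()} {..<n} (\<lambda>_ k. \<omega> k) * predual_mat_norm {..<n} {()} (\<lambda>k _. \<nu> k) |n \<omega> \<nu>.
        (\<forall>k<n. \<omega> k \<in> predual \<and> \<nu> k \<in> predual) \<and> u = tensor_form n \<omega> \<nu>} \<noteq> {}"
      using u unfolding predual_tensors_def by (elim CollectE exE) auto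
    fix x assume "x \<in> {predual_mat_norm {()} {..<n} (\<lambda>_ k. \<omega> k) * predual_mat_norm {..<n} {()} (\<lambda>k _. \<nu> k) |n \<omega> \<nu>.
        (\<forall>k<n. \<omega> k \<in> predual \<and> \<nu> k \<in> predual) \<and> u = tensor_form n \<omega> \<nu>}"
    then obtain n \<omega> \<nu> where x: "x = predual_mat_norm {()} {..<n} (\<lambda>_ k. \<omega> k) * predual_mat_norm {..<n} {()} (\<lambda>k _. \<nu> k)"
      and un: "u = tensor_form n \<omega> \<nu>" and pre: "\<forall>k<n. \<omega> k \<in> predual \<and> \<nu> k \<in> predual" by blast
    then have "norm (tensor_pairing T u) \<le> R * R' * x"
      using main[OF un] by simp
    then show "norm (tensor_pairing T u) / (R * R') \<le> x"
      using R by (simp add: divide_le_eq mult.commute)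
  qed
  then show ?thesis
    using R by (simp add: divide_le_eq mult.commute)
qed

lemma predual_haagerupD:
  assumes "X \<in> predual_haagerup"
  shows "X n \<in> predual_tensors"
    and "0 < e \<Longrightarrow> \<exists>N. \<forall>m\<ge>N. \<forall>n\<ge>N. predual_haagerup_norm (\<lambda>S T. X m S T - X n S T) < e"
  using assms by (simp_all add: predual_haagerup_def)

lemma sq_bounded_mono: "sq_bounded u I A \<Longrightarrow> A \<le> B \<Longrightarrow> sq_bounded u I B"
  unfolding sq_bounded_def by (meson mult_right_mono order_trans zero_le_power2)

text \<open>The pairing is Lipschitz for the Haagerup norm, so it maps Cauchy sequences to Cauchy
  sequences, and the \<open>lim\<close> in \<open>eh_pairing\<close> is a genuine limit.\<close>

lemma eh_pairing_tendsto:
  fixes T :: "'h::complex_hilbert bop \<Rightarrow> 'h bop"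
  assumes T: "T \<in> UNIV \<otimes>eh UNIV" and X: "X \<in> predual_haagerup"
  shows "(\<lambda>n. tensor_pairing T (X n)) \<longlonglongrightarrow> eh_pairing T X"
proof -
  obtain I v w a b where r: "eh_rep UNIV UNIV I v w a b T"
    using T by (rule eh_rep_of_eh)
  note fam = eh_familyD(1,2)[OF r[unfolded eh_rep_iff_eh_family]]
  \<comment> \<open>The summand 1 makes the bound positive, as \<open>tensor_pairing_bound\<close>
    requires.\<close>
  define R where "R = sqrt (norm a + 1)"
  define R' where "R' = sqrt (norm b + 1)"
  have R: "0 < R" "0 < R'" by (auto simp: R_def R'_def add_nonneg_pos)
  have v: "sq_bounded (\<lambda>i. adj (v i)) I (R\<^sup>2)" and w: "sq_bounded w I (R'\<^sup>2)"
    using fam by (auto simp: R_def R'_def intro: sq_bounded_mono)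
  have "Cauchy (\<lambda>n. tensor_pairing T (X n))"
  proof (rule metric_CauchyI)
    fix e :: real assume "0 < e"
    then have "0 < e / (R * R')" using R by simp
    then obtain N where N: "\<forall>m\<ge>N. \<forall>n\<ge>N. predual_haagerup_norm (\<lambda>S T. X m S T - X n S T) < e / (R * R')"
      using predual_haagerupD(2)[OF X] by blast
    have "dist (tensor_pairing T (X m)) (tensor_pairing T (X n)) < e" if "m \<ge> N" "n \<ge> N" for m n
    proof -
      have "dist (tensor_pairing T (X m)) (tensor_pairing T (X n)) = norm (tensor_pairing T (\<lambda>S T. X m S T - X n S T))"
        using tensor_pairing_diff[OF T predual_haagerupD(1)[OF X] predual_haagerupD(1)[OF X]]
        by (simp add: dist_norm)
      also have "\<dots> \<le> R * R' * predual_haagerup_norm (\<lambda>S T. X m S T - X n S T)"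
        by (intro tensor_pairing_bound[OF r v w R] predual_tensors_diff predual_haagerupD(1)[OF X])
      also have "\<dots> < R * R' * (e / (R * R'))"
        using N that R by (intro mult_strict_left_mono) auto
      finally show ?thesis using R by simp
    qed
    then show "\<exists>M. \<forall>m\<ge>M. \<forall>n\<ge>M. dist (tensor_pairing T (X m)) (tensor_pairing T (X n)) < e"
      by blast
  qed
  then show ?thesis
    unfolding eh_pairing_def using convergent_LIMSEQ_iff[THEN iffD1, OF Cauchy_convergent] by blast
qed

lemma const_in_predual_haagerup:
  assumes "u \<in> predual_tensors"
  shows "(\<lambda>_. u) \<in> predual_haagerup"
  using assms predual_haagerup_norm_zero by (auto simp: predual_haagerup_def intro: le_less_trans)

lemma eh_pairing_const:
  fixes T :: "'h::complex_hilbert bop \<Rightarrow> 'h bop"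
  assumes "T \<in> UNIV \<otimes>eh UNIV" "u \<in> predual_tensors"
  shows "eh_pairing T (\<lambda>_. u) = tensor_pairing T u"
  using eh_pairing_tendsto[OF assms(1) const_in_predual_haagerup[OF assms(2)]]
  by (rule LIMSEQ_unique) simp

text \<open>Constant sequences of tensors of vector functionals already recover the values at rank
  one operators. This gives uniqueness in the definite description of
  \<open>Gamma_rep\<close>.\<close>

lemma eh_pairing_inject:
  fixes T T' :: "'h::complex_hilbert bop \<Rightarrow> 'h bop"
  assumes T: "T \<in> UNIV \<otimes>eh UNIV" "T' \<in> UNIV \<otimes>eh UNIV"
    and eq: "\<And>X. X \<in> predual_haagerup \<Longrightarrow> eh_pairing T X = eh_pairing T' X"
  shows "T = T'"
proof (rule eh_ext[OF T], rule bop_eqI_cinner)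
  fix x y x' z :: 'h
  define u where "u = simple_tensor (\<lambda>S. cinner (app S x) z) (\<lambda>R. cinner (app R x') y)"
  have u: "u \<in> predual_tensors"
    unfolding u_def by (intro simple_tensor_in vector_functional_in_predual)
  have "tensor_pairing T u = tensor_pairing T' u"
    using eq[OF const_in_predual_haagerup[OF u]] eh_pairing_const[OF _ u] T by simp
  then show "cinner (app (T (rank_one x y)) x') z = cinner (app (T' (rank_one x y)) x') z"
    unfolding u_def tensor_pairing_vector[OF T(1)] tensor_pairing_vector[OF T(2)] .
qed

section \<open>Complex measures\<close>

definition cm_additive :: "('g::topological_space set \<Rightarrow> complex) \<Rightarrow> bool"
  where "cm_additive \<mu> \<longleftrightarrow> (\<forall>A :: nat \<Rightarrow> 'g set. range A \<subseteq> sets borel \<longrightarrow> disjoint_family A \<longrightarrow>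
      (\<lambda>n. \<mu> (A n)) sums \<mu> (\<Union>n. A n))"

text \<open>The part of \<open>complex_measures\<close> that integration uses. It leaves aside
  regularity and the convention on non-Borel sets, and so passes easily to derived measures.\<close>

definition cm_finite :: "('g::topological_space set \<Rightarrow> complex) \<Rightarrow> bool"
  where "cm_finite \<mu> \<longleftrightarrow> cm_additive \<mu> \<and> total_variation \<mu> UNIV < \<infinity>"

definition borel_partitions :: "'g::topological_space set \<Rightarrow> 'g set set set"
  where "borel_partitions E = {P. finite P \<and> disjoint P \<and> P \<subseteq> sets borel \<and> \<Union>P = E}"

lemma total_variation_partitions:
  "total_variation \<mu> E = (SUP P\<in>borel_partitions E. \<Sum>A\<in>P. ennreal (norm (\<mu> A)))"
  unfolding total_variation_def borel_partitions_def ..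

lemma cm_additive_sums:
  "cm_additive \<mu> \<Longrightarrow> (\<And>n. A n \<in> sets borel) \<Longrightarrow> disjoint_family A \<Longrightarrow> (\<lambda>n. \<mu> (A n)) sums \<mu> (\<Union>n. A n)"
  unfolding cm_additive_def by blast

lemma cm_additive_empty:
  assumes "cm_additive \<mu>"
  shows "\<mu> {} = 0"
proof -
  have "(\<lambda>n::nat. \<mu> {}) sums \<mu> (\<Union>n::nat. {})"
    by (rule cm_additive_sums[OF assms]) (auto simp: disjoint_family_on_def)
  then have "summable (\<lambda>n::nat. \<mu> {})" by (rule sums_summable)
  then show ?thesis by (simp add: summable_const_iff)
qed

lemma singleton_partition: "E \<in> sets borel \<Longrightarrow> {E} \<in> borel_partitions E"
  by (auto simp: borel_partitions_def disjoint_def)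

lemma norm_le_total_variation: "E \<in> sets borel \<Longrightarrow> ennreal (norm (\<mu> E)) \<le> total_variation \<mu> E"
  unfolding total_variation_partitions by (rule SUP_upper2[OF singleton_partition]) auto

lemma partition_union:
  assumes "P \<in> borel_partitions A" "Q \<in> borel_partitions B" "A \<inter> B = {}"
  shows "P \<union> Q \<in> borel_partitions (A \<union> B)"
  using assms unfolding borel_partitions_def disjoint_def by auto blast+

text \<open>Partitions of \<open>A\<close> and of \<open>B\<close> unite to a partition of the
  union. They can share only the empty set, where \<mu> vanishes.\<close>

lemma total_variation_superadditive:
  assumes \<mu>: "cm_additive \<mu>" and "A \<inter> B = {}" "A \<in> sets borel" "B \<in> sets borel"
  shows "total_variation \<mu> A + total_variation \<mu> B \<le> total_variation \<mu> (A \<union> B)"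
proof -
  let ?f = "\<lambda>P. \<Sum>A\<in>P. ennreal (norm (\<mu> A))"
  have neA: "borel_partitions A \<noteq> {}" and neB: "borel_partitions B \<noteq> {}"
    using singleton_partition assms(3,4) by blast+
  have "?f P + ?f Q \<le> total_variation \<mu> (A \<union> B)"
    if P: "P \<in> borel_partitions A" and Q: "Q \<in> borel_partitions B" for P Q
  proof -
    have fin: "finite P" "finite Q" using P Q by (auto simp: borel_partitions_def)
    have "P \<inter> Q \<subseteq> {{}}"
      using P Q assms(2) unfolding borel_partitions_def by blast
    then have "?f (P \<inter> Q) = 0"
      by (intro sum.neutral) (auto simp: cm_additive_empty[OF \<mu>])
    then have "?f P + ?f Q = ?f (P \<union> Q)"
      using sum.union_inter[OF fin, of "\<lambda>A. ennreal (norm (\<mu> A))"] by simp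
    also have "\<dots> \<le> total_variation \<mu> (A \<union> B)"
      unfolding total_variation_partitions by (rule SUP_upper[OF partition_union[OF P Q assms(2)]])
    finally show ?thesis .
  qed
  then have "?f P + total_variation \<mu> B \<le> total_variation \<mu> (A \<union> B)" if "P \<in> borel_partitions A" for P
    unfolding total_variation_partitions[of \<mu> B] ennreal_SUP_add_right[OF neB]
    using that by (intro SUP_least) auto
  then show ?thesis
    unfolding total_variation_partitions[of \<mu> A] ennreal_SUP_add_left[OF neA, symmetric]
    by (intro SUP_least) auto
qed

lemma total_variation_mono:
  assumes "cm_additive \<mu>" "A \<subseteq> B" "A \<in> sets borel" "B \<in> sets borel"
  shows "total_variation \<mu> A \<le> total_variation \<mu> B"
proof -
  have "total_variation \<mu> A \<le> total_variation \<mu> A + total_variation \<mu> (B - A)" by simp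
  also have "\<dots> \<le> total_variation \<mu> (A \<union> (B - A))"
    using assms by (intro total_variation_superadditive) auto
  finally show ?thesis using assms(2) by (simp add: Un_absorb1)
qed

lemma ennreal_norm_sums_le:
  fixes f :: "nat \<Rightarrow> complex"
  assumes "f sums s"
  shows "ennreal (norm s) \<le> (\<Sum>n. ennreal (norm (f n)))"
proof -
  have "(\<lambda>n. norm (\<Sum>i<n. f i)) \<longlonglongrightarrow> norm s"
    using assms unfolding sums_def by (rule tendsto_norm)
  then have lim: "(\<lambda>n. ennreal (norm (\<Sum>i<n. f i))) \<longlonglongrightarrow> ennreal (norm s)"
    by (rule tendsto_ennrealI)
  have "ennreal (norm (\<Sum>i<n. f i)) \<le> (\<Sum>n. ennreal (norm (f n)))" for n
  proof -
    have "ennreal (norm (\<Sum>i<n. f i)) \<le> ennreal (\<Sum>i<n. norm (f i))"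
      by (intro ennreal_leI norm_sum)
    also have "\<dots> = (\<Sum>i<n. ennreal (norm (f i)))"
      by (rule sum_ennreal[symmetric]) simp
    also have "\<dots> \<le> (\<Sum>n. ennreal (norm (f n)))"
      by (rule sum_le_suminf) auto
    finally show ?thesis .
  qed
  then show ?thesis
    by (intro LIMSEQ_le_const2[OF lim] exI[of _ 0] allI impI)
qed

text \<open>Each member of a partition is cut along the \<open>A n\<close>, and the traces of the
  partition on one \<open>A n\<close> form a partition of it.\<close>

lemma total_variation_countable_subadditive:
  assumes \<mu>: "cm_additive \<mu>" and A: "\<And>n :: nat. A n \<in> sets borel" "disjoint_family A"
  shows "total_variation \<mu> (\<Union>n. A n) \<le> (\<Sum>n. total_variation \<mu> (A n))"
  unfolding total_variation_partitions[of \<mu> "\<Union>n. A n"]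
proof (rule SUP_least)
  fix P assume P: "P \<in> borel_partitions (\<Union>n. A n)"
  have fin: "finite P" and disj: "disjoint P" and PU: "\<Union>P = (\<Union>n. A n)" and Pb: "\<And>B. B \<in> P \<Longrightarrow> B \<in> sets borel"
    using P by (auto simp: borel_partitions_def)
  have "ennreal (norm (\<mu> B)) \<le> (\<Sum>n. ennreal (norm (\<mu> (B \<inter> A n))))" if "B \<in> P" for B
  proof -
    have "(\<lambda>n. \<mu> (B \<inter> A n)) sums \<mu> (\<Union>n. B \<inter> A n)"
      using Pb[OF that] A by (intro cm_additive_sums[OF \<mu>]) (auto simp: disjoint_family_on_def)
    moreover have "(\<Union>n. B \<inter> A n) = B" using PU that by auto
    ultimately show ?thesis by (intro ennreal_norm_sums_le) simp
  qed
  then have "(\<Sum>B\<in>P. ennreal (norm (\<mu> B))) \<le> (\<Sum>B\<in>P. \<Sum>n. ennreal (norm (\<mu> (B \<inter> A n))))"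
    by (rule sum_mono)
  also have "\<dots> = (\<Sum>n. \<Sum>B\<in>P. ennreal (norm (\<mu> (B \<inter> A n))))"
    by (rule suminf_sum[symmetric]) auto
  also have "\<dots> \<le> (\<Sum>n. total_variation \<mu> (A n))"
  proof (rule suminf_le)
    fix n
    have "(\<Sum>B\<in>P. ennreal (norm (\<mu> (B \<inter> A n)))) = (\<Sum>C\<in>(\<lambda>B. B \<inter> A n) ` P. ennreal (norm (\<mu> C)))"
    \<comment> \<open>Two different members of the partition have equal traces only if both traces
      are empty, and then the terms are 0.\<close>
    proof (rule sum.reindex_nontrivial[symmetric, unfolded comp_def, OF fin])
      fix B C assume BC: "B \<in> P" "C \<in> P" "B \<noteq> C" "B \<inter> A n = C \<inter> A n"
      then have "B \<inter> C = {}" using disj by (auto simp: disjoint_def)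
      then have "B \<inter> A n = {}" using BC(4) by auto
      then show "ennreal (norm (\<mu> (B \<inter> A n))) = 0"
        by (simp add: cm_additive_empty[OF \<mu>])
    qed
    also have "\<dots> \<le> total_variation \<mu> (A n)"
      unfolding total_variation_partitions
    proof (rule SUP_upper)
      have "\<Union>((\<lambda>B. B \<inter> A n) ` P) = A n" using PU by auto
      moreover have "disjoint ((\<lambda>B. B \<inter> A n) ` P)"
        using disj unfolding disjoint_def by auto
      ultimately show "(\<lambda>B. B \<inter> A n) ` P \<in> borel_partitions (A n)"
        using fin Pb A(1) by (auto simp: borel_partitions_def)
    qed
    finally show "(\<Sum>B\<in>P. ennreal (norm (\<mu> (B \<inter> A n)))) \<le> total_variation \<mu> (A n)" .
  qed auto
  finally show "(\<Sum>B\<in>P. ennreal (norm (\<mu> B))) \<le> (\<Sum>n. total_variation \<mu> (A n))" .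
qed

lemma total_variation_empty:
  assumes "cm_additive \<mu>"
  shows "total_variation \<mu> {} = 0"
proof -
  have "(\<Sum>A\<in>P. ennreal (norm (\<mu> A))) \<le> 0" if "P \<in> borel_partitions {}" for P
  proof -
    have "\<forall>A\<in>P. A = {}" using that by (auto simp: borel_partitions_def)
    then have "(\<Sum>A\<in>P. ennreal (norm (\<mu> A))) = 0"
      by (intro sum.neutral) (auto simp: cm_additive_empty[OF assms])
    then show ?thesis by simp
  qed
  then have "total_variation \<mu> {} \<le> 0"
    unfolding total_variation_partitions by (rule SUP_least)
  then show ?thesis by simp
qed

definition tv_measure :: "('g::topological_space set \<Rightarrow> complex) \<Rightarrow> 'g measure"
  where "tv_measure \<mu> = measure_of UNIV (sets borel) (total_variation \<mu>)"

lemma sets_tv_measure [measurable_cong, simp]: "sets (tv_measure \<mu>) = sets borel"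
  unfolding tv_measure_def using sets.sigma_sets_eq[of borel] by simp

lemma space_tv_measure [simp]: "space (tv_measure \<mu>) = UNIV"
  unfolding tv_measure_def by simp

text \<open>Superadditivity on finite unions and monotonicity give the inequality opposite to
  countable subadditivity.\<close>

lemma total_variation_countably_additive:
  fixes \<mu> :: "'g::topological_space set \<Rightarrow> complex"
  assumes \<mu>: "cm_additive \<mu>"
  shows "countably_additive (sets borel) (total_variation \<mu>)"
proof (rule countably_additiveI)
  fix A :: "nat \<Rightarrow> 'g set"
  assume A: "range A \<subseteq> sets borel" "disjoint_family A"
  have Ab: "A n \<in> sets borel" for n using A by auto
  have fs: "(\<Sum>i<n. total_variation \<mu> (A i)) \<le> total_variation \<mu> (\<Union>i<n. A i)" for n
  proof (induction n)
    case (Suc n)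
    have "(\<Sum>i<Suc n. total_variation \<mu> (A i)) \<le> total_variation \<mu> (\<Union>i<n. A i) + total_variation \<mu> (A n)"
      using Suc by (simp add: add_mono)
    also have "\<dots> \<le> total_variation \<mu> ((\<Union>i<n. A i) \<union> A n)"
    proof (rule total_variation_superadditive[OF \<mu>])
      show "(\<Union>i<n. A i) \<inter> A n = {}"
        using disjoint_family_onD[OF A(2), of _ n] by fastforce
    qed (use Ab in auto)
    also have "(\<Union>i<n. A i) \<union> A n = (\<Union>i<Suc n. A i)" by (auto simp: less_Suc_eq)
    finally show ?case .
  qed simp
  have "(\<Sum>i. total_variation \<mu> (A i)) \<le> total_variation \<mu> (\<Union>i. A i)"
  proof (rule suminf_le_const)
    show "(\<Sum>i<n. total_variation \<mu> (A i)) \<le> total_variation \<mu> (\<Union>i. A i)" for n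
      using fs[of n] by (rule order_trans) (intro total_variation_mono \<mu>, use Ab in auto)
  qed simp
  then show "(\<Sum>i. total_variation \<mu> (A i)) = total_variation \<mu> (\<Union>i. A i)"
    using total_variation_countable_subadditive[OF \<mu> Ab A(2)] by simp
qed

lemma emeasure_tv_measure:
  assumes \<mu>: "cm_additive \<mu>" and "E \<in> sets borel"
  shows "emeasure (tv_measure \<mu>) E = total_variation \<mu> E"
  unfolding tv_measure_def
proof (rule emeasure_measure_of_sigma)
  show "sigma_algebra UNIV (sets borel)"
    using sets.sigma_algebra_axioms[of borel] by simp
  show "positive (sets borel) (total_variation \<mu>)"
    by (simp add: positive_def total_variation_empty[OF \<mu>])
qed (use assms total_variation_countably_additive in auto)

lemma finite_tv_measure: "cm_finite \<mu> \<Longrightarrow> finite_measure (tv_measure \<mu>)"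
  by (rule finite_measureI) (auto simp: emeasure_tv_measure cm_finite_def)

lemma norm_le_tv_measure:
  assumes "cm_finite \<mu>" "E \<in> sets borel"
  shows "norm (\<mu> E) \<le> measure (tv_measure \<mu>) E"
proof -
  interpret finite_measure "tv_measure \<mu>" using assms(1) by (rule finite_tv_measure)
  have "ennreal (norm (\<mu> E)) \<le> ennreal (measure (tv_measure \<mu>) E)"
    using norm_le_total_variation[OF assms(2), of \<mu>] assms
    by (simp add: emeasure_tv_measure cm_finite_def flip: emeasure_eq_measure)
  then show ?thesis by simp
qed

lemma cm_norm_tv_measure: "cm_finite \<mu> \<Longrightarrow> cm_norm \<mu> = measure (tv_measure \<mu>) UNIV"
  by (simp add: cm_norm_def measure_def emeasure_tv_measure cm_finite_def)

text \<open>Minimality of the total variation: summing the domination over a partition of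
  \<open>E\<close> yields the measure of \<open>E\<close>.\<close>

lemma total_variation_le_measure:
  assumes M: "sets M = sets borel" and "E \<in> sets borel"
    and le: "\<And>A. A \<in> sets borel \<Longrightarrow> A \<subseteq> E \<Longrightarrow> ennreal (norm (\<mu> A)) \<le> emeasure M A"
  shows "total_variation \<mu> E \<le> emeasure M E"
  unfolding total_variation_partitions
proof (rule SUP_least)
  fix P assume P: "P \<in> borel_partitions E"
  have "(\<Sum>A\<in>P. ennreal (norm (\<mu> A))) \<le> (\<Sum>A\<in>P. emeasure M A)"
    using P by (intro sum_mono le) (auto simp: borel_partitions_def)
  also have "\<dots> = emeasure M (\<Union>A\<in>P. A)"
    using P by (intro sum_emeasure) (auto simp: borel_partitions_def M disjoint_family_on_def disjoint_def)
  finally show "(\<Sum>A\<in>P. ennreal (norm (\<mu> A))) \<le> emeasure M E"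
    using P by (simp add: borel_partitions_def)
qed

section \<open>Densities and the polar decomposition\<close>

text \<open>The Radon-Nikodym theorem is applied to the positive measure \<open>r + M\<close>.\<close>

lemma signed_radon_nikodym:
  fixes r :: "'g::topological_space set \<Rightarrow> real"
  assumes "finite_measure M" and M: "sets M = sets borel"
    and r: "\<And>A :: nat \<Rightarrow> 'g set. (\<And>n. A n \<in> sets borel) \<Longrightarrow> disjoint_family A \<Longrightarrow> (\<lambda>n. r (A n)) sums r (\<Union>n. A n)"
    and le: "\<And>E. E \<in> sets borel \<Longrightarrow> \<bar>r E\<bar> \<le> measure M E"
  obtains k where "integrable M k" "\<And>E. E \<in> sets borel \<Longrightarrow> r E = (LINT x|M. indicator E x * k x)"
proof -
  interpret finite_measure M by fact
  have sp: "space M = UNIV" using sets_eq_imp_space_eq[OF M] by simp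
  define N where "N = measure_of UNIV (sets borel) (\<lambda>E. ennreal (r E + measure M E))"
  have setsN: "sets N = sets borel"
    unfolding N_def using sets.sigma_sets_eq[of "borel :: 'g measure"] by simp
  have ge: "0 \<le> r E + measure M E" if "E \<in> sets borel" for E
    using le[OF that] by simp
  have emN: "emeasure N E = ennreal (r E + measure M E)" if "E \<in> sets borel" for E
    unfolding N_def
  proof (rule emeasure_measure_of_sigma[OF _ _ _ that])
    show "sigma_algebra UNIV (sets (borel :: 'g measure))"
      using sets.sigma_algebra_axioms[of "borel :: 'g measure"] by simp
    show "positive (sets borel) (\<lambda>E. ennreal (r E + measure M E))"
      using le[of "{}"] by (simp add: positive_def)
    show "countably_additive (sets borel) (\<lambda>E. ennreal (r E + measure M E))"
    proof (rule countably_additiveI)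
      fix A :: "nat \<Rightarrow> 'g set"
      assume A: "range A \<subseteq> sets borel" "disjoint_family A"
      then have Ab: "A n \<in> sets borel" for n by auto
      have "(\<lambda>n. measure M (A n)) sums measure M (\<Union>n. A n)"
        using A M by (intro finite_measure_UNION) auto
      then have "(\<lambda>n. r (A n) + measure M (A n)) sums (r (\<Union>n. A n) + measure M (\<Union>n. A n))"
        by (intro sums_add r Ab A(2))
      then show "(\<Sum>i. ennreal (r (A i) + measure M (A i))) = ennreal (r (\<Union>n. A n) + measure M (\<Union>n. A n))"
        using ge[OF Ab] by (intro suminf_ennreal_eq)
    qed
  qed
  have finN: "finite_measure N"
    by (rule finite_measureI) (simp add: sets_eq_imp_space_eq[OF setsN] emN)
  have "absolutely_continuous M N"
    unfolding absolutely_continuous_def null_sets_def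
    using M setsN le by (auto simp: emN measure_def) force
  then obtain f where f: "f \<in> borel_measurable M" "density M f = N"
    using Radon_Nikodym_finite_measure[OF finN] setsN M by auto
  have "AE x in M. f x \<noteq> \<infinity>"
  proof (rule nn_integral_PInf_AE[OF f(1)])
    have "(\<integral>\<^sup>+x. f x \<partial>M) = emeasure N (space M)"
      using f by (simp flip: f(2) add: emeasure_density cong: nn_integral_cong)
    then show "(\<integral>\<^sup>+x. f x \<partial>M) \<noteq> \<infinity>"
      by (simp add: sp emN)
  qed
  then have fr: "AE x in M. f x = ennreal (enn2real (f x))"
    by eventually_elim (auto simp: less_top)
  define d where "d x = enn2real (f x)" for x
  have d[measurable]: "d \<in> borel_measurable M" unfolding d_def using f(1) by measurable
  have d0: "0 \<le> d x" for x by (simp add: d_def)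
  have dN: "(\<integral>\<^sup>+x. ennreal (indicator E x * d x) \<partial>M) = ennreal (r E + measure M E)" if "E \<in> sets borel" for E
  proof -
    have "(\<integral>\<^sup>+x. ennreal (indicator E x * d x) \<partial>M) = (\<integral>\<^sup>+x. f x * indicator E x \<partial>M)"
      using fr by (intro nn_integral_cong_AE) (auto simp: d_def indicator_def)
    also have "\<dots> = emeasure N E"
      using f that M by (simp flip: f(2) add: emeasure_density)
    finally show ?thesis using emN[OF that] by simp
  qed
  have int: "has_bochner_integral M (\<lambda>x. indicator E x * d x) (r E + measure M E)" if "E \<in> sets borel" for E
  proof -
    have [measurable]: "E \<in> sets M" using that M by simp
    show ?thesis
      using ge[OF that] dN[OF that] by (intro has_bochner_integral_nn_integral) (auto simp: d0)
  qed
  have intd: "integrable M d"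
    using int[of UNIV] by (simp add: has_bochner_integral_iff)
  show thesis
  \<comment> \<open>From the density \<open>d\<close> of \<open>r + M\<close> the density 1 of
    \<open>M\<close> itself is subtracted.\<close>
  proof (rule that[of "\<lambda>x. d x - 1"])
    show "integrable M (\<lambda>x. d x - 1)" using intd by simp
    fix E :: "'g set" assume E: "E \<in> sets borel"
    have "has_bochner_integral M (\<lambda>x. indicator E x * d x - indicator E x) (r E + measure M E - measure M E)"
      using E M by (intro has_bochner_integral_diff int) (auto intro!: has_bochner_integral_real_indicator simp: emeasure_eq_measure)
    then show "r E = (LINT x|M. indicator E x * (d x - 1))"
      by (simp add: has_bochner_integral_iff algebra_simps)
  qed
qed

text \<open>Real and imaginary part have densities by Radon-Nikodym. The averages of the resulting
  \<open>h0\<close> over sets of positive measure are quotients of \<mu> by its total variation, so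
  they lie in the closed unit disc, and therefore almost all values of \<open>h0\<close> do.\<close>

lemma polar_decomposition:
  fixes \<mu> :: "'g::topological_space set \<Rightarrow> complex"
  assumes \<mu>: "cm_finite \<mu>"
  obtains h where "h \<in> borel_measurable borel" "\<And>x. norm (h x) \<le> 1"
    "\<And>E. E \<in> sets borel \<Longrightarrow> \<mu> E = (LINT x|tv_measure \<mu>. indicator E x *\<^sub>R h x)"
proof -
  define \<tau> where "\<tau> = tv_measure \<mu>"
  have st[measurable_cong, simp]: "sets \<tau> = sets borel" and sp[simp]: "space \<tau> = UNIV" by (simp_all add: \<tau>_def)
  interpret finite_measure \<tau> unfolding \<tau>_def using \<mu> by (rule finite_tv_measure)
  have le: "norm (\<mu> E) \<le> measure \<tau> E" if "E \<in> sets borel" for E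
    unfolding \<tau>_def using \<mu> that by (rule norm_le_tv_measure)
  have ca: "(\<lambda>n. \<mu> (A n)) sums \<mu> (\<Union>n. A n)" if "\<And>n. A n \<in> sets borel" "disjoint_family A" for A :: "nat \<Rightarrow> 'g set"
    using \<mu> that by (intro cm_additive_sums) (auto simp: cm_finite_def)
  obtain k where k: "integrable \<tau> k" "\<And>E. E \<in> sets borel \<Longrightarrow> Re (\<mu> E) = (LINT x|\<tau>. indicator E x * k x)"
  proof (rule signed_radon_nikodym[of \<tau> "\<lambda>E. Re (\<mu> E)"])
    show "\<bar>Re (\<mu> E)\<bar> \<le> measure \<tau> E" if "E \<in> sets borel" for E
      using abs_Re_le_cmod le[OF that] by (rule order_trans)
  qed (use ca in \<open>auto intro: sums_Re finite_measure_axioms\<close>)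
  obtain l where l: "integrable \<tau> l" "\<And>E. E \<in> sets borel \<Longrightarrow> Im (\<mu> E) = (LINT x|\<tau>. indicator E x * l x)"
  proof (rule signed_radon_nikodym[of \<tau> "\<lambda>E. Im (\<mu> E)"])
    show "\<bar>Im (\<mu> E)\<bar> \<le> measure \<tau> E" if "E \<in> sets borel" for E
      using abs_Im_le_cmod le[OF that] by (rule order_trans)
  qed (use ca in \<open>auto intro: sums_Im finite_measure_axioms\<close>)
  define h0 where "h0 x = Complex (k x) (l x)" for x
  have [measurable]: "k \<in> borel_measurable borel" "l \<in> borel_measurable borel"
    using borel_measurable_integrable[OF k(1)] borel_measurable_integrable[OF l(1)] by simp_all
  have h0_alt: "h0 = (\<lambda>x. complex_of_real (k x) + \<i> * complex_of_real (l x))"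
    by (auto simp: h0_def complex_eq_iff)
  have [measurable]: "h0 \<in> borel_measurable borel" unfolding h0_alt by measurable
  have int0: "integrable \<tau> h0"
    unfolding h0_alt using k(1) l(1) by simp
  have h0E: "\<mu> E = (LINT x|\<tau>. indicator E x *\<^sub>R h0 x)" if "E \<in> sets borel" for E
  proof (rule complex_eqI)
    have i: "integrable \<tau> (\<lambda>x. indicator E x *\<^sub>R h0 x)"
      using int0 that by (intro integrable_mult_indicator) auto
    show "Re (\<mu> E) = Re (LINT x|\<tau>. indicator E x *\<^sub>R h0 x)"
      using i that k(2) by (simp add: h0_def flip: integral_Re)
    show "Im (\<mu> E) = Im (LINT x|\<tau>. indicator E x *\<^sub>R h0 x)"
      using i that l(2) by (simp add: h0_def flip: integral_Im)
  qed
  have ae: "AE x in \<tau>. h0 x \<in> cball 0 1"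
  proof (rule averaging_theorem[OF int0 closed_cball])
    fix A assume A: "A \<in> sets \<tau>" "0 < measure \<tau> A"
    then have "norm (\<mu> A) \<le> measure \<tau> A" by (intro le) simp
    then show "(1 / measure \<tau> A) *\<^sub>R set_lebesgue_integral \<tau> A h0 \<in> cball 0 1"
      using A h0E[of A] by (simp add: set_lebesgue_integral_def divide_le_eq_1)
  qed
  \<comment> \<open>A change on a null set makes the bound hold everywhere, so that \<open>h\<close>
    is a bounded Borel function.\<close>
  define h where "h x = (if norm (h0 x) \<le> 1 then h0 x else 0)" for x
  have hm[measurable]: "h \<in> borel_measurable borel" unfolding h_def by measurable
  show thesis
  proof (rule that[of h])
    show "norm (h x) \<le> 1" for x by (simp add: h_def)
    fix E :: "'g set" assume E: "E \<in> sets borel"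
    have "(LINT x|\<tau>. indicator E x *\<^sub>R h x) = (LINT x|\<tau>. indicator E x *\<^sub>R h0 x)"
      using ae E by (intro integral_cong_AE) (auto simp: h_def)
    then show "\<mu> E = (LINT x|tv_measure \<mu>. indicator E x *\<^sub>R h x)"
      using h0E[OF E] by (simp add: \<tau>_def)
  qed (rule hm)
qed

text \<open>The supremum that defines the positive part at \<open>E\<close> is attained at
  \<open>E \<inter> {x. 0 < k x}\<close> (Hahn decomposition).\<close>

lemma pos_part_density:
  fixes M :: "'g::topological_space measure"
  assumes M: "sets M = sets borel" and k: "integrable M k"
    and r: "\<And>E. E \<in> sets borel \<Longrightarrow> r E = (LINT x|M. indicator E x * k x)"
  shows "pos_part r = density M (\<lambda>x. ennreal (max (k x) 0))"
proof -
  let ?D = "density M (\<lambda>x. ennreal (max (k x) 0))"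
  have [measurable]: "k \<in> borel_measurable M" using k by simp
  have int: "integrable M (\<lambda>x. indicator E x * k x)" "integrable M (\<lambda>x. indicator E x * max (k x) 0)"
    if "E \<in> sets borel" for E
    using that M k integrable_mult_indicator[of E M k] integrable_mult_indicator[of E M "\<lambda>x. max (k x) 0"]
    by auto
  have em: "emeasure ?D E = ennreal (LINT x|M. indicator E x * max (k x) 0)" if E: "E \<in> sets borel" for E
  proof -
    have "emeasure ?D E = (\<integral>\<^sup>+x. ennreal (indicator E x * max (k x) 0) \<partial>M)"
      using that M by (simp add: emeasure_density mult.commute) (auto intro!: nn_integral_cong simp: indicator_def)
    also have "\<dots> = ennreal (LINT x|M. indicator E x * max (k x) 0)"
      by (rule nn_integral_eq_integral[OF int(2)[OF E]]) simp
    finally show ?thesis .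
  qed
  have "(SUP F\<in>{F \<in> sets borel. F \<subseteq> E}. ennreal (r F)) = emeasure ?D E" if E: "E \<in> sets borel" for E
  proof (rule antisym)
    show "(SUP F\<in>{F \<in> sets borel. F \<subseteq> E}. ennreal (r F)) \<le> emeasure ?D E"
    proof (rule SUP_least)
      fix F assume F: "F \<in> {F \<in> sets borel. F \<subseteq> E}"
      have "r F \<le> (LINT x|M. indicator E x * max (k x) 0)"
        using F E unfolding r[OF CollectD[OF F, THEN conjunct1]]
        by (intro integral_mono int) (auto simp: indicator_def)
      then show "ennreal (r F) \<le> emeasure ?D E"
        unfolding em[OF E] by (rule ennreal_leI)
    qed
    have F: "E \<inter> {x. 0 < k x} \<in> sets borel"
      using E M borel_measurable_less[of "\<lambda>_. 0" M k] sets_eq_imp_space_eq[OF M] by auto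
    have "(LINT x|M. indicator E x * max (k x) 0) = r (E \<inter> {x. 0 < k x})"
      unfolding r[OF F] by (rule Bochner_Integration.integral_cong) (auto simp: indicator_def)
    then show "emeasure ?D E \<le> (SUP F\<in>{F \<in> sets borel. F \<subseteq> E}. ennreal (r F))"
      unfolding em[OF E] using F by (intro SUP_upper2[of "E \<inter> {x. 0 < k x}"]) auto
  qed
  then have "pos_part r = measure_of UNIV (sets borel) (emeasure ?D)"
    unfolding pos_part_def
    by (intro measure_of_eq) (simp_all add: sets.sigma_sets_eq[of "borel :: 'g measure", simplified])
  also have "\<dots> = measure_of (space ?D) (sets ?D) (emeasure ?D)"
    using M sets_eq_imp_space_eq[OF M] by simp
  also have "\<dots> = ?D" by (rule measure_of_of_measure)
  finally show ?thesis .
qed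

text \<open>The four integrals against Jordan parts combine to one integral against the density
  \<open>k\<close>. It is applied to total variations and to the base measures of
  \<open>dens\<close>.\<close>

lemma cm_integral_density:
  fixes M :: "'g::topological_space measure" and k f :: "'g \<Rightarrow> complex"
  assumes M: "sets M = sets borel" and k: "integrable M k"
    and \<mu>: "\<And>E. E \<in> sets borel \<Longrightarrow> \<mu> E = (LINT x|M. indicator E x *\<^sub>R k x)"
    and f: "f \<in> borel_measurable borel" "\<And>x. norm (f x) \<le> C"
  shows "has_cm_integral \<mu> f (LINT x|M. f x * k x)" and "integrable M (\<lambda>x. f x * k x)"
proof -
  have fM[measurable]: "f \<in> borel_measurable M" using f(1) M by (simp cong: measurable_cong_sets)
  have kM[measurable]: "k \<in> borel_measurable M" using k by simp
  have C0: "0 \<le> C" using f(2)[of undefined] norm_ge_zero order_trans by blast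
  have intE: "integrable M (\<lambda>x. indicator E x *\<^sub>R k x)" if "E \<in> sets borel" for E
    using k that M by (intro integrable_mult_indicator) auto
  have Re: "Re (\<mu> E) = (LINT x|M. indicator E x * Re (k x))" and Im: "Im (\<mu> E) = (LINT x|M. indicator E x * Im (k x))"
    if "E \<in> sets borel" for E
    using intE[OF that] \<mu>[OF that] by (simp_all flip: integral_Re integral_Im)
  have p1: "pos_part (\<lambda>E. Re (\<mu> E)) = density M (\<lambda>x. ennreal (max (Re (k x)) 0))"
    using k Re by (intro pos_part_density M) auto
  have p2: "pos_part (\<lambda>E. - Re (\<mu> E)) = density M (\<lambda>x. ennreal (max (- Re (k x)) 0))"
    using k Re by (intro pos_part_density M) auto
  have p3: "pos_part (\<lambda>E. Im (\<mu> E)) = density M (\<lambda>x. ennreal (max (Im (k x)) 0))"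
    using k Im by (intro pos_part_density M) auto
  have p4: "pos_part (\<lambda>E. - Im (\<mu> E)) = density M (\<lambda>x. ennreal (max (- Im (k x)) 0))"
    using k Im by (intro pos_part_density M) auto
  have gen: "integrable M (\<lambda>x. g x *\<^sub>R f x)" if [measurable]: "g \<in> borel_measurable M" and "\<And>x. \<bar>g x\<bar> \<le> norm (k x)" for g
  proof (rule Bochner_Integration.integrable_bound[where f = "\<lambda>x. C * norm (k x)"])
    show "integrable M (\<lambda>x. C * norm (k x))" using k by simp
    show "AE x in M. norm (g x *\<^sub>R f x) \<le> norm (C * norm (k x))"
      using that(2) f(2) C0 by (auto intro!: AE_I2 simp: abs_mult) (metis mult.commute mult_mono norm_ge_zero abs_ge_zero)
  qed simp
  have b: "\<bar>max (Re z) 0\<bar> \<le> norm z" "\<bar>max (- Re z) 0\<bar> \<le> norm z" "\<bar>max (Im z) 0\<bar> \<le> norm z" "\<bar>max (- Im z) 0\<bar> \<le> norm z" for z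
    using abs_Re_le_cmod[of z] abs_Im_le_cmod[of z] by auto
  have i: "integrable M (\<lambda>x. max (Re (k x)) 0 *\<^sub>R f x)" "integrable M (\<lambda>x. max (- Re (k x)) 0 *\<^sub>R f x)"
    "integrable M (\<lambda>x. max (Im (k x)) 0 *\<^sub>R f x)" "integrable M (\<lambda>x. max (- Im (k x)) 0 *\<^sub>R f x)"
    by (auto intro!: gen b)
  have eq: "f x * k x = max (Re (k x)) 0 *\<^sub>R f x - max (- Re (k x)) 0 *\<^sub>R f x + \<i> * (max (Im (k x)) 0 *\<^sub>R f x - max (- Im (k x)) 0 *\<^sub>R f x)" for x
    by (auto simp: complex_eq_iff max_def algebra_simps)
  show "integrable M (\<lambda>x. f x * k x)"
    unfolding eq using i by simp
  have "cm_integrable \<mu> f"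
    unfolding cm_integrable_def p1 p2 p3 p4 using i by (simp add: integrable_density)
  moreover have "cm_integral \<mu> f = (LINT x|M. f x * k x)"
    unfolding cm_integral_def p1 p2 p3 p4 eq using i by (simp add: integral_density)
  ultimately show "has_cm_integral \<mu> f (LINT x|M. f x * k x)"
    by (simp add: has_cm_integral_def)
qed

section \<open>Integrals of bounded Borel functions\<close>

definition bounded_borel :: "('g::topological_space \<Rightarrow> complex) \<Rightarrow> bool"
  where "bounded_borel f \<longleftrightarrow> f \<in> borel_measurable borel \<and> (\<exists>C. \<forall>x. norm (f x) \<le> C)"

lemma bounded_borelI: "f \<in> borel_measurable borel \<Longrightarrow> (\<And>x. norm (f x) \<le> C) \<Longrightarrow> bounded_borel f"
  unfolding bounded_borel_def by blast

lemma bounded_borelD: "bounded_borel f \<Longrightarrow> f \<in> borel_measurable borel"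
  unfolding bounded_borel_def by blast

lemma bounded_borelE:
  assumes "bounded_borel f"
  obtains C where "0 \<le> C" "\<And>x. norm (f x) \<le> C"
proof -
  obtain C where C: "\<forall>x. norm (f x) \<le> C" using assms by (auto simp: bounded_borel_def)
  then have "0 \<le> C" using norm_ge_zero order_trans by blast
  then show thesis using C that by blast
qed

lemma bounded_borel_add:
  assumes "bounded_borel f" "bounded_borel g"
  shows "bounded_borel (\<lambda>x. f x + g x)"
proof -
  obtain C where "0 \<le> C" and C: "\<And>x. norm (f x) \<le> C" using assms(1) by (rule bounded_borelE) blast
  obtain D where "0 \<le> D" and D: "\<And>x. norm (g x) \<le> D" using assms(2) by (rule bounded_borelE) blast
  show ?thesis
    using bounded_borelD[OF assms(1)] bounded_borelD[OF assms(2)] C D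
    by (intro bounded_borelI[where C = "C + D"] borel_measurable_add norm_triangle_le add_mono)
qed

lemma bounded_borel_cmult:
  assumes "bounded_borel f"
  shows "bounded_borel (\<lambda>x. c * f x)"
proof -
  obtain C where "0 \<le> C" and C: "\<And>x. norm (f x) \<le> C" using assms(1) by (rule bounded_borelE) blast
  show ?thesis
    using bounded_borelD[OF assms] C
    by (intro bounded_borelI[where C = "norm c * C"]) (auto simp: norm_mult intro: mult_left_mono)
qed

lemma bounded_borel_mult:
  assumes "bounded_borel f" "bounded_borel g"
  shows "bounded_borel (\<lambda>x. f x * g x)"
proof -
  obtain C where C: "0 \<le> C" "\<And>x. norm (f x) \<le> C" using assms(1) by (rule bounded_borelE) blast
  obtain D where "0 \<le> D" and D: "\<And>x. norm (g x) \<le> D" using assms(2) by (rule bounded_borelE) blast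
  show ?thesis
    using bounded_borelD[OF assms(1)] bounded_borelD[OF assms(2)] C D
    by (intro bounded_borelI[where C = "C * D"]) (auto simp: norm_mult intro: mult_mono)
qed

lemma bounded_borel_indicator: "E \<in> sets borel \<Longrightarrow> bounded_borel (indicator E)"
  by (rule bounded_borelI[where C = 1]) (auto simp: indicator_def)

lemma bounded_borel_zero: "bounded_borel (\<lambda>x. 0)"
  by (rule bounded_borelI[where C = 0]) auto

lemma bounded_borel_sum:
  "finite I \<Longrightarrow> (\<And>i. i \<in> I \<Longrightarrow> bounded_borel (f i)) \<Longrightarrow> bounded_borel (\<lambda>x. \<Sum>i\<in>I. f i x)"
  by (induction I rule: finite_induct) (auto intro: bounded_borel_zero bounded_borel_add)

text \<open>Real and imaginary part are rounded down to multiples of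
  \<open>1 / real (Suc n)\<close>, whence the rate in the limit case. The rate is uniform in
  \<open>x\<close>, so a limit passes through every integral by the norm estimate alone.\<close>

lemma bounded_borel_induct [consumes 1, case_names indicator add cmult limit]:
  fixes f :: "'g::topological_space \<Rightarrow> complex"
  assumes f: "bounded_borel f"
    and indicator: "\<And>E. E \<in> sets borel \<Longrightarrow> P (indicator E)"
    and add: "\<And>f g. P f \<Longrightarrow> P g \<Longrightarrow> P (\<lambda>x. f x + g x)"
    and cmult: "\<And>f c. P f \<Longrightarrow> P (\<lambda>x. c * f x)"
    and limit: "\<And>F f. (\<And>n. P (F n)) \<Longrightarrow> bounded_borel f \<Longrightarrow>
      (\<And>n x. norm (F n x - f x) \<le> 2 / real (Suc n)) \<Longrightarrow> P f"
  shows "P f"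
proof -
  obtain C where C: "0 \<le> C" "\<And>x. norm (f x) \<le> C" using f by (rule bounded_borelE) blast
  have fm[measurable]: "f \<in> borel_measurable borel" using f by (rule bounded_borelD)
  have zero: "P (\<lambda>x. 0)" using cmult[OF indicator[of "{}"], of 0] by simp
  have sum: "P (\<lambda>x. \<Sum>i\<in>I. g i x)" if "finite I" "\<And>i. i \<in> I \<Longrightarrow> P (g i)" for I :: "int set" and g
    using that by (induction I rule: finite_induct) (auto intro: zero add)
  have step: "P (\<lambda>x. complex_of_real (real_of_int \<lfloor>real (Suc n) * g x\<rfloor> / real (Suc n)))"
    if g[measurable]: "g \<in> borel_measurable borel" and gC: "\<And>x. \<bar>g x\<bar> \<le> C" for g :: "'g \<Rightarrow> real" and n
  proof -
    \<comment> \<open>A finite range of integers containing all rounded values, since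
      \<open>g\<close> is bounded by \<open>C\<close>.\<close>
    define I where "I = {\<lfloor>- (real (Suc n) * C)\<rfloor>..\<lfloor>real (Suc n) * C\<rfloor>}"
    have mem: "\<lfloor>real (Suc n) * g x\<rfloor> \<in> I" for x
    proof -
      have "- (real (Suc n) * C) \<le> real (Suc n) * g x" "real (Suc n) * g x \<le> real (Suc n) * C"
        using mult_left_mono[of "g x" C "real (Suc n)"] mult_left_mono[of "- C" "g x" "real (Suc n)"] gC[of x]
        by (auto simp: abs_le_iff)
      then show ?thesis unfolding I_def by (auto intro: floor_mono)
    qed
    have "(\<lambda>x. complex_of_real (real_of_int \<lfloor>real (Suc n) * g x\<rfloor> / real (Suc n)))
      = (\<lambda>x. \<Sum>i\<in>I. complex_of_real (real_of_int i / real (Suc n)) * indicator {x. \<lfloor>real (Suc n) * g x\<rfloor> = i} x)"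
    proof
      fix x
      have "(\<Sum>i\<in>I. complex_of_real (real_of_int i / real (Suc n)) * indicator {x. \<lfloor>real (Suc n) * g x\<rfloor> = i} x)
        = (\<Sum>i\<in>I. if \<lfloor>real (Suc n) * g x\<rfloor> = i then complex_of_real (real_of_int i / real (Suc n)) else 0)"
        by (rule sum.cong) (auto simp: indicator_def)
      also have "\<dots> = complex_of_real (real_of_int \<lfloor>real (Suc n) * g x\<rfloor> / real (Suc n))"
        using mem[of x] by (subst sum.delta') (auto simp: I_def)
      finally show "complex_of_real (real_of_int \<lfloor>real (Suc n) * g x\<rfloor> / real (Suc n))
        = (\<Sum>i\<in>I. complex_of_real (real_of_int i / real (Suc n)) * indicator {x. \<lfloor>real (Suc n) * g x\<rfloor> = i} x)" ..
    qed
    moreover have "{x. \<lfloor>real (Suc n) * g x\<rfloor> = i} \<in> sets borel" for i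
      by measurable
    ultimately show ?thesis
      by (simp only:) (intro sum cmult indicator, auto simp: I_def)
  qed
  define F where "F n x = complex_of_real (real_of_int \<lfloor>real (Suc n) * Re (f x)\<rfloor> / real (Suc n))
    + \<i> * complex_of_real (real_of_int \<lfloor>real (Suc n) * Im (f x)\<rfloor> / real (Suc n))" for n x
  have fl: "\<bar>real_of_int \<lfloor>real (Suc n) * t\<rfloor> / real (Suc n) - t\<bar> \<le> 1 / real (Suc n)" for n t
  proof -
    have "real_of_int \<lfloor>real (Suc n) * t\<rfloor> / real (Suc n) - t = (real_of_int \<lfloor>real (Suc n) * t\<rfloor> - real (Suc n) * t) / real (Suc n)"
      by (simp add: field_simps)
    moreover have "\<bar>real_of_int \<lfloor>real (Suc n) * t\<rfloor> - real (Suc n) * t\<bar> \<le> 1"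
      using floor_correct[of "real (Suc n) * t"] unfolding abs_le_iff by linarith
    ultimately show ?thesis by (simp add: abs_divide divide_right_mono del: of_nat_Suc)
  qed
  show ?thesis
  proof (rule limit[of F])
    fix n
    have "\<bar>Re (f x)\<bar> \<le> C" "\<bar>Im (f x)\<bar> \<le> C" for x
      using C(2)[of x] abs_Re_le_cmod[of "f x"] abs_Im_le_cmod[of "f x"] by linarith+
    then show "P (F n)"
      unfolding F_def by (intro add cmult step) auto
    fix x
    have "norm (F n x - f x) \<le> \<bar>Re (F n x - f x)\<bar> + \<bar>Im (F n x - f x)\<bar>"
      by (rule cmod_le)
    also have "\<dots> \<le> 1 / real (Suc n) + 1 / real (Suc n)"
      using add_mono[OF fl[of n "Re (f x)"] fl[of n "Im (f x)"]] by (simp add: F_def del: of_nat_Suc)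
    finally show "norm (F n x - f x) \<le> 2 / real (Suc n)" by simp
  qed (rule f)
qed

lemma cm_integral_polar:
  fixes \<mu> :: "'g::topological_space set \<Rightarrow> complex"
  assumes \<mu>: "cm_finite \<mu>"
  obtains h where "h \<in> borel_measurable borel" "\<And>x. norm (h x) \<le> 1"
    "\<And>E. E \<in> sets borel \<Longrightarrow> \<mu> E = (LINT x|tv_measure \<mu>. indicator E x *\<^sub>R h x)"
    "\<And>f. bounded_borel f \<Longrightarrow> has_cm_integral \<mu> f (LINT x|tv_measure \<mu>. f x * h x)"
    "\<And>f. bounded_borel f \<Longrightarrow> integrable (tv_measure \<mu>) (\<lambda>x. f x * h x)"
proof -
  obtain h where h: "h \<in> borel_measurable borel" "\<And>x. norm (h x) \<le> 1"
    "\<And>E. E \<in> sets borel \<Longrightarrow> \<mu> E = (LINT x|tv_measure \<mu>. indicator E x *\<^sub>R h x)"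
    using \<mu> by (rule polar_decomposition) blast
  interpret finite_measure "tv_measure \<mu>" using \<mu> by (rule finite_tv_measure)
  have ih: "integrable (tv_measure \<mu>) h"
    by (rule integrable_const_bound[where B = 1]) (use h in auto)
  show thesis
  proof (rule that[OF h])
    fix f :: "'g \<Rightarrow> complex" assume f: "bounded_borel f"
    then obtain C where "0 \<le> C" and C: "\<And>x. norm (f x) \<le> C" by (rule bounded_borelE) blast
    show "has_cm_integral \<mu> f (LINT x|tv_measure \<mu>. f x * h x)"
      by (rule cm_integral_density(1)[OF sets_tv_measure ih _ bounded_borelD[OF f] C]) (rule h(3))
    show "integrable (tv_measure \<mu>) (\<lambda>x. f x * h x)"
      by (rule cm_integral_density(2)[OF sets_tv_measure ih _ bounded_borelD[OF f] C]) (rule h(3))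
  qed
qed

lemma has_cm_integral_bounded:
  assumes "cm_finite \<mu>" "bounded_borel f"
  shows "has_cm_integral \<mu> f (cm_integral \<mu> f)"
proof -
  obtain h where "has_cm_integral \<mu> f (LINT x|tv_measure \<mu>. f x * h x)"
    using assms(1) by (rule cm_integral_polar) (use assms(2) in blast)
  then show ?thesis by (simp add: has_cm_integral_def)
qed

lemma cm_integral_linear:
  assumes \<mu>: "cm_finite \<mu>" and f: "bounded_borel f" and g: "bounded_borel g"
  shows cm_integral_add: "cm_integral \<mu> (\<lambda>x. f x + g x) = cm_integral \<mu> f + cm_integral \<mu> g"
    and cm_integral_cmult: "cm_integral \<mu> (\<lambda>x. c * f x) = c * cm_integral \<mu> f"
proof -
  obtain h where h: "\<And>f. bounded_borel f \<Longrightarrow> has_cm_integral \<mu> f (LINT x|tv_measure \<mu>. f x * h x)"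
    "\<And>f. bounded_borel f \<Longrightarrow> integrable (tv_measure \<mu>) (\<lambda>x. f x * h x)"
    using \<mu> by (rule cm_integral_polar) blast
  have eq: "cm_integral \<mu> f = (LINT x|tv_measure \<mu>. f x * h x)" if "bounded_borel f" for f
    using h(1)[OF that] by (simp add: has_cm_integral_def)
  show "cm_integral \<mu> (\<lambda>x. f x + g x) = cm_integral \<mu> f + cm_integral \<mu> g"
    using f g by (simp add: eq bounded_borel_add distrib_right h(2))
  show "cm_integral \<mu> (\<lambda>x. c * f x) = c * cm_integral \<mu> f"
    using f by (simp add: eq bounded_borel_cmult mult.assoc h(2))
qed

lemma cm_integral_zero: "cm_integral \<mu> (\<lambda>x. 0) = 0"
  by (simp add: cm_integral_def)

lemma cm_integral_sum:
  assumes \<mu>: "cm_finite \<mu>" and "finite I" "\<And>i. i \<in> I \<Longrightarrow> bounded_borel (f i)"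
  shows "cm_integral \<mu> (\<lambda>x. \<Sum>i\<in>I. f i x) = (\<Sum>i\<in>I. cm_integral \<mu> (f i))"
  using assms(2,3)
  by (induction I rule: finite_induct) (auto simp: cm_integral_zero cm_integral_add[OF \<mu>] bounded_borel_sum)

lemma cm_integral_indicator:
  assumes \<mu>: "cm_finite \<mu>" and E: "E \<in> sets borel"
  shows "cm_integral \<mu> (indicator E) = \<mu> E"
proof -
  obtain h where h: "\<And>E. E \<in> sets borel \<Longrightarrow> \<mu> E = (LINT x|tv_measure \<mu>. indicator E x *\<^sub>R h x)"
    "\<And>f. bounded_borel f \<Longrightarrow> has_cm_integral \<mu> f (LINT x|tv_measure \<mu>. f x * h x)"
    using \<mu> by (rule cm_integral_polar) blast
  have "(LINT x|tv_measure \<mu>. indicator E x * h x) = (LINT x|tv_measure \<mu>. indicator E x *\<^sub>R h x)"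
    by (rule Bochner_Integration.integral_cong) (auto simp: indicator_def)
  then show ?thesis
    using h(1)[OF E] h(2)[OF bounded_borel_indicator[OF E]] by (simp add: has_cm_integral_def)
qed

lemma norm_integral_le_integral:
  fixes f :: "'a \<Rightarrow> 'b::{banach, second_countable_topology}"
  assumes "integrable M f" "integrable M g" "\<And>x. norm (f x) \<le> g x"
  shows "norm (LINT x|M. f x) \<le> (LINT x|M. g x)"
  using integral_norm_bound[of M f] integral_mono[OF integrable_norm[OF assms(1)] assms(2,3)]
  by (rule order_trans)

lemma norm_cm_integral_le_integral:
  assumes \<mu>: "cm_finite \<mu>" and f: "bounded_borel f" and g: "integrable (tv_measure \<mu>) g" "\<And>x. norm (f x) \<le> g x"
  shows "norm (cm_integral \<mu> f) \<le> (LINT x|tv_measure \<mu>. g x)"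
proof -
  obtain h where h: "\<And>x. norm (h x) \<le> 1" "has_cm_integral \<mu> f (LINT x|tv_measure \<mu>. f x * h x)"
    "integrable (tv_measure \<mu>) (\<lambda>x. f x * h x)"
    using \<mu> by (rule cm_integral_polar) (use f in blast)
  have "norm (LINT x|tv_measure \<mu>. f x * h x) \<le> (LINT x|tv_measure \<mu>. g x)"
  proof (rule norm_integral_le_integral[OF h(3) g(1)])
    fix x
    have "norm (f x * h x) \<le> norm (f x) * 1"
      unfolding norm_mult using h(1) by (intro mult_left_mono) auto
    then show "norm (f x * h x) \<le> g x" using g(2)[of x] by simp
  qed
  then show ?thesis using h(2) by (simp add: has_cm_integral_def)
qed

lemma norm_cm_integral_le:
  assumes \<mu>: "cm_finite \<mu>" and f: "bounded_borel f" and C: "\<And>x. norm (f x) \<le> C"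
  shows "norm (cm_integral \<mu> f) \<le> C * cm_norm \<mu>"
proof -
  interpret finite_measure "tv_measure \<mu>" using \<mu> by (rule finite_tv_measure)
  show ?thesis
    using norm_cm_integral_le_integral[OF \<mu> f, of "\<lambda>_. C"] C
    by (simp add: cm_norm_tv_measure[OF \<mu>] mult.commute)
qed

lemma cm_norm_nonneg: "0 \<le> cm_norm \<mu>"
  by (simp add: cm_norm_def)

lemma cm_integral_diff:
  assumes \<mu>: "cm_finite \<mu>" and f: "bounded_borel f" and g: "bounded_borel g"
  shows "bounded_borel (\<lambda>x. f x - g x)"
    and "cm_integral \<mu> (\<lambda>x. f x - g x) = cm_integral \<mu> f - cm_integral \<mu> g"
  using bounded_borel_add[OF f bounded_borel_cmult[OF g, of "-1"]]
    cm_integral_add[OF \<mu> f bounded_borel_cmult[OF g, of "-1"]] cm_integral_cmult[OF \<mu> g g, of "-1"]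
  by simp_all

lemma cm_integral_tendsto_uniform:
  assumes \<mu>: "cm_finite \<mu>" and f: "\<And>i. bounded_borel (f i)" "bounded_borel g"
    and e: "\<forall>\<^sub>F i in L. \<forall>x. norm (f i x - g x) \<le> e i" "(e \<longlongrightarrow> 0) L"
  shows "((\<lambda>i. cm_integral \<mu> (f i)) \<longlongrightarrow> cm_integral \<mu> g) L"
proof -
  have "((\<lambda>i. cm_integral \<mu> (f i) - cm_integral \<mu> g) \<longlongrightarrow> 0) L"
  proof (rule Lim_null_comparison)
    show "((\<lambda>i. e i * cm_norm \<mu>) \<longlongrightarrow> 0) L"
      using tendsto_mult_right[OF e(2), of "cm_norm \<mu>"] by simp
    show "\<forall>\<^sub>F i in L. norm (cm_integral \<mu> (f i) - cm_integral \<mu> g) \<le> e i * cm_norm \<mu>"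
      using e(1)
    proof eventually_elim
      case (elim i)
      then show ?case
        using norm_cm_integral_le[OF \<mu> cm_integral_diff(1)[OF \<mu> f(1)[of i] f(2)], of "e i"]
        by (simp add: cm_integral_diff(2)[OF \<mu> f(1)[of i] f(2)])
    qed
  qed
  then show ?thesis by (simp add: LIM_zero_iff)
qed

text \<open>Unordered sums converge along the net of finite sets, where dominated convergence fails
  in general. The majorant \<open>c\<close> does not depend on \<open>x\<close>, so its tails bound
  the remainders uniformly and the integrals converge.\<close>

lemma cm_integral_has_sum:
  assumes \<mu>: "cm_finite \<mu>" and f: "\<And>i. i \<in> I \<Longrightarrow> bounded_borel (f i)" "F \<in> borel_measurable borel"
    and hs: "\<And>x. ((\<lambda>i. f i x) has_sum F x) I"
    and c: "\<And>i x. i \<in> I \<Longrightarrow> norm (f i x) \<le> c i" "c summable_on I"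
  shows "bounded_borel F" and "((\<lambda>i. cm_integral \<mu> (f i)) has_sum cm_integral \<mu> F) I"
proof -
  have cs: "(c has_sum infsum c I) I" using c(2) by (rule has_sum_infsum)
  show F: "bounded_borel F"
    by (rule bounded_borelI[OF f(2)]) (rule norm_infsum_le[OF hs cs c(1)])
  have b: "norm ((\<Sum>i\<in>J. f i x) - F x) \<le> infsum c I - sum c J" if J: "finite J" "J \<subseteq> I" for J x
  proof -
    have "((\<lambda>i. f i x) has_sum (F x - (\<Sum>i\<in>J. f i x))) (I - J)"
      using J by (intro has_sum_Diff hs has_sum_finite)
    moreover have "(c has_sum (infsum c I - sum c J)) (I - J)"
      using J by (intro has_sum_Diff cs has_sum_finite)
    ultimately have "norm (F x - (\<Sum>i\<in>J. f i x)) \<le> infsum c I - sum c J"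
      by (rule norm_infsum_le) (use c(1) in auto)
    then show ?thesis by (simp add: norm_minus_commute)
  qed
  \<comment> \<open>The value 0 elsewhere makes \<open>f' J\<close> a bounded Borel function for
    every \<open>J\<close>, not only along the filter.\<close>
  define f' where "f' J = (if finite J \<and> J \<subseteq> I then (\<lambda>x. \<Sum>i\<in>J. f i x) else (\<lambda>x. 0))" for J
  have "((\<lambda>J. cm_integral \<mu> (f' J)) \<longlongrightarrow> cm_integral \<mu> F) (finite_subsets_at_top I)"
  proof (rule cm_integral_tendsto_uniform[OF \<mu> _ F])
    show "bounded_borel (f' J)" for J
      unfolding f'_def using f(1) by (auto intro!: bounded_borel_sum bounded_borel_zero)
    show "\<forall>\<^sub>F J in finite_subsets_at_top I. \<forall>x. norm (f' J x - F x) \<le> infsum c I - sum c J"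
      by (rule eventually_finite_subsets_at_top_weakI) (simp add: f'_def b)
    have "((\<lambda>J. infsum c I - sum c J) \<longlongrightarrow> infsum c I - infsum c I) (finite_subsets_at_top I)"
      using cs unfolding has_sum_def by (intro tendsto_diff tendsto_const)
    then show "((\<lambda>J. infsum c I - sum c J) \<longlongrightarrow> 0) (finite_subsets_at_top I)" by simp
  qed
  moreover have "\<forall>\<^sub>F J in finite_subsets_at_top I. cm_integral \<mu> (f' J) = (\<Sum>i\<in>J. cm_integral \<mu> (f i))"
    by (rule eventually_finite_subsets_at_top_weakI) (use f(1) in \<open>auto simp: f'_def intro!: cm_integral_sum[OF \<mu>]\<close>)
  ultimately show "((\<lambda>i. cm_integral \<mu> (f i)) has_sum cm_integral \<mu> F) I"
    unfolding has_sum_def using tendsto_cong by force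
qed

lemma cm_finite_add:
  assumes "cm_finite \<mu>" "cm_finite \<nu>"
  shows "cm_finite (\<lambda>E. \<mu> E + \<nu> E)"
    and total_variation_add_le: "total_variation (\<lambda>E. \<mu> E + \<nu> E) E \<le> total_variation \<mu> E + total_variation \<nu> E"
proof -
  show le: "total_variation (\<lambda>E. \<mu> E + \<nu> E) E \<le> total_variation \<mu> E + total_variation \<nu> E" for E
    unfolding total_variation_partitions[of "\<lambda>E. \<mu> E + \<nu> E"]
  proof (rule SUP_least)
    fix P assume P: "P \<in> borel_partitions E"
    have "(\<Sum>A\<in>P. ennreal (norm (\<mu> A + \<nu> A))) \<le> (\<Sum>A\<in>P. ennreal (norm (\<mu> A)) + ennreal (norm (\<nu> A)))"
      by (intro sum_mono) (auto simp: norm_triangle_ineq simp flip: ennreal_plus intro!: ennreal_leI)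
    also have "\<dots> = (\<Sum>A\<in>P. ennreal (norm (\<mu> A))) + (\<Sum>A\<in>P. ennreal (norm (\<nu> A)))"
      by (rule sum.distrib)
    also have "\<dots> \<le> total_variation \<mu> E + total_variation \<nu> E"
      unfolding total_variation_partitions by (intro add_mono SUP_upper P)
    finally show "(\<Sum>A\<in>P. ennreal (norm (\<mu> A + \<nu> A))) \<le> total_variation \<mu> E + total_variation \<nu> E" .
  qed
  have "cm_additive (\<lambda>E. \<mu> E + \<nu> E)"
    using assms unfolding cm_finite_def cm_additive_def by (auto intro: sums_add)
  moreover have "total_variation (\<lambda>E. \<mu> E + \<nu> E) UNIV < \<infinity>"
    using le[of UNIV] assms by (auto simp: cm_finite_def intro: le_less_trans)
  ultimately show "cm_finite (\<lambda>E. \<mu> E + \<nu> E)" by (simp add: cm_finite_def)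
qed

lemma cm_finite_cmult:
  assumes "cm_finite \<mu>"
  shows "cm_finite (\<lambda>E. c * \<mu> E)"
    and total_variation_cmult_le: "total_variation (\<lambda>E. c * \<mu> E) E \<le> ennreal (norm c) * total_variation \<mu> E"
proof -
  show le: "total_variation (\<lambda>E. c * \<mu> E) E \<le> ennreal (norm c) * total_variation \<mu> E" for E
    unfolding total_variation_partitions[of "\<lambda>E. c * \<mu> E"]
  proof (rule SUP_least)
    fix P assume P: "P \<in> borel_partitions E"
    have "(\<Sum>A\<in>P. ennreal (norm (c * \<mu> A))) = ennreal (norm c) * (\<Sum>A\<in>P. ennreal (norm (\<mu> A)))"
      by (simp add: norm_mult ennreal_mult sum_distrib_left del: sum_ennreal)
    also have "\<dots> \<le> ennreal (norm c) * total_variation \<mu> E"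
      unfolding total_variation_partitions by (intro mult_left_mono SUP_upper P) simp
    finally show "(\<Sum>A\<in>P. ennreal (norm (c * \<mu> A))) \<le> ennreal (norm c) * total_variation \<mu> E" .
  qed
  have "cm_additive (\<lambda>E. c * \<mu> E)"
    using assms unfolding cm_finite_def cm_additive_def by (auto intro: sums_mult)
  moreover have "total_variation (\<lambda>E. c * \<mu> E) UNIV < \<infinity>"
    using le[of UNIV] assms by (auto simp: cm_finite_def ennreal_mult_less_top intro: le_less_trans)
  ultimately show "cm_finite (\<lambda>E. c * \<mu> E)" by (simp add: cm_finite_def)
qed

text \<open>The Jordan parts in \<open>cm_integral\<close> are not additive in the measure. The
  claim is clear for indicators, where the integral is the measure of the set, and is extended by
  induction over \<open>f\<close>.\<close>

lemma cm_integral_measure_linear: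
  assumes \<mu>: "cm_finite \<mu>" and \<nu>: "cm_finite \<nu>" and f: "bounded_borel f"
  shows cm_integral_add_measure: "cm_integral (\<lambda>E. \<mu> E + \<nu> E) f = cm_integral \<mu> f + cm_integral \<nu> f"
    and cm_integral_cmult_measure: "cm_integral (\<lambda>E. c * \<mu> E) f = c * cm_integral \<mu> f"
proof -
  note fin = cm_finite_add(1)[OF \<mu> \<nu>] cm_finite_cmult(1)[OF \<mu>]
  have "bounded_borel f \<and> cm_integral (\<lambda>E. \<mu> E + \<nu> E) f = cm_integral \<mu> f + cm_integral \<nu> f
    \<and> cm_integral (\<lambda>E. c * \<mu> E) f = c * cm_integral \<mu> f" (is "?P f")
    using f
  proof (induction rule: bounded_borel_induct)
    case (indicator E)
    then show ?case
      using fin \<mu> \<nu> by (simp add: cm_integral_indicator bounded_borel_indicator)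
  next
    case (add f g)
    then show ?case
      using fin \<mu> \<nu> by (simp add: cm_integral_add bounded_borel_add algebra_simps)
  next
    case (cmult f d)
    then show ?case
      using fin \<mu> \<nu> by (simp add: cm_integral_cmult[where g = f] bounded_borel_cmult algebra_simps)
  next
    case (limit F f)
    have e: "(\<lambda>n. 2 / real (Suc n)) \<longlonglongrightarrow> 0"
      using tendsto_mult_right[OF LIMSEQ_inverse_real_of_nat, of 2] by (simp add: divide_inverse mult.commute)
    have lim: "(\<lambda>n. cm_integral \<kappa> (F n)) \<longlonglongrightarrow> cm_integral \<kappa> f" if "cm_finite \<kappa>" for \<kappa>
      by (rule cm_integral_tendsto_uniform[OF that _ limit(2) _ e]) (use limit in auto)
    have "cm_integral (\<lambda>E. \<mu> E + \<nu> E) f = cm_integral \<mu> f + cm_integral \<nu> f"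
      by (rule LIMSEQ_unique[OF lim[OF fin(1)]]) (use tendsto_add[OF lim[OF \<mu>] lim[OF \<nu>]] limit(1) in simp)
    moreover have "cm_integral (\<lambda>E. c * \<mu> E) f = c * cm_integral \<mu> f"
      by (rule LIMSEQ_unique[OF lim[OF fin(2)]]) (use tendsto_mult_left[OF lim[OF \<mu>], of c] limit(1) in simp)
    ultimately show ?case using limit(2) by simp
  qed
  then show "cm_integral (\<lambda>E. \<mu> E + \<nu> E) f = cm_integral \<mu> f + cm_integral \<nu> f"
    "cm_integral (\<lambda>E. c * \<mu> E) f = c * cm_integral \<mu> f" by auto
qed

subsection \<open>Regularity\<close>

text \<open>Inner regularity of the total variation at the whole space only.\<close>

definition cm_tight :: "('g::topological_space set \<Rightarrow> complex) \<Rightarrow> bool"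
  where "cm_tight \<mu> \<longleftrightarrow> cm_finite \<mu> \<and> (\<forall>e>0. \<exists>K. compact K \<and> measure (tv_measure \<mu>) (- K) < e)"

definition regular_measure :: "'g::topological_space measure \<Rightarrow> bool"
  where "regular_measure M \<longleftrightarrow> finite_measure M \<and> sets M = sets borel \<and>
    (\<forall>E\<in>sets borel. \<forall>e>0. \<exists>K U. compact K \<and> open U \<and> K \<subseteq> E \<and> E \<subseteq> U \<and> measure M (U - K) < e)"

lemma complex_measuresD:
  fixes \<mu> :: "'g::t2_space set \<Rightarrow> complex"
  assumes "\<mu> \<in> complex_measures"
  shows complex_measures_finite: "cm_finite \<mu>"
    and complex_measures_regular: "regular_measure (tv_measure \<mu>)"
    and complex_measures_tight: "cm_tight \<mu>"
proof -
  show fin: "cm_finite \<mu>"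
    using assms by (simp add: complex_measures_def cm_finite_def cm_additive_def)
  interpret finite_measure "tv_measure \<mu>" using fin by (rule finite_tv_measure)
  show reg: "regular_measure (tv_measure \<mu>)"
    unfolding regular_measure_def
  proof (intro conjI ballI allI impI)
    fix E :: "'g set" and e :: real assume "E \<in> sets borel" "0 < e"
    then obtain K U where KU: "compact K" "open U" "K \<subseteq> E" "E \<subseteq> U" "total_variation \<mu> (U - K) < ennreal e"
      using assms unfolding complex_measures_def by blast
    have "U - K \<in> sets borel" using KU(1,2) by (intro sets.Diff borel_open borel_compact)
    then have "measure (tv_measure \<mu>) (U - K) < e"
      using KU(5) fin \<open>0 < e\<close> by (simp add: emeasure_tv_measure cm_finite_def ennreal_less_iff flip: emeasure_eq_measure)
        (metis cm_finite_def emeasure_eq_measure emeasure_tv_measure ennreal_less_iff measure_nonneg)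
    then show "\<exists>K U. compact K \<and> open U \<and> K \<subseteq> E \<and> E \<subseteq> U \<and> measure (tv_measure \<mu>) (U - K) < e"
      using KU by blast
  qed (use finite_measure_axioms in auto)
  show "cm_tight \<mu>"
    unfolding cm_tight_def
  proof (intro conjI allI impI fin)
    fix e :: real assume "0 < e"
    then obtain K U where KU: "compact K" "(UNIV :: 'g set) \<subseteq> U" "measure (tv_measure \<mu>) (U - K) < e"
      using reg unfolding regular_measure_def by (metis sets.top space_borel)
    then show "\<exists>K. compact K \<and> measure (tv_measure \<mu>) (- K) < e"
      by (metis Compl_eq_Diff_UNIV top.extremum_uniqueI)
  qed
qed

lemma measure_tv_le:
  assumes "cm_finite \<mu>" "E \<in> sets borel" "total_variation \<mu> E \<le> ennreal c" "0 \<le> c"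
  shows "measure (tv_measure \<mu>) E \<le> c"
  using assms by (simp add: measure_def emeasure_tv_measure cm_finite_def enn2real_leI)

lemma total_variation_eq_measure:
  assumes "cm_finite \<mu>" "E \<in> sets borel"
  shows "total_variation \<mu> E = ennreal (measure (tv_measure \<mu>) E)"
proof -
  interpret finite_measure "tv_measure \<mu>" using assms(1) by (rule finite_tv_measure)
  show ?thesis using assms by (simp flip: emeasure_eq_measure add: emeasure_tv_measure cm_finite_def)
qed

lemma cm_tight_add:
  fixes \<mu> \<nu> :: "'g::t2_space set \<Rightarrow> complex"
  assumes "cm_tight \<mu>" "cm_tight \<nu>"
  shows "cm_tight (\<lambda>E. \<mu> E + \<nu> E)"
proof -
  have \<mu>: "cm_finite \<mu>" and \<nu>: "cm_finite \<nu>" using assms by (auto simp: cm_tight_def)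
  interpret m: finite_measure "tv_measure \<mu>" using \<mu> by (rule finite_tv_measure)
  interpret n: finite_measure "tv_measure \<nu>" using \<nu> by (rule finite_tv_measure)
  show ?thesis
    unfolding cm_tight_def
  proof (intro conjI allI impI cm_finite_add(1) \<mu> \<nu>)
    fix e :: real assume "0 < e"
    then have e2: "0 < e / 2" by simp
    obtain K where K: "compact K" "measure (tv_measure \<mu>) (- K) < e / 2"
      using assms(1) e2 unfolding cm_tight_def by blast
    obtain L where L: "compact L" "measure (tv_measure \<nu>) (- L) < e / 2"
      using assms(2) e2 unfolding cm_tight_def by blast
    have b: "- (K \<union> L) \<in> sets borel" "- K \<in> sets borel" "- L \<in> sets borel"
      using borel_comp[OF borel_compact[OF compact_Un[OF K(1) L(1)]]]
        borel_comp[OF borel_compact[OF K(1)]] borel_comp[OF borel_compact[OF L(1)]] by (simp_all only:)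
    have "measure (tv_measure (\<lambda>E. \<mu> E + \<nu> E)) (- (K \<union> L)) \<le> measure (tv_measure \<mu>) (- (K \<union> L)) + measure (tv_measure \<nu>) (- (K \<union> L))"
      using total_variation_add_le[OF \<mu> \<nu>, of "- (K \<union> L)"] b
      by (intro measure_tv_le cm_finite_add(1) \<mu> \<nu>) (simp_all add: total_variation_eq_measure[OF \<mu>] total_variation_eq_measure[OF \<nu>])
    also have "\<dots> \<le> measure (tv_measure \<mu>) (- K) + measure (tv_measure \<nu>) (- L)"
      using b by (intro add_mono m.finite_measure_mono n.finite_measure_mono) auto
    also have "\<dots> < e / 2 + e / 2" using K L by (intro add_strict_mono)
    finally show "\<exists>K. compact K \<and> measure (tv_measure (\<lambda>E. \<mu> E + \<nu> E)) (- K) < e"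
      using compact_Un[OF K(1) L(1)] by (intro exI[of _ "K \<union> L"]) simp
  qed
qed

lemma cm_tight_cmult:
  fixes \<mu> :: "'g::t2_space set \<Rightarrow> complex"
  assumes "cm_tight \<mu>"
  shows "cm_tight (\<lambda>E. c * \<mu> E)"
proof -
  have \<mu>: "cm_finite \<mu>" using assms by (auto simp: cm_tight_def)
  show ?thesis
    unfolding cm_tight_def
  proof (intro conjI allI impI cm_finite_cmult(1) \<mu>)
    fix e :: real assume "0 < e"
    \<comment> \<open>The summand 1 covers \<open>c = 0\<close>.\<close>
    define d where "d = e / (norm c + 1)"
    have c1: "0 < norm c + 1" using norm_ge_zero[of c] by linarith
    then have d: "0 < d" "norm c * d < e"
      using \<open>0 < e\<close> by (auto simp: d_def divide_less_eq algebra_simps)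
    obtain K where K: "compact K" "measure (tv_measure \<mu>) (- K) < d"
      using assms d(1) unfolding cm_tight_def by blast
    have b: "- K \<in> sets borel"
      using K(1) by (intro borel_comp borel_compact)
    have "measure (tv_measure (\<lambda>E. c * \<mu> E)) (- K) \<le> norm c * measure (tv_measure \<mu>) (- K)"
      using total_variation_cmult_le[OF \<mu>, of c "- K"] b
      by (intro measure_tv_le cm_finite_cmult(1) \<mu>) (simp_all add: total_variation_eq_measure[OF \<mu>] ennreal_mult)
    also have "\<dots> \<le> norm c * d" using K by (intro mult_left_mono) auto
    also have "\<dots> < e" by (rule d)
    finally show "\<exists>K. compact K \<and> measure (tv_measure (\<lambda>E. c * \<mu> E)) (- K) < e"
      using K(1) by blast
  qed
qed

lemma regular_measureD:
  assumes "regular_measure M"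
  shows regular_measure_finite: "finite_measure M"
    and regular_measure_sets: "sets M = sets borel"
    and regular_measure_space: "space M = UNIV"
    and regular_measure_approx: "E \<in> sets borel \<Longrightarrow> 0 < e \<Longrightarrow>
      \<exists>K U. compact K \<and> open U \<and> K \<subseteq> E \<and> E \<subseteq> U \<and> measure M (U - K) < e"
  using assms sets_eq_imp_space_eq[of M borel] unfolding regular_measure_def by auto

section \<open>Measures with square integrable densities\<close>

definition L2 :: "'g::topological_space measure \<Rightarrow> ('g \<Rightarrow> complex) \<Rightarrow> bool"
  where "L2 M g \<longleftrightarrow> g \<in> borel_measurable borel \<and> integrable M (\<lambda>x. (norm (g x))\<^sup>2)"

definition dens :: "'g::topological_space measure \<Rightarrow> ('g \<Rightarrow> complex) \<Rightarrow> 'g set \<Rightarrow> complex"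
  where "dens M g E = (if E \<in> sets borel then LINT x|M. indicator E x *\<^sub>R g x else 0)"

lemma L2_integrable:
  assumes "finite_measure M" and M: "sets M = sets borel" and g: "L2 M g"
  shows "integrable M g"
proof (rule Bochner_Integration.integrable_bound)
  interpret finite_measure M by fact
  show "integrable M (\<lambda>x. 1 + (norm (g x))\<^sup>2)" using g by (simp add: L2_def)
  show "g \<in> borel_measurable M" using g M by (simp add: L2_def cong: measurable_cong_sets)
  have "norm (g x) \<le> 1 + (norm (g x))\<^sup>2" for x
  proof -
    have "2 * norm (g x) \<le> 1 + (norm (g x))\<^sup>2" using sum_squares_bound[of 1 "norm (g x)"] by simp
    then show ?thesis using norm_ge_zero[of "g x"] by linarith
  qed
  then show "AE x in M. norm (g x) \<le> norm (1 + (norm (g x))\<^sup>2)" by (auto simp: abs_of_nonneg)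
qed

lemma indicator_sums_complex:
  assumes "disjoint_family (A :: nat \<Rightarrow> 'a set)"
  shows "(\<lambda>n. indicator (A n) x :: complex) sums indicator (\<Union>n. A n) x"
proof -
  have "(\<lambda>n. complex_of_real (indicator (A n) x)) sums complex_of_real (indicator (\<Union>n. A n) x)"
    using assms by (intro sums_of_real indicator_sums) (auto simp: disjoint_family_on_def)
  moreover have "complex_of_real (indicator B x) = indicator B x" for B :: "'a set"
    by (simp add: indicator_def)
  ultimately show ?thesis by (simp only:)
qed

lemma dens_additive:
  assumes M: "sets M = sets borel" and g: "integrable M g"
  shows "cm_additive (dens M g)"
  unfolding cm_additive_def
proof (intro allI impI)
  fix A :: "nat \<Rightarrow> 'a set"
  assume A: "range A \<subseteq> sets borel" "disjoint_family A"
  then have Ab: "A n \<in> sets borel" for n by auto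
  have gm[measurable]: "g \<in> borel_measurable M" using g by simp
  have AM[measurable]: "A n \<in> sets M" for n using Ab M by simp
  have i: "integrable M (\<lambda>x. indicator (A n) x *\<^sub>R g x)" for n
    using Ab M g by (intro integrable_mult_indicator) auto
  have sm: "(\<lambda>n. indicator (A n) x *\<^sub>R g x) sums (indicator (\<Union>n. A n) x *\<^sub>R g x)" for x
  proof -
    have e: "indicator B x *\<^sub>R g x = indicator B x * g x" for B by (simp add: indicator_def)
    show ?thesis unfolding e by (rule sums_mult2[OF indicator_sums_complex[OF A(2)]])
  qed
  have bd: "norm (\<Sum>i<n. indicator (A i) x *\<^sub>R g x) \<le> norm (g x)" for n x
  proof -
    have "(\<Sum>i<n. indicator (A i) x *\<^sub>R g x) = indicator (\<Union>i<n. A i) x *\<^sub>R g x"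
      using A(2) by (subst indicator_UN_disjoint) (auto simp: disjoint_family_on_def scaleR_sum_left)
    then show ?thesis by (simp add: indicator_def)
  qed
  have "(\<lambda>n. LINT x|M. (\<Sum>i<n. indicator (A i) x *\<^sub>R g x)) \<longlonglongrightarrow> (LINT x|M. indicator (\<Union>n. A n) x *\<^sub>R g x)"
    using sm bd g by (intro integral_dominated_convergence[where w = "\<lambda>x. norm (g x)"]) (auto simp: sums_def)
  then have "(\<lambda>n. LINT x|M. indicator (A n) x *\<^sub>R g x) sums (LINT x|M. indicator (\<Union>n. A n) x *\<^sub>R g x)"
    unfolding sums_def by (subst (asm) Bochner_Integration.integral_sum) (rule i)
  then show "(\<lambda>n. dens M g (A n)) sums dens M g (\<Union>n. A n)"
    using Ab by (simp add: dens_def)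
qed

lemma total_variation_dens_le:
  assumes M: "sets M = sets borel" and g: "integrable M g" and E: "E \<in> sets borel"
  shows "total_variation (dens M g) E \<le> ennreal (LINT x|M. indicator E x * norm (g x))"
proof -
  have gm[measurable]: "g \<in> borel_measurable M" using g by simp
  define D where "D = density M (\<lambda>x. ennreal (norm (g x)))"
  have i: "integrable M (\<lambda>x. indicator A x * norm (g x))" "integrable M (\<lambda>x. indicator A x *\<^sub>R g x)" if "A \<in> sets borel" for A
    using that M g integrable_mult_indicator[of A M "\<lambda>x. norm (g x)"] integrable_mult_indicator[of A M g] by auto
  have em: "emeasure D A = ennreal (LINT x|M. indicator A x * norm (g x))" if A: "A \<in> sets borel" for A
  proof -
    have "emeasure D A = (\<integral>\<^sup>+x. ennreal (indicator A x * norm (g x)) \<partial>M)"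
      using A M by (simp add: D_def emeasure_density) (auto intro!: nn_integral_cong simp: indicator_def)
    also have "\<dots> = ennreal (LINT x|M. indicator A x * norm (g x))"
      by (rule nn_integral_eq_integral[OF i(1)[OF A]]) simp
    finally show ?thesis .
  qed
  have "total_variation (dens M g) E \<le> emeasure D E"
  proof (rule total_variation_le_measure[OF _ E])
    show "sets D = sets borel" by (simp add: D_def M)
    fix A :: "'a set" assume A: "A \<in> sets borel"
    have "norm (dens M g A) \<le> (LINT x|M. indicator A x * norm (g x))"
      using norm_integral_le_integral[OF i(2)[OF A] i(1)[OF A]] A by (simp add: dens_def indicator_def)
    then show "ennreal (norm (dens M g A)) \<le> emeasure D A"
      unfolding em[OF A] by (rule ennreal_leI)
  qed
  then show ?thesis by (simp add: em[OF E])
qed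

text \<open>Regularity passes from \<open>M\<close> to the density by splitting at a level
  \<open>n\<close>: the part of \<open>norm (g x)\<close> below \<open>n\<close> is controlled by
  the measure of \<open>U - K\<close>, the part above by
  \<open>(norm (g x))\<^sup>2 / n\<close>.\<close>

lemma dens_in_complex_measures:
  fixes M :: "'g::t2_space measure"
  assumes reg: "regular_measure M" and g: "L2 M g"
  shows "dens M g \<in> complex_measures"
proof -
  note M = regular_measure_sets[OF reg]
  interpret finite_measure M using reg by (rule regular_measure_finite)
  have ig: "integrable M g" by (rule L2_integrable[OF finite_measure_axioms M g])
  have ig2: "integrable M (\<lambda>x. (norm (g x))\<^sup>2)" using g by (simp add: L2_def)
  have i: "integrable M (\<lambda>x. indicator A x * norm (g x))" if "A \<in> sets borel" for A
    using that M ig integrable_mult_indicator[of A M "\<lambda>x. norm (g x)"] by auto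
  define N where "N = (LINT x|M. (norm (g x))\<^sup>2)"
  have N0: "0 \<le> N" by (simp add: N_def)
  have "\<exists>K U. compact K \<and> open U \<and> K \<subseteq> E \<and> E \<subseteq> U \<and> total_variation (dens M g) (U - K) < ennreal e"
    if E: "E \<in> sets borel" and e: "0 < e" for E e
  proof -
    \<comment> \<open>Chosen so that \<open>N / n < e / 2\<close>; the summand 1 keeps
      \<open>n\<close> positive if \<open>N = 0\<close>.\<close>
    define n where "n = (2 * N + 1) / e"
    have n: "0 < n" using N0 e by (simp add: n_def)
    have en: "0 < e / (2 * n)" using n e by simp
    obtain K U where KU: "compact K" "open U" "K \<subseteq> E" "E \<subseteq> U" "measure M (U - K) < e / (2 * n)"
      using regular_measure_approx[OF reg E en] by (elim exE conjE)
    have b: "U - K \<in> sets borel" using KU(1,2) by (intro sets.Diff borel_open borel_compact)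
    have ind: "integrable M (indicator (U - K) :: _ \<Rightarrow> real)"
      using b M by (intro integrable_real_indicator) (auto simp: emeasure_eq_measure)
    have pt: "indicator (U - K) x * norm (g x) \<le> n * indicator (U - K) x + (norm (g x))\<^sup>2 / n" for x
    proof (cases "norm (g x) \<le> n")
      case True
      moreover have "0 \<le> (norm (g x))\<^sup>2 / n" using n by simp
      ultimately show ?thesis by (auto simp: indicator_def intro: add_increasing2)
    next
      case False
      then have "norm (g x) * n \<le> norm (g x) * norm (g x)" by (intro mult_left_mono) auto
      then have "norm (g x) \<le> (norm (g x))\<^sup>2 / n" using n by (simp add: pos_le_divide_eq power2_eq_square)
      then show ?thesis using n by (auto simp: indicator_def)
    qed
    have "(LINT x|M. indicator (U - K) x * norm (g x)) \<le> (LINT x|M. n * indicator (U - K) x + (norm (g x))\<^sup>2 / n)"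
      by (rule integral_mono[OF i[OF b] _ pt]) (intro Bochner_Integration.integrable_add integrable_mult_right integrable_divide ind ig2)
    also have "\<dots> = n * measure M (U - K) + N / n"
      using b M ig2 ind by (simp add: N_def)
    also have "\<dots> < e"
    proof -
      have "n * measure M (U - K) < n * (e / (2 * n))" using KU(5) n by (intro mult_strict_left_mono)
      then have 1: "n * measure M (U - K) < e / 2" using n by simp
      have "n * e = 2 * N + 1" using e by (simp add: n_def)
      then have "N < (e / 2) * n" by (simp add: mult.commute)
      then have "N / n < e / 2" using n by (simp add: pos_divide_less_eq)
      with 1 have "n * measure M (U - K) + N / n < e / 2 + e / 2" by (rule add_strict_mono)
      then show ?thesis by simp
    qed
    finally have "ennreal (LINT x|M. indicator (U - K) x * norm (g x)) < ennreal e"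
      using e by (simp add: ennreal_less_iff)
    then have "total_variation (dens M g) (U - K) < ennreal e"
      using total_variation_dens_le[OF M ig b] by (rule le_less_trans[rotated])
    then show ?thesis using KU by blast
  qed
  moreover have "total_variation (dens M g) UNIV < \<infinity>"
    using total_variation_dens_le[OF M ig, of UNIV] by (auto intro: le_less_trans)
  moreover have "cm_additive (dens M g)" by (rule dens_additive[OF M ig])
  moreover have "\<forall>E. E \<notin> sets borel \<longrightarrow> dens M g E = 0" by (simp add: dens_def)
  ultimately show ?thesis
    unfolding complex_measures_def cm_additive_def by (intro CollectI conjI ballI allI impI) blast+
qed

lemma dens_integral:
  assumes "finite_measure M" "sets M = sets borel" "L2 M g" "bounded_borel f"
  shows "has_cm_integral (dens M g) f (LINT x|M. f x * g x)"
proof -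
  obtain C where "0 \<le> C" and C: "\<And>x. norm (f x) \<le> C" using assms(4) by (rule bounded_borelE) blast
  show ?thesis
    by (rule cm_integral_density(1)[OF assms(2) L2_integrable[OF assms(1-3)] _ bounded_borelD[OF assms(4)] C])
      (simp add: dens_def)
qed

section \<open>Reflection of measures under inversion\<close>

lemma borel_measurable_uminus_group [measurable]:
  "(uminus :: 'g::topological_group_add \<Rightarrow> 'g) \<in> borel \<rightarrow>\<^sub>M borel"
  by (intro borel_measurable_continuous_onI continuous_intros)

lemma borel_measurable_translation [measurable]:
  "(\<lambda>t. s + t :: 'g::topological_group_add) \<in> borel \<rightarrow>\<^sub>M borel"
  by (intro borel_measurable_continuous_onI continuous_intros)

lemma uminus_vimage_image: "uminus -` A = uminus ` (A :: 'g::group_add set)"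
  by (auto intro: image_eqI[where x = "- x" for x])

lemma regular_measure_reflect:
  fixes M :: "'g::{topological_group_add, t2_space} measure"
  assumes reg: "regular_measure M"
  shows "regular_measure (distr M borel uminus)"
proof -
  note M = regular_measure_sets[OF reg] and sp = regular_measure_space[OF reg]
  interpret finite_measure M using reg by (rule regular_measure_finite)
  have um[measurable]: "uminus \<in> M \<rightarrow>\<^sub>M borel" using M by (simp cong: measurable_cong_sets)
  have invol: "uminus -` uminus -` A = (A :: 'g set)" for A by auto
  show ?thesis
    unfolding regular_measure_def
  proof (intro conjI ballI allI impI)
    show "finite_measure (distr M borel uminus)" by (rule finite_measure_distr) simp
    fix E :: "'g set" and e :: real assume E: "E \<in> sets borel" and e: "0 < e"
    have uE: "uminus -` E \<in> sets borel"
      using measurable_sets[OF borel_measurable_uminus_group E] by simp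
    obtain K U where KU: "compact K" "open U" "K \<subseteq> uminus -` E" "uminus -` E \<subseteq> U" "measure M (U - K) < e"
      using regular_measure_approx[OF reg uE e] by (elim exE conjE)
    have 1: "compact (uminus -` K)"
      unfolding uminus_vimage_image by (intro compact_continuous_image continuous_intros KU(1))
    have 2: "open (uminus -` U)"
      by (intro open_vimage KU(2) continuous_intros)
    have "uminus -` U - uminus -` K \<in> sets borel"
      using 1 2 by (intro sets.Diff borel_open borel_compact)
    then have "measure (distr M borel uminus) (uminus -` U - uminus -` K) = measure M (U - K)"
      by (simp add: measure_distr sp vimage_Diff invol)
    moreover have "uminus -` K \<subseteq> E"
      using KU(3) by auto
    moreover have "E \<subseteq> uminus -` U"
    proof
      fix x assume "x \<in> E"
      then have "- x \<in> uminus -` E" by simp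
      then show "x \<in> uminus -` U" using KU(4) by blast
    qed
    ultimately show "\<exists>K U. compact K \<and> open U \<and> K \<subseteq> E \<and> E \<subseteq> U \<and> measure (distr M borel uminus) (U - K) < e"
      using 1 2 KU(5) by (intro exI[of _ "uminus -` K"] exI[of _ "uminus -` U"]) simp
  qed simp
qed

lemma L2_reflect:
  fixes M :: "'g::{topological_group_add, t2_space} measure"
  assumes M: "sets M = sets borel" and g: "L2 M g"
  shows "L2 (distr M borel uminus) (\<lambda>x. g (- x))"
proof -
  have gm[measurable]: "g \<in> borel_measurable borel" using g by (simp add: L2_def)
  have um[measurable]: "uminus \<in> M \<rightarrow>\<^sub>M borel" using M by (simp cong: measurable_cong_sets)
  have "integrable (distr M borel uminus) (\<lambda>x. (norm (g (- x)))\<^sup>2)"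
    using g by (subst integrable_distr_eq) (auto simp: L2_def)
  then show ?thesis by (simp add: L2_def)
qed

lemma integral_reflect:
  fixes M :: "'g::{topological_group_add, t2_space} measure" and f :: "'g \<Rightarrow> complex"
  assumes M: "sets M = sets borel" and [measurable]: "f \<in> borel_measurable borel"
  shows "(LINT x|distr M borel uminus. f x) = (LINT x|M. f (- x))"
proof -
  have um[measurable]: "uminus \<in> M \<rightarrow>\<^sub>M borel" using M by (simp cong: measurable_cong_sets)
  show ?thesis by (subst integral_distr) auto
qed

subsection \<open>Finitely supported measures\<close>

text \<open>Counting measure of \<open>F\<close> on the Borel sets. Finite combinations of Dirac
  measures are densities for it, so the facts on \<open>dens\<close> cover them.\<close>

definition points :: "'g::topological_space set \<Rightarrow> 'g measure"
  where "points F = distr (count_space F) borel (\<lambda>x. x)"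

lemma regular_points:
  fixes F :: "'g::t2_space set"
  assumes F: "finite F"
  shows "regular_measure (points F)"
proof -
  interpret c: finite_measure "count_space F" using F by (rule finite_measure_count_space)
  have m: "measure (points F) A = card (A \<inter> F)" if "A \<in> sets borel" for A
    using F that by (simp add: points_def measure_distr measure_count_space)
  show ?thesis
    unfolding regular_measure_def
  proof (intro conjI ballI allI impI)
    show "finite_measure (points F)" unfolding points_def by (rule c.finite_measure_distr) simp
    fix E :: "'g set" and e :: real assume E: "E \<in> sets borel" and e: "0 < e"
    have 1: "compact (E \<inter> F)" using F by (intro finite_imp_compact) simp
    have 2: "open (- (F - E))" using F by (intro open_Compl finite_imp_closed) simp
    have "- (F - E) - E \<inter> F \<in> sets borel" using 1 2 by (intro sets.Diff borel_open borel_compact)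
    moreover have "(- (F - E) - E \<inter> F) \<inter> F = {}" by auto
    ultimately have "measure (points F) (- (F - E) - E \<inter> F) = 0" by (simp add: m)
    then show "\<exists>K U. compact K \<and> open U \<and> K \<subseteq> E \<and> E \<subseteq> U \<and> measure (points F) (U - K) < e"
      using 1 2 e by (intro exI[of _ "E \<inter> F"] exI[of _ "- (F - E)"]) auto
  qed (simp add: points_def)
qed

lemma integral_points:
  fixes f :: "'g::topological_space \<Rightarrow> complex"
  assumes "finite F" and f: "f \<in> borel_measurable borel"
  shows "(LINT x|points F. f x) = (\<Sum>x\<in>F. f x)"
  unfolding points_def using assms by (subst integral_distr) (auto simp: lebesgue_integral_count_space_finite)

lemma finite_combination_dens:
  fixes F :: "'g::t2_space set" and c :: "'g \<Rightarrow> complex"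
  assumes F: "finite F"
  defines "k \<equiv> (\<lambda>x. \<Sum>s\<in>F. c s * indicator {s} x)"
  shows finite_combination_eq_dens: "(\<lambda>E. \<Sum>s\<in>F. c s * dirac s E) = dens (points F) k"
    and finite_combination_L2: "L2 (points F) k"
    and finite_combination_integral: "bounded_borel f \<Longrightarrow>
      has_cm_integral (\<lambda>E. \<Sum>s\<in>F. c s * dirac s E) f (\<Sum>s\<in>F. c s * f s)"
    and finite_combination_complex_measure: "(\<lambda>E. \<Sum>s\<in>F. c s * dirac s E) \<in> complex_measures"
proof -
  have km[measurable]: "k \<in> borel_measurable borel" unfolding k_def by measurable
  have ks: "k s = c s" if "s \<in> F" for s
  proof -
    have "k s = (\<Sum>t\<in>F. if s = t then c t else 0)"
      unfolding k_def by (rule sum.cong) (auto simp: indicator_def)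
    then show ?thesis using F that by simp
  qed
  show eq: "(\<lambda>E. \<Sum>s\<in>F. c s * dirac s E) = dens (points F) k"
  proof
    fix E :: "'g set"
    show "(\<Sum>s\<in>F. c s * dirac s E) = dens (points F) k E"
    proof (cases "E \<in> sets borel")
      case True
      have "(LINT x|points F. indicator E x *\<^sub>R k x) = (\<Sum>x\<in>F. indicator E x *\<^sub>R k x)"
        by (rule integral_points[OF F borel_measurable_scaleR[OF borel_measurable_indicator[OF True] km]])
      also have "\<dots> = (\<Sum>s\<in>F. c s * dirac s E)"
        using True by (intro sum.cong) (auto simp: ks dirac_def indicator_def)
      finally show ?thesis using True by (simp add: dens_def)
    qed (simp add: dens_def dirac_def)
  qed
  interpret c: finite_measure "count_space F" using F by (rule finite_measure_count_space)
  show L: "L2 (points F) k"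
    unfolding L2_def points_def using F by (auto simp: integrable_distr_eq integrable_count_space)
  note reg = regular_points[OF F]
  show "(\<lambda>E. \<Sum>s\<in>F. c s * dirac s E) \<in> complex_measures"
    unfolding eq by (rule dens_in_complex_measures[OF reg L])
  assume f: "bounded_borel f"
  have "(LINT x|points F. f x * k x) = (\<Sum>x\<in>F. f x * k x)"
    by (rule integral_points[OF F borel_measurable_times[OF bounded_borelD[OF f] km]])
  also have "\<dots> = (\<Sum>s\<in>F. c s * f s)" by (rule sum.cong) (simp_all add: ks)
  finally show "has_cm_integral (\<lambda>E. \<Sum>s\<in>F. c s * dirac s E) f (\<Sum>s\<in>F. c s * f s)"
    unfolding eq using dens_integral[OF regular_measure_finite[OF reg] regular_measure_sets[OF reg] L f] by simp
qed

lemma finite_combination_l1: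
  fixes F :: "'g::t2_space set"
  assumes F: "finite F"
  shows "(\<lambda>E. \<Sum>s\<in>F. c s * dirac s E) \<in> l1_measures"
proof -
  have "cm_norm (\<lambda>E::'g set. 0) = 0"
  proof -
    have "borel_partitions (UNIV :: 'g set) \<noteq> {}" using singleton_partition[of UNIV] by auto
    then show ?thesis by (simp add: cm_norm_def total_variation_partitions)
  qed
  then have "\<exists>F' c'. finite F' \<and> cm_norm (\<lambda>E. (\<Sum>s\<in>F. c s * dirac s E) - (\<Sum>s\<in>F'. c' s * dirac s E)) < e" if "0 < e" for e
    using F that by (intro exI[of _ F] exI[of _ c]) simp
  then show ?thesis
    using finite_combination_complex_measure[OF F, of c] by (simp add: l1_measures_def)
qed

subsection \<open>Convolution\<close>

text \<open>For open \<open>E\<close> the function is lower semicontinuous: a compact subset of the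
  translate at \<open>s\<close> with almost full measure stays inside the translates at all points
  near \<open>s\<close>. Since the open sets are stable under intersections, Dynkin's lemma extends
  measurability to all Borel sets.\<close>

lemma borel_measurable_measure_translate:
  fixes q :: "'g::{topological_group_add, t2_space} measure"
  assumes "finite_measure q" and q: "sets q = sets borel"
    and reg: "\<And>U e. open U \<Longrightarrow> 0 < e \<Longrightarrow> \<exists>K. compact K \<and> K \<subseteq> U \<and> measure q (U - K) < e"
    and E: "E \<in> sets borel"
  shows "(\<lambda>s. measure q {t. s + t \<in> E}) \<in> borel_measurable borel"
proof -
  interpret finite_measure q by fact
  have sp: "space q = UNIV" using sets_eq_imp_space_eq[OF q] by simp
  have tr: "{t. s + t \<in> A} \<in> sets q" if "A \<in> sets borel" for s and A :: "'g set"
    using measurable_sets[OF borel_measurable_translation that, of s] q by (simp add: vimage_def)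
  have b: "(borel :: 'g measure) = sigma UNIV {S. open S}" by (rule borel_def)
  have "E \<in> sigma_sets UNIV {S. open S}" using E by (simp add: b)
  have "Int_stable {S :: 'g set. open S}" by (auto simp: Int_stable_def)
  moreover have "{S :: 'g set. open S} \<subseteq> Pow UNIV" by simp
  ultimately show ?thesis
    using \<open>E \<in> sigma_sets UNIV {S. open S}\<close>
  proof (induction rule: sigma_sets_induct_disjoint)
    case (basic U)
    then have U: "open U" by simp
    show ?case
      unfolding borel_measurable_iff_greater
    proof
      fix a
      have "open {s. a < measure q {t. s + t \<in> U}}"
        unfolding open_subopen[of "{s. a < measure q {t. s + t \<in> U}}"]
      proof
        fix s assume "s \<in> {s. a < measure q {t. s + t \<in> U}}"
        then have s: "a < measure q {t. s + t \<in> U}" by simp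
        have oV: "open {t. s + t \<in> U}"
          using open_vimage[OF U, of "\<lambda>t. s + t"] by (simp add: vimage_def continuous_intros)
        obtain K where K: "compact K" "K \<subseteq> {t. s + t \<in> U}" "measure q ({t. s + t \<in> U} - K) < measure q {t. s + t \<in> U} - a"
          using reg[OF oV, of "measure q {t. s + t \<in> U} - a"] s by auto
        have Kq: "K \<in> sets q" using K(1) q by (simp add: borel_compact)
        have "measure q ({t. s + t \<in> U} - K) = measure q {t. s + t \<in> U} - measure q K"
          using tr[of U s] U K(2) Kq by (intro finite_measure_Diff) auto
        then have aK: "a < measure q K" using K(3) by linarith
        \<comment> \<open>Pairs are ordered as \<open>(t, s)\<close>, so that the tube lemma is
          applied around the compact \<open>K\<close> times a point.\<close>
        define W where "W = {p. snd p + fst p \<in> U}"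
        have "open ((\<lambda>p. snd p + fst p) -` U)"
          by (intro open_vimage U continuous_intros)
        then have W: "open W" by (simp add: W_def vimage_def)
        have "\<exists>U' V. openin euclidean U' \<and> openin euclidean V \<and> K \<subseteq> U' \<and> s \<in> V \<and> U' \<times> V \<subseteq> W"
          by (rule tube_lemma_left) (use W K in \<open>auto simp: W_def\<close>)
        then obtain U' V where V: "open V" "K \<subseteq> U'" "s \<in> V" "U' \<times> V \<subseteq> W" by auto
        have "V \<subseteq> {s. a < measure q {t. s + t \<in> U}}"
        proof
          fix r assume "r \<in> V"
          have "r + t \<in> U" if "t \<in> K" for t
          proof -
            have "(t, r) \<in> W" using V(2,4) that \<open>r \<in> V\<close> by blast
            then show ?thesis by (simp add: W_def)
          qed
          then have "K \<subseteq> {t. r + t \<in> U}" by auto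
          then have "measure q K \<le> measure q {t. r + t \<in> U}"
            using tr[of U r] U by (intro finite_measure_mono) auto
          then show "r \<in> {s. a < measure q {t. s + t \<in> U}}" using aK by simp
        qed
        then show "\<exists>T. open T \<and> s \<in> T \<and> T \<subseteq> {s. a < measure q {t. s + t \<in> U}}"
          using V by blast
      qed
      then show "{w \<in> space borel. a < measure q {t. w + t \<in> U}} \<in> sets borel" by simp
    qed
  next
    case empty
    then show ?case by simp
  next
    case (compl A)
    have "A \<in> sets borel" using compl(1) by (simp add: b)
    then have "measure q {t. s + t \<in> UNIV - A} = measure q UNIV - measure q {t. s + t \<in> A}" for s
      using finite_measure_compl[OF tr, of A s] sp by (simp add: Collect_neg_eq Compl_eq_Diff_UNIV)
    then show ?case using compl(2) by simp
  next
    case (union A)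
    have "A i \<in> sets borel" for i using union(2) by (auto simp: b)
    then have "(\<lambda>i. measure q {t. s + t \<in> A i}) sums measure q (\<Union>i. {t. s + t \<in> A i})" for s
      using tr disjoint_family_onD[OF union(1)] by (intro finite_measure_UNION) (fastforce simp: disjoint_family_on_def)+
    then have "measure q {t. s + t \<in> (\<Union>i. A i)} = (\<Sum>i. measure q {t. s + t \<in> A i})" for s
      using sums_unique by (simp add: Collect_ex_eq) blast
    then show ?case using union(3) by simp
  qed
qed

lemma vimage_translate_borel:
  fixes E :: "'g::topological_group_add set"
  assumes "E \<in> sets borel"
  shows "{t. s + t \<in> E} \<in> sets borel"
  using measurable_sets[OF borel_measurable_translation assms, of s] by (simp add: vimage_def)

lemma bounded_borel_translate:
  fixes f :: "'g::topological_group_add \<Rightarrow> complex"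
  assumes "bounded_borel f"
  shows "bounded_borel (\<lambda>t. f (s + t))"
proof -
  obtain C where "0 \<le> C" and C: "\<And>x. norm (f x) \<le> C" using assms by (rule bounded_borelE) blast
  have "(\<lambda>t. f (s + t)) \<in> borel_measurable borel"
    using measurable_compose[OF borel_measurable_translation bounded_borelD[OF assms], of s] .
  then show ?thesis using C by (rule bounded_borelI)
qed

text \<open>As \<open>0 \<le> k \<le> 1\<close>, the measure with density \<open>k\<close> is
  dominated by \<open>M\<close> and inherits the inner approximation of open sets.\<close>

lemma borel_measurable_density_translate:
  fixes M :: "'g::{topological_group_add, t2_space} measure" and k :: "'g \<Rightarrow> real"
  assumes reg: "regular_measure M" and E: "E \<in> sets borel"
    and k[measurable]: "k \<in> borel_measurable borel" and k01: "\<And>x. 0 \<le> k x" "\<And>x. k x \<le> 1"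
  shows "(\<lambda>s. LINT t|M. indicator {t. s + t \<in> E} t * k t) \<in> borel_measurable borel"
proof -
  interpret finite_measure M using reg by (rule regular_measure_finite)
  note M = regular_measure_sets[OF reg] and sp = regular_measure_space[OF reg]
  define q where "q = density M (\<lambda>x. ennreal (k x))"
  have kM[measurable]: "k \<in> borel_measurable M" using k M by (simp cong: measurable_cong_sets)
  have sq: "sets q = sets borel" by (simp add: q_def M)
  have le: "emeasure q A \<le> emeasure M A" if "A \<in> sets borel" for A
  proof -
    have A: "A \<in> sets M" using that M by simp
    have "emeasure q A = (\<integral>\<^sup>+x. ennreal (k x) * indicator A x \<partial>M)"
      using A by (simp add: q_def emeasure_density)
    also have "\<dots> \<le> (\<integral>\<^sup>+x. indicator A x \<partial>M)"
      using k01 by (intro nn_integral_mono) (auto simp: indicator_def)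
    finally show ?thesis using A by simp
  qed
  have finq: "finite_measure q"
  proof (rule finite_measureI)
    have "emeasure q UNIV \<le> emeasure M UNIV" by (rule le) simp
    then show "emeasure q (space q) \<noteq> \<infinity>"
      using sets_eq_imp_space_eq[OF sq] emeasure_finite[of UNIV] by (auto simp: top_unique)
  qed
  interpret q: finite_measure q by (rule finq)
  have mle: "measure q A \<le> measure M A" if "A \<in> sets borel" for A
    using le[OF that] by (simp add: emeasure_eq_measure q.emeasure_eq_measure)
  have mq: "measure q A = (LINT t|M. indicator A t * k t)" if "A \<in> sets borel" for A
  proof -
    have A[measurable]: "A \<in> sets M" using that M by simp
    have "measure q A = (LINT t|q. indicator A t)"
      using sets_eq_imp_space_eq[OF sq] by simp
    also have "\<dots> = (LINT t|M. k t *\<^sub>R indicator A t)"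
      unfolding q_def using k01 by (intro integral_density) auto
    finally show ?thesis by (simp add: mult.commute)
  qed
  have "(\<lambda>s. measure q {t. s + t \<in> E}) \<in> borel_measurable borel"
  proof (rule borel_measurable_measure_translate[OF finq sq _ E])
    fix U :: "'g set" and e :: real assume U: "open U" and e: "0 < e"
    have Ub: "U \<in> sets borel" using U by simp
    obtain K U' where K: "compact K" "open U'" "K \<subseteq> U" "U \<subseteq> U'" "measure M (U' - K) < e"
      using regular_measure_approx[OF reg Ub e] by (elim exE conjE)
    have b: "U' - K \<in> sets borel" "U - K \<in> sets borel"
      using sets.Diff[OF borel_open[OF K(2)] borel_compact[OF K(1)]]
        sets.Diff[OF borel_open[OF U] borel_compact[OF K(1)]] by (simp_all only:)
    have "measure q (U - K) \<le> measure M (U - K)" by (rule mle[OF b(2)])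
    also have "\<dots> \<le> measure M (U' - K)" using b M K(4) by (intro finite_measure_mono) auto
    also have "\<dots> < e" by (rule K(5))
    finally show "\<exists>K. compact K \<and> K \<subseteq> U \<and> measure q (U - K) < e" using K(1,3) by blast
  qed
  then show ?thesis by (simp add: mq vimage_translate_borel[OF E])
qed

lemma borel_measurable_tv_translate:
  fixes \<nu> :: "'g::{topological_group_add, t2_space} set \<Rightarrow> complex"
  assumes \<nu>: "\<nu> \<in> complex_measures" and E: "E \<in> sets borel"
  shows "(\<lambda>s. measure (tv_measure \<nu>) {t. s + t \<in> E}) \<in> borel_measurable borel"
  using borel_measurable_density_translate[OF complex_measures_regular[OF \<nu>] E, of "\<lambda>_. 1"] by simp

text \<open>The positive and negative parts of the real and imaginary parts of the polar density
  take values between 0 and 1, so the case of positive densities applies to each.\<close>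

lemma bounded_borel_measure_translate:
  fixes \<nu> :: "'g::{topological_group_add, t2_space} set \<Rightarrow> complex"
  assumes \<nu>: "\<nu> \<in> complex_measures" and E: "E \<in> sets borel"
  shows "bounded_borel (\<lambda>s. \<nu> {t. s + t \<in> E})"
proof (rule bounded_borelI)
  note fin = complex_measures_finite[OF \<nu>] and reg = complex_measures_regular[OF \<nu>]
  interpret finite_measure "tv_measure \<nu>" using fin by (rule finite_tv_measure)
  note b = vimage_translate_borel[OF E]
  obtain h where h[measurable]: "h \<in> borel_measurable borel" and h1: "\<And>x. norm (h x) \<le> 1"
    and hE: "\<And>E. E \<in> sets borel \<Longrightarrow> \<nu> E = (LINT x|tv_measure \<nu>. indicator E x *\<^sub>R h x)"
    using fin by (rule polar_decomposition) blast
  have ih: "integrable (tv_measure \<nu>) h"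
    by (rule integrable_const_bound[where B = 1]) (use h1 in auto)
  have ii: "integrable (tv_measure \<nu>) (\<lambda>x. indicator A x *\<^sub>R h x)" if "A \<in> sets borel" for A
    using that ih by (intro integrable_mult_indicator) auto
  have split: "(LINT x|tv_measure \<nu>. indicator A x * r x) =
      (LINT x|tv_measure \<nu>. indicator A x * max (r x) 0) - (LINT x|tv_measure \<nu>. indicator A x * max (- r x) 0)"
    if A[measurable]: "A \<in> sets borel" and r[measurable]: "r \<in> borel_measurable borel" and r1: "\<And>x. \<bar>r x\<bar> \<le> 1" for A and r :: "'g \<Rightarrow> real"
  proof -
    have e: "indicator A x * r x = indicator A x * max (r x) 0 - indicator A x * max (- r x) 0" for x
      by (auto simp: indicator_def max_def)
    have "integrable (tv_measure \<nu>) (\<lambda>x. indicator A x * max (r x) 0)"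
      using r1 by (intro integrable_const_bound[where B = 1]) (auto simp: indicator_def abs_le_iff)
    moreover have "integrable (tv_measure \<nu>) (\<lambda>x. indicator A x * max (- r x) 0)"
      using r1 by (intro integrable_const_bound[where B = 1]) (auto simp: indicator_def abs_le_iff)
    ultimately show ?thesis
      unfolding e by (rule Bochner_Integration.integral_diff)
  qed
  have parts: "(\<lambda>s. LINT x|tv_measure \<nu>. indicator {t. s + t \<in> E} x * r x) \<in> borel_measurable borel"
    if r[measurable]: "r \<in> borel_measurable borel" and r1: "\<And>x. \<bar>r x\<bar> \<le> 1" for r :: "'g \<Rightarrow> real"
    unfolding split[OF b r r1] using r1
    by (intro borel_measurable_diff borel_measurable_density_translate reg E) (auto simp: abs_le_iff)
  have "Re (\<nu> {t. s + t \<in> E}) = (LINT x|tv_measure \<nu>. indicator {t. s + t \<in> E} x * Re (h x))"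
    "Im (\<nu> {t. s + t \<in> E}) = (LINT x|tv_measure \<nu>. indicator {t. s + t \<in> E} x * Im (h x))" for s
    using ii[OF b, of s] hE[OF b, of s] by (simp_all flip: integral_Re integral_Im)
  moreover have "\<bar>Re (h x)\<bar> \<le> 1" "\<bar>Im (h x)\<bar> \<le> 1" for x
    using h1[of x] abs_Re_le_cmod[of "h x"] abs_Im_le_cmod[of "h x"] by linarith+
  ultimately show "(\<lambda>s. \<nu> {t. s + t \<in> E}) \<in> borel_measurable borel"
    by (subst borel_measurable_complex_iff) (simp add: parts)
  fix s
  have "norm (\<nu> {t. s + t \<in> E}) \<le> measure (tv_measure \<nu>) {t. s + t \<in> E}"
    by (rule norm_le_tv_measure[OF fin b])
  also have "\<dots> \<le> cm_norm \<nu>"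
    unfolding cm_norm_tv_measure[OF fin] by (rule finite_measure_mono) auto
  finally show "norm (\<nu> {t. s + t \<in> E}) \<le> cm_norm \<nu>" .
qed

lemma lim_2_over_Suc: "(\<lambda>n. 2 / real (Suc n)) \<longlonglongrightarrow> 0"
  using tendsto_mult_right[OF LIMSEQ_inverse_real_of_nat, of 2] by (simp add: divide_inverse mult.commute)

lemma bounded_borel_integral_translate:
  fixes \<nu> :: "'g::{topological_group_add, t2_space} set \<Rightarrow> complex"
  assumes \<nu>: "\<nu> \<in> complex_measures" and f: "bounded_borel f"
  shows "bounded_borel (\<lambda>s. cm_integral \<nu> (\<lambda>t. f (s + t)))"
proof -
  note fin = complex_measures_finite[OF \<nu>]
  have "(\<lambda>s. cm_integral \<nu> (\<lambda>t. f (s + t))) \<in> borel_measurable borel \<and> bounded_borel f"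
    using f
  proof (induction rule: bounded_borel_induct)
    case (indicator E)
    have "cm_integral \<nu> (\<lambda>t. indicator E (s + t)) = \<nu> {t. s + t \<in> E}" for s
      using cm_integral_indicator[OF fin vimage_translate_borel[OF indicator], of s]
      by (simp add: indicator_def[abs_def])
    then show ?case
      using bounded_borelD[OF bounded_borel_measure_translate[OF \<nu> indicator]]
        bounded_borel_indicator[OF indicator] by simp
  next
    case (add f g)
    then show ?case
      by (simp add: cm_integral_add[OF fin] bounded_borel_translate bounded_borel_add borel_measurable_add)
  next
    case (cmult f c)
    then show ?case
      by (simp add: borel_measurable_times cm_integral_cmult[OF fin, where g = "\<lambda>t. f (_ + t)"] bounded_borel_translate bounded_borel_cmult)
  next
    case (limit F f)
    have lim: "(\<lambda>n. cm_integral \<nu> (\<lambda>t. F n (s + t))) \<longlonglongrightarrow> cm_integral \<nu> (\<lambda>t. f (s + t))" for s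
      by (rule cm_integral_tendsto_uniform[OF fin _ _ _ lim_2_over_Suc])
        (use limit in \<open>auto intro: bounded_borel_translate\<close>)
    have "(\<lambda>s. cm_integral \<nu> (\<lambda>t. f (s + t))) \<in> borel_measurable borel"
      by (rule borel_measurable_LIMSEQ_metric[OF _ lim]) (use limit(1) in simp)
    then show ?case using limit(2) by simp
  qed
  moreover obtain C where "0 \<le> C" and C: "\<And>x. norm (f x) \<le> C" using f by (rule bounded_borelE) blast
  have "norm (cm_integral \<nu> (\<lambda>t. f (s + t))) \<le> C * cm_norm \<nu>" for s
    by (rule norm_cm_integral_le[OF fin bounded_borel_translate[OF f] C])
  ultimately show ?thesis by (intro bounded_borelI) auto
qed

lemma compact_sums_group:
  fixes K L :: "'g::topological_group_add set"
  assumes "compact K" "compact L"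
  shows "compact ((\<lambda>p. fst p + snd p) ` (K \<times> L))"
  by (intro compact_continuous_image compact_Times assms continuous_intros)

text \<open>Both claims follow from one estimate: the total variation of the convolution at
  \<open>E\<close> is at most the integral over \<mu>'s total variation of the measures that \<nu>'s
  total variation gives to the translates \<open>S E s\<close>.\<close>

lemma convolution_props:
  fixes \<mu> \<nu> :: "'g::{topological_group_add, t2_space} set \<Rightarrow> complex"
  assumes \<mu>: "\<mu> \<in> complex_measures" and \<nu>: "\<nu> \<in> complex_measures"
  shows convolution_finite: "cm_finite (convolution \<mu> \<nu>)"
    and convolution_tight: "cm_tight (convolution \<mu> \<nu>)"
proof -
  note fin = complex_measures_finite[OF \<mu>] and finn = complex_measures_finite[OF \<nu>]
  define S where "S E = (\<lambda>s. {t. s + t \<in> E})" for E :: "'g set"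
  have Sb: "S E s \<in> sets borel" if "E \<in> sets borel" for E s
    unfolding S_def using that by (rule vimage_translate_borel)
  have bb: "bounded_borel (\<lambda>s. \<nu> (S E s))" if "E \<in> sets borel" for E
    unfolding S_def by (rule bounded_borel_measure_translate[OF \<nu> that])
  have tvm: "(\<lambda>s. measure (tv_measure \<nu>) (S E s)) \<in> borel_measurable borel" if "E \<in> sets borel" for E
    unfolding S_def by (rule borel_measurable_tv_translate[OF \<nu> that])
  have conv: "convolution \<mu> \<nu> E = cm_integral \<mu> (\<lambda>s. \<nu> (S E s))" if "E \<in> sets borel" for E
    using that by (simp add: convolution_def S_def)
  interpret m: finite_measure "tv_measure \<mu>" using fin by (rule finite_tv_measure)
  interpret n: finite_measure "tv_measure \<nu>" using finn by (rule finite_tv_measure)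
  have bd: "measure (tv_measure \<nu>) A \<le> cm_norm \<nu>" for A
    unfolding cm_norm_tv_measure[OF finn] using n.bounded_measure[of A] by simp
  have itv: "integrable (tv_measure \<mu>) (\<lambda>s. measure (tv_measure \<nu>) (S E s))" if "E \<in> sets borel" for E
    using tvm[OF that] bd by (intro m.integrable_const_bound[where B = "cm_norm \<nu>"]) auto
  obtain h where h: "h \<in> borel_measurable borel" "\<And>x. norm (h x) \<le> 1"
    "\<And>f. bounded_borel f \<Longrightarrow> has_cm_integral \<mu> f (LINT x|tv_measure \<mu>. f x * h x)"
    "\<And>f. bounded_borel f \<Longrightarrow> integrable (tv_measure \<mu>) (\<lambda>x. f x * h x)"
    using fin by (rule cm_integral_polar) blast
  have add: "cm_additive (convolution \<mu> \<nu>)"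
    unfolding cm_additive_def
  proof (intro allI impI)
    fix A :: "nat \<Rightarrow> 'g set"
    assume A: "range A \<subseteq> sets borel" "disjoint_family A"
    then have Ab: "A n \<in> sets borel" for n by auto
    then have Ub: "(\<Union>n. A n) \<in> sets borel" by auto
    have disjS: "disjoint_family (\<lambda>n. S (A n) s)" for s
      using disjoint_family_onD[OF A(2)] by (fastforce simp: disjoint_family_on_def S_def)
    have US: "S (\<Union>n. A n) s = (\<Union>n. S (A n) s)" for s by (auto simp: S_def)
    have sm: "(\<lambda>n. \<nu> (S (A n) s)) sums \<nu> (S (\<Union>n. A n) s)" for s
      unfolding US using finn disjS Sb[OF Ab] by (intro cm_additive_sums) (auto simp: cm_finite_def)
    have bds: "norm (\<Sum>i<n. \<nu> (S (A i) s)) \<le> cm_norm \<nu>" for n s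
    proof -
      have "norm (\<Sum>i<n. \<nu> (S (A i) s)) \<le> (\<Sum>i<n. measure (tv_measure \<nu>) (S (A i) s))"
        by (intro sum_norm_le norm_le_tv_measure finn Sb Ab)
      also have "\<dots> = measure (tv_measure \<nu>) (\<Union>i<n. S (A i) s)"
        by (rule n.finite_measure_finite_Union[symmetric])
          (use Sb[OF Ab] disjS[of s] in \<open>auto simp: disjoint_family_on_def\<close>)
      also have "\<dots> \<le> cm_norm \<nu>" by (rule bd)
      finally show ?thesis .
    qed
    have "(\<lambda>n. LINT s|tv_measure \<mu>. (\<Sum>i<n. \<nu> (S (A i) s)) * h s) \<longlonglongrightarrow> (LINT s|tv_measure \<mu>. \<nu> (S (\<Union>n. A n) s) * h s)"
    proof (rule integral_dominated_convergence[where w = "\<lambda>_. cm_norm \<nu>"])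
      show "(\<lambda>s. \<nu> (S (\<Union>n. A n) s) * h s) \<in> borel_measurable (tv_measure \<mu>)"
        using borel_measurable_integrable[OF h(4)[OF bb[OF Ub]]] .
      show "(\<lambda>s. (\<Sum>i<n. \<nu> (S (A i) s)) * h s) \<in> borel_measurable (tv_measure \<mu>)" for n
        by (rule borel_measurable_integrable[OF h(4)]) (intro bounded_borel_sum bb Ab, simp)
      show "AE s in tv_measure \<mu>. (\<lambda>n. (\<Sum>i<n. \<nu> (S (A i) s)) * h s) \<longlonglongrightarrow> \<nu> (S (\<Union>n. A n) s) * h s"
        using sm by (intro AE_I2 tendsto_mult_right) (simp add: sums_def)
      have "norm ((\<Sum>i<n. \<nu> (S (A i) s)) * h s) \<le> cm_norm \<nu>" for n s
        unfolding norm_mult using mult_mono[OF bds[where n = n and s = s] h(2)[of s] cm_norm_nonneg norm_ge_zero] by simp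
      then show "AE s in tv_measure \<mu>. norm ((\<Sum>i<n. \<nu> (S (A i) s)) * h s) \<le> cm_norm \<nu>" for n
        by (intro AE_I2)
    qed simp
    moreover have "(LINT s|tv_measure \<mu>. (\<Sum>i<n. \<nu> (S (A i) s)) * h s) = (\<Sum>i<n. convolution \<mu> \<nu> (A i))" for n
    proof -
      have "has_cm_integral \<mu> (\<lambda>s. \<Sum>i<n. \<nu> (S (A i) s)) (LINT s|tv_measure \<mu>. (\<Sum>i<n. \<nu> (S (A i) s)) * h s)"
        by (rule h(3)) (intro bounded_borel_sum bb Ab, simp)
      then have "(LINT s|tv_measure \<mu>. (\<Sum>i<n. \<nu> (S (A i) s)) * h s) = cm_integral \<mu> (\<lambda>s. \<Sum>i<n. \<nu> (S (A i) s))"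
        by (simp add: has_cm_integral_def)
      also have "\<dots> = (\<Sum>i<n. cm_integral \<mu> (\<lambda>s. \<nu> (S (A i) s)))"
        by (rule cm_integral_sum[OF fin]) (auto intro: bb Ab)
      finally show ?thesis by (simp add: conv Ab)
    qed
    moreover have "(LINT s|tv_measure \<mu>. \<nu> (S (\<Union>n. A n) s) * h s) = convolution \<mu> \<nu> (\<Union>n. A n)"
      using h(3)[OF bb[OF Ub]] by (simp add: has_cm_integral_def conv Ub)
    ultimately show "(\<lambda>n. convolution \<mu> \<nu> (A n)) sums convolution \<mu> \<nu> (\<Union>n. A n)"
      by (simp add: sums_def)
  qed
  have tv: "total_variation (convolution \<mu> \<nu>) E \<le> ennreal (LINT s|tv_measure \<mu>. measure (tv_measure \<nu>) (S E s))"
    if E: "E \<in> sets borel" for E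
    unfolding total_variation_partitions
  proof (rule SUP_least)
    fix P assume P: "P \<in> borel_partitions E"
    then have fP: "finite P" and Pb: "A \<in> sets borel" if "A \<in> P" for A
      using that by (auto simp: borel_partitions_def)
    have finP: "finite P" using P by (simp add: borel_partitions_def)
    have "(\<Sum>A\<in>P. ennreal (norm (convolution \<mu> \<nu> A))) \<le> (\<Sum>A\<in>P. ennreal (LINT s|tv_measure \<mu>. measure (tv_measure \<nu>) (S A s)))"
    proof (intro sum_mono ennreal_leI)
      fix A assume "A \<in> P"
      then have A: "A \<in> sets borel" by (rule Pb)
      show "norm (convolution \<mu> \<nu> A) \<le> (LINT s|tv_measure \<mu>. measure (tv_measure \<nu>) (S A s))"
        unfolding conv[OF A]
        by (rule norm_cm_integral_le_integral[OF fin bb[OF A] itv[OF A]]) (rule norm_le_tv_measure[OF finn Sb[OF A]])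
    qed
    also have "\<dots> = ennreal (\<Sum>A\<in>P. LINT s|tv_measure \<mu>. measure (tv_measure \<nu>) (S A s))"
      by (rule sum_ennreal) simp
    also have "(\<Sum>A\<in>P. LINT s|tv_measure \<mu>. measure (tv_measure \<nu>) (S A s)) = (LINT s|tv_measure \<mu>. (\<Sum>A\<in>P. measure (tv_measure \<nu>) (S A s)))"
      using itv Pb by (intro Bochner_Integration.integral_sum[symmetric]) auto
    also have "(\<lambda>s. \<Sum>A\<in>P. measure (tv_measure \<nu>) (S A s)) = (\<lambda>s. measure (tv_measure \<nu>) (S E s))"
    proof
      fix s
      have "measure (tv_measure \<nu>) (\<Union>A\<in>P. S A s) = (\<Sum>A\<in>P. measure (tv_measure \<nu>) (S A s))"
      proof (rule n.finite_measure_finite_Union[OF finP])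
        show "(\<lambda>A. S A s) ` P \<subseteq> sets (tv_measure \<nu>)" using Pb Sb by auto
        have "A \<inter> B = {}" if "A \<in> P" "B \<in> P" "A \<noteq> B" for A B
          using P that by (auto simp: borel_partitions_def disjoint_def)
        then show "disjoint_family_on (\<lambda>A. S A s) P"
          by (fastforce simp: disjoint_family_on_def S_def)
      qed
      moreover have "(\<Union>A\<in>P. S A s) = S E s"
        using P by (auto simp: borel_partitions_def S_def)
      ultimately show "(\<Sum>A\<in>P. measure (tv_measure \<nu>) (S A s)) = measure (tv_measure \<nu>) (S E s)" by simp
    qed
    finally show "(\<Sum>A\<in>P. ennreal (norm (convolution \<mu> \<nu> A))) \<le> ennreal (LINT s|tv_measure \<mu>. measure (tv_measure \<nu>) (S E s))" .
  qed
  show finc: "cm_finite (convolution \<mu> \<nu>)"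
    using add tv[of UNIV] by (auto simp: cm_finite_def intro: le_less_trans)
  show "cm_tight (convolution \<mu> \<nu>)"
    unfolding cm_tight_def
  proof (intro conjI allI impI finc)
    fix e :: real assume e: "0 < e"
    \<comment> \<open>The error at the end is at most
      \<open>d * cm_norm \<mu> + cm_norm \<nu> * d\<close>; the summand 1 makes the inequality
      strict.\<close>
    define d where "d = e / (cm_norm \<mu> + cm_norm \<nu> + 1)"
    have N: "0 < cm_norm \<mu> + cm_norm \<nu> + 1" using cm_norm_nonneg[of \<mu>] cm_norm_nonneg[of \<nu>] by linarith
    have d: "0 < d" using e N by (simp add: d_def)
    obtain K where K: "compact K" "measure (tv_measure \<mu>) (- K) < d"
      using complex_measures_tight[OF \<mu>] d unfolding cm_tight_def by (elim conjE allE[of _ d] impE exE)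
    obtain L where L: "compact L" "measure (tv_measure \<nu>) (- L) < d"
      using complex_measures_tight[OF \<nu>] d unfolding cm_tight_def by (elim conjE allE[of _ d] impE exE)
    define C where "C = (\<lambda>p. fst p + snd p) ` (K \<times> L)"
    have C: "compact C" unfolding C_def by (rule compact_sums_group[OF K(1) L(1)])
    have b: "- C \<in> sets borel" "- K \<in> sets borel" "- L \<in> sets borel"
      using borel_comp[OF borel_compact[OF C]] borel_comp[OF borel_compact[OF K(1)]] borel_comp[OF borel_compact[OF L(1)]]
      by (simp_all only:)
    \<comment> \<open>If \<open>s\<close> lies in \<open>K\<close> and \<open>s + t\<close> is
      outside \<open>K + L\<close>, then \<open>t\<close> is outside \<open>L\<close>.\<close>
    have pt: "measure (tv_measure \<nu>) (S (- C) s) \<le> d + cm_norm \<nu> * indicator (- K) s" for s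
    proof (cases "s \<in> K")
      case True
      have "S (- C) s \<subseteq> - L" using True by (force simp: S_def C_def)
      then have "measure (tv_measure \<nu>) (S (- C) s) \<le> measure (tv_measure \<nu>) (- L)"
        using b(3) by (intro n.finite_measure_mono) auto
      then show ?thesis using L(2) True by simp
    next
      case False
      then show ?thesis using bd[of "S (- C) s"] d by simp
    qed
    have ind: "integrable (tv_measure \<mu>) (indicator (- K) :: _ \<Rightarrow> real)"
      using b(2) by (intro integrable_real_indicator) (auto simp: m.emeasure_eq_measure)
    have "measure (tv_measure (convolution \<mu> \<nu>)) (- C) \<le> (LINT s|tv_measure \<mu>. measure (tv_measure \<nu>) (S (- C) s))"
      by (rule measure_tv_le[OF finc b(1) tv[OF b(1)]]) simp
    also have "\<dots> \<le> (LINT s|tv_measure \<mu>. d + cm_norm \<nu> * indicator (- K) s)"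
      using ind by (intro integral_mono itv b(1) pt) auto
    also have "\<dots> = d * cm_norm \<mu> + cm_norm \<nu> * measure (tv_measure \<mu>) (- K)"
      using ind b(2) by (simp add: cm_norm_tv_measure[OF fin] mult.commute)
    also have "\<dots> \<le> d * cm_norm \<mu> + cm_norm \<nu> * d"
      using K(2) cm_norm_nonneg by (intro add_left_mono mult_left_mono) auto
    also have "\<dots> < d * (cm_norm \<mu> + cm_norm \<nu> + 1)"
      using d by (simp add: algebra_simps)
    also have "\<dots> = e" using N by (simp add: d_def)
    finally show "\<exists>K. compact K \<and> measure (tv_measure (convolution \<mu> \<nu>)) (- K) < e"
      using C by blast
  qed
qed

text \<open>For indicators this is the definition of the convolution; the rest is induction over
  \<open>f\<close>, with the inner integrals converging uniformly in \<open>s\<close>.\<close>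

lemma convolution_integral:
  fixes \<mu> \<nu> :: "'g::{topological_group_add, t2_space} set \<Rightarrow> complex"
  assumes \<mu>: "\<mu> \<in> complex_measures" and \<nu>: "\<nu> \<in> complex_measures" and f: "bounded_borel f"
  shows "cm_integral (convolution \<mu> \<nu>) f = cm_integral \<mu> (\<lambda>s. cm_integral \<nu> (\<lambda>t. f (s + t)))"
proof -
  note fin = complex_measures_finite[OF \<mu>] and finn = complex_measures_finite[OF \<nu>]
    and finc = convolution_finite[OF \<mu> \<nu>] and bb = bounded_borel_integral_translate[OF \<nu>]
  have "bounded_borel f \<and> cm_integral (convolution \<mu> \<nu>) f = cm_integral \<mu> (\<lambda>s. cm_integral \<nu> (\<lambda>t. f (s + t)))"
    using f
  proof (induction rule: bounded_borel_induct)
    case (indicator E)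
    have "cm_integral \<nu> (\<lambda>t. indicator E (s + t)) = \<nu> {t. s + t \<in> E}" for s
      using cm_integral_indicator[OF finn vimage_translate_borel[OF indicator], of s]
      by (simp add: indicator_def[abs_def])
    moreover have "convolution \<mu> \<nu> E = cm_integral \<mu> (\<lambda>s. \<nu> {t. s + t \<in> E})"
      using indicator by (simp add: convolution_def)
    ultimately show ?case
      using indicator by (simp add: cm_integral_indicator[OF finc] bounded_borel_indicator)
  next
    case (add f g)
    then show ?case
      by (simp add: cm_integral_add[OF fin] cm_integral_add[OF finn] cm_integral_add[OF finc]
          bounded_borel_translate bounded_borel_add bb)
  next
    case (cmult f c)
    then show ?case
      using cm_integral_cmult[OF fin bb bb, of f f c]
      by (simp add: cm_integral_cmult[OF finn, where g = "\<lambda>t. f (_ + t)"]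
          cm_integral_cmult[OF finc, where g = f] bounded_borel_translate bounded_borel_cmult)
  next
    case (limit F f)
    have 1: "(\<lambda>n. cm_integral (convolution \<mu> \<nu>) (F n)) \<longlonglongrightarrow> cm_integral (convolution \<mu> \<nu>) f"
      by (rule cm_integral_tendsto_uniform[OF finc _ limit(2) _ lim_2_over_Suc]) (use limit in auto)
    have 2: "(\<lambda>n. cm_integral \<mu> (\<lambda>s. cm_integral \<nu> (\<lambda>t. F n (s + t)))) \<longlonglongrightarrow> cm_integral \<mu> (\<lambda>s. cm_integral \<nu> (\<lambda>t. f (s + t)))"
    proof (rule cm_integral_tendsto_uniform[OF fin _ bb[OF limit(2)]])
      show "bounded_borel (\<lambda>s. cm_integral \<nu> (\<lambda>t. F n (s + t)))" for n
        using limit(1) by (intro bb) simp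
      show "\<forall>\<^sub>F n in sequentially. \<forall>s. norm (cm_integral \<nu> (\<lambda>t. F n (s + t)) - cm_integral \<nu> (\<lambda>t. f (s + t))) \<le> 2 / real (Suc n) * cm_norm \<nu>"
      proof (intro always_eventually allI)
        fix n s
        have tF: "bounded_borel (\<lambda>t. F n (s + t))" and tf: "bounded_borel (\<lambda>t. f (s + t))"
          using limit(1,2) by (auto intro: bounded_borel_translate)
        show "norm (cm_integral \<nu> (\<lambda>t. F n (s + t)) - cm_integral \<nu> (\<lambda>t. f (s + t))) \<le> 2 / real (Suc n) * cm_norm \<nu>"
          unfolding cm_integral_diff(2)[OF finn tF tf, symmetric]
          by (rule norm_cm_integral_le[OF finn cm_integral_diff(1)[OF finn tF tf]]) (rule limit(3))
      qed
      show "(\<lambda>n. 2 / real (Suc n) * cm_norm \<nu>) \<longlonglongrightarrow> 0"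
        using tendsto_mult_right[OF lim_2_over_Suc, of "cm_norm \<nu>"] by simp
    qed
    show ?case
      using LIMSEQ_unique[OF 1] 2 limit(1,2) by simp
  qed
  then show ?thesis by simp
qed

section \<open>Orthonormal bases of square integrable functions\<close>

lemma integral_cauchy_schwarz:
  fixes u v :: "'a \<Rightarrow> real"
  assumes u: "integrable M (\<lambda>x. (u x)\<^sup>2)" and v: "integrable M (\<lambda>x. (v x)\<^sup>2)" and uv: "integrable M (\<lambda>x. u x * v x)"
  shows "(LINT x|M. u x * v x) \<le> sqrt (LINT x|M. (u x)\<^sup>2) * sqrt (LINT x|M. (v x)\<^sup>2)"
proof -
  define A B C where "A = (LINT x|M. (u x)\<^sup>2)" and "B = (LINT x|M. (v x)\<^sup>2)" and "C = (LINT x|M. u x * v x)"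
  have A0: "0 \<le> A" and B0: "0 \<le> B" by (simp_all add: A_def B_def)
  have q: "0 \<le> A * t\<^sup>2 - 2 * C * t + B" for t
  proof -
    have "0 \<le> (LINT x|M. (t * u x - v x)\<^sup>2)" by simp
    also have "(\<lambda>x. (t * u x - v x)\<^sup>2) = (\<lambda>x. t\<^sup>2 * (u x)\<^sup>2 - 2 * t * (u x * v x) + (v x)\<^sup>2)"
      by (simp add: power2_diff power_mult_distrib algebra_simps)
    also have "(LINT x|M. t\<^sup>2 * (u x)\<^sup>2 - 2 * t * (u x * v x) + (v x)\<^sup>2) = A * t\<^sup>2 - 2 * C * t + B"
      using u v uv by (simp add: A_def B_def C_def)
    finally show ?thesis .
  qed
  have "C\<^sup>2 \<le> A * B"
  proof (cases "A = 0")
    case True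
    have "C = 0"
    proof (rule ccontr)
      assume "C \<noteq> 0"
      \<comment> \<open>In the degenerate case \<open>A = 0\<close> the quadratic would take the
        value -1 at this point.\<close>
      then have "2 * C * ((B + 1) / (2 * C)) = B + 1" by simp
      then show False using q[of "(B + 1) / (2 * C)"] True by simp
    qed
    then show ?thesis using True by simp
  next
    case False
    then have e: "A * (C / A)\<^sup>2 = C\<^sup>2 / A" "2 * C * (C / A) = 2 * (C\<^sup>2 / A)"
      by (simp_all add: power2_eq_square)
    have "C\<^sup>2 / A \<le> B" using q[of "C / A"] unfolding e by simp
    then show ?thesis using A0 False by (simp add: divide_le_eq mult.commute)
  qed
  then have "C \<le> sqrt (A * B)" by (rule real_le_rsqrt)
  then show ?thesis by (simp add: A_def B_def C_def real_sqrt_mult)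
qed

lemma integrable_mult_squares:
  fixes u v :: "'a \<Rightarrow> real"
  assumes "u \<in> borel_measurable M" "v \<in> borel_measurable M"
    and "integrable M (\<lambda>x. (u x)\<^sup>2)" "integrable M (\<lambda>x. (v x)\<^sup>2)"
  shows "integrable M (\<lambda>x. u x * v x)"
proof (rule Bochner_Integration.integrable_bound)
  show "integrable M (\<lambda>x. (u x)\<^sup>2 + (v x)\<^sup>2)" using assms by simp
  show "(\<lambda>x. u x * v x) \<in> borel_measurable M" using assms by simp
  have "\<bar>a * b\<bar> \<le> a\<^sup>2 + b\<^sup>2" for a b :: real
    using sum_squares_bound[of a b] sum_squares_bound[of "- a" b] zero_le_power2[of a] zero_le_power2[of b]
    by (auto simp: abs_le_iff power2_eq_square)
  then show "AE x in M. norm (u x * v x) \<le> norm ((u x)\<^sup>2 + (v x)\<^sup>2)"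
    by (intro AE_I2) (simp add: abs_of_nonneg)
qed

locale l2_space =
  fixes M :: "'g::topological_space measure"
  assumes fin: "finite_measure M" and sets_M [measurable_cong, simp]: "sets M = sets borel"
begin

sublocale finite_measure M by (rule fin)

lemma space_M [simp]: "space M = UNIV"
  using sets_eq_imp_space_eq[OF sets_M] by simp

definition ip :: "('g \<Rightarrow> complex) \<Rightarrow> ('g \<Rightarrow> complex) \<Rightarrow> complex"
  where "ip f g = (LINT x|M. f x * cnj (g x))"

definition sqn :: "('g \<Rightarrow> complex) \<Rightarrow> real"
  where "sqn f = (LINT x|M. (norm (f x))\<^sup>2)"

lemma borel_measurable_M: "borel_measurable M = borel_measurable borel"
  by (rule measurable_cong_sets) simp_all

lemma L2_measurable: "L2 M f \<Longrightarrow> f \<in> borel_measurable M"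
  by (simp add: L2_def borel_measurable_M)

lemma L2_norm_measurable: "L2 M f \<Longrightarrow> (\<lambda>x. norm (f x)) \<in> borel_measurable M"
proof -
  assume "L2 M f"
  then have [measurable]: "f \<in> borel_measurable borel" by (simp add: L2_def)
  show "(\<lambda>x. norm (f x)) \<in> borel_measurable M" by measurable
qed

lemma L2_square: "L2 M f \<Longrightarrow> integrable M (\<lambda>x. (norm (f x))\<^sup>2)"
  by (simp add: L2_def)

lemma L2_product_integrable:
  assumes f: "L2 M f" and g: "L2 M g"
  shows "integrable M (\<lambda>x. f x * cnj (g x))"
proof (rule integrable_norm_cancel)
  show "integrable M (\<lambda>x. norm (f x * cnj (g x)))"
    unfolding norm_mult complex_mod_cnj using f g
    by (intro integrable_mult_squares L2_norm_measurable L2_square)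
  have "(\<lambda>x. cnj (g x)) \<in> borel_measurable M"
    using L2_measurable[OF g] by (intro borel_measurable_continuous_on[OF _ L2_measurable[OF g]] continuous_intros)
  then show "(\<lambda>x. f x * cnj (g x)) \<in> borel_measurable M"
    using L2_measurable[OF f] by simp
qed

lemma L2_add:
  assumes f: "L2 M f" and g: "L2 M g"
  shows "L2 M (\<lambda>x. f x + g x)"
  unfolding L2_def
proof
  have [measurable]: "f \<in> borel_measurable borel" "g \<in> borel_measurable borel" using assms by (simp_all add: L2_def)
  show m: "(\<lambda>x. f x + g x) \<in> borel_measurable borel" by measurable
  show "integrable M (\<lambda>x. (norm (f x + g x))\<^sup>2)"
  proof (rule Bochner_Integration.integrable_bound)
    show "integrable M (\<lambda>x. 2 * (norm (f x))\<^sup>2 + 2 * (norm (g x))\<^sup>2)"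
      using L2_square[OF f] L2_square[OF g] by simp
    show "(\<lambda>x. (norm (f x + g x))\<^sup>2) \<in> borel_measurable M" using m by simp
    show "AE x in M. norm ((norm (f x + g x))\<^sup>2) \<le> norm (2 * (norm (f x))\<^sup>2 + 2 * (norm (g x))\<^sup>2)"
      using norm_add_sq_le by (intro AE_I2) (simp add: abs_of_nonneg)
  qed
qed

lemma L2_cmult:
  assumes f: "L2 M f"
  shows "L2 M (\<lambda>x. c * f x)"
proof -
  have [measurable]: "f \<in> borel_measurable borel" using assms by (simp add: L2_def)
  have "(\<lambda>x. c * f x) \<in> borel_measurable borel" by measurable
  then show ?thesis using assms by (simp add: L2_def norm_mult power_mult_distrib)
qed

lemma L2_zero: "L2 M (\<lambda>x. 0)"
  by (simp add: L2_def)

lemma L2_diff: "L2 M f \<Longrightarrow> L2 M g \<Longrightarrow> L2 M (\<lambda>x. f x - g x)"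
  using L2_add[OF _ L2_cmult[of g "-1"], of f] by simp

lemma L2_sum: "finite I \<Longrightarrow> (\<And>i. i \<in> I \<Longrightarrow> L2 M (f i)) \<Longrightarrow> L2 M (\<lambda>x. \<Sum>i\<in>I. f i x)"
  by (induction I rule: finite_induct) (auto intro: L2_zero L2_add)

lemma L2_bounded: "bounded_borel f \<Longrightarrow> L2 M f"
proof -
  assume f: "bounded_borel f"
  then obtain C where "0 \<le> C" and C: "\<And>x. norm (f x) \<le> C" by (rule bounded_borelE) blast
  have m: "f \<in> borel_measurable borel" using f by (rule bounded_borelD)
  have "integrable M (\<lambda>x. (norm (f x))\<^sup>2)"
    using m C by (intro integrable_const_bound[where B = "C\<^sup>2"]) (auto intro!: AE_I2 power_mono)
  then show "L2 M f" using m by (simp add: L2_def)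
qed

lemma ip_cnj: "ip g f = cnj (ip f g)"
  by (simp add: ip_def mult.commute flip: Bochner_Integration.integral_cnj)

lemma ip_add_left: "L2 M f \<Longrightarrow> L2 M g \<Longrightarrow> L2 M h \<Longrightarrow> ip (\<lambda>x. f x + g x) h = ip f h + ip g h"
  by (simp add: ip_def distrib_right L2_product_integrable)

lemma ip_cmult_left: "ip (\<lambda>x. c * f x) h = c * ip f h"
  by (simp add: ip_def mult.assoc)

lemma ip_diff_left: "L2 M f \<Longrightarrow> L2 M g \<Longrightarrow> L2 M h \<Longrightarrow> ip (\<lambda>x. f x - g x) h = ip f h - ip g h"
  by (simp add: ip_def left_diff_distrib L2_product_integrable)

lemma ip_sum_left:
  "finite I \<Longrightarrow> (\<And>i. i \<in> I \<Longrightarrow> L2 M (f i)) \<Longrightarrow> L2 M h \<Longrightarrow> ip (\<lambda>x. \<Sum>i\<in>I. f i x) h = (\<Sum>i\<in>I. ip (f i) h)"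
proof (induction I rule: finite_induct)
  case empty
  show ?case by (simp add: ip_def)
next
  case (insert i I)
  then show ?case by (simp add: ip_add_left L2_sum)
qed

lemma ip_self: "ip f f = complex_of_real (sqn f)"
  by (simp add: ip_def sqn_def complex_norm_square[symmetric] del: of_real_power)

lemma sqn_nonneg: "0 \<le> sqn f"
  by (simp add: sqn_def)

lemma norm_ip_le:
  assumes "L2 M f" "L2 M g"
  shows "norm (ip f g) \<le> sqrt (sqn f) * sqrt (sqn g)"
proof -
  have i: "integrable M (\<lambda>x. norm (f x) * norm (g x))"
    using assms by (intro integrable_mult_squares L2_norm_measurable L2_square)
  have "norm (ip f g) \<le> (LINT x|M. norm (f x) * norm (g x))"
    unfolding ip_def by (rule norm_integral_le_integral[OF L2_product_integrable[OF assms] i]) (simp add: norm_mult)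
  also have "\<dots> \<le> sqrt (sqn f) * sqrt (sqn g)"
    unfolding sqn_def using assms by (intro integral_cauchy_schwarz i L2_square)
  finally show ?thesis .
qed

lemma sqn_diff:
  assumes "L2 M f" "L2 M g"
  shows "sqn (\<lambda>x. f x - g x) = sqn f - 2 * Re (ip f g) + sqn g"
proof -
  have "complex_of_real (sqn (\<lambda>x. f x - g x)) = ip (\<lambda>x. f x - g x) (\<lambda>x. f x - g x)"
    by (rule ip_self[symmetric])
  also have "\<dots> = ip f (\<lambda>x. f x - g x) - ip g (\<lambda>x. f x - g x)"
    by (intro ip_diff_left assms L2_diff)
  also have "ip f (\<lambda>x. f x - g x) = cnj (ip f f - ip g f)"
    by (subst ip_cnj) (simp add: ip_diff_left assms)
  also have "ip g (\<lambda>x. f x - g x) = cnj (ip f g - ip g g)"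
    by (subst ip_cnj) (simp add: ip_diff_left assms)
  finally have "sqn (\<lambda>x. f x - g x) = Re (cnj (ip f f - ip g f) - cnj (ip f g - ip g g))"
    by (metis Re_complex_of_real)
  moreover have "Re (ip g f) = Re (ip f g)" by (subst ip_cnj) simp
  ultimately show ?thesis by (simp add: ip_self)
qed

text \<open>Functions stand for their classes modulo null functions. Two distinct members cannot
  agree almost everywhere, for their inner product would then be 1 and not 0.\<close>

definition ons :: "('g \<Rightarrow> complex) set \<Rightarrow> bool"
  where "ons E \<longleftrightarrow> (\<forall>e\<in>E. L2 M e) \<and> (\<forall>e\<in>E. \<forall>f\<in>E. ip e f = (if e = f then 1 else 0))"

text \<open>Partial Fourier sum; for orthonormal \<open>J\<close> it is the projection of
  \<open>f\<close> to the span of \<open>J\<close>.\<close>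

definition fpart :: "('g \<Rightarrow> complex) set \<Rightarrow> ('g \<Rightarrow> complex) \<Rightarrow> 'g \<Rightarrow> complex"
  where "fpart J f = (\<lambda>x. \<Sum>e\<in>J. ip f e * e x)"

lemma onsD: "ons E \<Longrightarrow> e \<in> E \<Longrightarrow> L2 M e" "ons E \<Longrightarrow> e \<in> E \<Longrightarrow> f \<in> E \<Longrightarrow> ip e f = (if e = f then 1 else 0)"
  by (auto simp: ons_def)

lemma L2_fpart: "ons E \<Longrightarrow> finite J \<Longrightarrow> J \<subseteq> E \<Longrightarrow> L2 M (fpart J f)"
  unfolding fpart_def by (intro L2_sum L2_cmult) (auto dest: onsD)

lemma ip_fpart:
  assumes "ons E" "finite J" "J \<subseteq> E" "e \<in> E"
  shows "ip (fpart J f) e = (if e \<in> J then ip f e else 0)"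
proof -
  have "ip (fpart J f) e = (\<Sum>d\<in>J. ip f d * ip d e)"
    unfolding fpart_def using assms onsD(1)[OF assms(1)]
    by (subst ip_sum_left) (auto simp: ip_cmult_left intro!: L2_cmult)
  also have "\<dots> = (\<Sum>d\<in>J. if d = e then ip f e else 0)"
    using assms onsD(2)[OF assms(1)] by (intro sum.cong) auto
  finally show ?thesis using assms(2) by simp
qed

lemma ip_fpart_right:
  assumes "ons E" "finite J" "J \<subseteq> E" "L2 M g"
  shows "ip g (fpart J f) = (\<Sum>e\<in>J. cnj (ip f e) * ip g e)"
proof -
  have "ip (fpart J f) g = (\<Sum>e\<in>J. ip f e * ip e g)"
    unfolding fpart_def using assms onsD(1)[OF assms(1)]
    by (subst ip_sum_left) (auto simp: ip_cmult_left intro!: L2_cmult)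
  then have "ip g (fpart J f) = cnj (\<Sum>e\<in>J. ip f e * ip e g)"
    by (subst ip_cnj) simp
  also have "\<dots> = (\<Sum>e\<in>J. cnj (ip f e) * ip g e)"
    by (simp add: ip_cnj[of _ g])
  finally show ?thesis .
qed

lemma sqn_fpart:
  assumes "ons E" "finite J" "J \<subseteq> E"
  shows "sqn (fpart J f) = (\<Sum>e\<in>J. (norm (ip f e))\<^sup>2)"
proof -
  have "complex_of_real (sqn (fpart J f)) = (\<Sum>e\<in>J. cnj (ip f e) * ip (fpart J f) e)"
    unfolding ip_self[symmetric] by (rule ip_fpart_right[OF assms L2_fpart[OF assms]])
  also have "\<dots> = (\<Sum>e\<in>J. complex_of_real ((norm (ip f e))\<^sup>2))"
  proof (rule sum.cong[OF refl])
    fix e assume e: "e \<in> J"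
    then have "ip (fpart J f) e = ip f e" using assms by (subst ip_fpart[OF assms]) auto
    then show "cnj (ip f e) * ip (fpart J f) e = complex_of_real ((norm (ip f e))\<^sup>2)"
      by (simp only: complex_norm_square mult.commute)
  qed
  finally show ?thesis by (metis of_real_sum of_real_eq_iff)
qed

lemma bessel:
  assumes "ons E" "finite J" "J \<subseteq> E" and f: "L2 M f"
  shows "sqn (\<lambda>x. f x - fpart J f x) = sqn f - (\<Sum>e\<in>J. (norm (ip f e))\<^sup>2)"
proof -
  have "ip f (fpart J f) = (\<Sum>e\<in>J. complex_of_real ((norm (ip f e))\<^sup>2))"
    unfolding ip_fpart_right[OF assms(1-3) f]
    by (rule sum.cong[OF refl]) (simp only: complex_norm_square mult.commute)
  then have "Re (ip f (fpart J f)) = (\<Sum>e\<in>J. (norm (ip f e))\<^sup>2)"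
    by (simp del: of_real_power)
  then show ?thesis
    by (simp add: sqn_diff[OF f L2_fpart[OF assms(1-3)]] sqn_fpart[OF assms(1-3)])
qed

lemma bessel_le:
  assumes "ons E" "finite J" "J \<subseteq> E" and f: "L2 M f"
  shows "(\<Sum>e\<in>J. (norm (ip f e))\<^sup>2) \<le> sqn f"
  using bessel[OF assms] sqn_nonneg[of "\<lambda>x. f x - fpart J f x"] by simp

text \<open>On a finite measure space, mean square Cauchy implies Cauchy in mean, so a subsequence
  converges almost everywhere; Fatou's lemma then bounds the mean square distance to the
  limit.\<close>

lemma riesz_fischer:
  assumes g: "\<And>n. L2 M (g n)"
    and cauchy: "\<And>e. 0 < e \<Longrightarrow> \<exists>N. \<forall>m\<ge>N. \<forall>n\<ge>N. sqn (\<lambda>x. g m x - g n x) \<le> e"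
  obtains l where "L2 M l" "(\<lambda>n. sqn (\<lambda>x. g n x - l x)) \<longlonglongrightarrow> 0"
proof -
  have gm[measurable]: "g n \<in> borel_measurable M" for n using g by (rule L2_measurable)
  have ig: "integrable M (g n)" for n by (rule L2_integrable[OF fin sets_M g])
  define m where "m = measure M UNIV"
  have l1: "(LINT x|M. norm (g i x - g j x)) \<le> sqrt (sqn (\<lambda>x. g i x - g j x)) * sqrt m" for i j
    using integral_cauchy_schwarz[of M "\<lambda>x. norm (g i x - g j x)" "\<lambda>_. 1"] L2_square[OF L2_diff[OF g[of i] g[of j]]] ig
    by (simp add: sqn_def m_def)
  have l1c: "\<exists>N. \<forall>i\<ge>N. \<forall>j\<ge>N. (LINT x|M. norm (g i x - g j x)) < e" if e: "0 < e" for e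
  proof -
    \<comment> \<open>Cauchy-Schwarz costs a factor \<open>sqrt m\<close>; the summand 1 covers the
      zero measure.\<close>
    define d where "d = (e / (sqrt m + 1))\<^sup>2"
    have sm: "0 < sqrt m + 1" by (simp add: m_def add_nonneg_pos)
    then have "0 < d" using e by (simp add: d_def)
    then obtain N where N: "\<forall>i\<ge>N. \<forall>j\<ge>N. sqn (\<lambda>x. g i x - g j x) \<le> d" using cauchy by blast
    have "(LINT x|M. norm (g i x - g j x)) < e" if "N \<le> i" "N \<le> j" for i j
    proof -
      have "sqrt (sqn (\<lambda>x. g i x - g j x)) \<le> sqrt d" using N that by (intro real_sqrt_le_mono) simp
      also have "sqrt d = e / (sqrt m + 1)" using e sm by (simp add: d_def)
      finally have "sqrt (sqn (\<lambda>x. g i x - g j x)) * sqrt m \<le> e / (sqrt m + 1) * sqrt m"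
        by (intro mult_right_mono) (simp_all add: m_def)
      also have "\<dots> < e / (sqrt m + 1) * (sqrt m + 1)"
        using e sm by (intro mult_strict_left_mono) auto
      also have "\<dots> = e" using sm by simp
      finally show ?thesis using l1[of i j] by simp
    qed
    then show ?thesis by blast
  qed
  obtain r where r: "strict_mono r" "AE x in M. Cauchy (\<lambda>i. g (r i) x)"
    by (rule cauchy_L1_AE_cauchy_subseq[of M g, OF ig l1c])
  define l where "l x = lim (\<lambda>i. g (r i) x)" for x
  have lm[measurable]: "l \<in> borel_measurable M" unfolding l_def by measurable
  have lim: "AE x in M. (\<lambda>i. g (r i) x) \<longlonglongrightarrow> l x"
    using r(2)
  proof eventually_elim
    case (elim x)
    then have "convergent (\<lambda>i. g (r i) x)" by (rule Cauchy_convergent)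
    then show ?case unfolding l_def by (simp only: convergent_LIMSEQ_iff)
  qed
  have small: "integrable M (\<lambda>x. (norm (g n x - l x))\<^sup>2) \<and> sqn (\<lambda>x. g n x - l x) \<le> e"
    if e: "0 < e" and N: "\<forall>i\<ge>N. \<forall>j\<ge>N. sqn (\<lambda>x. g i x - g j x) \<le> e" "N \<le> n" for e N n
  proof -
    \<comment> \<open>Fatou's lemma is applied in the second index, along the subsequence, with
      \<open>n\<close> fixed.\<close>
    have "(\<integral>\<^sup>+x. ennreal ((norm (g n x - l x))\<^sup>2) \<partial>M) = (\<integral>\<^sup>+x. liminf (\<lambda>i. ennreal ((norm (g n x - g (r i) x))\<^sup>2)) \<partial>M)"
    proof (rule nn_integral_cong_AE)
      show "AE x in M. ennreal ((norm (g n x - l x))\<^sup>2) = liminf (\<lambda>i. ennreal ((norm (g n x - g (r i) x))\<^sup>2))"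
        using lim
      proof eventually_elim
        case (elim x)
        then have "(\<lambda>i. ennreal ((norm (g n x - g (r i) x))\<^sup>2)) \<longlonglongrightarrow> ennreal ((norm (g n x - l x))\<^sup>2)"
          by (intro tendsto_ennrealI tendsto_power tendsto_norm tendsto_diff tendsto_const)
        then show ?case by (rule lim_imp_Liminf[OF trivial_limit_sequentially, symmetric])
      qed
    qed
    also have "\<dots> \<le> liminf (\<lambda>i. \<integral>\<^sup>+x. ennreal ((norm (g n x - g (r i) x))\<^sup>2) \<partial>M)"
      by (rule nn_integral_liminf) measurable
    also have "\<dots> \<le> limsup (\<lambda>i. \<integral>\<^sup>+x. ennreal ((norm (g n x - g (r i) x))\<^sup>2) \<partial>M)"
      by (rule Liminf_le_Limsup) simp
    also have "\<dots> \<le> ennreal e"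
    proof (rule Limsup_bounded, rule eventually_sequentiallyI[of N])
      fix i assume "N \<le> i"
      then have "N \<le> r i" using seq_suble[OF r(1), of i] by simp
      then have "sqn (\<lambda>x. g n x - g (r i) x) \<le> e" using N by simp
      then show "(\<integral>\<^sup>+x. ennreal ((norm (g n x - g (r i) x))\<^sup>2) \<partial>M) \<le> ennreal e"
        using L2_square[OF L2_diff[OF g[of n] g[of "r i"]]]
        by (subst nn_integral_eq_integral) (auto simp: sqn_def intro: ennreal_leI)
    qed
    finally have le: "(\<integral>\<^sup>+x. ennreal ((norm (g n x - l x))\<^sup>2) \<partial>M) \<le> ennreal e" .
    have int: "integrable M (\<lambda>x. (norm (g n x - l x))\<^sup>2)"
      using le by (intro integrableI_bounded) (auto intro: le_less_trans)
    moreover have "sqn (\<lambda>x. g n x - l x) \<le> e"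
      using le int e by (subst (asm) nn_integral_eq_integral) (auto simp: sqn_def)
    ultimately show ?thesis by simp
  qed
  obtain N where N: "\<forall>i\<ge>N. \<forall>j\<ge>N. sqn (\<lambda>x. g i x - g j x) \<le> 1" using cauchy[of 1] by auto
  have "L2 M (\<lambda>x. g N x - l x)"
    using small[OF _ N, of N] by (simp add: L2_def)
  from L2_diff[OF g[of N] this] have l: "L2 M l" by simp
  have "(\<lambda>n. sqn (\<lambda>x. g n x - l x)) \<longlonglongrightarrow> 0"
  proof (rule LIMSEQ_I)
    fix e :: real assume "0 < e"
    then have e2: "0 < e / 2" by simp
    obtain N where N: "\<forall>i\<ge>N. \<forall>j\<ge>N. sqn (\<lambda>x. g i x - g j x) \<le> e / 2" using cauchy[OF e2] by blast
    have "norm (sqn (\<lambda>x. g n x - l x) - 0) < e" if "N \<le> n" for n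
      using small[OF e2 N that] \<open>0 < e\<close> sqn_nonneg[of "\<lambda>x. g n x - l x"] by simp
    then show "\<exists>no. \<forall>n\<ge>no. norm (sqn (\<lambda>x. g n x - l x) - 0) < e" by blast
  qed
  with l show thesis by (rule that)
qed

lemma ex_maximal_ons: "\<exists>E. ons E \<and> (\<forall>E'. ons E' \<longrightarrow> E \<subseteq> E' \<longrightarrow> E' = E)"
proof -
  have "\<Union>C \<in> {E. ons E}" if C: "subset.chain {E. ons E} C" for C
  proof -
    have o: "ons A" if "A \<in> C" for A using C that by (auto simp: subset.chain_def)
    have ch: "A \<subseteq> B \<or> B \<subseteq> A" if "A \<in> C" "B \<in> C" for A B
      using C that by (auto simp: subset_chain_def)
    have "ip e f = (if e = f then 1 else 0)" if "e \<in> A" "A \<in> C" "f \<in> B" "B \<in> C" for e f A B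
      using ch[OF that(2,4)] onsD(2)[OF o[OF that(2)], of e f] onsD(2)[OF o[OF that(4)], of e f] that by blast
    moreover have "L2 M e" if "e \<in> A" "A \<in> C" for e A using onsD(1)[OF o] that by blast
    ultimately show ?thesis by (auto simp: ons_def)
  qed
  from subset_Zorn'[of "{E. ons E}", OF this] show ?thesis by auto
qed

text \<open>In a maximal orthonormal system Bessel's inequality is an equality. Otherwise the
  remainders of \<open>f\<close> along suitable finite sets converge to a nonzero function
  orthogonal to the whole system, and its normalization could be added. The system may be
  uncountable, so the finite sets are chosen by how much of the sum they exhaust.\<close>

lemma ex_onb:
  obtains E where "ons E" "\<And>f. L2 M f \<Longrightarrow> ((\<lambda>e. (norm (ip f e))\<^sup>2) has_sum sqn f) E"
proof -
  obtain E where E: "ons E" and max: "\<And>E'. ons E' \<Longrightarrow> E \<subseteq> E' \<Longrightarrow> E' = E"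
    using ex_maximal_ons by blast
  have "((\<lambda>e. (norm (ip f e))\<^sup>2) has_sum sqn f) E" if f: "L2 M f" for f
  proof -
    define t where "t e = (norm (ip f e))\<^sup>2" for e
    have ts: "t summable_on E"
      by (rule nonneg_bdd_above_summable_on, simp add: t_def, rule bdd_aboveI2[where M = "sqn f"])
        (use bessel_le[OF E _ _ f] in \<open>auto simp: t_def\<close>)
    define S where "S = infsum t E"
    have tS: "(t has_sum S) E" unfolding S_def using ts by (rule has_sum_infsum)
    have S_ge: "sum t J \<le> S" if "finite J" "J \<subseteq> E" for J
      by (rule finite_sum_le_has_sum[OF tS]) (use that in \<open>auto simp: t_def\<close>)
    have S_le: "S \<le> sqn f"
      by (rule has_sum_le_finite_sums[OF tS]) (use bessel_le[OF E _ _ f] in \<open>auto simp: t_def\<close>)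
    have "S = sqn f"
    proof (rule ccontr)
      assume "S \<noteq> sqn f"
      then have lt: "S < sqn f" using S_le by simp
      have "\<exists>J. finite J \<and> J \<subseteq> E \<and> S - sum t J \<le> 1 / real (Suc n)" for n
      proof -
        obtain J where "finite J" "J \<subseteq> E" "dist (sum t J) S \<le> 1 / real (Suc n)"
          using has_sum_finite_approximation[OF tS, of "1 / real (Suc n)"] by auto
        then show ?thesis by (intro exI[of _ J]) (auto simp: dist_real_def)
      qed
      then obtain J where J: "\<And>n. finite (J n)" "\<And>n. J n \<subseteq> E" "\<And>n. S - sum t (J n) \<le> 1 / real (Suc n)"
        by metis
      have J0: "(\<lambda>n. 1 / real (Suc n)) \<longlonglongrightarrow> 0"
        using LIMSEQ_inverse_real_of_nat by (simp add: inverse_eq_divide)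
      define g where "g n = (\<lambda>x. f x - fpart (J n) f x)" for n
      have gL: "L2 M (g n)" for n
        unfolding g_def by (intro L2_diff f L2_fpart[OF E] J)
      have ipg: "ip (g n) e = (if e \<in> J n then 0 else ip f e)" if "e \<in> E" for n e
        unfolding g_def
        by (subst ip_diff_left[OF f L2_fpart[OF E J(1,2)] onsD(1)[OF E that]])
          (simp add: ip_fpart[OF E J(1,2) that])
      have cauchy: "\<exists>N. \<forall>m\<ge>N. \<forall>n\<ge>N. sqn (\<lambda>x. g m x - g n x) \<le> e" if e: "0 < e" for e
      proof -
        have le: "sqn (\<lambda>x. g m x - g n x) \<le> (S - sum t (J m)) + (S - sum t (J n))" for m n
        proof -
          \<comment> \<open>The sets \<open>J n\<close> need not be nested, so two remainders differ
            by the Fourier sums over both set differences.\<close>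
          define A B where "A = J n - J m" and "B = J m - J n"
          have fA: "finite A" "A \<subseteq> E" and fB: "finite B" "B \<subseteq> E" and disj: "A \<inter> B = {}"
            using J by (auto simp: A_def B_def)
          have "g m x - g n x = fpart A f x - fpart B f x" for x
          proof -
            have "fpart (J n) f x = fpart A f x + fpart (J n \<inter> J m) f x"
              unfolding fpart_def A_def using J(1) by (subst sum.union_disjoint[symmetric]) (auto intro!: sum.cong)
            moreover have "fpart (J m) f x = fpart B f x + fpart (J n \<inter> J m) f x"
              unfolding fpart_def B_def using J(1) by (subst sum.union_disjoint[symmetric]) (auto intro!: sum.cong)
            ultimately show ?thesis by (simp add: g_def)
          qed
          then have "sqn (\<lambda>x. g m x - g n x) = sqn (\<lambda>x. fpart A f x - fpart B f x)" by simp
          also have "\<dots> = sum t A + sum t B"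
          proof -
            have "ip (fpart A f) (fpart B f) = 0"
              unfolding ip_fpart_right[OF E fB L2_fpart[OF E fA]]
            proof (rule sum.neutral, rule ballI)
              fix e assume "e \<in> B"
              then have "e \<in> E" "e \<notin> A" using fB disj by auto
              then show "cnj (ip f e) * ip (fpart A f) e = 0" by (simp add: ip_fpart[OF E fA])
            qed
            then show ?thesis
              by (simp add: sqn_diff[OF L2_fpart[OF E fA] L2_fpart[OF E fB]] sqn_fpart[OF E fA] sqn_fpart[OF E fB] t_def)
          qed
          also have "sum t A \<le> S - sum t (J m)"
          proof -
            have "sum t A + sum t (J m) = sum t (A \<union> J m)"
              using J(1) by (subst sum.union_disjoint) (auto simp: A_def)
            also have "\<dots> \<le> S" using J(1,2) fA by (intro S_ge) auto
            finally show ?thesis by simp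
          qed
          also have "sum t B \<le> S - sum t (J n)"
          proof -
            have "sum t B + sum t (J n) = sum t (B \<union> J n)"
              using J(1) by (subst sum.union_disjoint) (auto simp: B_def)
            also have "\<dots> \<le> S" using J(1,2) fB by (intro S_ge) auto
            finally show ?thesis by simp
          qed
          finally show ?thesis by simp
        qed
        have "\<forall>\<^sub>F n in sequentially. 1 / real (Suc n) < e / 2"
          using order_tendstoD(2)[OF J0, of "e / 2"] e by simp
        then obtain N where N: "\<And>n. n \<ge> N \<Longrightarrow> 1 / real (Suc n) < e / 2"
          unfolding eventually_sequentially by blast
        have "sqn (\<lambda>x. g m x - g n x) \<le> e" if mn: "N \<le> m" "N \<le> n" for m n
        proof -
          have "S - sum t (J m) \<le> e / 2" "S - sum t (J n) \<le> e / 2"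
            using J(3)[of m] J(3)[of n] N[OF mn(1)] N[OF mn(2)] by linarith+
          then have "(S - sum t (J m)) + (S - sum t (J n)) \<le> e / 2 + e / 2" by (rule add_mono)
          then show ?thesis using le[of m n] by simp
        qed
        then show ?thesis by blast
      qed
      obtain l where l: "L2 M l" "(\<lambda>n. sqn (\<lambda>x. g n x - l x)) \<longlonglongrightarrow> 0"
        by (rule riesz_fischer[of g, OF gL cauchy])
      have sl: "(\<lambda>n. sqrt (sqn (\<lambda>x. g n x - l x))) \<longlonglongrightarrow> 0"
        using tendsto_real_sqrt[OF l(2)] by simp
      have conv: "(\<lambda>n. ip (g n) h) \<longlonglongrightarrow> ip l h" if h: "L2 M h" for h
      proof -
        have "(\<lambda>n. ip (g n) h - ip l h) \<longlonglongrightarrow> 0"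
        proof (rule Lim_null_comparison)
          show "(\<lambda>n. sqrt (sqn (\<lambda>x. g n x - l x)) * sqrt (sqn h)) \<longlonglongrightarrow> 0"
            using tendsto_mult_right[OF sl, of "sqrt (sqn h)"] by simp
          show "\<forall>\<^sub>F n in sequentially. norm (ip (g n) h - ip l h) \<le> sqrt (sqn (\<lambda>x. g n x - l x)) * sqrt (sqn h)"
            using norm_ip_le[OF L2_diff[OF gL l(1)] h] ip_diff_left[OF gL l(1) h] by (intro always_eventually) simp
        qed
        then show ?thesis by (simp add: LIM_zero_iff)
      qed
      have le0: "ip l e = 0" if e: "e \<in> E" for e
      proof -
        \<comment> \<open>An \<open>e\<close> outside \<open>J n\<close> has its coefficient among
          the missing part of the sum, which is at most \<open>1 / real (Suc n)\<close>.\<close>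
        have bd: "norm (ip (g n) e) \<le> sqrt (1 / real (Suc n))" for n
        proof (cases "e \<in> J n")
          case False
          have "t e + sum t (J n) = sum t (insert e (J n))" using False J(1) by simp
          also have "\<dots> \<le> S" using J(1,2) e by (intro S_ge) auto
          finally have "(norm (ip f e))\<^sup>2 \<le> 1 / real (Suc n)" using J(3)[of n] by (simp add: t_def)
          then show ?thesis using False by (simp add: ipg[OF e] real_le_rsqrt)
        qed (simp add: ipg[OF e])
        have "(\<lambda>n. sqrt (1 / real (Suc n))) \<longlonglongrightarrow> 0"
          using tendsto_real_sqrt[OF J0] by simp
        then have "(\<lambda>n. ip (g n) e) \<longlonglongrightarrow> 0"
          by (rule Lim_null_comparison[rotated]) (use bd in simp)
        then show ?thesis using conv[OF onsD(1)[OF E e]] LIMSEQ_unique by blast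
      qed
      \<comment> \<open>Every remainder has square norm at least \<open>sqn f - S\<close>, so
        remainders tending to 0 would contradict \<open>S < sqn f\<close>.\<close>
      have "sqn l \<noteq> 0"
      proof
        assume l0: "sqn l = 0"
        have gs: "sqn (g n) = sqn f - sum t (J n)" for n
          unfolding g_def t_def by (rule bessel[OF E J(1,2) f])
        have "Re (ip (g n) l) = 0" for n
          using norm_ip_le[OF gL l(1), of n] by (simp add: l0)
        then have "sqn (\<lambda>x. g n x - l x) = sqn (g n)" for n
          by (simp add: sqn_diff[OF gL l(1)] l0)
        then have "sqn f - S \<le> sqn (\<lambda>x. g n x - l x)" for n
          using gs[of n] S_ge[OF J(1,2)[of n]] by simp
        then have "sqn f - S \<le> 0"
          by (intro LIMSEQ_le_const[OF l(2)]) auto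
        then show False using lt by simp
      qed
      then have sl0: "0 < sqn l" using sqn_nonneg[of l] by simp
      define u where "u = (\<lambda>x. complex_of_real (1 / sqrt (sqn l)) * l x)"
      have uL: "L2 M u" unfolding u_def by (rule L2_cmult[OF l(1)])
      have ue: "ip u e = 0" "ip e u = 0" if "e \<in> E" for e
      proof -
        show "ip u e = 0" unfolding u_def ip_cmult_left by (simp add: le0[OF that])
        then show "ip e u = 0" by (subst ip_cnj) simp
      qed
      have uu: "ip u u = 1"
      proof -
        have "ip u u = complex_of_real (1 / sqrt (sqn l)) * cnj (ip u l)"
          unfolding u_def by (subst ip_cmult_left) (simp add: ip_cnj[of l])
        also have "ip u l = complex_of_real (1 / sqrt (sqn l)) * complex_of_real (sqn l)"
          unfolding u_def by (simp only: ip_cmult_left ip_self)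
        finally have "ip u u = complex_of_real (1 / sqrt (sqn l) * (1 / sqrt (sqn l) * sqn l))"
          by (simp only: of_real_mult complex_cnj_mult complex_cnj_complex_of_real)
        also have "1 / sqrt (sqn l) * (1 / sqrt (sqn l) * sqn l) = 1"
          using sl0 by (simp add: field_simps)
        finally show ?thesis by simp
      qed
      have "u \<notin> E" using ue uu by force
      have "ons (insert u E)"
        unfolding ons_def using uL onsD[OF E] ue uu \<open>u \<notin> E\<close> by auto
      then have "insert u E = E" using max by blast
      then show False using \<open>u \<notin> E\<close> by blast
    qed
    then show ?thesis using tS unfolding t_def by simp
  qed
  with E show thesis by (rule that)
qed

end

section \<open>Parseval's identity for vector-valued functions\<close>

context l2_space
begin

text \<open>Weak measurability, suited to nonseparable H. There it does not imply that the norm is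
  measurable, hence the separate condition.\<close>

definition vL2 :: "('g \<Rightarrow> 'h::complex_hilbert) \<Rightarrow> bool"
  where "vL2 F \<longleftrightarrow> (\<forall>z. (\<lambda>s. cinner (F s) z) \<in> borel_measurable borel) \<and>
    (\<lambda>s. norm (F s)) \<in> borel_measurable borel \<and> integrable M (\<lambda>s. (norm (F s))\<^sup>2)"

definition vsq :: "('g \<Rightarrow> 'h::complex_hilbert) \<Rightarrow> real"
  where "vsq F = (LINT s|M. (norm (F s))\<^sup>2)"

lemma vsq_nonneg: "0 \<le> vsq F"
  by (simp add: vsq_def)

lemma vL2D:
  assumes "vL2 F"
  shows "(\<lambda>s. cinner (F s) z) \<in> borel_measurable M" "(\<lambda>s. norm (F s)) \<in> borel_measurable M"
    "integrable M (\<lambda>s. (norm (F s))\<^sup>2)"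
  using assms by (simp_all add: vL2_def borel_measurable_M)

text \<open>Weak measurability of a sum is immediate. Measurability of its norm is obtained by
  expanding the square, where \<open>cinner (F s) z\<close> involves only the fixed vector
  \<open>z\<close>.\<close>

lemma vL2_add_rank_one:
  assumes F: "vL2 F" and f: "L2 M f"
  shows "vL2 (\<lambda>s. F s + scaleC (f s) z)"
proof -
  have fm[measurable]: "f \<in> borel_measurable borel" using f by (simp add: L2_def)
  have wm[measurable]: "(\<lambda>s. cinner (F s) y) \<in> borel_measurable borel" for y using F by (simp add: vL2_def)
  have nm[measurable]: "(\<lambda>s. norm (F s)) \<in> borel_measurable borel" using F by (simp add: vL2_def)
  have nrm: "norm (F s + scaleC (f s) z) = sqrt ((norm (F s))\<^sup>2 + 2 * Re (cnj (f s) * cinner (F s) z) + (norm (f s) * norm z)\<^sup>2)" for s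
    using norm_add_sq[of "F s" "scaleC (f s) z"]
    by (simp add: cinner_scaleC_right norm_scaleC real_sqrt_unique[symmetric])
  have cm: "(\<lambda>s. cnj (f s)) \<in> borel_measurable borel"
    by (intro borel_measurable_continuous_on[OF _ fm] continuous_intros)
  have m: "(\<lambda>s. norm (F s + scaleC (f s) z)) \<in> borel_measurable borel"
    unfolding nrm using cm by measurable
  have "integrable M (\<lambda>s. (norm (F s + scaleC (f s) z))\<^sup>2)"
  proof (rule Bochner_Integration.integrable_bound)
    show "integrable M (\<lambda>s. 2 * (norm (F s))\<^sup>2 + 2 * ((norm (f s))\<^sup>2 * (norm z)\<^sup>2))"
      using vL2D(3)[OF F] L2_square[OF f] by simp
    show "(\<lambda>s. (norm (F s + scaleC (f s) z))\<^sup>2) \<in> borel_measurable M"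
      using m by (simp add: borel_measurable_M)
    show "AE s in M. norm ((norm (F s + scaleC (f s) z))\<^sup>2) \<le> norm (2 * (norm (F s))\<^sup>2 + 2 * ((norm (f s))\<^sup>2 * (norm z)\<^sup>2))"
    proof (rule AE_I2)
      fix s
      show "norm ((norm (F s + scaleC (f s) z))\<^sup>2) \<le> norm (2 * (norm (F s))\<^sup>2 + 2 * ((norm (f s))\<^sup>2 * (norm z)\<^sup>2))"
        using norm_add_sq_le[of "F s" "scaleC (f s) z"] by (simp add: norm_scaleC power_mult_distrib)
    qed
  qed
  moreover have "(\<lambda>s. cinner (F s + scaleC (f s) z) y) \<in> borel_measurable borel" for y
    by (simp add: cinner_add_left cinner_scaleC_left)
  ultimately show ?thesis using m by (simp add: vL2_def)
qed

lemma vL2_diff_sum: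
  assumes F: "vL2 F" and "finite K" "\<And>k. k \<in> K \<Longrightarrow> L2 M (f k)"
  shows "vL2 (\<lambda>s. F s - (\<Sum>k\<in>K. scaleC (f k s) (z k)))"
  using assms(2,3)
proof (induction K rule: finite_induct)
  case empty
  show ?case using F by simp
next
  case (insert k K)
  then have "vL2 (\<lambda>s. (F s - (\<Sum>k\<in>K. scaleC (f k s) (z k))) + scaleC (f k s) (- z k))"
    by (intro vL2_add_rank_one) auto
  then show ?case using insert by (simp add: scaleC.minus_right algebra_simps)
qed

lemma vL2_cinner_integrable:
  assumes F: "vL2 F" and e: "L2 M e"
  shows "integrable M (\<lambda>s. cinner (F s) z * cnj (e s))"
    and "norm (LINT s|M. cinner (F s) z * cnj (e s)) \<le> (sqrt (vsq F) * sqrt (sqn e)) * norm z"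
proof -
  have i: "integrable M (\<lambda>s. norm (F s) * norm (e s))"
    using F e by (intro integrable_mult_squares vL2D L2_norm_measurable L2_square)
  have b: "norm (cinner (F s) z * cnj (e s)) \<le> (norm (F s) * norm (e s)) * norm z" for s
    using mult_right_mono[OF cinner_cauchy_schwarz[of "F s" z], of "norm (e s)"] by (simp add: norm_mult mult_ac)
  show int: "integrable M (\<lambda>s. cinner (F s) z * cnj (e s))"
  proof (rule Bochner_Integration.integrable_bound[OF integrable_mult_left[OF i, of "norm z"]])
    have "(\<lambda>s. cnj (e s)) \<in> borel_measurable M"
      by (intro borel_measurable_continuous_on[OF _ L2_measurable[OF e]] continuous_intros)
    then show "(\<lambda>s. cinner (F s) z * cnj (e s)) \<in> borel_measurable M"
      using vL2D(1)[OF F] by (intro borel_measurable_times)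
    show "AE s in M. norm (cinner (F s) z * cnj (e s)) \<le> norm (norm (F s) * norm (e s) * norm z)"
      using b by (intro AE_I2) (simp add: abs_of_nonneg)
  qed
  have "norm (LINT s|M. cinner (F s) z * cnj (e s)) \<le> (LINT s|M. norm (F s) * norm (e s) * norm z)"
    by (rule norm_integral_le_integral[OF int integrable_mult_left[OF i] b])
  also have "\<dots> = (LINT s|M. norm (F s) * norm (e s)) * norm z" by simp
  also have "\<dots> \<le> (sqrt (vsq F) * sqrt (sqn e)) * norm z"
    unfolding vsq_def sqn_def
    by (intro mult_right_mono integral_cauchy_schwarz vL2D(3)[OF F] L2_square[OF e] i norm_ge_zero)
  finally show "norm (LINT s|M. cinner (F s) z * cnj (e s)) \<le> (sqrt (vsq F) * sqrt (sqn e)) * norm z" .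
qed

text \<open>The Fourier coefficient of a vector-valued function: the weak integral of
  \<open>scaleC (cnj (e s)) (F s)\<close>.\<close>

definition coeff :: "('g \<Rightarrow> 'h::complex_hilbert) \<Rightarrow> ('g \<Rightarrow> complex) \<Rightarrow> 'h"
  where "coeff F e = (SOME x. \<forall>z. cinner x z = (LINT s|M. cinner (F s) z * cnj (e s)))"

lemma cinner_coeff:
  assumes F: "vL2 F" and e: "L2 M e"
  shows "cinner (coeff F e) z = (LINT s|M. cinner (F s) z * cnj (e s))"
proof -
  note i = vL2_cinner_integrable(1)[OF F e]
  have "\<exists>x. \<forall>z. cinner x z = (LINT s|M. cinner (F s) z * cnj (e s))"
  proof -
    obtain x where x: "\<And>z. cnj (LINT s|M. cinner (F s) z * cnj (e s)) = cinner z x"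
    proof (rule riesz_representation[of "\<lambda>z. cnj (LINT s|M. cinner (F s) z * cnj (e s))" "sqrt (vsq F) * sqrt (sqn e)"])
      show "cnj (LINT s|M. cinner (F s) (x + y) * cnj (e s)) =
        cnj (LINT s|M. cinner (F s) x * cnj (e s)) + cnj (LINT s|M. cinner (F s) y * cnj (e s))" for x y
        using i by (simp add: cinner_add_right distrib_right)
      show "cnj (LINT s|M. cinner (F s) (scaleC c x) * cnj (e s)) = c * cnj (LINT s|M. cinner (F s) x * cnj (e s))" for c x
        by (simp add: cinner_scaleC_right mult.assoc)
      show "norm (cnj (LINT s|M. cinner (F s) x * cnj (e s))) \<le> sqrt (vsq F) * sqrt (sqn e) * norm x" for x
        using vL2_cinner_integrable(2)[OF F e, of x] by (simp only: complex_mod_cnj)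
    qed blast
    have "cinner x z = (LINT s|M. cinner (F s) z * cnj (e s))" for z
      using cinner_commute[of x z] x[of z] by (metis complex_cnj_cnj)
    then show ?thesis by blast
  qed
  from someI_ex[OF this] show ?thesis unfolding coeff_def by (rule spec)
qed

definition resid :: "('g \<Rightarrow> complex) set \<Rightarrow> ('g \<Rightarrow> 'h::complex_hilbert) \<Rightarrow> 'g \<Rightarrow> 'h"
  where "resid J F = (\<lambda>s. F s - (\<Sum>e\<in>J. scaleC (e s) (coeff F e)))"

lemma vL2_resid: "vL2 F \<Longrightarrow> ons E \<Longrightarrow> finite J \<Longrightarrow> J \<subseteq> E \<Longrightarrow> vL2 (resid J F)"
  unfolding resid_def by (rule vL2_diff_sum) (auto dest: onsD)

lemma resid_sq:
  assumes F: "vL2 F" and E: "ons E" and J: "finite J" "J \<subseteq> E"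
  shows "vsq (resid J F) = vsq F - (\<Sum>e\<in>J. (norm (coeff F e))\<^sup>2)"
proof -
  have L: "L2 M e" if "e \<in> J" for e using onsD(1)[OF E] that J(2) by blast
  define x where "x = coeff F"
  \<comment> \<open>The integrands \<open>P\<close> and \<open>Q\<close> are the cross term and the
    square of the partial Fourier sum; both integrate to the same sum of squares.\<close>
  define P where "P s = (\<Sum>e\<in>J. cinner (F s) (x e) * cnj (e s))" for s
  define Q where "Q s = (\<Sum>e\<in>J. \<Sum>f\<in>J. (e s * cnj (f s)) * cinner (x e) (x f))" for s
  have pt: "(norm (resid J F s))\<^sup>2 = (norm (F s))\<^sup>2 - 2 * Re (P s) + Re (Q s)" for s
  proof -
    have "cinner (F s) (\<Sum>e\<in>J. scaleC (e s) (x e)) = P s"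
      by (simp add: P_def cinner.sum_right cinner_scaleC_right mult.commute)
    moreover have "cinner (\<Sum>e\<in>J. scaleC (e s) (x e)) (\<Sum>e\<in>J. scaleC (e s) (x e)) = Q s"
      by (simp add: Q_def cinner.sum_left cinner.sum_right cinner_scaleC_left cinner_scaleC_right
          sum_distrib_left mult_ac) (rule sum.swap)
    then have "(norm (\<Sum>e\<in>J. scaleC (e s) (x e)))\<^sup>2 = Re (Q s)"
      by (metis Re_complex_of_real cinner_self)
    ultimately show ?thesis by (simp add: resid_def norm_diff_sq x_def)
  qed
  have iP: "integrable M P" and vP: "(LINT s|M. P s) = (\<Sum>e\<in>J. complex_of_real ((norm (x e))\<^sup>2))"
  proof -
    have i: "integrable M (\<lambda>s. cinner (F s) (x e) * cnj (e s))" if "e \<in> J" for e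
      by (rule vL2_cinner_integrable(1)[OF F L[OF that]])
    then show "integrable M P" unfolding P_def by (intro Bochner_Integration.integrable_sum)
    have "(LINT s|M. P s) = (\<Sum>e\<in>J. LINT s|M. cinner (F s) (x e) * cnj (e s))"
      unfolding P_def by (rule Bochner_Integration.integral_sum[OF i])
    also have "\<dots> = (\<Sum>e\<in>J. complex_of_real ((norm (x e))\<^sup>2))"
      by (rule sum.cong[OF refl]) (simp only: cinner_coeff[OF F L, symmetric] x_def cinner_self)
    finally show "(LINT s|M. P s) = (\<Sum>e\<in>J. complex_of_real ((norm (x e))\<^sup>2))" .
  qed
  have iQ: "integrable M Q" and vQ: "(LINT s|M. Q s) = (\<Sum>e\<in>J. complex_of_real ((norm (x e))\<^sup>2))"
  proof -
    have i: "integrable M (\<lambda>s. (e s * cnj (f s)) * cinner (x e) (x f))" if "e \<in> J" "f \<in> J" for e f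
      using L2_product_integrable[OF L[OF that(1)] L[OF that(2)]] by simp
    then show "integrable M Q" unfolding Q_def by (intro Bochner_Integration.integrable_sum)
    have "(LINT s|M. Q s) = (\<Sum>e\<in>J. \<Sum>f\<in>J. LINT s|M. (e s * cnj (f s)) * cinner (x e) (x f))"
      unfolding Q_def using i
      by (subst Bochner_Integration.integral_sum, intro Bochner_Integration.integrable_sum, simp)
        (intro sum.cong refl Bochner_Integration.integral_sum, simp)
    also have "\<dots> = (\<Sum>e\<in>J. \<Sum>f\<in>J. if e = f then cinner (x e) (x e) else 0)"
    proof (intro sum.cong refl)
      fix e f assume ef: "e \<in> J" "f \<in> J"
      have "e \<in> E" "f \<in> E" using ef J(2) by auto
      then have "ip e f = (if e = f then 1 else 0)" by (rule onsD(2)[OF E])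
      moreover have "(LINT s|M. (e s * cnj (f s)) * cinner (x e) (x f)) = ip e f * cinner (x e) (x f)"
        unfolding ip_def by simp
      ultimately show "(LINT s|M. (e s * cnj (f s)) * cinner (x e) (x f)) = (if e = f then cinner (x e) (x e) else 0)"
        by (simp only:) simp
    qed
    also have "\<dots> = (\<Sum>e\<in>J. complex_of_real ((norm (x e))\<^sup>2))"
      using J(1) by (simp add: cinner_self del: of_real_power)
    finally show "(LINT s|M. Q s) = (\<Sum>e\<in>J. complex_of_real ((norm (x e))\<^sup>2))" .
  qed
  have "vsq (resid J F) = vsq F - 2 * Re (LINT s|M. P s) + Re (LINT s|M. Q s)"
    unfolding vsq_def pt using vL2D(3)[OF F] iP iQ by (simp flip: integral_Re)
  also have "\<dots> = vsq F - (\<Sum>e\<in>J. (norm (x e))\<^sup>2)"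
    unfolding vP vQ by (simp del: of_real_power)
  finally show ?thesis by (simp add: x_def)
qed

lemma sum_norm_coeff_le:
  assumes "vL2 F" "ons E" "finite J" "J \<subseteq> E"
  shows "(\<Sum>e\<in>J. (norm (coeff F e))\<^sup>2) \<le> vsq F"
  using resid_sq[OF assms] vsq_nonneg[of "resid J F"] by simp

text \<open>The error of a partial Parseval sum is the integral of
  \<open>cinner (resid J F s) (G s)\<close>, so it suffices that the residual of one of the two
  functions is small.\<close>

lemma cross_resid:
  assumes F: "vL2 F" and G: "vL2 G" and FG: "integrable M (\<lambda>s. cinner (F s) (G s))"
    and E: "ons E" and J: "finite J" "J \<subseteq> E"
  shows "norm ((LINT s|M. cinner (F s) (G s)) - (\<Sum>e\<in>J. cinner (coeff F e) (coeff G e)))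
    \<le> sqrt (vsq (resid J F)) * sqrt (vsq G)"
proof -
  have L: "L2 M e" if "e \<in> J" for e using onsD(1)[OF E] that J(2) by blast
  have eq: "e s * cinner x (G s) = cnj (cinner (G s) x * cnj (e s))" for e s and x
    using cinner_commute[of x "G s"] by simp
  have i: "integrable M (\<lambda>s. e s * cinner x (G s))" if "e \<in> J" for e x
    unfolding eq using vL2_cinner_integrable(1)[OF G L[OF that]] by (intro integrable_cnj)
  have v: "(LINT s|M. e s * cinner x (G s)) = cinner x (coeff G e)" if "e \<in> J" for e x
    unfolding eq Bochner_Integration.integral_cnj cinner_coeff[OF G L[OF that], symmetric] by (rule cinner_commute[symmetric])
  have pt: "cinner (resid J F s) (G s) = cinner (F s) (G s) - (\<Sum>e\<in>J. e s * cinner (coeff F e) (G s))" for s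
    by (simp add: resid_def cinner.diff_left cinner.sum_left cinner_scaleC_left)
  have ir: "integrable M (\<lambda>s. cinner (resid J F s) (G s))"
    unfolding pt using FG i by (intro Bochner_Integration.integrable_diff Bochner_Integration.integrable_sum)
  have "(LINT s|M. cinner (resid J F s) (G s)) = (LINT s|M. cinner (F s) (G s)) - (\<Sum>e\<in>J. cinner (coeff F e) (coeff G e))"
    unfolding pt using FG i v
    by (subst Bochner_Integration.integral_diff) (auto simp: Bochner_Integration.integral_sum)
  then have "norm ((LINT s|M. cinner (F s) (G s)) - (\<Sum>e\<in>J. cinner (coeff F e) (coeff G e))) = norm (LINT s|M. cinner (resid J F s) (G s))"
    by simp
  also have "\<dots> \<le> (LINT s|M. norm (resid J F s) * norm (G s))"
    by (rule norm_integral_le_integral[OF ir _ cinner_cauchy_schwarz])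
      (intro integrable_mult_squares vL2D vL2_resid[OF F E J] G)
  also have "\<dots> \<le> sqrt (vsq (resid J F)) * sqrt (vsq G)"
    unfolding vsq_def
    by (intro integral_cauchy_schwarz integrable_mult_squares vL2D vL2_resid[OF F E J] G)
  finally show ?thesis .
qed

text \<open>The residual is linear in the function and does not increase \<open>vsq\<close>. For the
  finite rank part it reduces to the scalar Bessel remainders of the \<open>f k\<close>. The vectors
  \<open>z k\<close> enter the bound only through their norms, which later makes it uniform over the
  unit ball of H.\<close>

lemma resid_finite_rank_bound:
  fixes F :: "'g \<Rightarrow> 'h::complex_hilbert"
  assumes F: "vL2 F" and K: "finite K" "\<And>k. k \<in> K \<Longrightarrow> L2 M (f k)"
    and approx: "vsq (\<lambda>s. F s - (\<Sum>k\<in>K. scaleC (f k s) (z k))) \<le> \<epsilon>"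
    and E: "ons E" and J: "finite J" "J \<subseteq> E"
  shows "vsq (resid J F) \<le> 2 * \<epsilon> + 2 * (card K * (\<Sum>k\<in>K. (sqn (f k) - (\<Sum>e\<in>J. (norm (ip (f k) e))\<^sup>2)) * (norm (z k))\<^sup>2))"
proof -
  have L: "L2 M e" if "e \<in> J" for e using onsD(1)[OF E] that J(2) by blast
  define H where "H s = F s - (\<Sum>k\<in>K. scaleC (f k s) (z k))" for s
  have H: "vL2 H" unfolding H_def by (rule vL2_diff_sum[OF F K])
  define r where "r k s = f k s - fpart J (f k) s" for k s
  have cf: "coeff F e = coeff H e + (\<Sum>k\<in>K. scaleC (ip (f k) e) (z k))" if e: "e \<in> J" for e
  proof (rule cinner_ext)
    fix y
    have "cinner (coeff F e) y = (LINT s|M. cinner (H s) y * cnj (e s) + (\<Sum>k\<in>K. (f k s * cnj (e s)) * cinner (z k) y))"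
      unfolding cinner_coeff[OF F L[OF e]]
      by (rule Bochner_Integration.integral_cong[OF refl])
        (simp add: H_def cinner.diff_left cinner.sum_left cinner_scaleC_left algebra_simps sum_distrib_left)
    also have "\<dots> = (LINT s|M. cinner (H s) y * cnj (e s)) + (\<Sum>k\<in>K. ip (f k) e * cinner (z k) y)"
      using vL2_cinner_integrable(1)[OF H L[OF e]] L2_product_integrable[OF K(2) L[OF e]]
      by (subst Bochner_Integration.integral_add) (auto simp: ip_def)
    finally show "cinner (coeff F e) y = cinner (coeff H e + (\<Sum>k\<in>K. scaleC (ip (f k) e) (z k))) y"
      by (simp add: cinner_coeff[OF H L[OF e]] cinner_add_left cinner.sum_left cinner_scaleC_left)
  qed
  have res: "resid J F s = resid J H s + (\<Sum>k\<in>K. scaleC (r k s) (z k))" for s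
  proof -
    have "(\<Sum>e\<in>J. scaleC (e s) (\<Sum>k\<in>K. scaleC (ip (f k) e) (z k))) = (\<Sum>k\<in>K. scaleC (fpart J (f k) s) (z k))"
      by (simp add: fpart_def scaleC.sum_left scaleC.sum_right scaleC_scaleC mult.commute) (rule sum.swap)
    then have "(\<Sum>e\<in>J. scaleC (e s) (coeff F e)) = (\<Sum>e\<in>J. scaleC (e s) (coeff H e)) + (\<Sum>k\<in>K. scaleC (fpart J (f k) s) (z k))"
      using cf by (simp add: scaleC_add_right sum.distrib cong: sum.cong)
    then show ?thesis
      by (simp add: resid_def H_def r_def scaleC.diff_left sum_subtractf)
  qed
  have rL: "L2 M (r k)" if "k \<in> K" for k
    unfolding r_def using K(2)[OF that] by (intro L2_diff L2_fpart[OF E J]) auto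
  have pt: "(norm (resid J F s))\<^sup>2 \<le> 2 * (norm (resid J H s))\<^sup>2 + 2 * (card K * (\<Sum>k\<in>K. (norm (r k s))\<^sup>2 * (norm (z k))\<^sup>2))" for s
  proof -
    have "(norm (\<Sum>k\<in>K. scaleC (r k s) (z k)))\<^sup>2 \<le> (\<Sum>k\<in>K. norm (scaleC (r k s) (z k)))\<^sup>2"
      by (intro power_mono norm_sum) simp
    also have "\<dots> \<le> (\<Sum>k\<in>K. (norm (scaleC (r k s) (z k)))\<^sup>2) * card K"
      by (rule sum_squared_le_sum_of_squares)
    also have "\<dots> = card K * (\<Sum>k\<in>K. (norm (r k s))\<^sup>2 * (norm (z k))\<^sup>2)"
      by (simp add: norm_scaleC power_mult_distrib mult.commute)
    finally show ?thesis
      using norm_add_sq_le[of "resid J H s" "\<Sum>k\<in>K. scaleC (r k s) (z k)"] unfolding res by linarith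
  qed
  have i1: "integrable M (\<lambda>s. (norm (resid J H s))\<^sup>2)" by (rule vL2D(3)[OF vL2_resid[OF H E J]])
  have i2: "integrable M (\<lambda>s. \<Sum>k\<in>K. (norm (r k s))\<^sup>2 * (norm (z k))\<^sup>2)"
    using L2_square[OF rL] by (intro Bochner_Integration.integrable_sum) simp
  have "vsq (resid J F) \<le> (LINT s|M. 2 * (norm (resid J H s))\<^sup>2 + 2 * (card K * (\<Sum>k\<in>K. (norm (r k s))\<^sup>2 * (norm (z k))\<^sup>2)))"
    unfolding vsq_def using i1 i2 by (intro integral_mono vL2D(3)[OF vL2_resid[OF F E J]] pt) auto
  also have "\<dots> = 2 * vsq (resid J H) + 2 * (card K * (\<Sum>k\<in>K. sqn (r k) * (norm (z k))\<^sup>2))"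
    using i1 i2 L2_square[OF rL] by (simp add: vsq_def sqn_def)
  also have "(\<Sum>k\<in>K. sqn (r k) * (norm (z k))\<^sup>2) = (\<Sum>k\<in>K. (sqn (f k) - (\<Sum>e\<in>J. (norm (ip (f k) e))\<^sup>2)) * (norm (z k))\<^sup>2)"
    unfolding r_def using bessel[OF E J K(2)] by (intro sum.cong) auto
  also have "vsq (resid J H) \<le> \<epsilon>"
  proof -
    have "vsq H \<le> \<epsilon>" using approx by (simp add: H_def[abs_def])
    then show ?thesis
      using resid_sq[OF H E J] sum_nonneg[of J "\<lambda>e. (norm (coeff H e))\<^sup>2"] by simp
  qed
  finally show ?thesis by simp
qed

lemma tendsto_residual_sum:
  assumes onb: "\<And>f. L2 M f \<Longrightarrow> ((\<lambda>e. (norm (ip f e))\<^sup>2) has_sum sqn f) E" and K: "\<And>k. k \<in> K \<Longrightarrow> L2 M (f k)"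
  shows "((\<lambda>J. 2 * (card K * (\<Sum>k\<in>K. (sqn (f k) - (\<Sum>e\<in>J. (norm (ip (f k) e))\<^sup>2)) * c k))) \<longlongrightarrow> 0) (finite_subsets_at_top E)"
proof -
  have "((\<lambda>J. \<Sum>e\<in>J. (norm (ip (f k) e))\<^sup>2) \<longlongrightarrow> sqn (f k)) (finite_subsets_at_top E)" if "k \<in> K" for k
    using onb[OF K[OF that]] by (simp add: has_sum_def)
  then have "((\<lambda>J. 2 * (card K * (\<Sum>k\<in>K. (sqn (f k) - (\<Sum>e\<in>J. (norm (ip (f k) e))\<^sup>2)) * c k))) \<longlongrightarrow>
      2 * (card K * (\<Sum>k\<in>K. (sqn (f k) - sqn (f k)) * c k))) (finite_subsets_at_top E)"
    by (intro tendsto_mult tendsto_const tendsto_sum tendsto_diff)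
  then show ?thesis by simp
qed

lemma vsq_resid_tendsto_zero:
  fixes F :: "'g \<Rightarrow> 'h::complex_hilbert"
  assumes F: "vL2 F" and E: "ons E" and onb: "\<And>f. L2 M f \<Longrightarrow> ((\<lambda>e. (norm (ip f e))\<^sup>2) has_sum sqn f) E"
    and approx: "\<And>\<epsilon>. 0 < \<epsilon> \<Longrightarrow> \<exists>(K :: 'h set) f. finite K \<and> (\<forall>k\<in>K. L2 M (f k)) \<and>
      vsq (\<lambda>s. F s - (\<Sum>k\<in>K. scaleC (f k s) k)) \<le> \<epsilon>"
  shows "((\<lambda>J. vsq (resid J F)) \<longlongrightarrow> 0) (finite_subsets_at_top E)"
proof (rule tendstoI)
  fix e :: real assume e: "0 < e"
  then have "0 < e / 4" by simp
  then obtain K :: "'h set" and f where K: "finite K" "\<forall>k\<in>K. L2 M (f k)" "vsq (\<lambda>s. F s - (\<Sum>k\<in>K. scaleC (f k s) k)) \<le> e / 4"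
    using approx[OF \<open>0 < e / 4\<close>] by (elim exE conjE)
  have "((\<lambda>J. 2 * (card K * (\<Sum>k\<in>K. (sqn (f k) - (\<Sum>e\<in>J. (norm (ip (f k) e))\<^sup>2)) * (norm k)\<^sup>2))) \<longlongrightarrow> 0) (finite_subsets_at_top E)"
    by (rule tendsto_residual_sum[OF onb]) (use K in auto)
  then have "\<forall>\<^sub>F J in finite_subsets_at_top E. 2 * (card K * (\<Sum>k\<in>K. (sqn (f k) - (\<Sum>e\<in>J. (norm (ip (f k) e))\<^sup>2)) * (norm k)\<^sup>2)) < e / 2"
    using e by (intro order_tendstoD(2)) auto
  moreover have "\<forall>\<^sub>F J in finite_subsets_at_top E. finite J \<and> J \<subseteq> E"
    by (rule eventually_finite_subsets_at_top_weakI) simp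
  ultimately show "\<forall>\<^sub>F J in finite_subsets_at_top E. dist (vsq (resid J F)) 0 < e"
  proof eventually_elim
    case (elim J)
    have "vsq (resid J F) \<le> 2 * (e / 4) + 2 * (card K * (\<Sum>k\<in>K. (sqn (f k) - (\<Sum>e\<in>J. (norm (ip (f k) e))\<^sup>2)) * (norm k)\<^sup>2))"
      by (rule resid_finite_rank_bound[OF F K(1) _ K(3) E]) (use K(2) elim in auto)
    also have "\<dots> < 2 * (e / 4) + e / 2" using elim by (intro add_strict_left_mono) auto
    also have "\<dots> = e" by simp
    finally show ?case using vsq_nonneg[of "resid J F"] by simp
  qed
qed

lemma vL2_scaled_continuous:
  fixes C :: "'g \<Rightarrow> 'h::complex_hilbert"
  assumes c: "bounded_borel c" and C: "continuous_on UNIV C" and D: "\<And>s. norm (C s) \<le> D"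
  shows "vL2 (\<lambda>s. scaleC (c s) (C s))"
proof -
  have cm[measurable]: "c \<in> borel_measurable borel" using c by (rule bounded_borelD)
  obtain B where B: "0 \<le> B" "\<And>x. norm (c x) \<le> B" using c by (rule bounded_borelE) blast
  have D0: "0 \<le> D" using D norm_ge_zero order_trans by blast
  have "(\<lambda>s. cinner (C s) z) \<in> borel_measurable borel" for z
    by (intro borel_measurable_continuous_onI cinner.continuous_on C continuous_on_const)
  then have 1: "(\<lambda>s. cinner (scaleC (c s) (C s)) z) \<in> borel_measurable borel" for z
    by (simp add: cinner_scaleC_left)
  have nC[measurable]: "(\<lambda>s. norm (C s)) \<in> borel_measurable borel"
    by (intro borel_measurable_continuous_onI continuous_on_norm C)
  have 2: "(\<lambda>s. norm (scaleC (c s) (C s))) \<in> borel_measurable borel"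
    unfolding norm_scaleC by measurable
  have 3: "norm (scaleC (c s) (C s)) \<le> B * D" for s
    unfolding norm_scaleC using B D by (intro mult_mono) auto
  have "integrable M (\<lambda>s. (norm (scaleC (c s) (C s)))\<^sup>2)"
  proof (rule integrable_const_bound)
    show "AE s in M. norm ((norm (scaleC (c s) (C s)))\<^sup>2) \<le> (B * D)\<^sup>2"
      using power_mono[OF 3, of _ 2] by (intro AE_I2) simp
  qed (use 2 in \<open>simp add: borel_measurable_M\<close>)
  then show ?thesis using 1 2 by (simp add: vL2_def)
qed

text \<open>Tightness does the work of separability: off a set of small measure the continuous
  function takes values in a compact set, which lies close to a finite-dimensional subspace. The
  functions \<open>f k\<close> are the coordinates of the projection to that subspace.\<close>

lemma tight_finite_rank_approx:
  fixes C :: "'g \<Rightarrow> 'h::complex_hilbert"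
  assumes c: "bounded_borel c" and C: "continuous_on UNIV C" and D: "\<And>s. norm (C s) \<le> D"
    and tight: "\<And>e. 0 < e \<Longrightarrow> \<exists>K. compact K \<and> K \<in> sets borel \<and> measure M (- K) < e" and "0 < \<epsilon>"
  shows "\<exists>(K :: 'h set) f. finite K \<and> (\<forall>k\<in>K. L2 M (f k)) \<and>
      vsq (\<lambda>s. scaleC (c s) (C s) - (\<Sum>k\<in>K. scaleC (f k s) k)) \<le> \<epsilon>"
proof -
  have cm: "c \<in> borel_measurable borel" using c by (rule bounded_borelD)
  obtain B where B: "0 \<le> B" "\<And>x. norm (c x) \<le> B" using c by (rule bounded_borelE) blast
  have D0: "0 \<le> D" using D norm_ge_zero order_trans by blast
  define m where "m = measure M UNIV"
  \<comment> \<open>The first summand collects the error on \<open>K\<close>, the second the error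
    on its complement; the third makes \<open>N\<close> positive.\<close>
  define N where "N = B\<^sup>2 * m + B\<^sup>2 * D\<^sup>2 + 1"
  have N: "0 < N" by (simp add: N_def m_def add_nonneg_pos)
  define d where "d = \<epsilon> / N"
  have d: "0 < d" using N \<open>0 < \<epsilon>\<close> by (simp add: d_def)
  obtain K where K: "compact K" "K \<in> sets borel" "measure M (- K) < d" using tight[OF d] by (elim exE conjE)
  have sd: "0 < sqrt d" using d by simp
  have "compact (C ` K)" by (rule compact_continuous_image[OF continuous_on_subset[OF C] K(1)]) simp
  then obtain S where S: "finite S" "C ` K \<subseteq> (\<Union>x\<in>S. ball x (sqrt d))"
    unfolding compact_eq_totally_bounded using sd by blast
  obtain P where P: "finite P" "orthonormal P" "\<forall>x\<in>S. proj P x = x"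
    using ex_orthonormal_span[OF S(1)] by (elim exE conjE)
  define f where "f k s = c s * cinner (C s) k" for k s
  have f: "L2 M (f k)" for k
  proof (rule L2_bounded, rule bounded_borelI)
    have "(\<lambda>s. cinner (C s) k) \<in> borel_measurable borel"
      by (intro borel_measurable_continuous_onI cinner.continuous_on C continuous_on_const)
    then show "f k \<in> borel_measurable borel" unfolding f_def using cm by (intro borel_measurable_times)
    fix s
    have "norm (cinner (C s) k) \<le> D * norm k"
      using cinner_cauchy_schwarz[of "C s" k] mult_right_mono[OF D[of s], of "norm k"] by simp
    then show "norm (f k s) \<le> B * (D * norm k)"
      unfolding f_def norm_mult using B by (intro mult_mono) auto
  qed
  have eq: "scaleC (c s) (C s) - (\<Sum>k\<in>P. scaleC (f k s) k) = scaleC (c s) (C s - proj P (C s))" for s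
    by (simp add: f_def proj_def scaleC.diff_right scaleC.sum_right scaleC_scaleC)
  have pt: "(norm (scaleC (c s) (C s - proj P (C s))))\<^sup>2 \<le> B\<^sup>2 * d + B\<^sup>2 * D\<^sup>2 * indicator (- K) s" for s
  proof -
    have "(norm (C s - proj P (C s)))\<^sup>2 \<le> d + D\<^sup>2 * indicator (- K) s"
    proof (cases "s \<in> K")
      case True
      then obtain x where x: "x \<in> S" "dist x (C s) < sqrt d" using S(2) by auto
      have e: "C s - proj P (C s) = (C s - x) - proj P (C s - x)"
        using P(3) x(1) by (simp add: proj_diff)
      have "norm (C s - proj P (C s)) \<le> norm (C s - x)"
        unfolding e by (rule norm_diff_proj_le[OF P(1,2)])
      also have "\<dots> \<le> sqrt d" using x(2) by (simp add: dist_norm norm_minus_commute)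
      finally have "(norm (C s - proj P (C s)))\<^sup>2 \<le> (sqrt d)\<^sup>2" by (intro power_mono) auto
      then show ?thesis using d True by simp
    next
      case False
      have "norm (C s - proj P (C s)) \<le> D"
        using norm_diff_proj_le[OF P(1,2), of "C s"] D[of s] by linarith
      then have "(norm (C s - proj P (C s)))\<^sup>2 \<le> D\<^sup>2" by (intro power_mono) auto
      then show ?thesis using d False by simp
    qed
    moreover have "(norm (c s))\<^sup>2 \<le> B\<^sup>2" using B by (intro power_mono) auto
    ultimately have "(norm (c s))\<^sup>2 * (norm (C s - proj P (C s)))\<^sup>2 \<le> B\<^sup>2 * (d + D\<^sup>2 * indicator (- K) s)"
      by (intro mult_mono) auto
    then show ?thesis by (simp add: norm_scaleC power_mult_distrib algebra_simps)
  qed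
  have ind: "integrable M (indicator (- K) :: _ \<Rightarrow> real)"
    using borel_comp[OF K(2)] by (intro integrable_real_indicator) (auto simp: emeasure_eq_measure)
  have v: "vL2 (\<lambda>s. scaleC (c s) (C s) - (\<Sum>k\<in>P. scaleC (f k s) k))"
    by (rule vL2_diff_sum[OF vL2_scaled_continuous[OF c C D] P(1) f])
  have "vsq (\<lambda>s. scaleC (c s) (C s) - (\<Sum>k\<in>P. scaleC (f k s) k)) \<le> (LINT s|M. B\<^sup>2 * d + B\<^sup>2 * D\<^sup>2 * indicator (- K) s)"
    unfolding vsq_def
    by (rule integral_mono[OF vL2D(3)[OF v]]) (use ind pt in \<open>auto simp: eq\<close>)
  also have "\<dots> = B\<^sup>2 * d * m + B\<^sup>2 * D\<^sup>2 * measure M (- K)"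
    using ind borel_comp[OF K(2)] by (simp add: m_def)
  also have "\<dots> \<le> B\<^sup>2 * d * m + B\<^sup>2 * D\<^sup>2 * d"
    using K(3) by (intro add_left_mono mult_left_mono) auto
  also have "\<dots> \<le> N * d" using d by (simp add: N_def algebra_simps)
  also have "\<dots> = \<epsilon>" using N by (simp add: d_def)
  finally show ?thesis using P(1) f by (intro exI[of _ P] exI[of _ f]) simp
qed

text \<open>Only the first function is approximated; the second enters through its norm, by
  \<open>cross_resid\<close>.\<close>

lemma parseval:
  fixes C C' :: "'g \<Rightarrow> 'h::complex_hilbert"
  assumes c: "bounded_borel c" and C: "continuous_on UNIV C" "\<And>s. norm (C s) \<le> D"
    and c': "bounded_borel c'" and C': "continuous_on UNIV C'" "\<And>s. norm (C' s) \<le> D'"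
    and tight: "\<And>e. 0 < e \<Longrightarrow> \<exists>K. compact K \<and> K \<in> sets borel \<and> measure M (- K) < e"
    and E: "ons E" and onb: "\<And>f. L2 M f \<Longrightarrow> ((\<lambda>e. (norm (ip f e))\<^sup>2) has_sum sqn f) E"
  shows "((\<lambda>e. cinner (coeff (\<lambda>s. scaleC (c s) (C s)) e) (coeff (\<lambda>s. scaleC (c' s) (C' s)) e))
    has_sum (LINT s|M. c s * cnj (c' s) * cinner (C s) (C' s))) E"
proof -
  define F where "F s = scaleC (c s) (C s)" for s
  define G where "G s = scaleC (c' s) (C' s)" for s
  have F: "vL2 F" unfolding F_def by (rule vL2_scaled_continuous[OF c C])
  have G: "vL2 G" unfolding G_def by (rule vL2_scaled_continuous[OF c' C'])
  have FG: "cinner (F s) (G s) = c s * cnj (c' s) * cinner (C s) (C' s)" for s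
    by (simp add: F_def G_def cinner_scaleC_left cinner_scaleC_right)
  have "bounded_borel (\<lambda>s. c s * cnj (c' s) * cinner (C s) (C' s))"
  proof (intro bounded_borel_mult c)
    obtain B where B: "0 \<le> B" "\<And>x. norm (c' x) \<le> B" using c' by (rule bounded_borelE) blast
    show "bounded_borel (\<lambda>s. cnj (c' s))"
      by (rule bounded_borelI[where C = B], intro borel_measurable_continuous_on[OF _ bounded_borelD[OF c']] continuous_intros)
        (use B in simp)
    have "norm (cinner (C s) (C' s)) \<le> D * D'" for s
      using cinner_cauchy_schwarz[of "C s" "C' s"] mult_mono[OF C(2)[of s] C'(2)[of s]]
        order_trans[OF norm_ge_zero C(2)[of s]] by fastforce
    then show "bounded_borel (\<lambda>s. cinner (C s) (C' s))"
      by (intro bounded_borelI borel_measurable_continuous_onI cinner.continuous_on C C')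
  qed
  then have iFG: "integrable M (\<lambda>s. cinner (F s) (G s))"
    unfolding FG by (rule L2_integrable[OF fin sets_M L2_bounded])
  have lim: "((\<lambda>J. vsq (resid J F)) \<longlongrightarrow> 0) (finite_subsets_at_top E)"
    by (rule vsq_resid_tendsto_zero[OF F E onb], assumption, unfold F_def)
      (rule tight_finite_rank_approx[OF c C tight])
  have "((\<lambda>J. (\<Sum>e\<in>J. cinner (coeff F e) (coeff G e)) - (LINT s|M. cinner (F s) (G s))) \<longlongrightarrow> 0) (finite_subsets_at_top E)"
  proof (rule Lim_null_comparison)
    show "((\<lambda>J. sqrt (vsq (resid J F)) * sqrt (vsq G)) \<longlongrightarrow> 0) (finite_subsets_at_top E)"
      using tendsto_mult_right[OF tendsto_real_sqrt[OF lim], of "sqrt (vsq G)"] by simp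
    show "\<forall>\<^sub>F J in finite_subsets_at_top E. norm ((\<Sum>e\<in>J. cinner (coeff F e) (coeff G e)) - (LINT s|M. cinner (F s) (G s)))
        \<le> sqrt (vsq (resid J F)) * sqrt (vsq G)"
      by (rule eventually_finite_subsets_at_top_weakI)
        (use cross_resid[OF F G iFG E] in \<open>simp add: norm_minus_commute\<close>)
  qed
  then have "((\<lambda>e. cinner (coeff F e) (coeff G e)) has_sum (LINT s|M. cinner (F s) (G s))) E"
    unfolding has_sum_def by (simp add: LIM_zero_iff)
  then show ?thesis unfolding FG by (simp add: F_def[abs_def] G_def[abs_def])
qed

end

section \<open>Coefficient operators of a representation\<close>

locale strongly_continuous_rep =
  fixes \<pi> :: "'g::{topological_group_add, t2_space} \<Rightarrow> 'h::complex_hilbert bop"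
  assumes rep: "unitary_rep \<pi>" and strongly_cont: "strongly_continuous \<pi>"
begin

lemma pi_add: "\<pi> (s + t) = \<pi> s * \<pi> t"
  using rep by (simp add: unitary_rep_def)

lemma unitary_pi: "adj (\<pi> s) * \<pi> s = 1" "\<pi> s * adj (\<pi> s) = 1"
  using rep by (auto simp: unitary_rep_def unitaries_def)

lemma pi_zero [simp]: "\<pi> 0 = 1"
proof -
  have "adj (\<pi> 0) * \<pi> 0 = (adj (\<pi> 0) * \<pi> 0) * \<pi> 0"
    using pi_add[of 0 0] by (simp add: mult.assoc)
  then show ?thesis by (simp add: unitary_pi)
qed

lemma adj_pi: "adj (\<pi> s) = \<pi> (- s)"
proof -
  have "adj (\<pi> s) = adj (\<pi> s) * (\<pi> s * \<pi> (- s))" by (simp flip: pi_add)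
  also have "\<dots> = (adj (\<pi> s) * \<pi> s) * \<pi> (- s)" by (simp only: mult.assoc)
  finally show ?thesis by (simp add: unitary_pi)
qed

lemma cinner_pi: "cinner (app (\<pi> s) x) y = cinner x (app (\<pi> (- s)) y)"
  by (metis adj_pi cinner_adj_right)

lemma cinner_pi_pi [simp]: "cinner (app (\<pi> s) x) (app (\<pi> s) y) = cinner x y"
  by (simp add: cinner_pi flip: app_times pi_add)

lemma norm_pi [simp]: "norm (app (\<pi> s) x) = norm x"
proof -
  have "complex_of_real ((norm (app (\<pi> s) x))\<^sup>2) = complex_of_real ((norm x)\<^sup>2)"
    by (simp only: cinner_pi_pi flip: cinner_self)
  then show ?thesis by (simp add: of_real_eq_iff del: of_real_power)
qed

lemma norm_pi_le: "norm (\<pi> s) \<le> 1"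
  by (rule norm_bop_leI) simp_all

lemma continuous_pi: "continuous_on UNIV (\<lambda>s. app (\<pi> s) x)"
  using strongly_cont by (simp add: strongly_continuous_def)

lemma continuous_pi_minus: "continuous_on UNIV (\<lambda>s. app (\<pi> (- s)) x)"
  by (rule continuous_on_compose2[OF continuous_pi]) (auto intro: continuous_intros)

lemma continuous_app_pi_minus: "continuous_on UNIV (\<lambda>s. app z (app (\<pi> (- s)) x))"
  by (intro app.continuous_on continuous_on_const continuous_pi_minus)

lemma bounded_borel_pi: "bounded_borel (\<lambda>s. cinner (app (\<pi> s) x) y)"
proof (rule bounded_borelI)
  show "(\<lambda>s. cinner (app (\<pi> s) x) y) \<in> borel_measurable borel"
    by (intro borel_measurable_continuous_onI cinner.continuous_on continuous_pi continuous_on_const)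
  show "norm (cinner (app (\<pi> s) x) y) \<le> norm x * norm y" for s
    using cinner_cauchy_schwarz[of "app (\<pi> s) x" y] by simp
qed

lemma norm_conj_pi: "norm (cinner (app z (app (\<pi> s) x)) (app (\<pi> s) y)) \<le> norm z * norm x * norm y"
  using norm_cinner_app_le[of z "app (\<pi> s) x" "app (\<pi> s) y"] by (simp add: mult.assoc)

lemma bounded_borel_conj_pi: "bounded_borel (\<lambda>s. cinner (app z (app (\<pi> (- s)) x)) (app (\<pi> (- s)) y))"
  by (rule bounded_borelI[OF _ norm_conj_pi])
    (intro borel_measurable_continuous_onI cinner.continuous_on continuous_app_pi_minus continuous_pi_minus)

end

text \<open>\<open>M\<close> becomes the total variation of a tight measure and \<open>E\<close> a
  maximal orthonormal system of its square integrable functions.\<close>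

locale rep_l2_basis = strongly_continuous_rep \<pi> + l2_space M
  for \<pi> :: "'g::{topological_group_add, t2_space} \<Rightarrow> 'h::complex_hilbert bop" and M :: "'g measure" +
  fixes E :: "('g \<Rightarrow> complex) set"
  assumes tight: "\<And>e. 0 < e \<Longrightarrow> \<exists>K. compact K \<and> K \<in> sets borel \<and> measure M (- K) < e"
    and ons_E: "ons E" and onb: "\<And>f. L2 M f \<Longrightarrow> ((\<lambda>e. (norm (ip f e))\<^sup>2) has_sum sqn f) E"
begin

text \<open>In additive notation \<open>\<pi> (- s)\<close> is the adjoint of
  \<open>\<pi> s\<close>; the weight \<open>c\<close> will be 1 or the conjugate of the polar
  density.\<close>

definition orbit :: "('g \<Rightarrow> complex) \<Rightarrow> 'h \<Rightarrow> 'g \<Rightarrow> 'h"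
  where "orbit c \<xi> = (\<lambda>s. scaleC (c s) (app (\<pi> (- s)) \<xi>))"

text \<open>The weak integral of the operators \<open>\<pi> (- s)\<close> with weight
  \<open>c s * cnj (e s)\<close>. For \<open>c = 1\<close> this is the factor \<open>w e\<close> of
  the series; for the conjugate of \<open>h\<close> it is the adjoint of \<open>v e\<close>.\<close>

definition coeff_op :: "('g \<Rightarrow> complex) \<Rightarrow> ('g \<Rightarrow> complex) \<Rightarrow> 'h bop"
  where "coeff_op c e = (SOME T. app T = (\<lambda>\<xi>. coeff (orbit c \<xi>) e))"

lemma vL2_orbit: "bounded_borel c \<Longrightarrow> vL2 (orbit c \<xi>)"
  unfolding orbit_def by (rule vL2_scaled_continuous[where D = "norm \<xi>"]) (auto intro: continuous_pi_minus)

lemma vsq_orbit: "vsq (orbit c \<xi>) = sqn c * (norm \<xi>)\<^sup>2"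
  by (simp add: vsq_def orbit_def sqn_def norm_scaleC power_mult_distrib)

lemma L2_E: "e \<in> E \<Longrightarrow> L2 M e"
  by (rule onsD(1)[OF ons_E])

lemma app_coeff_op:
  assumes c: "bounded_borel c" and e: "e \<in> E"
  shows "app (coeff_op c e) \<xi> = coeff (orbit c \<xi>) e"
proof -
  note L = L2_E[OF e] and v = vL2_orbit[OF c]
  have "\<exists>T. app T = (\<lambda>\<xi>. coeff (orbit c \<xi>) e)"
  proof (rule ex_bop)
    show "coeff (orbit c (x + y)) e = coeff (orbit c x) e + coeff (orbit c y) e" for x y
    proof (rule cinner_ext)
      fix z
      have "cinner (coeff (orbit c (x + y)) e) z
          = (LINT s|M. cinner (orbit c x s) z * cnj (e s) + cinner (orbit c y s) z * cnj (e s))"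
        unfolding cinner_coeff[OF v L]
        by (simp add: orbit_def app.add_right scaleC_add_right cinner_add_left distrib_right)
      also have "\<dots> = cinner (coeff (orbit c x) e + coeff (orbit c y) e) z"
        unfolding cinner_add_left cinner_coeff[OF v L]
        by (intro Bochner_Integration.integral_add vL2_cinner_integrable(1) v L)
      finally show "cinner (coeff (orbit c (x + y)) e) z = cinner (coeff (orbit c x) e + coeff (orbit c y) e) z" .
    qed
    show "coeff (orbit c (scaleC a x)) e = scaleC a (coeff (orbit c x) e)" for a x
    proof (rule cinner_ext)
      fix z
      have "cinner (coeff (orbit c (scaleC a x)) e) z = (LINT s|M. a * (cinner (orbit c x s) z * cnj (e s)))"
        unfolding cinner_coeff[OF v L]
        by (simp add: orbit_def cinner_scaleC_left mult_ac)
      then show "cinner (coeff (orbit c (scaleC a x)) e) z = cinner (scaleC a (coeff (orbit c x) e)) z"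
        unfolding cinner_scaleC_left cinner_coeff[OF v L] by simp
    qed
    \<comment> \<open>Bessel's inequality for the single function \<open>e\<close>.\<close>
    have "(norm (coeff (orbit c x) e))\<^sup>2 \<le> (sqrt (sqn c) * norm x)\<^sup>2" for x
      using sum_norm_coeff_le[OF v ons_E, of "{e}" x] e
      by (simp add: vsq_orbit power_mult_distrib sqn_nonneg)
    then show "norm (coeff (orbit c x) e) \<le> sqrt (sqn c) * norm x" for x
      by (rule power2_le_imp_le) (simp add: sqn_nonneg)
  qed
  then have "app (coeff_op c e) = (\<lambda>\<xi>. coeff (orbit c \<xi>) e)"
    unfolding coeff_op_def by (rule someI_ex)
  then show ?thesis by simp
qed

lemma cinner_coeff_op:
  assumes c: "bounded_borel c" and e: "e \<in> E"
  shows "cinner (app (coeff_op c e) \<xi>) z = (LINT s|M. cinner (app (\<pi> (- s)) \<xi>) z * (c s * cnj (e s)))"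
  unfolding app_coeff_op[OF assms] cinner_coeff[OF vL2_orbit[OF c] L2_E[OF e]]
  by (simp add: orbit_def cinner_scaleC_left mult_ac)

lemma sq_bounded_coeff_op:
  assumes c: "bounded_borel c"
  shows "sq_bounded (coeff_op c) E (sqn c)"
  unfolding sq_bounded_def
proof (intro allI impI)
  fix F \<xi> assume F: "finite F" "F \<subseteq> E"
  have "(\<Sum>e\<in>F. (norm (app (coeff_op c e) \<xi>))\<^sup>2) = (\<Sum>e\<in>F. (norm (coeff (orbit c \<xi>) e))\<^sup>2)"
    using F by (intro sum.cong) (auto simp: app_coeff_op[OF c])
  also have "\<dots> \<le> sqn c * (norm \<xi>)\<^sup>2"
    using sum_norm_coeff_le[OF vL2_orbit[OF c] ons_E F] by (simp add: vsq_orbit)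
  finally show "(\<Sum>e\<in>F. (norm (app (coeff_op c e) \<xi>))\<^sup>2) \<le> sqn c * (norm \<xi>)\<^sup>2" .
qed

text \<open>Applying \<open>z\<close> commutes with taking coefficients, so Parseval's identity is
  used for the continuous functions \<open>app z (app (\<pi> (- s)) \<xi>)\<close> and
  \<open>app (\<pi> (- s)) \<eta>\<close>.\<close>

lemma parseval_coeff_op:
  assumes c: "bounded_borel c" and c': "bounded_borel c'"
  shows "((\<lambda>e. cinner (app z (app (coeff_op c e) \<xi>)) (app (coeff_op c' e) \<eta>)) has_sum
    (LINT s|M. c s * cnj (c' s) * cinner (app z (app (\<pi> (- s)) \<xi>)) (app (\<pi> (- s)) \<eta>))) E"
proof -
  have b: "norm (app z (app (\<pi> (- s)) \<xi>)) \<le> norm z * norm \<xi>" for s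
    using norm_app[of z "app (\<pi> (- s)) \<xi>"] by simp
  note z = vL2_scaled_continuous[OF c continuous_app_pi_minus[of z \<xi>] b]
  have "app z (app (coeff_op c e) \<xi>) = coeff (\<lambda>s. scaleC (c s) (app z (app (\<pi> (- s)) \<xi>))) e" if e: "e \<in> E" for e
  proof (rule cinner_ext)
    fix y
    have "cinner (app z (app (coeff_op c e) \<xi>)) y = cinner (app (coeff_op c e) \<xi>) (app (adj z) y)"
      by (simp add: cinner_adj_right)
    also have "\<dots> = cinner (coeff (\<lambda>s. scaleC (c s) (app z (app (\<pi> (- s)) \<xi>))) e) y"
      unfolding cinner_coeff_op[OF c e] cinner_coeff[OF z L2_E[OF e]]
      by (simp add: cinner_adj_right cinner_scaleC_left mult_ac)
    finally show "cinner (app z (app (coeff_op c e) \<xi>)) y = \<dots>" .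
  qed
  then have "((\<lambda>e. cinner (app z (app (coeff_op c e) \<xi>)) (app (coeff_op c' e) \<eta>)) has_sum
      (LINT s|M. c s * cnj (c' s) * cinner (app z (app (\<pi> (- s)) \<xi>)) (app (\<pi> (- s)) \<eta>))) E \<longleftrightarrow>
    ((\<lambda>e. cinner (coeff (\<lambda>s. scaleC (c s) (app z (app (\<pi> (- s)) \<xi>))) e) (coeff (\<lambda>s. scaleC (c' s) (app (\<pi> (- s)) \<eta>)) e)) has_sum
      (LINT s|M. c s * cnj (c' s) * cinner (app z (app (\<pi> (- s)) \<xi>)) (app (\<pi> (- s)) \<eta>))) E"
    by (intro has_sum_cong) (simp add: app_coeff_op[OF c'] orbit_def)
  moreover have "norm (app (\<pi> (- s)) \<eta>) \<le> norm \<eta>" for s by simp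
  ultimately show ?thesis
    using parseval[OF c continuous_app_pi_minus b c' continuous_pi_minus _ tight ons_E onb] by blast
qed

text \<open>For \<open>z = 1\<close> unitarity removes \<open>\<pi>\<close> from the integrand,
  which leaves a scalar multiple of \<open>cinner \<xi> \<eta>\<close>.\<close>

lemma coeff_op_square_sum:
  assumes c: "bounded_borel c"
  shows "((\<lambda>e. cinner (app (coeff_op c e) \<xi>) (app (coeff_op c e) \<eta>)) has_sum
    cinner (app (scaleC_bop (sqn c) 1) \<xi>) \<eta>) E"
proof -
  have "(LINT s|M. c s * cnj (c s)) = complex_of_real (sqn c)"
    using ip_self[of c] by (simp add: ip_def)
  then show ?thesis
    using parseval_coeff_op[OF c c, of 1 \<xi> \<eta>] by (simp add: cinner_scaleC_left)
qed

text \<open>With weight 1 on one side and \<open>cnj (h s)\<close> on the other, the conjugation in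
  the second argument of the inner product restores the factor \<open>h s\<close>.\<close>

lemma eh_family_coeff_op:
  assumes h: "bounded_borel h"
    and V: "\<And>e. e \<in> E \<Longrightarrow> adj (coeff_op (\<lambda>s. cnj (h s)) e) \<in> V"
    and W: "\<And>e. e \<in> E \<Longrightarrow> coeff_op (\<lambda>s. 1) e \<in> W"
    and T: "\<And>z \<xi> \<eta>. cinner (app (T z) \<xi>) \<eta> =
      (LINT s|M. cinner (app z (app (\<pi> (- s)) \<xi>)) (app (\<pi> (- s)) \<eta>) * h s)"
  shows "eh_family V W E (\<lambda>e. adj (coeff_op (\<lambda>s. cnj (h s)) e)) (coeff_op (\<lambda>s. 1))
    (scaleC_bop (sqn h) 1) (scaleC_bop (measure M UNIV) 1) T"
proof (rule eh_familyI[OF V W], assumption, assumption)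
  have 1: "bounded_borel (\<lambda>s :: 'g. 1)" by (rule bounded_borelI[where C = 1]) auto
  obtain B where B: "0 \<le> B" "\<And>x. norm (h x) \<le> B" using h by (rule bounded_borelE) blast
  have hm: "bounded_borel (\<lambda>s. cnj (h s))"
    by (rule bounded_borelI[where C = B], intro borel_measurable_continuous_on[OF _ bounded_borelD[OF h]] continuous_intros)
      (use B in simp)
  have sq: "sqn (\<lambda>s. cnj (h s)) = sqn h" "sqn (\<lambda>s. 1) = measure M UNIV"
    by (simp_all add: sqn_def)
  show "sq_bounded (\<lambda>e. adj (adj (coeff_op (\<lambda>s. cnj (h s)) e))) E (sqn h)"
    using sq_bounded_coeff_op[OF hm] by (simp add: sq)
  show "sq_bounded (coeff_op (\<lambda>s. 1)) E (measure M UNIV)"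
    using sq_bounded_coeff_op[OF 1] by (simp add: sq)
  show "((\<lambda>e. cinner (app (adj (adj (coeff_op (\<lambda>s. cnj (h s)) e))) x) (app (adj (adj (coeff_op (\<lambda>s. cnj (h s)) e))) y))
      has_sum cinner (app (scaleC_bop (sqn h) 1) x) y) E" for x y
    using coeff_op_square_sum[OF hm, of x y] by (simp add: sq)
  show "((\<lambda>e. cinner (app (coeff_op (\<lambda>s. 1) e) x) (app (coeff_op (\<lambda>s. 1) e) y))
      has_sum cinner (app (scaleC_bop (measure M UNIV) 1) x) y) E" for x y
    using coeff_op_square_sum[OF 1, of x y] by (simp add: sq)
  show "((\<lambda>e. cinner (app z (app (coeff_op (\<lambda>s. 1) e) x)) (app (adj (adj (coeff_op (\<lambda>s. cnj (h s)) e))) y))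
      has_sum cinner (app (T z) x) y) E" for z x y
    using parseval_coeff_op[OF 1 hm, of z x y] by (simp add: T mult.commute)
qed

end

section \<open>The weak* integral of \<open>\<pi>(s) \<otimes> \<pi>(s)\<^sup>*\<close>\<close>

lemma ex_rep_l2_basis:
  fixes \<pi> :: "'g::{topological_group_add, t2_space} \<Rightarrow> 'h::complex_hilbert bop"
  assumes "strongly_continuous_rep \<pi>" and \<mu>: "cm_tight \<mu>"
  obtains E where "rep_l2_basis \<pi> (tv_measure \<mu>) E"
proof -
  interpret strongly_continuous_rep \<pi> by fact
  have f: "cm_finite \<mu>" using \<mu> by (simp add: cm_tight_def)
  interpret l2_space "tv_measure \<mu>"
    by (rule l2_space.intro[OF finite_tv_measure[OF f] sets_tv_measure])
  obtain E where E: "ons E" "\<And>f. L2 (tv_measure \<mu>) f \<Longrightarrow> ((\<lambda>e. (norm (ip f e))\<^sup>2) has_sum sqn f) E"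
    by (rule ex_onb) blast
  have "rep_l2_basis \<pi> (tv_measure \<mu>) E"
  proof
    show "\<exists>K. compact K \<and> K \<in> sets borel \<and> measure (tv_measure \<mu>) (- K) < e" if "0 < e" for e
      using \<mu> that borel_compact unfolding cm_tight_def by blast
  qed (use E in auto)
  then show ?thesis by (rule that)
qed

lemma eh_family_in_ext_haagerup:
  fixes v w :: "'i \<Rightarrow> 'h::complex_hilbert bop"
  assumes "eh_family V W I v w a b T"
  shows "T \<in> V \<otimes>eh W"
proof -
  obtain J :: "'h set" and v' w' where "eh_rep V W J v' w' a b T" by (rule eh_family_reindex[OF assms])
  then show ?thesis unfolding ext_haagerup_def by blast
qed

lemma sqn_le_cm_norm:
  fixes \<mu> :: "'g::topological_space set \<Rightarrow> complex"
  assumes \<mu>: "cm_finite \<mu>" and h: "bounded_borel h" "\<And>x. norm (h x) \<le> 1"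
  shows "l2_space.sqn (tv_measure \<mu>) h \<le> cm_norm \<mu>"
proof -
  interpret l2_space "tv_measure \<mu>"
    by (rule l2_space.intro[OF finite_tv_measure[OF \<mu>] sets_tv_measure])
  have "sqn h \<le> (LINT s|tv_measure \<mu>. 1)"
    unfolding sqn_def
    by (intro integral_mono L2_square[OF L2_bounded[OF h(1)]]) (use h(2) in \<open>auto simp: power_le_one\<close>)
  then show ?thesis by (simp add: cm_norm_tv_measure[OF \<mu>])
qed

lemma norm_scaleC_bop_one_le: "norm (scaleC_bop (complex_of_real r) (1 :: 'h::complex_hilbert bop)) \<le> \<bar>r\<bar>"
  by (rule norm_bop_leI) (simp_all add: norm_scaleC)

context strongly_continuous_rep
begin

text \<open>The weak integral of \<open>\<pi> s * z * adj (\<pi> s)\<close> against \<mu>, described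
  by its form and thus independent of any basis.\<close>

definition gamma_op :: "('g set \<Rightarrow> complex) \<Rightarrow> 'h bop \<Rightarrow> 'h bop"
  where "gamma_op \<mu> z = (SOME T. \<forall>\<xi> \<eta>. cinner (app T \<xi>) \<eta> =
    cm_integral \<mu> (\<lambda>s. cinner (app z (app (\<pi> (- s)) \<xi>)) (app (\<pi> (- s)) \<eta>)))"

lemma cinner_gamma_op:
  assumes \<mu>: "cm_finite \<mu>"
  shows "cinner (app (gamma_op \<mu> z) \<xi>) \<eta> =
    cm_integral \<mu> (\<lambda>s. cinner (app z (app (\<pi> (- s)) \<xi>)) (app (\<pi> (- s)) \<eta>))"
proof -
  define B where "B \<xi> \<eta> = cm_integral \<mu> (\<lambda>s. cinner (app z (app (\<pi> (- s)) \<xi>)) (app (\<pi> (- s)) \<eta>))" for \<xi> \<eta>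
  note b = bounded_borel_conj_pi
  have "\<exists>T. \<forall>\<xi> \<eta>. cinner (app T \<xi>) \<eta> = B \<xi> \<eta>"
  proof (rule ex_bop_sesquilinear[of B "norm z * cm_norm \<mu>"])
    show "B (x + x') y = B x y + B x' y" for x x' y
      unfolding B_def by (simp add: app.add_right cinner_add_left cm_integral_add[OF \<mu> b b])
    show "B (scaleC c x) y = c * B x y" for c x y
      unfolding B_def by (simp add: cinner_scaleC_left cm_integral_cmult[OF \<mu> b b])
    show "B x (y + y') = B x y + B x y'" for x y y'
      unfolding B_def by (simp add: app.add_right cinner_add_right cm_integral_add[OF \<mu> b b])
    show "B x (scaleC c y) = cnj c * B x y" for c x y
      unfolding B_def by (simp add: cinner_scaleC_right cm_integral_cmult[OF \<mu> b b])
    show "norm (B x y) \<le> norm z * cm_norm \<mu> * norm x * norm y" for x y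
      unfolding B_def using norm_cm_integral_le[OF \<mu> b norm_conj_pi, of z x y] by (simp add: mult_ac)
    show "0 \<le> norm z * cm_norm \<mu>" by (simp add: cm_norm_nonneg)
  qed blast
  from someI_ex[OF this[unfolded B_def]] show ?thesis unfolding gamma_op_def by blast
qed

text \<open>The spaces \<open>V\<close> and \<open>W\<close> stay open, so that one series serves
  all the inclusions: each of them only has to locate the coefficient operators.\<close>

lemma gamma_op_family:
  assumes \<mu>: "cm_tight \<mu>"
  obtains E h where "rep_l2_basis \<pi> (tv_measure \<mu>) E" "bounded_borel h" "\<And>x. norm (h x) \<le> 1"
    "\<And>A. A \<in> sets borel \<Longrightarrow> \<mu> A = (LINT x|tv_measure \<mu>. indicator A x *\<^sub>R h x)"
    "\<And>V W. (\<And>e. e \<in> E \<Longrightarrow> adj (rep_l2_basis.coeff_op \<pi> (tv_measure \<mu>) (\<lambda>s. cnj (h s)) e) \<in> V) \<Longrightarrow>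
      (\<And>e. e \<in> E \<Longrightarrow> rep_l2_basis.coeff_op \<pi> (tv_measure \<mu>) (\<lambda>s. 1) e \<in> W) \<Longrightarrow>
      eh_family V W E (\<lambda>e. adj (rep_l2_basis.coeff_op \<pi> (tv_measure \<mu>) (\<lambda>s. cnj (h s)) e))
        (rep_l2_basis.coeff_op \<pi> (tv_measure \<mu>) (\<lambda>s. 1))
        (scaleC_bop (l2_space.sqn (tv_measure \<mu>) h) 1) (scaleC_bop (measure (tv_measure \<mu>) UNIV) 1) (gamma_op \<mu>)"
proof -
  have f: "cm_finite \<mu>" using \<mu> by (simp add: cm_tight_def)
  obtain h where h: "h \<in> borel_measurable borel" "\<And>x. norm (h x) \<le> 1"
    "\<And>E. E \<in> sets borel \<Longrightarrow> \<mu> E = (LINT x|tv_measure \<mu>. indicator E x *\<^sub>R h x)"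
    "\<And>f. bounded_borel f \<Longrightarrow> has_cm_integral \<mu> f (LINT x|tv_measure \<mu>. f x * h x)"
    by (rule cm_integral_polar[OF f]) blast
  obtain E where E: "rep_l2_basis \<pi> (tv_measure \<mu>) E"
    by (rule ex_rep_l2_basis[OF strongly_continuous_rep_axioms \<mu>])
  interpret rep_l2_basis \<pi> "tv_measure \<mu>" E by fact
  have bh: "bounded_borel h" by (rule bounded_borelI[OF h(1,2)])
  have T: "cinner (app (gamma_op \<mu> z) \<xi>) \<eta> =
      (LINT s|tv_measure \<mu>. cinner (app z (app (\<pi> (- s)) \<xi>)) (app (\<pi> (- s)) \<eta>) * h s)" for z \<xi> \<eta>
    unfolding cinner_gamma_op[OF f] using h(4)[OF bounded_borel_conj_pi] by (simp add: has_cm_integral_def)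
  show ?thesis
    by (rule that[OF E bh h(2,3) eh_family_coeff_op[OF bh _ _ T]])
qed

lemma gamma_op_eh_norm:
  assumes \<mu>: "cm_tight \<mu>"
  shows "gamma_op \<mu> \<in> UNIV \<otimes>eh UNIV" and "eh_norm UNIV UNIV (gamma_op \<mu>) \<le> cm_norm \<mu>"
proof -
  have f: "cm_finite \<mu>" using \<mu> by (simp add: cm_tight_def)
  obtain E h where h: "bounded_borel h" "\<And>x. norm (h x) \<le> 1"
    and fam: "eh_family UNIV UNIV E (\<lambda>e. adj (rep_l2_basis.coeff_op \<pi> (tv_measure \<mu>) (\<lambda>s. cnj (h s)) e))
        (rep_l2_basis.coeff_op \<pi> (tv_measure \<mu>) (\<lambda>s. 1))
        (scaleC_bop (l2_space.sqn (tv_measure \<mu>) h) 1) (scaleC_bop (measure (tv_measure \<mu>) UNIV) 1) (gamma_op \<mu>)"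
    by (rule gamma_op_family[OF \<mu>]) blast
  define q where "q = l2_space.sqn (tv_measure \<mu>) h"
  interpret l2_space "tv_measure \<mu>"
    by (rule l2_space.intro[OF finite_tv_measure[OF f] sets_tv_measure])
  have q: "0 \<le> q" "q \<le> cm_norm \<mu>"
    using sqn_le_cm_norm[OF f h] sqn_nonneg[of h] by (auto simp: q_def)
  have m: "measure (tv_measure \<mu>) UNIV = cm_norm \<mu>" by (simp add: cm_norm_tv_measure[OF f])
  obtain I v w where r: "eh_rep UNIV UNIV I v w (scaleC_bop q 1) (scaleC_bop (cm_norm \<mu>) 1) (gamma_op \<mu>)"
    by (rule eh_family_reindex[OF fam[folded q_def, unfolded m]])
  then show "gamma_op \<mu> \<in> UNIV \<otimes>eh UNIV" unfolding ext_haagerup_def by blast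
  have "eh_norm UNIV UNIV (gamma_op \<mu>) \<le> sqrt (norm (scaleC_bop q (1 :: 'h bop))) * sqrt (norm (scaleC_bop (cm_norm \<mu>) (1 :: 'h bop)))"
    unfolding eh_norm_def
  proof (rule cInf_lower)
    show "sqrt (norm (scaleC_bop q (1 :: 'h bop))) * sqrt (norm (scaleC_bop (cm_norm \<mu>) (1 :: 'h bop))) \<in>
        {sqrt (norm a) * sqrt (norm b) | I v w a b. eh_rep UNIV UNIV I v w a b (gamma_op \<mu>)}"
      unfolding mem_Collect_eq by (intro exI conjI, rule refl, rule r)
  qed (auto intro!: bdd_belowI[where m = 0])
  also have "\<dots> \<le> sqrt (cm_norm \<mu>) * sqrt (cm_norm \<mu>)"
    using norm_scaleC_bop_one_le[where 'h = 'h, of q] norm_scaleC_bop_one_le[where 'h = 'h, of "cm_norm \<mu>"] q cm_norm_nonneg[of \<mu>]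
    by (intro mult_mono real_sqrt_le_mono) auto
  also have "\<dots> = cm_norm \<mu>" using cm_norm_nonneg[of \<mu>] by simp
  finally show "eh_norm UNIV UNIV (gamma_op \<mu>) \<le> cm_norm \<mu>" .
qed

lemma borel_measurable_predual_pi:
  assumes "\<omega> \<in> predual"
  shows "(\<lambda>s. \<omega> (\<pi> s)) \<in> borel_measurable borel"
proof -
  obtain x y where d: "predual_data \<omega> x y" by (rule predual_dataE[OF assms])
  show ?thesis
  proof (rule borel_measurable_LIMSEQ_metric)
    show "(\<lambda>s. \<Sum>n<N. cinner (app (\<pi> s) (x n)) (y n)) \<in> borel_measurable borel" for N
      by (intro borel_measurable_sum bounded_borelD bounded_borel_pi)
    show "(\<lambda>N. \<Sum>n<N. cinner (app (\<pi> s) (x n)) (y n)) \<longlonglongrightarrow> \<omega> (\<pi> s)" for s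
      using d has_sum_imp_sums unfolding predual_data_def sums_def by blast
  qed
qed

text \<open>Both sides are expanded over pairs of representing vectors, with rank one operators in
  place of \<open>z\<close>. The majorant \<open>c p\<close> does not depend on \<open>s\<close>, so
  sum and integral can be interchanged.\<close>

lemma simple_tensor_integral:
  assumes \<mu>: "cm_tight \<mu>" and "\<omega> \<in> predual" "\<nu> \<in> predual"
  shows "bounded_borel (\<lambda>s. simple_tensor \<omega> \<nu> (\<pi> s) (adj (\<pi> s)))"
    and "tensor_pairing (gamma_op \<mu>) (simple_tensor \<omega> \<nu>) = cm_integral \<mu> (\<lambda>s. simple_tensor \<omega> \<nu> (\<pi> s) (adj (\<pi> s)))"
proof -
  have f: "cm_finite \<mu>" using \<mu> by (simp add: cm_tight_def)
  obtain x y where w: "predual_data \<omega> x y" by (rule predual_dataE[OF assms(2)])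
  obtain x' y' where v: "predual_data \<nu> x' y'" by (rule predual_dataE[OF assms(3)])
  define g where "g p s = cinner (app (rank_one (x (fst p)) (y' (snd p))) (app (\<pi> (- s)) (x' (snd p)))) (app (\<pi> (- s)) (y (fst p)))" for p s
  define F where "F s = simple_tensor \<omega> \<nu> (\<pi> s) (adj (\<pi> s))" for s
  define c where "c p = (case p of (m, n) \<Rightarrow> (norm (x m) * norm (y m)) * (norm (x' n) * norm (y' n)))" for p
  have "(\<lambda>s. \<nu> (\<pi> (- s))) \<in> borel_measurable borel"
    using measurable_compose[OF borel_measurable_uminus_group borel_measurable_predual_pi[OF assms(3)]] by simp
  then have F: "F \<in> borel_measurable borel"
    unfolding F_def simple_tensor_def adj_pi using borel_measurable_predual_pi[OF assms(2)] by simp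
  have hs: "((\<lambda>p. g p s) has_sum F s) (UNIV \<times> UNIV)" for s
    using tensor_pairing_simple[OF elem_tensor_in_eh[of "\<pi> s" "adj (\<pi> s)"] assms(2,3) w v]
    unfolding tensor_pairing_elem_tensor[OF simple_tensor_in[OF assms(2,3)]] F_def[symmetric]
    by (simp add: elem_tensor_def g_def adj_pi flip: cinner_pi)
  have c: "c summable_on (UNIV \<times> UNIV)"
    unfolding c_def using w v by (intro summable_on_product_nonneg) (auto simp: predual_data_def)
  have gc: "norm (g p s) \<le> c p" for p s
  proof -
    obtain m n where p: "p = (m, n)" by (cases p)
    have "norm (g p s) = norm (cinner (app (\<pi> (- s)) (x' n)) (y' n)) * norm (cinner (x m) (app (\<pi> (- s)) (y m)))"
      by (simp add: g_def p cinner_scaleC_left norm_mult)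
    also have "\<dots> \<le> (norm (x' n) * norm (y' n)) * (norm (x m) * norm (y m))"
      using cinner_cauchy_schwarz[of "app (\<pi> (- s)) (x' n)" "y' n"] cinner_cauchy_schwarz[of "x m" "app (\<pi> (- s)) (y m)"]
      by (intro mult_mono) auto
    finally show ?thesis by (simp add: c_def p mult_ac)
  qed
  have gb: "bounded_borel (g p)" for p unfolding g_def by (rule bounded_borel_conj_pi)
  show "bounded_borel (\<lambda>s. simple_tensor \<omega> \<nu> (\<pi> s) (adj (\<pi> s)))"
    using cm_integral_has_sum(1)[OF f gb F hs gc c] by (simp add: F_def)
  have 1: "((\<lambda>p. cm_integral \<mu> (g p)) has_sum cm_integral \<mu> F) (UNIV \<times> UNIV)"
    by (rule cm_integral_has_sum(2)[OF f gb F hs gc c])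
  have 2: "((\<lambda>p. cm_integral \<mu> (g p)) has_sum tensor_pairing (gamma_op \<mu>) (simple_tensor \<omega> \<nu>)) (UNIV \<times> UNIV)"
    using tensor_pairing_simple[OF gamma_op_eh_norm(1)[OF \<mu>] assms(2,3) w v]
    unfolding cinner_gamma_op[OF f] g_def .
  show "tensor_pairing (gamma_op \<mu>) (simple_tensor \<omega> \<nu>) = cm_integral \<mu> (\<lambda>s. simple_tensor \<omega> \<nu> (\<pi> s) (adj (\<pi> s)))"
    using has_sum_unique[OF 2 1] by (simp add: F_def[abs_def])
qed

lemma predual_tensor_integral:
  assumes \<mu>: "cm_tight \<mu>" and u: "u \<in> predual_tensors"
  shows "bounded_borel (\<lambda>s. u (\<pi> s) (adj (\<pi> s)))"
    and "tensor_pairing (gamma_op \<mu>) u = cm_integral \<mu> (\<lambda>s. u (\<pi> s) (adj (\<pi> s)))"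
proof -
  have f: "cm_finite \<mu>" using \<mu> by (simp add: cm_tight_def)
  obtain n \<omega> \<nu> where pre: "\<And>k. k < n \<Longrightarrow> \<omega> k \<in> predual \<and> \<nu> k \<in> predual" and u: "u = tensor_form n \<omega> \<nu>"
    using u unfolding predual_tensors_def by blast
  have e: "(\<lambda>s. u (\<pi> s) (adj (\<pi> s))) = (\<lambda>s. \<Sum>k<n. simple_tensor (\<omega> k) (\<nu> k) (\<pi> s) (adj (\<pi> s)))"
    by (simp add: u tensor_form_def simple_tensor_def)
  have b: "bounded_borel (\<lambda>s. simple_tensor (\<omega> k) (\<nu> k) (\<pi> s) (adj (\<pi> s)))" if "k \<in> {..<n}" for k
    using simple_tensor_integral(1)[OF \<mu>] pre that by simp
  show "bounded_borel (\<lambda>s. u (\<pi> s) (adj (\<pi> s)))"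
    unfolding e by (rule bounded_borel_sum[OF _ b]) simp
  show "tensor_pairing (gamma_op \<mu>) u = cm_integral \<mu> (\<lambda>s. u (\<pi> s) (adj (\<pi> s)))"
  proof -
    have "cm_integral \<mu> (\<lambda>s. u (\<pi> s) (adj (\<pi> s))) = (\<Sum>k<n. cm_integral \<mu> (\<lambda>s. simple_tensor (\<omega> k) (\<nu> k) (\<pi> s) (adj (\<pi> s))))"
      unfolding e by (rule cm_integral_sum[OF f finite_lessThan b])
    also have "\<dots> = (\<Sum>k<n. tensor_pairing (gamma_op \<mu>) (simple_tensor (\<omega> k) (\<nu> k)))"
      by (intro sum.cong refl simple_tensor_integral(2)[OF \<mu>, symmetric]) (use pre in auto)
    also have "\<dots> = tensor_pairing (gamma_op \<mu>) u"
      unfolding u by (rule tensor_pairing_tensor_form[OF gamma_op_eh_norm(1)[OF \<mu>] pre, symmetric])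
    finally show ?thesis ..
  qed
qed

text \<open>The elementary tensor of two unitaries is a series with one term whose row and column
  norms are at most 1. The estimate is uniform in \<open>s\<close>, which the passage to the
  completion requires.\<close>

lemma tensor_pi_le:
  assumes u: "u \<in> predual_tensors"
  shows "norm (u (\<pi> s) (adj (\<pi> s))) \<le> predual_haagerup_norm u"
proof -
  have sq: "sq_bounded (\<lambda>_. \<pi> t) {0 :: 'h} (1\<^sup>2)" for t
    unfolding sq_bounded_def
  proof (intro allI impI)
    fix F :: "'h set" and x assume "finite F" "F \<subseteq> {0}"
    then have "F = {} \<or> F = {0}" by blast
    then show "(\<Sum>i\<in>F. (norm (app (\<pi> t) x))\<^sup>2) \<le> 1\<^sup>2 * (norm x)\<^sup>2" by auto
  qed
  have "eh_rep UNIV UNIV {0 :: 'h} (\<lambda>_. \<pi> s) (\<lambda>_. adj (\<pi> s)) (\<pi> s * adj (\<pi> s)) (adj (adj (\<pi> s)) * adj (\<pi> s)) (elem_tensor (\<pi> s) (adj (\<pi> s)))"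
    unfolding eh_rep_iff_eh_family by (rule eh_family_elem_tensor)
  then have "norm (tensor_pairing (elem_tensor (\<pi> s) (adj (\<pi> s))) u) \<le> 1 * 1 * predual_haagerup_norm u"
    by (rule tensor_pairing_bound[OF _ sq[of "- s", folded adj_pi] sq[of "- s", folded adj_pi] _ _ u]) simp_all
  then show ?thesis by (simp add: tensor_pairing_elem_tensor[OF u])
qed

text \<open>For a Cauchy sequence of tensors the integrands are uniformly Cauchy in
  \<open>s\<close>, by \<open>tensor_pi_le\<close>, so the identity for algebraic tensors passes to
  the limit on both sides.\<close>

lemma is_Gamma_rep_gamma_op:
  assumes \<mu>: "cm_tight \<mu>"
  shows "is_Gamma_rep \<pi> \<mu> (gamma_op \<mu>)"
  unfolding is_Gamma_rep_def
proof (intro conjI ballI)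
  have f: "cm_finite \<mu>" using \<mu> by (simp add: cm_tight_def)
  show eh: "gamma_op \<mu> \<in> UNIV \<otimes>eh UNIV" by (rule gamma_op_eh_norm[OF \<mu>])
  fix X :: "nat \<Rightarrow> 'h bop \<Rightarrow> 'h bop \<Rightarrow> complex" assume X: "X \<in> predual_haagerup"
  define g where "g n s = X n (\<pi> s) (adj (\<pi> s))" for n s
  define G where "G s = eh_pairing (elem_tensor (\<pi> s) (adj (\<pi> s))) X" for s
  have gb: "bounded_borel (g n)" for n
    unfolding g_def by (rule predual_tensor_integral(1)[OF \<mu> predual_haagerupD(1)[OF X]])
  have lim: "(\<lambda>n. g n s) \<longlonglongrightarrow> G s" for s
    using eh_pairing_tendsto[OF elem_tensor_in_eh X, of "\<pi> s" "adj (\<pi> s)"]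
    unfolding tensor_pairing_elem_tensor[OF predual_haagerupD(1)[OF X]] g_def G_def .
  have un: "\<exists>N. \<forall>n\<ge>N. \<forall>s. norm (g n s - G s) \<le> e" if e: "0 < e" for e
  proof -
    obtain N where N: "\<forall>m\<ge>N. \<forall>n\<ge>N. predual_haagerup_norm (\<lambda>S T. X m S T - X n S T) < e"
      using predual_haagerupD(2)[OF X e] by (elim exE)
    have "norm (g n s - G s) \<le> e" if n: "n \<ge> N" for n s
    proof (rule tendsto_upperbound)
      show "(\<lambda>m. norm (g n s - g m s)) \<longlonglongrightarrow> norm (g n s - G s)"
        by (intro tendsto_intros lim)
      show "\<forall>\<^sub>F m in sequentially. norm (g n s - g m s) \<le> e"
        unfolding eventually_sequentially
      proof (intro exI allI impI)
        fix m assume m: "N \<le> m"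
        show "norm (g n s - g m s) \<le> e"
          using tensor_pi_le[OF predual_tensors_diff[OF predual_haagerupD(1)[OF X, of n] predual_haagerupD(1)[OF X, of m]], of s]
            N[rule_format, OF n m] unfolding g_def by linarith
      qed
    qed simp
    then show ?thesis by blast
  qed
  have Gb: "bounded_borel G"
  proof -
    obtain N where N: "\<forall>n\<ge>N. \<forall>s. norm (g n s - G s) \<le> 1" using un[of 1] by auto
    obtain C where C: "0 \<le> C" "\<And>s. norm (g N s) \<le> C" using gb by (rule bounded_borelE) blast
    show ?thesis
    proof (rule bounded_borelI)
      show "G \<in> borel_measurable borel"
        by (rule borel_measurable_LIMSEQ_metric[OF bounded_borelD[OF gb] lim])
      show "norm (G s) \<le> C + 1" for s
        using N[rule_format, of N s] C(2)[of s] norm_triangle_sub[of "G s" "g N s"] by (simp add: norm_minus_commute)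
    qed
  qed
  have "(\<lambda>n. cm_integral \<mu> (g n)) \<longlonglongrightarrow> cm_integral \<mu> G"
  proof (rule LIMSEQ_I)
    fix r :: real assume r: "0 < r"
    \<comment> \<open>The integral multiplies a uniform error by \<open>cm_norm \<mu>\<close>; the
      summand 1 covers measures of norm 0.\<close>
    define e where "e = r / (cm_norm \<mu> + 1)"
    have e: "0 < e" using r cm_norm_nonneg[of \<mu>] by (simp add: e_def)
    obtain N where N: "\<forall>n\<ge>N. \<forall>s. norm (g n s - G s) \<le> e" using un[OF e] by (elim exE)
    have "norm (cm_integral \<mu> (g n) - cm_integral \<mu> G) < r" if "N \<le> n" for n
    proof -
      have "norm (cm_integral \<mu> (g n) - cm_integral \<mu> G) \<le> e * cm_norm \<mu>"
        unfolding cm_integral_diff(2)[OF f gb Gb, symmetric]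
        by (rule norm_cm_integral_le[OF f cm_integral_diff(1)[OF f gb Gb]]) (use N that in blast)
      also have "\<dots> < e * (cm_norm \<mu> + 1)" using e by simp
      also have "\<dots> = r" using cm_norm_nonneg[of \<mu>] by (simp add: e_def)
      finally show ?thesis .
    qed
    then show "\<exists>N. \<forall>n\<ge>N. norm (cm_integral \<mu> (g n) - cm_integral \<mu> G) < r" by blast
  qed
  moreover have "(\<lambda>n. cm_integral \<mu> (g n)) \<longlonglongrightarrow> eh_pairing (gamma_op \<mu>) X"
    using eh_pairing_tendsto[OF eh X] unfolding predual_tensor_integral(2)[OF \<mu> predual_haagerupD(1)[OF X]] g_def .
  ultimately have "cm_integral \<mu> G = eh_pairing (gamma_op \<mu>) X" by (rule LIMSEQ_unique)
  then show "has_cm_integral \<mu> (\<lambda>s. eh_pairing (elem_tensor (\<pi> s) (adj (\<pi> s))) X) (eh_pairing (gamma_op \<mu>) X)"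
    using has_cm_integral_bounded[OF f Gb] by (simp add: G_def[abs_def])
qed

lemma Gamma_rep_eq:
  assumes \<mu>: "cm_tight \<mu>"
  shows "Gamma_rep \<pi> \<mu> = gamma_op \<mu>"
  unfolding Gamma_rep_def
proof (rule the_equality[where P = "is_Gamma_rep \<pi> \<mu>", OF is_Gamma_rep_gamma_op[OF \<mu>]])
  note 1 = is_Gamma_rep_gamma_op[OF \<mu>]
  fix T assume T: "is_Gamma_rep \<pi> \<mu> T"
  show "T = gamma_op \<mu>"
    by (rule eh_pairing_inject) (use T 1 in \<open>auto simp: is_Gamma_rep_def has_cm_integral_def\<close>)
qed

lemma gamma_op_eqI:
  assumes "cm_finite \<mu>"
    and "\<And>\<xi> \<eta>. cinner (app (T z) \<xi>) \<eta> =
      cm_integral \<mu> (\<lambda>s. cinner (app z (app (\<pi> (- s)) \<xi>)) (app (\<pi> (- s)) \<eta>))"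
  shows "gamma_op \<mu> z = T z"
  by (rule bop_eqI_cinner) (simp add: assms cinner_gamma_op)

lemma gamma_op_add:
  assumes "cm_finite \<mu>" "cm_finite \<nu>"
  shows "gamma_op (\<lambda>E. \<mu> E + \<nu> E) = (\<lambda>x. gamma_op \<mu> x + gamma_op \<nu> x)"
  by (intro ext gamma_op_eqI cm_finite_add assms)
    (simp add: app.add_left cinner_add_left cinner_gamma_op assms cm_integral_add_measure bounded_borel_conj_pi)

lemma gamma_op_cmult:
  assumes "cm_finite \<mu>"
  shows "gamma_op (\<lambda>E. c * \<mu> E) = (\<lambda>x. scaleC_bop c (gamma_op \<mu> x))"
  by (intro ext gamma_op_eqI cm_finite_cmult assms)
    (simp add: cinner_scaleC_left cinner_gamma_op assms cm_integral_cmult_measure[OF assms assms] bounded_borel_conj_pi)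

lemma gamma_op_convolution:
  assumes \<mu>: "\<mu> \<in> complex_measures" and \<nu>: "\<nu> \<in> complex_measures"
  shows "gamma_op (convolution \<mu> \<nu>) = gamma_op \<mu> \<circ> gamma_op \<nu>"
proof (rule ext)
  fix z
  note f = complex_measures_finite[OF \<mu>] complex_measures_finite[OF \<nu>]
  have "gamma_op (convolution \<mu> \<nu>) z = (\<lambda>z. gamma_op \<mu> (gamma_op \<nu> z)) z"
  proof (rule gamma_op_eqI[OF convolution_finite[OF \<mu> \<nu>]])
    fix \<xi> \<eta>
    \<comment> \<open>With this factorization the inner integral over \<open>t\<close> is the form
      of \<open>gamma_op \<nu> z\<close> at the vectors \<open>app (\<pi> (- s)) \<xi>\<close> and
      \<open>app (\<pi> (- s)) \<eta>\<close>.\<close>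
    have "\<pi> (- (s + t)) = \<pi> (- t) * \<pi> (- s)" for s t by (simp only: minus_add pi_add)
    then show "cinner (app (gamma_op \<mu> (gamma_op \<nu> z)) \<xi>) \<eta> =
        cm_integral (convolution \<mu> \<nu>) (\<lambda>s. cinner (app z (app (\<pi> (- s)) \<xi>)) (app (\<pi> (- s)) \<eta>))"
      unfolding convolution_integral[OF \<mu> \<nu> bounded_borel_conj_pi] cinner_gamma_op[OF f(1)]
      by (simp only: cinner_gamma_op[OF f(2)] app_times)
  qed
  then show "gamma_op (convolution \<mu> \<nu>) z = (gamma_op \<mu> \<circ> gamma_op \<nu>) z" by simp
qed

end

section \<open>Reflection of Haar null sets\<close>

lemma finite_disjoint_refinement:
  fixes W :: "'i \<Rightarrow> 'a::topological_space set"
  assumes "finite Y" "\<And>y. y \<in> Y \<Longrightarrow> W y \<in> sets borel"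
  shows "\<exists>B. (\<forall>y\<in>Y. B y \<in> sets borel \<and> B y \<subseteq> W y) \<and> disjoint_family_on B Y \<and> (\<Union>y\<in>Y. B y) = (\<Union>y\<in>Y. W y)"
  using assms
proof (induction Y rule: finite_induct)
  case empty
  show ?case by (simp add: disjoint_family_on_def)
next
  case (insert x Y)
  have "\<exists>B. (\<forall>y\<in>Y. B y \<in> sets borel \<and> B y \<subseteq> W y) \<and> disjoint_family_on B Y \<and> (\<Union>y\<in>Y. B y) = (\<Union>y\<in>Y. W y)"
    by (rule insert.IH) (simp add: insert.prems)
  then obtain B where B: "\<forall>y\<in>Y. B y \<in> sets borel \<and> B y \<subseteq> W y" "disjoint_family_on B Y"
    "(\<Union>y\<in>Y. B y) = (\<Union>y\<in>Y. W y)" by (elim exE conjE)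
  define C where "C = B(x := W x - (\<Union>y\<in>Y. B y))"
  have CB: "C y = B y" if "y \<in> Y" for y using insert.hyps(2) that by (auto simp: C_def)
  have Cx: "C x = W x - (\<Union>y\<in>Y. B y)" by (simp add: C_def)
  have "(\<Union>y\<in>Y. B y) \<in> sets borel" using B(1) insert.hyps(1) by (intro sets.finite_UN) auto
  then have "C x \<in> sets borel" unfolding Cx by (intro sets.Diff insert.prems) auto
  then have "\<forall>y\<in>insert x Y. C y \<in> sets borel \<and> C y \<subseteq> W y" using B(1) CB Cx by auto
  moreover have "disjoint_family_on C (insert x Y)"
    unfolding disjoint_family_on_insert[OF insert.hyps(2)] using B(2) CB Cx by (auto simp: disjoint_family_on_def)
  moreover have "(\<Union>y\<in>insert x Y. C y) = (\<Union>y\<in>insert x Y. W y)"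
  proof -
    have "(\<Union>y\<in>insert x Y. C y) = C x \<union> (\<Union>y\<in>Y. B y)" using CB by auto
    then show ?thesis unfolding Cx B(3) by auto
  qed
  ultimately show ?case by blast
qed

text \<open>A finite subcover, cut down to \<open>K\<close> and made disjoint. It serves for Haar
  measure and for the norm approximation of \<pi>.\<close>

lemma compact_borel_partition:
  fixes K :: "'a::t2_space set"
  assumes K: "compact K" and W: "\<And>y. y \<in> K \<Longrightarrow> open (W y) \<and> y \<in> W y"
  obtains Y B where "finite Y" "\<And>y. y \<in> Y \<Longrightarrow> B y \<in> sets borel \<and> B y \<subseteq> W y"
    "disjoint_family_on B Y" "(\<Union>y\<in>Y. B y) = K"
proof -
  obtain Y where Y: "Y \<subseteq> K" "finite Y" "K \<subseteq> (\<Union>y\<in>Y. W y)"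
    by (rule compactE_image[OF K, of K W]) (use W in auto)
  have "\<exists>B. (\<forall>y\<in>Y. B y \<in> sets borel \<and> B y \<subseteq> W y \<inter> K) \<and> disjoint_family_on B Y \<and> (\<Union>y\<in>Y. B y) = (\<Union>y\<in>Y. W y \<inter> K)"
  proof (rule finite_disjoint_refinement[OF Y(2)])
    fix y assume "y \<in> Y"
    then have "open (W y)" using W Y(1) by blast
    then show "W y \<inter> K \<in> sets borel" using borel_compact[OF K] by (intro sets.Int) auto
  qed
  then obtain B where B: "\<forall>y\<in>Y. B y \<in> sets borel \<and> B y \<subseteq> W y \<inter> K" "disjoint_family_on B Y"
    "(\<Union>y\<in>Y. B y) = (\<Union>y\<in>Y. W y \<inter> K)" by (elim exE conjE)
  have "(\<Union>y\<in>Y. B y) = K" using B(3) Y(3) by auto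
  then show ?thesis using that[OF Y(2) _ B(2)] B(1) by auto
qed

lemma left_haarD:
  assumes "left_haar h"
  shows "sets h = sets borel" "emeasure h UNIV \<noteq> 0"
    "E \<in> sets borel \<Longrightarrow> emeasure h ((+) s ` E) = emeasure h E"
    "compact K \<Longrightarrow> emeasure h K < \<infinity>"
    "E \<in> sets borel \<Longrightarrow> emeasure h E = (INF U\<in>{U. open U \<and> E \<subseteq> U}. emeasure h U)"
    "open U \<Longrightarrow> emeasure h U = (SUP K\<in>{K. compact K \<and> K \<subseteq> U}. emeasure h K)"
proof -
  note a = assms[unfolded left_haar_def]
  note b = a[THEN conjunct2] note c = b[THEN conjunct2] note d = c[THEN conjunct2]
  show "sets h = sets borel" by (rule a[THEN conjunct1])
  show "emeasure h UNIV \<noteq> 0" by (rule b[THEN conjunct1])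
  show "emeasure h ((+) s ` E) = emeasure h E" if "E \<in> sets borel"
    by (rule bspec[OF spec[OF c[THEN conjunct1]] that])
  show "emeasure h K < \<infinity>" if "compact K"
    by (rule mp[OF spec[OF d[THEN conjunct1]] that])
  show "emeasure h E = (INF U\<in>{U. open U \<and> E \<subseteq> U}. emeasure h U)" if "E \<in> sets borel"
    by (rule bspec[OF d[THEN conjunct2, THEN conjunct1] that])
  show "emeasure h U = (SUP K\<in>{K. compact K \<and> K \<subseteq> U}. emeasure h K)" if "open U"
    by (rule mp[OF spec[OF d[THEN conjunct2, THEN conjunct2]] that])
qed

text \<open>The set of pairs \<open>(k, y)\<close> with \<open>k\<close> in \<open>K\<close> and
  \<open>y\<close> in \<open>k + C\<close> is measured in two ways. Integrating over
  \<open>y\<close> first gives the left side by invariance. For fixed \<open>y\<close>, which must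
  lie in \<open>K + C\<close>, the admissible \<open>k\<close> lie in \<open>y - C\<close> and hence
  in \<open>y + U\<close>. The exchange of the integrals is carried out on a finite partition of
  \<open>K + C\<close>.\<close>

lemma haar_reflect_bound:
  fixes h :: "'g::{topological_group_add, t2_space} measure"
  assumes h: "left_haar h" and K: "compact K" and C: "compact C" and U: "open U" "uminus ` C \<subseteq> U"
  shows "emeasure h K * emeasure h C \<le> emeasure h U * emeasure h ((\<lambda>p. fst p + snd p) ` (K \<times> C))"
proof -
  note sh = left_haarD(1)[OF h]
  define L where "L = (\<lambda>p. fst p + snd p) ` (K \<times> C)"
  have L: "compact L" unfolding L_def by (rule compact_sums_group[OF K C])
  \<comment> \<open>This is the translate \<open>y + U\<close>, of the same measure as
    \<open>U\<close>.\<close>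
  define O' where "O' y = {k. - y + k \<in> U}" for y
  have O': "O' y \<in> sets h" "emeasure h (O' y) = emeasure h U" for y
  proof -
    have "O' y = (+) y ` U" by (auto simp: O'_def image_iff intro!: bexI[of _ "- y + _"] simp flip: add.assoc)
    then show "emeasure h (O' y) = emeasure h U" using left_haarD(3)[OF h, of U y] U(1) by simp
    show "O' y \<in> sets h" unfolding O'_def sh using U(1) by (intro vimage_translate_borel) simp
  qed
  \<comment> \<open>Compactness of \<open>C\<close> gives a neighbourhood of \<open>y\<close> whose
    points \<open>y'\<close> all satisfy \<open>y' - C \<subseteq> y + U\<close>, so that on one
    piece of the partition a single translate serves.\<close>
  have "\<exists>W. open W \<and> y \<in> W \<and> (\<forall>y'\<in>W. \<forall>c\<in>C. y' - c \<in> O' y)" for y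
  proof -
    have cont: "continuous_on UNIV (\<lambda>p. - y + (fst p - snd p))" by (intro continuous_intros)
    have "open ((\<lambda>p. - y + (fst p - snd p)) -` U)" by (rule open_vimage[OF U(1) cont])
    moreover have "{y} \<times> C \<subseteq> (\<lambda>p. - y + (fst p - snd p)) -` U"
    proof
      fix p assume "p \<in> {y} \<times> C"
      then have "fst p = y" "- snd p \<in> U" using U(2) by auto
      moreover have "- y + (y - snd p) = - snd p" by (simp add: diff_conv_add_uminus del: add_uminus_conv_diff flip: add.assoc)
      ultimately show "p \<in> (\<lambda>p. - y + (fst p - snd p)) -` U" by simp
    qed
    ultimately have "\<exists>W. y \<in> W \<and> open W \<and> W \<times> C \<subseteq> (\<lambda>p. - y + (fst p - snd p)) -` U"
      by (rule Elementary_Topology.tube_lemma[OF C])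
    then obtain W where "y \<in> W" "open W" "W \<times> C \<subseteq> (\<lambda>p. - y + (fst p - snd p)) -` U"
      by (elim exE conjE)
    then show ?thesis by (intro exI[of _ W]) (auto simp: O'_def)
  qed
  then obtain W where W: "\<And>y. open (W y)" "\<And>y. y \<in> W y" "\<And>y y' c. y' \<in> W y \<Longrightarrow> c \<in> C \<Longrightarrow> y' - c \<in> O' y"
    by metis
  obtain Y B where Y: "finite Y" "\<And>y. y \<in> Y \<Longrightarrow> B y \<in> sets borel \<and> B y \<subseteq> W y"
    "disjoint_family_on B Y" "(\<Union>y\<in>Y. B y) = L"
    by (rule compact_borel_partition[OF L, of W]) (use W in auto)
  \<comment> \<open>For \<open>k\<close> in \<open>K\<close> the translate \<open>k + C\<close> is
    cut by the partition; a piece \<open>B y\<close> that it meets forces \<open>k\<close> to lie in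
    \<open>O' y\<close>.\<close>
  have pt: "emeasure h C * indicator K k \<le> (\<Sum>y\<in>Y. emeasure h (B y) * indicator (O' y) k)" for k
  proof (cases "k \<in> K")
    case True
    define D where "D y = (+) k ` C \<inter> B y" for y
    have kC: "(+) k ` C \<in> sets h"
      unfolding sh by (intro borel_compact compact_continuous_image C continuous_intros)
    have "(+) k ` C \<subseteq> L" using True by (force simp: L_def)
    then have "(+) k ` C = (\<Union>y\<in>Y. D y)" using Y(4) by (auto simp: D_def)
    then have "emeasure h C = emeasure h (\<Union>y\<in>Y. D y)"
      using left_haarD(3)[OF h borel_compact[OF C], of k] by simp
    also have "\<dots> = (\<Sum>y\<in>Y. emeasure h (D y))"
      using Y(2,3) kC by (intro sum_emeasure[symmetric] Y(1)) (auto simp: D_def sh intro: disjoint_family_on_bisimulation)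
    also have "\<dots> \<le> (\<Sum>y\<in>Y. emeasure h (B y) * indicator (O' y) k)"
    proof (rule sum_mono)
      fix y assume y: "y \<in> Y"
      show "emeasure h (D y) \<le> emeasure h (B y) * indicator (O' y) k"
      proof (cases "k \<in> O' y")
        case True
        then show ?thesis using Y(2)[OF y] by (auto simp: D_def sh intro!: emeasure_mono)
      next
        case False
        have "D y = {}"
        proof (rule ccontr)
          assume "D y \<noteq> {}"
          then obtain c where "c \<in> C" "k + c \<in> B y" by (auto simp: D_def)
          then have "(k + c) - c \<in> O' y" using W(3) Y(2)[OF y] by blast
          then show False using False by simp
        qed
        then show ?thesis by simp
      qed
    qed
    finally show ?thesis using True by simp
  qed simp
  have "emeasure h K * emeasure h C = (\<integral>\<^sup>+k. emeasure h C * indicator K k \<partial>h)"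
    using borel_compact[OF K] by (subst nn_integral_cmult_indicator) (simp_all add: sh mult.commute)
  also have "\<dots> \<le> (\<integral>\<^sup>+k. (\<Sum>y\<in>Y. emeasure h (B y) * indicator (O' y) k) \<partial>h)"
    by (rule nn_integral_mono[OF pt])
  also have "\<dots> = (\<Sum>y\<in>Y. emeasure h (B y) * emeasure h U)"
    using O' by (subst nn_integral_sum) (auto simp: nn_integral_cmult_indicator)
  also have "\<dots> = emeasure h U * (\<Sum>y\<in>Y. emeasure h (B y))"
    by (simp add: sum_distrib_left mult.commute)
  also have "(\<Sum>y\<in>Y. emeasure h (B y)) = emeasure h L"
    unfolding Y(4)[symmetric] using Y(2,3) by (intro sum_emeasure Y(1)) (auto simp: sh)
  finally show ?thesis by (simp add: L_def)
qed

lemma haar_null_compact_reflect: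
  fixes h :: "'g::{topological_group_add, t2_space} measure"
  assumes h: "left_haar h" and C: "compact C" and null: "emeasure h (uminus ` C) = 0"
  shows "emeasure h C = 0"
proof -
  have "emeasure h UNIV = (SUP K\<in>{K. compact K \<and> K \<subseteq> UNIV}. emeasure h K)"
    by (rule left_haarD(6)[OF h open_UNIV])
  then have "\<not> (SUP K\<in>{K. compact K \<and> K \<subseteq> UNIV}. emeasure h K) \<le> 0"
    using left_haarD(2)[OF h] by simp
  then have "\<exists>K. compact K \<and> emeasure h K \<noteq> 0"
    by (metis (mono_tags, lifting) SUP_least mem_Collect_eq order_refl)
  then obtain K where K: "compact K" "emeasure h K \<noteq> 0" by blast
  define l where "l = emeasure h ((\<lambda>p. fst p + snd p) ` (K \<times> C))"
  have l: "l < \<infinity>" unfolding l_def by (rule left_haarD(4)[OF h compact_sums_group[OF K(1) C]])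
  have "uminus ` C \<in> sets borel" by (intro borel_compact compact_continuous_image C continuous_intros)
  then have inf: "(INF U\<in>{U. open U \<and> uminus ` C \<subseteq> U}. emeasure h U) = 0"
    using left_haarD(5)[OF h, of "uminus ` C"] null by simp
  have "emeasure h K * emeasure h C \<le> ennreal (\<epsilon> * enn2real l)" if "0 < \<epsilon>" for \<epsilon>
  proof -
    have "(INF U\<in>{U. open U \<and> uminus ` C \<subseteq> U}. emeasure h U) < ennreal \<epsilon>" using inf that by simp
    then obtain U where U: "open U" "uminus ` C \<subseteq> U" "emeasure h U < ennreal \<epsilon>"
      unfolding INF_less_iff by blast
    have "emeasure h K * emeasure h C \<le> emeasure h U * l"
      unfolding l_def by (rule haar_reflect_bound[OF h K(1) C U(1,2)])
    also have "\<dots> \<le> ennreal \<epsilon> * ennreal (enn2real l)"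
      using U(3) l by (intro mult_mono) (auto simp: less_top)
    also have "\<dots> = ennreal (\<epsilon> * enn2real l)" using that by (simp add: ennreal_mult')
    finally show ?thesis .
  qed
  note bd = this
  have "emeasure h K * emeasure h C \<le> 0 + ennreal e" if "0 < e" for e
  proof -
    have "e / (enn2real l + 1) * enn2real l \<le> e"
      using mult_left_mono[of "enn2real l" "enn2real l + 1" e] that
      by (simp add: pos_divide_le_eq add_nonneg_pos)
    then have "ennreal (e / (enn2real l + 1) * enn2real l) \<le> ennreal e" by (rule ennreal_leI)
    moreover have "0 < e / (enn2real l + 1)" using that by (intro divide_pos_pos add_nonneg_pos) auto
    ultimately show ?thesis using bd[of "e / (enn2real l + 1)"] by (auto intro: order_trans)
  qed
  then have "emeasure h K * emeasure h C \<le> 0" by (rule ennreal_le_epsilon)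
  then show ?thesis using K(2) by simp
qed

text \<open>The reflection of null sets is known for compact sets. If the reflected set had positive
  \<open>M\<close>-measure, regularity of \<open>M\<close> would provide a compact subset of
  positive measure, whose own reflection lies in the null set \<open>E\<close>.\<close>

lemma abs_continuous_reflect:
  fixes h :: "'g::{topological_group_add, t2_space} measure"
  assumes h: "left_haar h" and reg: "regular_measure M"
    and ac: "\<And>A. A \<in> sets borel \<Longrightarrow> emeasure h A = 0 \<Longrightarrow> measure M A = 0"
    and E: "E \<in> sets borel" "emeasure h E = 0"
  shows "measure M (uminus -` E) = 0"
proof (rule ccontr)
  interpret finite_measure M by (rule regular_measure_finite[OF reg])
  note sM = regular_measure_sets[OF reg]
  assume "measure M (uminus -` E) \<noteq> 0"
  then have pos: "0 < measure M (uminus -` E)" by (simp add: less_le)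
  have E': "uminus -` E \<in> sets borel"
    using measurable_sets[OF borel_measurable_uminus_group E(1)] by simp
  obtain K U where K: "compact K" "open U" "K \<subseteq> uminus -` E" "uminus -` E \<subseteq> U" "measure M (U - K) < measure M (uminus -` E)"
    using regular_measure_approx[OF reg E' pos] by (elim exE conjE)
  have Kb: "K \<in> sets borel" by (rule borel_compact[OF K(1)])
  have "measure M (uminus -` E) \<le> measure M (K \<union> (U - K))"
    using K(2,3,4) Kb by (intro finite_measure_mono) (auto simp: sM)
  also have "\<dots> \<le> measure M K + measure M (U - K)"
    using K(2) Kb by (intro measure_subadditive) (auto simp: sM)
  finally have "0 < measure M K" using K(5) by linarith
  have "uminus ` K \<subseteq> E" using K(3) by auto
  then have "emeasure h (uminus ` K) \<le> emeasure h E"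
    using E(1) by (intro emeasure_mono) (auto simp: left_haarD(1)[OF h])
  then have "emeasure h K = 0"
    using E(2) by (intro haar_null_compact_reflect[OF h K(1)]) simp
  then show False using ac[OF Kb] \<open>0 < measure M K\<close> by simp
qed

section \<open>Coefficient operators in the operator algebras of \<open>\<pi>\<close>\<close>

lemma L2_cnj: "L2 M g \<Longrightarrow> L2 M (\<lambda>s. cnj (g s))"
  unfolding L2_def by (auto intro!: borel_measurable_continuous_on[where f = cnj] continuous_intros)

lemma L2_mult_bounded:
  fixes M :: "'g::topological_space measure"
  assumes M: "sets M = sets borel" and h: "bounded_borel h" and g: "L2 M g"
  shows "L2 M (\<lambda>s. h s * g s)"
proof -
  have [measurable]: "g \<in> borel_measurable borel" using g by (simp add: L2_def)
  have [measurable]: "h \<in> borel_measurable borel" using h by (rule bounded_borelD)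
  obtain B where B: "0 \<le> B" "\<And>x. norm (h x) \<le> B" using h by (rule bounded_borelE) blast
  have m: "(\<lambda>s. h s * g s) \<in> borel_measurable borel" by measurable
  have "integrable M (\<lambda>s. (norm (h s * g s))\<^sup>2)"
  proof (rule Bochner_Integration.integrable_bound)
    show "integrable M (\<lambda>s. B\<^sup>2 * (norm (g s))\<^sup>2)" using g by (simp add: L2_def)
    show "(\<lambda>s. (norm (h s * g s))\<^sup>2) \<in> borel_measurable M"
      unfolding measurable_cong_sets[OF M refl] by measurable
    show "AE s in M. norm ((norm (h s * g s))\<^sup>2) \<le> norm (B\<^sup>2 * (norm (g s))\<^sup>2)"
      using B by (intro AE_I2) (simp add: norm_mult power_mult_distrib mult_right_mono power_mono)
  qed
  then show ?thesis using m by (simp add: L2_def)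
qed

lemma dens_in_L1_measures:
  fixes N :: "'g::{topological_group_add, t2_space} measure"
  assumes reg: "regular_measure N" and g: "L2 N g" and h: "left_haar h"
    and ac: "\<And>A. A \<in> sets borel \<Longrightarrow> emeasure h A = 0 \<Longrightarrow> measure N A = 0"
  shows "dens N g \<in> L1_measures"
proof -
  interpret N: finite_measure N by (rule regular_measure_finite[OF reg])
  note sN = regular_measure_sets[OF reg]
  have "dens N g A = 0" if A: "A \<in> sets borel" "emeasure h A = 0" for A
  proof -
    have "A \<in> null_sets N" using ac[OF A] A(1) by (intro null_setsI) (simp_all add: N.emeasure_eq_measure sN)
    then have "AE x in N. indicator A x *\<^sub>R g x = 0"
      by (rule AE_mp[OF AE_not_in]) (simp add: indicator_def)
    then show ?thesis unfolding dens_def by (simp add: integral_eq_zero_AE)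
  qed
  then show ?thesis unfolding L1_measures_def using dens_in_complex_measures[OF reg g] h by blast
qed

context strongly_continuous_rep
begin

text \<open>Vector functionals determine an operator, and normal functionals are series of them with
  a majorant independent of \<open>s\<close>. Hence the forms alone identify the weak*
  integral.\<close>

lemma integrated_rep_eqI:
  assumes l: "cm_finite l"
    and T: "\<And>\<xi> \<eta>. cinner (app T \<xi>) \<eta> = cm_integral l (\<lambda>s. cinner (app (\<pi> s) \<xi>) \<eta>)"
  shows "integrated_rep \<pi> l = T"
  unfolding integrated_rep_def
proof (rule the_equality)
  show "\<forall>\<omega>\<in>predual. has_cm_integral l (\<lambda>s. \<omega> (\<pi> s)) (\<omega> T)"
  proof
    fix \<omega> :: "'h bop \<Rightarrow> complex" assume \<omega>: "\<omega> \<in> predual"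
    obtain x y where d: "predual_data \<omega> x y" by (rule predual_dataE[OF \<omega>])
    have hs: "((\<lambda>n. cinner (app S (x n)) (y n)) has_sum \<omega> S) UNIV" for S
      using d by (simp add: predual_data_def)
    have bd: "norm (cinner (app (\<pi> s) (x n)) (y n)) \<le> norm (x n) * norm (y n)" for s n
      using cinner_cauchy_schwarz[of "app (\<pi> s) (x n)" "y n"] by simp
    have c: "(\<lambda>n. norm (x n) * norm (y n)) summable_on UNIV" using d by (simp add: predual_data_def)
    note s = cm_integral_has_sum[OF l bounded_borel_pi borel_measurable_predual_pi[OF \<omega>] hs bd c]
    have "cm_integral l (\<lambda>s. \<omega> (\<pi> s)) = \<omega> T"
      using has_sum_unique[OF s(2)] hs[of T] by (simp add: T)
    then show "has_cm_integral l (\<lambda>s. \<omega> (\<pi> s)) (\<omega> T)"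
      using has_cm_integral_bounded[OF l s(1)] by simp
  qed
  fix S assume S: "\<forall>\<omega>\<in>predual. has_cm_integral l (\<lambda>s. \<omega> (\<pi> s)) (\<omega> S)"
  show "S = T"
  proof (rule bop_eqI_cinner)
    fix x y
    have "has_cm_integral l (\<lambda>s. cinner (app (\<pi> s) x) y) (cinner (app S x) y)"
      using bspec[OF S vector_functional_in_predual[of x y]] .
    then show "cinner (app S x) y = cinner (app T x) y" by (simp add: T has_cm_integral_def)
  qed
qed

lemma integrated_rep_dens:
  assumes reg: "regular_measure M" and g: "L2 M g"
    and T: "\<And>\<xi> \<eta>. cinner (app T \<xi>) \<eta> = (LINT s|M. cinner (app (\<pi> s) \<xi>) \<eta> * g s)"
  shows "integrated_rep \<pi> (dens M g) = T"
proof (rule integrated_rep_eqI[OF complex_measures_finite[OF dens_in_complex_measures[OF reg g]]])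
  show "cinner (app T \<xi>) \<eta> = cm_integral (dens M g) (\<lambda>s. cinner (app (\<pi> s) \<xi>) \<eta>)" for \<xi> \<eta>
    using dens_integral[OF regular_measureD(1,2)[OF reg] g bounded_borel_pi[of \<xi> \<eta>]]
    by (simp add: T has_cm_integral_def)
qed

end

context rep_l2_basis
begin

lemma cinner_adj_coeff_op:
  assumes h: "bounded_borel h" and e: "e \<in> E"
  shows "cinner (app (adj (coeff_op (\<lambda>s. cnj (h s)) e)) \<xi>) \<eta> = (LINT s|M. cinner (app (\<pi> s) \<xi>) \<eta> * (h s * e s))"
proof -
  obtain B where B: "0 \<le> B" "\<And>x. norm (h x) \<le> B" using h by (rule bounded_borelE) blast
  have hm: "bounded_borel (\<lambda>s. cnj (h s))"
    by (rule bounded_borelI[where C = B], intro borel_measurable_continuous_on[OF _ bounded_borelD[OF h]] continuous_intros)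
      (use B in simp)
  have "cinner (app (adj (coeff_op (\<lambda>s. cnj (h s)) e)) \<xi>) \<eta> = cnj (cinner (app (coeff_op (\<lambda>s. cnj (h s)) e) \<eta>) \<xi>)"
    unfolding cinner_adj_left by (rule cinner_commute)
  also have "\<dots> = (LINT s|M. cnj (cinner (app (\<pi> (- s)) \<eta>) \<xi> * (cnj (h s) * cnj (e s))))"
    unfolding cinner_coeff_op[OF hm e] by (rule Bochner_Integration.integral_cnj[symmetric])
  also have "\<dots> = (LINT s|M. cinner (app (\<pi> s) \<xi>) \<eta> * (h s * e s))"
    by (simp add: cinner_pi cinner_commute[of _ \<xi>])
  finally show ?thesis .
qed

lemma cinner_coeff_op_one:
  assumes e: "e \<in> E"
  shows "cinner (app (coeff_op (\<lambda>s. 1) e) \<xi>) \<eta> = (LINT s|M. cinner (app (\<pi> (- s)) \<xi>) \<eta> * cnj (e s))"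
  using cinner_coeff_op[OF bounded_borelI[of "\<lambda>s. 1" 1] e] by simp

text \<open>The second operator integrates \<open>\<pi> (- s)\<close>; the substitution of
  \<open>- s\<close> for \<open>s\<close> turns it into an integral of \<open>\<pi>\<close> against
  a density for the reflected measure.\<close>

lemma coeff_op_integrated:
  assumes reg: "regular_measure M" and h: "bounded_borel h" and e: "e \<in> E"
  shows "adj (coeff_op (\<lambda>s. cnj (h s)) e) = integrated_rep \<pi> (dens M (\<lambda>s. h s * e s))"
    and "coeff_op (\<lambda>s. 1) e = integrated_rep \<pi> (dens (distr M borel uminus) (\<lambda>s. cnj (e (- s))))"
proof -
  show "adj (coeff_op (\<lambda>s. cnj (h s)) e) = integrated_rep \<pi> (dens M (\<lambda>s. h s * e s))"
    by (rule integrated_rep_dens[OF reg L2_mult_bounded[OF sets_M h L2_E[OF e]] cinner_adj_coeff_op[OF h e], symmetric])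
  have L: "L2 (distr M borel uminus) (\<lambda>s. cnj (e (- s)))"
    by (rule L2_cnj[OF L2_reflect[OF sets_M L2_E[OF e]]])
  show "coeff_op (\<lambda>s. 1) e = integrated_rep \<pi> (dens (distr M borel uminus) (\<lambda>s. cnj (e (- s))))"
  proof (rule integrated_rep_dens[OF regular_measure_reflect[OF reg] L, symmetric])
    fix \<xi> \<eta>
    have "(\<lambda>s. cnj (e (- s))) \<in> borel_measurable borel" using L by (simp add: L2_def)
    then have "(\<lambda>s. cinner (app (\<pi> s) \<xi>) \<eta> * cnj (e (- s))) \<in> borel_measurable borel"
      using bounded_borelD[OF bounded_borel_pi] by (rule borel_measurable_times[rotated])
    from integral_reflect[OF sets_M this]
    show "cinner (app (coeff_op (\<lambda>s. 1) e) \<xi>) \<eta>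
        = (LINT s|distr M borel uminus. cinner (app (\<pi> s) \<xi>) \<eta> * cnj (e (- s)))"
      unfolding cinner_coeff_op_one[OF e] by simp
  qed
qed

lemma coeff_op_in_Mstar:
  assumes reg: "regular_measure M" and h: "bounded_borel h" and e: "e \<in> E"
  shows "adj (coeff_op (\<lambda>s. cnj (h s)) e) \<in> Mstar \<pi>" and "coeff_op (\<lambda>s. 1) e \<in> Mstar \<pi>"
  unfolding coeff_op_integrated[OF assms] Mstar_def
  by (intro subsetD[OF closure_subset] imageI dens_in_complex_measures reg regular_measure_reflect
      L2_mult_bounded[OF sets_M h] L2_cnj L2_reflect[OF sets_M] L2_E[OF e])+

lemma coeff_op_in_Cstar:
  assumes reg: "regular_measure M" and h: "bounded_borel h" and e: "e \<in> E" and haar: "left_haar l"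
    and ac: "\<And>A. A \<in> sets borel \<Longrightarrow> emeasure l A = 0 \<Longrightarrow> measure M A = 0"
  shows "adj (coeff_op (\<lambda>s. cnj (h s)) e) \<in> Cstar \<pi>" and "coeff_op (\<lambda>s. 1) e \<in> Cstar \<pi>"
proof -
  have ac': "measure (distr M borel uminus) A = 0" if A: "A \<in> sets borel" "emeasure l A = 0" for A
    using abs_continuous_reflect[OF haar reg ac A] A(1) by (subst measure_distr) simp_all
  show "adj (coeff_op (\<lambda>s. cnj (h s)) e) \<in> Cstar \<pi>"
    unfolding coeff_op_integrated(1)[OF reg h e] Cstar_def
    by (intro subsetD[OF closure_subset] imageI dens_in_L1_measures[OF reg _ haar ac] L2_mult_bounded[OF sets_M h] L2_E[OF e])
  show "coeff_op (\<lambda>s. 1) e \<in> Cstar \<pi>"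
    unfolding coeff_op_integrated(2)[OF reg h e] Cstar_def
    by (intro subsetD[OF closure_subset] imageI dens_in_L1_measures[OF regular_measure_reflect[OF reg] _ haar ac']
        L2_cnj L2_reflect[OF sets_M] L2_E[OF e])
qed

end

text \<open>All Borel subsets of a Haar null set are Haar null, so \<mu> vanishes on each of them
  and its total variation vanishes too.\<close>

lemma L1_measures_abs_continuous:
  fixes \<mu> :: "'g::{topological_group_add, t2_space} set \<Rightarrow> complex"
  assumes "\<mu> \<in> L1_measures"
  obtains l where "left_haar l" "\<And>A. A \<in> sets borel \<Longrightarrow> emeasure l A = 0 \<Longrightarrow> measure (tv_measure \<mu>) A = 0"
proof -
  have \<mu>: "\<mu> \<in> complex_measures" using assms by (simp add: L1_measures_def)
  note f = complex_measures_finite[OF \<mu>]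
  obtain l where l: "left_haar l" "\<forall>E\<in>sets borel. emeasure l E = 0 \<longrightarrow> \<mu> E = 0"
    using assms unfolding L1_measures_def by blast
  have "measure (tv_measure \<mu>) A = 0" if A: "A \<in> sets borel" "emeasure l A = 0" for A
  proof -
    have "total_variation \<mu> A \<le> emeasure l A"
    proof (rule total_variation_le_measure[OF left_haarD(1)[OF l(1)] A(1)])
      fix C assume C: "C \<in> sets borel" "C \<subseteq> A"
      have "emeasure l C \<le> emeasure l A" using C A(1) by (intro emeasure_mono) (auto simp: left_haarD(1)[OF l(1)])
      then show "ennreal (norm (\<mu> C)) \<le> emeasure l C" using l(2) C(1) A(2) by simp
    qed
    then show ?thesis using measure_tv_le[OF f A(1), of 0] A(2) by (simp add: measure_le_0_iff)
  qed
  then show ?thesis using that[OF l(1)] by blast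
qed

context strongly_continuous_rep
begin

lemma gamma_op_in_Mstar:
  assumes \<mu>: "\<mu> \<in> complex_measures"
  shows "gamma_op \<mu> \<in> Mstar \<pi> \<otimes>eh Mstar \<pi>"
proof (rule gamma_op_family[OF complex_measures_tight[OF \<mu>]])
  fix E h
  let ?c = "rep_l2_basis.coeff_op \<pi> (tv_measure \<mu>)"
  assume b: "rep_l2_basis \<pi> (tv_measure \<mu>) E" and h: "bounded_borel h"
    and fam: "\<And>V W. (\<And>e. e \<in> E \<Longrightarrow> adj (?c (\<lambda>s. cnj (h s)) e) \<in> V) \<Longrightarrow> (\<And>e. e \<in> E \<Longrightarrow> ?c (\<lambda>s. 1) e \<in> W) \<Longrightarrow>
      eh_family V W E (\<lambda>e. adj (?c (\<lambda>s. cnj (h s)) e)) (?c (\<lambda>s. 1))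
        (scaleC_bop (l2_space.sqn (tv_measure \<mu>) h) 1) (scaleC_bop (measure (tv_measure \<mu>) UNIV) 1) (gamma_op \<mu>)"
  interpret rep_l2_basis \<pi> "tv_measure \<mu>" E by fact
  show ?thesis
    by (rule eh_family_in_ext_haagerup[OF fam]) (rule coeff_op_in_Mstar[OF complex_measures_regular[OF \<mu>] h], assumption)+
qed

lemma gamma_op_in_Cstar:
  assumes "\<mu> \<in> L1_measures"
  shows "gamma_op \<mu> \<in> Cstar \<pi> \<otimes>eh Cstar \<pi>"
proof -
  have \<mu>: "\<mu> \<in> complex_measures" using assms by (simp add: L1_measures_def)
  obtain l where l: "left_haar l" "\<And>A. A \<in> sets borel \<Longrightarrow> emeasure l A = 0 \<Longrightarrow> measure (tv_measure \<mu>) A = 0"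
    by (rule L1_measures_abs_continuous[OF assms]) blast
  show ?thesis
  proof (rule gamma_op_family[OF complex_measures_tight[OF \<mu>]])
    fix E h
    let ?c = "rep_l2_basis.coeff_op \<pi> (tv_measure \<mu>)"
    assume b: "rep_l2_basis \<pi> (tv_measure \<mu>) E" and h: "bounded_borel h"
      and fam: "\<And>V W. (\<And>e. e \<in> E \<Longrightarrow> adj (?c (\<lambda>s. cnj (h s)) e) \<in> V) \<Longrightarrow> (\<And>e. e \<in> E \<Longrightarrow> ?c (\<lambda>s. 1) e \<in> W) \<Longrightarrow>
        eh_family V W E (\<lambda>e. adj (?c (\<lambda>s. cnj (h s)) e)) (?c (\<lambda>s. 1))
          (scaleC_bop (l2_space.sqn (tv_measure \<mu>) h) 1) (scaleC_bop (measure (tv_measure \<mu>) UNIV) 1) (gamma_op \<mu>)"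
    interpret rep_l2_basis \<pi> "tv_measure \<mu>" E by fact
    show ?thesis
      by (rule eh_family_in_ext_haagerup[OF fam])
        (rule coeff_op_in_Cstar[OF complex_measures_regular[OF \<mu>] h _ l], assumption+)+
  qed
qed

end

section \<open>Approximation by finite sums and norm convergence\<close>

context strongly_continuous_rep
begin

definition norm_approximable :: "'g measure \<Rightarrow> bool"
  where "norm_approximable M \<longleftrightarrow> (\<forall>\<epsilon>>0. \<exists>Y B. finite Y \<and> (\<forall>y\<in>Y. B y \<in> sets borel) \<and> disjoint_family_on B Y \<and>
    (\<forall>y\<in>Y. \<forall>s\<in>B y. norm (\<pi> s - \<pi> y) \<le> \<epsilon>) \<and> measure M (- (\<Union>y\<in>Y. B y)) \<le> \<epsilon>)"

text \<open>It lets one partition serve for \<open>\<pi>\<close> and for its adjoints, hence for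
  both factors of the series.\<close>

lemma norm_pi_minus_diff_le: "norm (\<pi> (- s) - \<pi> (- y)) \<le> norm (\<pi> s - \<pi> y)"
proof -
  have "\<pi> (- s) - \<pi> (- y) = \<pi> (- s) * (\<pi> y - \<pi> s) * \<pi> (- y)"
    by (simp add: algebra_simps flip: pi_add)
  also have "norm \<dots> \<le> norm (\<pi> (- s)) * norm (\<pi> y - \<pi> s) * norm (\<pi> (- y))"
    by (rule order_trans[OF norm_mult_ineq]) (intro mult_right_mono norm_mult_ineq norm_ge_zero)
  also have "\<dots> \<le> 1 * norm (\<pi> y - \<pi> s) * 1"
    by (intro mult_mono norm_pi_le) auto
  finally show ?thesis by (simp add: norm_minus_commute)
qed

lemma norm_approximable_continuous:
  assumes cont: "continuous_on UNIV \<pi>"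
    and tight: "\<And>e. 0 < e \<Longrightarrow> \<exists>K. compact K \<and> K \<in> sets borel \<and> measure M (- K) < e"
  shows "norm_approximable M"
  unfolding norm_approximable_def
proof (intro allI impI)
  fix e :: real assume e: "0 < e"
  obtain K where K: "compact K" "measure M (- K) < e" using tight[OF e] by (elim exE conjE)
  define W where "W y = \<pi> -` ball (\<pi> y) e" for y
  have W: "open (W y) \<and> y \<in> W y" for y
    unfolding W_def using e cont by (auto intro: open_vimage)
  obtain Y B where Y: "finite Y" "\<And>y. y \<in> Y \<Longrightarrow> B y \<in> sets borel \<and> B y \<subseteq> W y"
    "disjoint_family_on B Y" "(\<Union>y\<in>Y. B y) = K"
    by (rule compact_borel_partition[OF K(1) W]) blast
  have "norm (\<pi> s - \<pi> y) \<le> e" if "y \<in> Y" "s \<in> B y" for s y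
  proof -
    have "s \<in> W y" using Y(2)[OF that(1)] that(2) by blast
    then show ?thesis by (simp add: W_def dist_norm norm_minus_commute)
  qed
  then show "\<exists>Y B. finite Y \<and> (\<forall>y\<in>Y. B y \<in> sets borel) \<and> disjoint_family_on B Y \<and>
    (\<forall>y\<in>Y. \<forall>s\<in>B y. norm (\<pi> s - \<pi> y) \<le> e) \<and> measure M (- (\<Union>y\<in>Y. B y)) \<le> e"
    using Y(1,3) less_imp_le[OF K(2)] unfolding Y(4)[symmetric]
    by (intro exI[of _ Y] exI[of _ B] conjI ballI) (simp_all add: Y(2))
qed

text \<open>Off the finite set \<open>F\<close> the measure \<mu> coincides with its difference to
  the finite combination, which has small norm. The pieces are the points of \<open>F\<close>, where
  \<pi> is approximated without error.\<close>

lemma norm_approximable_l1: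
  assumes "\<mu> \<in> l1_measures"
  shows "norm_approximable (tv_measure \<mu>)"
  unfolding norm_approximable_def
proof (intro allI impI)
  fix e :: real assume e: "0 < e"
  have \<mu>: "\<mu> \<in> complex_measures" using assms by (simp add: l1_measures_def)
  note f = complex_measures_finite[OF \<mu>]
  obtain F and c :: "'g \<Rightarrow> complex" where F: "finite F" "cm_norm (\<lambda>E. \<mu> E - (\<Sum>s\<in>F. c s * dirac s E)) < e"
    using assms e unfolding l1_measures_def by blast
  define d where "d E = (\<Sum>s\<in>F. c s * dirac s E)" for E
  have "cm_finite d" unfolding d_def by (rule complex_measures_finite[OF finite_combination_complex_measure[OF F(1)]])
  then have fd: "cm_finite (\<lambda>E. \<mu> E - d E)"
    using cm_finite_add(1)[OF f cm_finite_cmult(1)[of d "- 1"]] by simp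
  have Fb: "F \<in> sets borel" by (rule borel_compact[OF finite_imp_compact[OF F(1)]])
  then have Fc: "- F \<in> sets borel" by (rule borel_comp)
  have "total_variation \<mu> (- F) = total_variation (\<lambda>E. \<mu> E - d E) (- F)"
    unfolding total_variation_partitions
  proof (intro SUP_cong refl sum.cong)
    fix P A assume "P \<in> borel_partitions (- F)" "A \<in> P"
    then have "A \<subseteq> - F" by (auto simp: borel_partitions_def)
    then have "d A = 0" unfolding d_def by (intro sum.neutral) (auto simp: dirac_def)
    then show "ennreal (norm (\<mu> A)) = ennreal (norm (\<mu> A - d A))" by simp
  qed
  also have "\<dots> \<le> total_variation (\<lambda>E. \<mu> E - d E) UNIV"
    using fd Fc by (intro total_variation_mono) (auto simp: cm_finite_def)
  also have "\<dots> = ennreal (cm_norm (\<lambda>E. \<mu> E - d E))"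
    using fd by (simp add: cm_norm_def cm_finite_def less_top)
  finally have "measure (tv_measure \<mu>) (- F) \<le> cm_norm (\<lambda>E. \<mu> E - d E)"
    by (rule measure_tv_le[OF f Fc _ cm_norm_nonneg])
  also have "\<dots> < e" using F(2) by (simp add: d_def)
  finally have "measure (tv_measure \<mu>) (- (\<Union>y\<in>F. {y})) \<le> e" by simp
  moreover have "disjoint_family_on (\<lambda>y. {y}) F" by (auto simp: disjoint_family_on_def)
  moreover have "{y} \<in> sets borel" for y :: 'g by simp
  ultimately show "\<exists>Y B. finite Y \<and> (\<forall>y\<in>Y. B y \<in> sets borel) \<and> disjoint_family_on B Y \<and>
    (\<forall>y\<in>Y. \<forall>s\<in>B y. norm (\<pi> s - \<pi> y) \<le> e) \<and> measure (tv_measure \<mu>) (- (\<Union>y\<in>Y. B y)) \<le> e"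
    using F(1) e by (intro exI[of _ F] exI[of _ "\<lambda>y. {y}"]) auto
qed

text \<open>In the applications \<open>p\<close> is the identity or the inversion.\<close>

lemma finite_sum_in_integrated_rep:
  fixes p :: "'g \<Rightarrow> 'g"
  assumes Y: "finite Y" and p: "inj p"
  shows "(\<Sum>y\<in>Y. scaleC_bop (c y) (\<pi> (p y))) \<in> integrated_rep \<pi> ` l1_measures"
proof -
  have F: "finite (p ` Y)" using Y by simp
  \<comment> \<open>Injectivity of \<open>p\<close> lets the coefficients be carried over to the
    points \<open>p y\<close>.\<close>
  define k where "k = c \<circ> inv p"
  have k: "k (p y) = c y" for y using p by (simp add: k_def)
  have i: "inj_on p Y" using p by (rule inj_on_subset) simp
  have "integrated_rep \<pi> (\<lambda>E. \<Sum>x\<in>p ` Y. k x * dirac x E) = (\<Sum>y\<in>Y. scaleC_bop (c y) (\<pi> (p y)))"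
  proof (rule integrated_rep_eqI[OF complex_measures_finite[OF finite_combination_complex_measure[OF F]]])
    fix \<xi> \<eta>
    have "cm_integral (\<lambda>E. \<Sum>x\<in>p ` Y. k x * dirac x E) (\<lambda>s. cinner (app (\<pi> s) \<xi>) \<eta>) = (\<Sum>x\<in>p ` Y. k x * cinner (app (\<pi> x) \<xi>) \<eta>)"
      using finite_combination_integral[OF F bounded_borel_pi] by (simp add: has_cm_integral_def)
    then show "cinner (app (\<Sum>y\<in>Y. scaleC_bop (c y) (\<pi> (p y))) \<xi>) \<eta> = cm_integral (\<lambda>E. \<Sum>x\<in>p ` Y. k x * dirac x E) (\<lambda>s. cinner (app (\<pi> s) \<xi>) \<eta>)"
      by (simp add: app.sum_left cinner.sum_left cinner_scaleC_left sum.reindex[OF i] k)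
  qed
  from this[symmetric] show ?thesis by (rule image_eqI[OF _ finite_combination_l1[OF F]])
qed

end

context rep_l2_basis
begin

text \<open>On each piece \<pi> is replaced by its value at one point, which turns \<open>T\<close>
  into a finite combination with coefficients the integrals of \<open>g\<close> over the pieces. The
  error is an integral of \<open>g\<close> against a function that is small in mean square, so
  Cauchy-Schwarz bounds it in operator norm.\<close>

lemma in_Dstar:
  fixes p :: "'g \<Rightarrow> 'g"
  assumes ap: "norm_approximable M" and g: "L2 M g" and p: "inj p" "\<And>s y. norm (\<pi> (p s) - \<pi> (p y)) \<le> norm (\<pi> s - \<pi> y)"
    and b: "\<And>\<xi> \<eta>. bounded_borel (\<lambda>s. cinner (app (\<pi> (p s)) \<xi>) \<eta>)"
    and T: "\<And>\<xi> \<eta>. cinner (app T \<xi>) \<eta> = (LINT s|M. cinner (app (\<pi> (p s)) \<xi>) \<eta> * g s)"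
  shows "T \<in> Dstar \<pi>"
  unfolding Dstar_def closure_approachable
proof (intro allI impI)
  interpret finite_measure M by (rule fin)
  fix e :: real assume e: "0 < e"
  define m where "m = measure M UNIV"
  have m: "0 \<le> m" by (simp add: m_def)
  \<comment> \<open>The final estimate is \<open>R \<le> sqrt (\<epsilon> * N)\<close>: the first
    factor of \<open>N\<close> bounds the mean square of \<open>r\<close>, the second that of
    \<open>g\<close>.\<close>
  define N where "N = (m + 3) * (sqn g + 1)"
  have N: "0 < N" using m sqn_nonneg[of g] by (simp add: N_def)
  \<comment> \<open>The bound by 1 gives \<open>\<epsilon>\<^sup>2 \<le> \<epsilon>\<close>; the
    factor 2 makes the final inequality strict.\<close>
  define \<epsilon> where "\<epsilon> = min 1 (e\<^sup>2 / (2 * N))"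
  have \<epsilon>: "0 < \<epsilon>" "\<epsilon> \<le> 1" using e N by (auto simp: \<epsilon>_def)
  have "\<epsilon> * N \<le> e\<^sup>2 / (2 * N) * N" using N by (intro mult_right_mono) (auto simp: \<epsilon>_def)
  also have "\<dots> = e\<^sup>2 / 2" using N by simp
  also have "\<dots> < e\<^sup>2" using e by simp
  finally have \<epsilon>N: "\<epsilon> * N < e\<^sup>2" .
  obtain Y B where Y: "finite Y" "\<forall>y\<in>Y. B y \<in> sets borel" "disjoint_family_on B Y"
    "\<forall>y\<in>Y. \<forall>s\<in>B y. norm (\<pi> s - \<pi> y) \<le> \<epsilon>" "measure M (- (\<Union>y\<in>Y. B y)) \<le> \<epsilon>"
    using mp[OF spec[OF ap[unfolded norm_approximable_def]] \<epsilon>(1)] by (elim exE conjE)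
  define U where "U = (\<Union>y\<in>Y. B y)"
  have U: "U \<in> sets borel" unfolding U_def using Y(1,2) by (intro sets.finite_UN) auto
  then have Uc: "- U \<in> sets borel" by (rule borel_comp)
  define c where "c y = (LINT s|M. indicator (B y) s * g s)" for y
  define S where "S = (\<Sum>y\<in>Y. scaleC_bop (c y) (\<pi> (p y)))"
  \<comment> \<open>Pointwise bound of the error: \<epsilon> on the pieces, and outside them the
    trivial bound 1 for a unitary with \<epsilon> added.\<close>
  define r :: "'g \<Rightarrow> real" where "r s = \<epsilon> + indicator (- U) s" for s
  have ig: "integrable M g" by (rule L2_integrable[OF fin sets_M g])
  have ind: "integrable M (indicator (- U) :: _ \<Rightarrow> real)"
    using Uc by (intro integrable_real_indicator) (auto simp: emeasure_eq_measure)
  have rm[measurable]: "r \<in> borel_measurable M" unfolding r_def using Uc by measurable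
  \<comment> \<open>The constant 3 comes from \<open>2 * \<epsilon> + 1 \<le> 3\<close> outside the
    pieces.\<close>
  have r2: "(r s)\<^sup>2 \<le> 3 * indicator (- U) s + \<epsilon>\<^sup>2" for s
  proof (cases "s \<in> U")
    case False
    then have "(r s)\<^sup>2 = \<epsilon>\<^sup>2 + 2 * \<epsilon> + 1" by (simp add: r_def power2_sum)
    then show ?thesis using False \<epsilon>(2) by simp
  qed (simp add: r_def)
  have ir: "integrable M (\<lambda>s. (r s)\<^sup>2)"
  proof (rule Bochner_Integration.integrable_bound)
    show "integrable M (\<lambda>s. 3 * indicator (- U) s + \<epsilon>\<^sup>2)" using ind by simp
    show "AE s in M. norm ((r s)\<^sup>2) \<le> norm (3 * indicator (- U) s + \<epsilon>\<^sup>2)"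
      using r2 by (intro AE_I2) simp
  qed measurable
  have "(LINT s|M. (r s)\<^sup>2) \<le> (LINT s|M. 3 * indicator (- U) s + \<epsilon>\<^sup>2)"
    using ind by (intro integral_mono ir r2) simp
  also have "\<dots> = 3 * measure M (- U) + \<epsilon>\<^sup>2 * m" using ind Uc by (simp add: m_def mult.commute)
  finally have rsq: "(LINT s|M. (r s)\<^sup>2) \<le> 3 * measure M (- U) + \<epsilon>\<^sup>2 * m" .
  have irg: "integrable M (\<lambda>s. r s * norm (g s))"
    by (intro integrable_mult_squares rm ir L2_norm_measurable L2_square g)
  define D where "D \<xi> \<eta> s = cinner (app (\<pi> (p s)) \<xi>) \<eta> - (\<Sum>y\<in>Y. indicator (B y) s * cinner (app (\<pi> (p y)) \<xi>) \<eta>)" for \<xi> \<eta> s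
  have Dr: "norm (D \<xi> \<eta> s) \<le> r s * (norm \<xi> * norm \<eta>)" for \<xi> \<eta> s
  proof (cases "s \<in> U")
    case True
    then obtain z where z: "z \<in> Y" "s \<in> B z" by (auto simp: U_def)
    have "indicator (B y) s = (if y = z then 1 else 0 :: complex)" if "y \<in> Y" for y
    proof (cases "y = z")
      case False
      then have "B y \<inter> B z = {}" using Y(3) z(1) that unfolding disjoint_family_on_def by blast
      then show ?thesis using z(2) False by (auto simp: indicator_def)
    qed (use z in simp)
    then have "(\<Sum>y\<in>Y. indicator (B y) s * cinner (app (\<pi> (p y)) \<xi>) \<eta>) = (\<Sum>y\<in>Y. if y = z then cinner (app (\<pi> (p y)) \<xi>) \<eta> else 0)"
      by (intro sum.cong) auto
    then have "D \<xi> \<eta> s = cinner (app (\<pi> (p s) - \<pi> (p z)) \<xi>) \<eta>"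
      using Y(1) z(1) by (simp add: D_def app.diff_left cinner.diff_left)
    then have "norm (D \<xi> \<eta> s) \<le> norm (\<pi> (p s) - \<pi> (p z)) * (norm \<xi> * norm \<eta>)"
      by (simp only: norm_cinner_app_le)
    also have "norm (\<pi> (p s) - \<pi> (p z)) \<le> \<epsilon>" using p(2)[of s z] Y(4) z by (meson order_trans)
    finally show ?thesis using True by (simp add: r_def mult_right_mono)
  next
    case False
    then have "indicator (B y) s = (0 :: complex)" if "y \<in> Y" for y using that by (auto simp: U_def)
    then have "norm (D \<xi> \<eta> s) \<le> 1 * (norm \<xi> * norm \<eta>)"
      using cinner_cauchy_schwarz[of "app (\<pi> (p s)) \<xi>" \<eta>] by (simp add: D_def)
    also have "\<dots> \<le> r s * (norm \<xi> * norm \<eta>)" using \<epsilon>(1) False by (intro mult_right_mono) (auto simp: r_def)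
    finally show ?thesis .
  qed
  have Db: "bounded_borel (D \<xi> \<eta>)" for \<xi> \<eta>
  proof -
    have "bounded_borel (\<lambda>s. \<Sum>y\<in>Y. indicator (B y) s * cinner (app (\<pi> (p y)) \<xi>) \<eta>)"
      using Y(2) bounded_borel_cmult[OF bounded_borel_indicator, of "B _" "cinner (app (\<pi> (p _)) \<xi>) \<eta>"]
      by (intro bounded_borel_sum Y(1)) (simp add: mult.commute)
    from bounded_borel_add[OF b bounded_borel_cmult[OF this, of "- 1"]] show ?thesis by (simp add: D_def[abs_def])
  qed
  have iDg: "integrable M (\<lambda>s. D \<xi> \<eta> s * g s)" for \<xi> \<eta>
    by (rule L2_integrable[OF fin sets_M L2_mult_bounded[OF sets_M Db g]])
  have TS: "cinner (app (T - S) \<xi>) \<eta> = (LINT s|M. D \<xi> \<eta> s * g s)" for \<xi> \<eta>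
  proof -
    have i1: "integrable M (\<lambda>s. cinner (app (\<pi> (p s)) \<xi>) \<eta> * g s)"
      by (rule L2_integrable[OF fin sets_M L2_mult_bounded[OF sets_M b g]])
    have i2: "integrable M (\<lambda>s. (indicator (B y) s * g s) * cinner (app (\<pi> (p y)) \<xi>) \<eta>)" if "y \<in> Y" for y
      by (intro integrable_mult_left L2_integrable[OF fin sets_M L2_mult_bounded[OF sets_M bounded_borel_indicator g]])
        (use Y(2) that in blast)
    have "(LINT s|M. D \<xi> \<eta> s * g s) = (LINT s|M. cinner (app (\<pi> (p s)) \<xi>) \<eta> * g s - (\<Sum>y\<in>Y. (indicator (B y) s * g s) * cinner (app (\<pi> (p y)) \<xi>) \<eta>))"
      by (intro Bochner_Integration.integral_cong refl) (simp add: D_def algebra_simps sum_distrib_left)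
    also have "\<dots> = cinner (app T \<xi>) \<eta> - (\<Sum>y\<in>Y. c y * cinner (app (\<pi> (p y)) \<xi>) \<eta>)"
      using i1 i2 by (subst Bochner_Integration.integral_diff) (auto simp: T c_def Bochner_Integration.integral_sum)
    also have "\<dots> = cinner (app (T - S) \<xi>) \<eta>"
      by (simp add: S_def app.diff_left cinner.diff_left app.sum_left cinner.sum_left cinner_scaleC_left)
    finally show ?thesis ..
  qed
  define R where "R = (LINT s|M. r s * norm (g s))"
  have r0: "0 \<le> r s" for s using \<epsilon>(1) by (simp add: r_def)
  have R0: "0 \<le> R" unfolding R_def by (intro integral_nonneg_AE AE_I2) (simp add: r0)
  have TSR: "norm (cinner (app (T - S) \<xi>) \<eta>) \<le> R * norm \<xi> * norm \<eta>" for \<xi> \<eta>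
  proof -
    have "norm (cinner (app (T - S) \<xi>) \<eta>) \<le> (LINT s|M. (r s * norm (g s)) * (norm \<xi> * norm \<eta>))"
      unfolding TS
    proof (rule norm_integral_le_integral[OF iDg integrable_mult_left[OF irg]])
      show "norm (D \<xi> \<eta> s * g s) \<le> r s * norm (g s) * (norm \<xi> * norm \<eta>)" for s
        using mult_right_mono[OF Dr[of \<xi> \<eta> s], of "norm (g s)"] by (simp add: norm_mult mult_ac)
    qed
    then show ?thesis unfolding integral_mult_left_zero by (simp add: R_def mult.assoc)
  qed
  have "norm (app (T - S) \<xi>) \<le> R * norm \<xi>" for \<xi>
    using R0 by (intro norm_leI_cinner[OF TSR]) simp
  then have TR: "norm (T - S) \<le> R" by (rule norm_bop_leI[OF R0])
  have "R \<le> sqrt (LINT s|M. (r s)\<^sup>2) * sqrt (sqn g)"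
    unfolding R_def sqn_def by (intro integral_cauchy_schwarz ir L2_square g irg)
  also have "\<dots> \<le> sqrt (\<epsilon> * (m + 3)) * sqrt (sqn g + 1)"
  proof (intro mult_mono real_sqrt_le_mono)
    have "\<epsilon>\<^sup>2 \<le> \<epsilon>" using \<epsilon> by (simp add: power2_eq_square mult_left_le)
    then have "\<epsilon>\<^sup>2 * m \<le> \<epsilon> * m" using m by (rule mult_right_mono)
    then show "(LINT s|M. (r s)\<^sup>2) \<le> \<epsilon> * (m + 3)"
      using rsq Y(5) by (simp add: U_def algebra_simps)
  qed (use m \<epsilon> sqn_nonneg[of g] in auto)
  also have "\<dots> = sqrt (\<epsilon> * N)" by (simp add: N_def real_sqrt_mult)
  also have "\<dots> < sqrt (e\<^sup>2)" using \<epsilon>N by (simp only: real_sqrt_less_iff)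
  finally have "R < e" using e by simp
  then have "dist S T < e" using TR by (simp add: dist_norm norm_minus_commute)
  then show "\<exists>y\<in>integrated_rep \<pi> ` l1_measures. dist y T < e"
    using finite_sum_in_integrated_rep[OF Y(1) p(1), of c] unfolding S_def by blast
qed

lemma coeff_op_in_Dstar:
  assumes ap: "norm_approximable M" and h: "bounded_borel h" and e: "e \<in> E"
  shows "adj (coeff_op (\<lambda>s. cnj (h s)) e) \<in> Dstar \<pi>" and "coeff_op (\<lambda>s. 1) e \<in> Dstar \<pi>"
proof -
  show "adj (coeff_op (\<lambda>s. cnj (h s)) e) \<in> Dstar \<pi>"
    by (rule in_Dstar[where p = "\<lambda>s. s", OF ap L2_mult_bounded[OF sets_M h L2_E[OF e]] _ _ bounded_borel_pi cinner_adj_coeff_op[OF h e]])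
      simp_all
  have "bounded_borel (\<lambda>s. cinner (app (\<pi> (- s)) \<xi>) \<eta>)" for \<xi> \<eta>
  proof (rule bounded_borelI)
    show "(\<lambda>s. cinner (app (\<pi> (- s)) \<xi>) \<eta>) \<in> borel_measurable borel"
      by (intro borel_measurable_continuous_onI cinner.continuous_on continuous_pi_minus continuous_on_const)
    show "norm (cinner (app (\<pi> (- s)) \<xi>) \<eta>) \<le> norm \<xi> * norm \<eta>" for s
      using cinner_cauchy_schwarz[of "app (\<pi> (- s)) \<xi>" \<eta>] by simp
  qed
  then show "coeff_op (\<lambda>s. 1) e \<in> Dstar \<pi>"
    by (intro in_Dstar[where p = uminus, OF ap L2_cnj[OF L2_E[OF e]] _ norm_pi_minus_diff_le _ cinner_coeff_op_one[OF e]])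
      simp_all
qed

text \<open>The scalar functions of the approximation do not depend on \<xi>, and the error is
  proportional to the square of \<open>norm \<xi>\<close>. This uniformity distinguishes norm from
  weak* convergence of the sums of squares.\<close>

lemma vsq_orbit_diff_le:
  assumes c: "bounded_borel c" "\<And>s. norm (c s) \<le> 1"
    and Y: "finite Y" "\<forall>y\<in>Y. B y \<in> sets borel" "disjoint_family_on B Y"
      "\<forall>y\<in>Y. \<forall>s\<in>B y. norm (\<pi> s - \<pi> y) \<le> \<epsilon>" "measure M (- (\<Union>y\<in>Y. B y)) \<le> \<epsilon>"
    and \<epsilon>: "0 < \<epsilon>" "\<epsilon> \<le> 1"
  shows "vsq (\<lambda>s. orbit c \<xi> s - (\<Sum>y\<in>Y. scaleC (c s * indicator (B y) s) (app (\<pi> (- y)) \<xi>)))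
    \<le> \<epsilon> * (measure M UNIV + 1) * (norm \<xi>)\<^sup>2"
proof -
  interpret finite_measure M by (rule fin)
  define m where "m = measure M UNIV"
  define U where "U = (\<Union>y\<in>Y. B y)"
  have "U \<in> sets borel" unfolding U_def using Y(1,2) by (intro sets.finite_UN) auto
  then have Uc: "- U \<in> sets borel" by (rule borel_comp)
  have ind: "integrable M (indicator (- U) :: _ \<Rightarrow> real)"
    using Uc by (intro integrable_real_indicator) (auto simp: emeasure_eq_measure)
  define H where "H s = orbit c \<xi> s - (\<Sum>y\<in>Y. scaleC (c s * indicator (B y) s) (app (\<pi> (- y)) \<xi>))" for s
  have H: "vL2 H" unfolding H_def
  proof (rule vL2_diff_sum[OF vL2_orbit[OF c(1)] Y(1)])
    show "L2 M (\<lambda>s. c s * indicator (B y) s)" if "y \<in> Y" for y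
      using Y(2) that by (intro L2_bounded bounded_borel_mult c(1) bounded_borel_indicator) blast
  qed
  have pt: "(norm (H s))\<^sup>2 \<le> (\<epsilon> + indicator (- U) s) * (norm \<xi>)\<^sup>2" for s
  proof (cases "s \<in> U")
    case True
    then obtain z where z: "z \<in> Y" "s \<in> B z" by (auto simp: U_def)
    have "indicator (B y) s = (if y = z then 1 else 0 :: complex)" if "y \<in> Y" for y
    proof (cases "y = z")
      case False
      then have "B y \<inter> B z = {}" using Y(3) z(1) that unfolding disjoint_family_on_def by blast
      then show ?thesis using z(2) False by (auto simp: indicator_def)
    qed (use z in simp)
    then have "(\<Sum>y\<in>Y. scaleC (c s * indicator (B y) s) (app (\<pi> (- y)) \<xi>)) = (\<Sum>y\<in>Y. if y = z then scaleC (c s) (app (\<pi> (- y)) \<xi>) else 0)"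
      by (intro sum.cong) auto
    then have "H s = scaleC (c s) (app (\<pi> (- s) - \<pi> (- z)) \<xi>)"
      using Y(1) z(1) by (simp add: H_def orbit_def app.diff_left scaleC.diff_right)
    then have "norm (H s) = norm (c s) * norm (app (\<pi> (- s) - \<pi> (- z)) \<xi>)" by (simp only: norm_scaleC)
    also have "\<dots> \<le> 1 * (\<epsilon> * norm \<xi>)"
    proof (intro mult_mono c(2))
      have "norm (\<pi> (- s) - \<pi> (- z)) \<le> \<epsilon>" using norm_pi_minus_diff_le[of s z] Y(4) z by (meson order_trans)
      then show "norm (app (\<pi> (- s) - \<pi> (- z)) \<xi>) \<le> \<epsilon> * norm \<xi>"
        by (rule order_trans[OF norm_app mult_right_mono]) simp
    qed auto
    finally have "(norm (H s))\<^sup>2 \<le> (\<epsilon> * norm \<xi>)\<^sup>2" by (intro power_mono) auto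
    also have "\<dots> \<le> \<epsilon> * (norm \<xi>)\<^sup>2"
      unfolding power_mult_distrib using \<epsilon> by (intro mult_right_mono) (auto simp: power2_eq_square mult_left_le)
    finally show ?thesis using True by simp
  next
    case False
    then have "indicator (B y) s = (0 :: complex)" if "y \<in> Y" for y using that by (auto simp: U_def)
    then have "norm (H s) \<le> 1 * norm \<xi>"
      using mult_right_mono[OF c(2)[of s], of "norm \<xi>"] by (simp add: H_def orbit_def norm_scaleC)
    then have "(norm (H s))\<^sup>2 \<le> (norm \<xi>)\<^sup>2" by (simp add: power_mono)
    also have "\<dots> \<le> (\<epsilon> + indicator (- U) s) * (norm \<xi>)\<^sup>2"
      using mult_right_mono[of 1 "\<epsilon> + indicator (- U) s" "(norm \<xi>)\<^sup>2"] \<epsilon>(1) False by simp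
    finally show ?thesis .
  qed
  have "vsq H \<le> (LINT s|M. (\<epsilon> + indicator (- U) s) * (norm \<xi>)\<^sup>2)"
    unfolding vsq_def using ind by (intro integral_mono vL2D(3)[OF H] pt) simp
  also have "\<dots> = (\<epsilon> * m + measure M (- U)) * (norm \<xi>)\<^sup>2" using ind Uc by (simp add: m_def mult.commute)
  also have "\<dots> \<le> \<epsilon> * (m + 1) * (norm \<xi>)\<^sup>2"
    using Y(5) by (intro mult_right_mono) (auto simp: U_def algebra_simps)
  finally show ?thesis by (simp add: H_def[abs_def] m_def)
qed

text \<open>The forms of the remainder are controlled by the residuals of the orbits, through
  \<open>cross_resid\<close>. By \<open>resid_finite_rank_bound\<close> these depend on finitely
  many scalar functions common to all \<xi>, since each \<open>\<pi> (- y)\<close> preserves norms;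
  hence the remainder is small in operator norm.\<close>

lemma coeff_op_norm_has_sum:
  assumes ap: "norm_approximable M" and c: "bounded_borel c" "\<And>s. norm (c s) \<le> 1"
  shows "((\<lambda>e. adj (coeff_op c e) * coeff_op c e) has_sum scaleC_bop (sqn c) 1) E"
  unfolding has_sum_def
proof (rule tendstoI)
  fix e :: real assume e: "0 < e"
  define m where "m = measure M UNIV"
  have m: "0 \<le> m" by (simp add: m_def)
  have cm: "sqn c \<le> m"
    unfolding sqn_def m_def using integral_mono[OF L2_square[OF L2_bounded[OF c(1)]], of "\<lambda>_. 1"] c(2) fin
    by (simp add: power_le_one finite_measure.integrable_const)
  \<comment> \<open>Chosen so that \<open>\<kappa> * (m + 1) = \<epsilon> * N\<close>, with \<kappa>
    the residual bound found below and \<open>m + 1\<close> a bound for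
    \<open>sqn c\<close>.\<close>
  define N where "N = (2 * (m + 1) + 1) * (m + 1)"
  have N: "0 < N" using m by (simp add: N_def)
  define \<epsilon> where "\<epsilon> = min 1 (e\<^sup>2 / (2 * N))"
  have \<epsilon>: "0 < \<epsilon>" "\<epsilon> \<le> 1" using e N by (auto simp: \<epsilon>_def)
  have "\<epsilon> * N \<le> e\<^sup>2 / (2 * N) * N" using N by (intro mult_right_mono) (auto simp: \<epsilon>_def)
  also have "\<dots> = e\<^sup>2 / 2" using N by simp
  also have "\<dots> < e\<^sup>2" using e by simp
  finally have \<epsilon>N: "\<epsilon> * N < e\<^sup>2" .
  obtain Y B where Y: "finite Y" "\<forall>y\<in>Y. B y \<in> sets borel" "disjoint_family_on B Y"
    "\<forall>y\<in>Y. \<forall>s\<in>B y. norm (\<pi> s - \<pi> y) \<le> \<epsilon>" "measure M (- (\<Union>y\<in>Y. B y)) \<le> \<epsilon>"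
    using mp[OF spec[OF ap[unfolded norm_approximable_def]] \<epsilon>(1)] by (elim exE conjE)
  define f where "f y s = c s * indicator (B y) s" for y s
  have f: "L2 M (f y)" if "y \<in> Y" for y
    unfolding f_def using Y(2) that by (intro L2_bounded bounded_borel_mult c(1) bounded_borel_indicator) blast
  \<comment> \<open>The factor 1 stands for the squared norms of the vectors
    \<open>app (\<pi> (- y)) \<xi>\<close>, from which the common value
    \<open>(norm \<xi>)\<^sup>2\<close> is taken out.\<close>
  define q where "q J = 2 * (card Y * (\<Sum>y\<in>Y. (sqn (f y) - (\<Sum>e\<in>J. (norm (ip (f y) e))\<^sup>2)) * 1))" for J
  have "(q \<longlongrightarrow> 0) (finite_subsets_at_top E)"
    unfolding q_def by (rule tendsto_residual_sum[OF onb f])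
  then have "\<forall>\<^sub>F J in finite_subsets_at_top E. q J < \<epsilon>" using \<epsilon>(1) by (rule order_tendstoD(2))
  moreover have "\<forall>\<^sub>F J in finite_subsets_at_top E. finite J \<and> J \<subseteq> E"
    by (rule eventually_finite_subsets_at_top_weakI) simp
  ultimately show "\<forall>\<^sub>F J in finite_subsets_at_top E. dist (\<Sum>e\<in>J. adj (coeff_op c e) * coeff_op c e) (scaleC_bop (sqn c) 1) < e"
  proof eventually_elim
    case (elim J)
    then have J: "finite J" "J \<subseteq> E" "q J < \<epsilon>" by auto
    define D where "D = scaleC_bop (sqn c) 1 - (\<Sum>e\<in>J. adj (coeff_op c e) * coeff_op c e)"
    \<comment> \<open>The summand \<open>2 * (m + 1)\<close> comes from the approximation of the
      orbit, the summand 1 from \<open>q J < \<epsilon>\<close>.\<close>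
    define \<kappa> where "\<kappa> = \<epsilon> * (2 * (m + 1) + 1)"
    have \<kappa>: "0 \<le> \<kappa>" using \<epsilon> m by (simp add: \<kappa>_def)
    have res: "vsq (resid J (orbit c \<xi>)) \<le> \<kappa> * (norm \<xi>)\<^sup>2" for \<xi>
    proof -
      have "vsq (resid J (orbit c \<xi>)) \<le> 2 * (\<epsilon> * (m + 1) * (norm \<xi>)\<^sup>2) +
          2 * (card Y * (\<Sum>y\<in>Y. (sqn (f y) - (\<Sum>e\<in>J. (norm (ip (f y) e))\<^sup>2)) * (norm (app (\<pi> (- y)) \<xi>))\<^sup>2))"
        by (rule resid_finite_rank_bound[OF vL2_orbit[OF c(1)] Y(1) f _ ons_E J(1,2)])
          (use vsq_orbit_diff_le[OF c Y \<epsilon>] in \<open>simp_all add: f_def m_def\<close>)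
      also have "\<dots> = 2 * (\<epsilon> * (m + 1) * (norm \<xi>)\<^sup>2) + q J * (norm \<xi>)\<^sup>2"
        unfolding norm_pi q_def sum_distrib_right[symmetric] by (simp add: mult_ac)
      also have "\<dots> \<le> 2 * (\<epsilon> * (m + 1) * (norm \<xi>)\<^sup>2) + \<epsilon> * (norm \<xi>)\<^sup>2"
        using J(3) by (intro add_left_mono mult_right_mono) auto
      also have "\<dots> = \<kappa> * (norm \<xi>)\<^sup>2" by (simp add: \<kappa>_def algebra_simps)
      finally show ?thesis .
    qed
    have Dle: "norm (cinner (app D \<xi>) \<eta>) \<le> sqrt (\<kappa> * (m + 1)) * norm \<xi> * norm \<eta>" for \<xi> \<eta>
    proof -
      have e1: "cinner (orbit c \<xi> s) (orbit c \<eta> s) = (c s * cnj (c s)) * cinner \<xi> \<eta>" for s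
        by (simp add: orbit_def cinner_scaleC_left cinner_scaleC_right)
      have i: "integrable M (\<lambda>s. cinner (orbit c \<xi> s) (orbit c \<eta> s))"
        unfolding e1 by (intro integrable_mult_left L2_product_integrable L2_bounded c(1))
      have "(LINT s|M. cinner (orbit c \<xi> s) (orbit c \<eta> s)) = sqn c * cinner \<xi> \<eta>"
        unfolding e1 using ip_self[of c] by (simp add: ip_def)
      moreover have "(\<Sum>e\<in>J. cinner (app (coeff_op c e) \<xi>) (app (coeff_op c e) \<eta>)) = (\<Sum>e\<in>J. cinner (coeff (orbit c \<xi>) e) (coeff (orbit c \<eta>) e))"
        using J(2) by (intro sum.cong) (auto simp: app_coeff_op[OF c(1)])
      ultimately have "cinner (app D \<xi>) \<eta> = (LINT s|M. cinner (orbit c \<xi> s) (orbit c \<eta> s)) - (\<Sum>e\<in>J. cinner (coeff (orbit c \<xi>) e) (coeff (orbit c \<eta>) e))"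
        by (simp add: D_def app.diff_left app.sum_left cinner.diff_left cinner.sum_left cinner_scaleC_left cinner_adj_left)
      then have "norm (cinner (app D \<xi>) \<eta>) \<le> sqrt (vsq (resid J (orbit c \<xi>))) * sqrt (vsq (orbit c \<eta>))"
        using cross_resid[OF vL2_orbit[OF c(1)] vL2_orbit[OF c(1)] i ons_E J(1,2)] by simp
      also have "\<dots> \<le> sqrt (\<kappa> * (norm \<xi>)\<^sup>2) * sqrt ((m + 1) * (norm \<eta>)\<^sup>2)"
        using res[of \<xi>] cm \<kappa> m sqn_nonneg[of c] by (intro mult_mono real_sqrt_le_mono) (auto simp: vsq_orbit intro!: mult_right_mono)
      also have "\<dots> = sqrt (\<kappa> * (m + 1)) * norm \<xi> * norm \<eta>" by (simp add: real_sqrt_mult)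
      finally show ?thesis .
    qed
    have "norm (app D \<xi>) \<le> sqrt (\<kappa> * (m + 1)) * norm \<xi>" for \<xi>
      using \<kappa> m by (intro norm_leI_cinner[OF Dle]) simp
    then have "norm D \<le> sqrt (\<kappa> * (m + 1))" by (rule norm_bop_leI[rotated]) (use \<kappa> m in simp)
    also have "\<dots> = sqrt (\<epsilon> * N)" by (simp add: \<kappa>_def N_def mult_ac)
    also have "\<dots> < sqrt (e\<^sup>2)" using \<epsilon>N by (simp only: real_sqrt_less_iff)
    finally have "norm D < e" using e by simp
    then show ?case by (simp add: D_def dist_norm norm_minus_commute)
  qed
qed

end

context strongly_continuous_rep
begin

lemma gamma_op_in_Dstar:
  assumes \<mu>: "\<mu> \<in> complex_measures" and ap: "norm_approximable (tv_measure \<mu>)"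
  shows "gamma_op \<mu> \<in> Dstar \<pi> \<otimes>h Dstar \<pi>"
proof (rule gamma_op_family[OF complex_measures_tight[OF \<mu>]])
  fix E h
  let ?c = "rep_l2_basis.coeff_op \<pi> (tv_measure \<mu>)"
  assume b: "rep_l2_basis \<pi> (tv_measure \<mu>) E" and h: "bounded_borel h" "\<And>x. norm (h x) \<le> 1"
    and fam: "\<And>V W. (\<And>e. e \<in> E \<Longrightarrow> adj (?c (\<lambda>s. cnj (h s)) e) \<in> V) \<Longrightarrow> (\<And>e. e \<in> E \<Longrightarrow> ?c (\<lambda>s. 1) e \<in> W) \<Longrightarrow>
      eh_family V W E (\<lambda>e. adj (?c (\<lambda>s. cnj (h s)) e)) (?c (\<lambda>s. 1))
        (scaleC_bop (l2_space.sqn (tv_measure \<mu>) h) 1) (scaleC_bop (measure (tv_measure \<mu>) UNIV) 1) (gamma_op \<mu>)"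
  interpret rep_l2_basis \<pi> "tv_measure \<mu>" E by fact
  note f = fam[OF coeff_op_in_Dstar(1)[OF ap h(1)] coeff_op_in_Dstar(2)[OF ap h(1)]]
  have "bounded_borel (\<lambda>s. cnj (h s))"
    by (rule bounded_borelI[where C = 1], intro borel_measurable_continuous_on[OF _ bounded_borelD[OF h(1)]] continuous_intros)
      (use h(2) in simp)
  then have 1: "(\<lambda>e. adj (?c (\<lambda>s. cnj (h s)) e) * adj (adj (?c (\<lambda>s. cnj (h s)) e))) summable_on E"
    using has_sum_imp_summable[OF coeff_op_norm_has_sum[OF ap, of "\<lambda>s. cnj (h s)"]] h(2) by simp
  have 2: "(\<lambda>e. adj (?c (\<lambda>s. 1) e) * ?c (\<lambda>s. 1) e) summable_on E"
    by (rule has_sum_imp_summable[OF coeff_op_norm_has_sum[OF ap bounded_borelI[where C = 1]]]) auto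
  show ?thesis
  proof (rule eh_family_reindex[OF f])
    fix J :: "'h set" and v w
    assume J: "eh_rep (Dstar \<pi>) (Dstar \<pi>) J v w (scaleC_bop (sqn h) 1) (scaleC_bop (measure (tv_measure \<mu>) UNIV) 1) (gamma_op \<mu>)"
      and v: "(\<lambda>e. adj (?c (\<lambda>s. cnj (h s)) e) * adj (adj (?c (\<lambda>s. cnj (h s)) e))) summable_on E \<Longrightarrow> (\<lambda>i. v i * adj (v i)) summable_on J"
      and w: "(\<lambda>e. adj (?c (\<lambda>s. 1) e) * ?c (\<lambda>s. 1) e) summable_on E \<Longrightarrow> (\<lambda>i. adj (w i) * w i) summable_on J"
    show ?thesis unfolding haagerup_def mem_Collect_eq by (intro exI conjI) (rule J, rule v[OF 1], rule w[OF 2])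
  qed
qed

end

theorem proposition3p5:
  fixes \<pi> :: "'g::{topological_group_add, t2_space} \<Rightarrow> 'h::complex_hilbert bop"
  assumes "locally compact (UNIV :: 'g set)"
    and "unitary_rep \<pi>"
    and "strongly_continuous \<pi>"
  shows
    "(\<forall>\<mu>\<in>complex_measures.
        Gamma_rep \<pi> \<mu> \<in> UNIV \<otimes>eh UNIV \<and>
        (\<forall>X\<in>predual_haagerup.
          has_cm_integral \<mu> (\<lambda>s. eh_pairing (elem_tensor (\<pi> s) (adj (\<pi> s))) X)
            (eh_pairing (Gamma_rep \<pi> \<mu>) X))) \<and>
     ((\<forall>\<mu>\<in>complex_measures. \<forall>\<nu>\<in>complex_measures.
          Gamma_rep \<pi> (\<lambda>E. \<mu> E + \<nu> E) = (\<lambda>x. Gamma_rep \<pi> \<mu> x + Gamma_rep \<pi> \<nu> x)) \<and>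
      (\<forall>c. \<forall>\<mu>\<in>complex_measures.
          Gamma_rep \<pi> (\<lambda>E. c * \<mu> E) = (\<lambda>x. scaleC_bop c (Gamma_rep \<pi> \<mu> x))) \<and>
      (\<forall>\<mu>\<in>complex_measures. \<forall>\<nu>\<in>complex_measures.
          Gamma_rep \<pi> (convolution \<mu> \<nu>) = Gamma_rep \<pi> \<mu> \<circ> Gamma_rep \<pi> \<nu>) \<and>
      (\<forall>\<mu>\<in>complex_measures. eh_norm UNIV UNIV (Gamma_rep \<pi> \<mu>) \<le> cm_norm \<mu>) \<and>
      Gamma_rep \<pi> ` complex_measures \<subseteq> Mstar \<pi> \<otimes>eh Mstar \<pi>) \<and>
     Gamma_rep \<pi> ` L1_measures \<subseteq> Cstar \<pi> \<otimes>eh Cstar \<pi> \<and>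
     Gamma_rep \<pi> ` l1_measures \<subseteq> Dstar \<pi> \<otimes>h Dstar \<pi> \<and>
     (continuous_on UNIV \<pi> \<longrightarrow> Gamma_rep \<pi> ` complex_measures \<subseteq> Dstar \<pi> \<otimes>h Dstar \<pi>)"
proof -
  interpret strongly_continuous_rep \<pi>
    using assms(2,3) by (rule strongly_continuous_rep.intro)
  have T: "cm_tight \<mu>" and F: "cm_finite \<mu>" and G: "Gamma_rep \<pi> \<mu> = gamma_op \<mu>"
    if "\<mu> \<in> complex_measures" for \<mu>
    using complex_measures_tight[OF that] complex_measures_finite[OF that] Gamma_rep_eq by auto
  have 0: "Gamma_rep \<pi> \<mu> \<in> UNIV \<otimes>eh UNIV \<and> (\<forall>X\<in>predual_haagerup.
      has_cm_integral \<mu> (\<lambda>s. eh_pairing (elem_tensor (\<pi> s) (adj (\<pi> s))) X) (eh_pairing (Gamma_rep \<pi> \<mu>) X))"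
    if "\<mu> \<in> complex_measures" for \<mu>
    using is_Gamma_rep_gamma_op[OF T[OF that]] unfolding is_Gamma_rep_def G[OF that] .
  have add: "Gamma_rep \<pi> (\<lambda>E. \<mu> E + \<nu> E) = (\<lambda>x. Gamma_rep \<pi> \<mu> x + Gamma_rep \<pi> \<nu> x)"
    if "\<mu> \<in> complex_measures" "\<nu> \<in> complex_measures" for \<mu> \<nu>
    unfolding Gamma_rep_eq[OF cm_tight_add[OF T[OF that(1)] T[OF that(2)]]] G[OF that(1)] G[OF that(2)]
    by (rule gamma_op_add[OF F[OF that(1)] F[OF that(2)]])
  have scale: "Gamma_rep \<pi> (\<lambda>E. c * \<mu> E) = (\<lambda>x. scaleC_bop c (Gamma_rep \<pi> \<mu> x))"
    if "\<mu> \<in> complex_measures" for c \<mu>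
    unfolding Gamma_rep_eq[OF cm_tight_cmult[OF T[OF that]]] G[OF that] by (rule gamma_op_cmult[OF F[OF that]])
  have conv: "Gamma_rep \<pi> (convolution \<mu> \<nu>) = Gamma_rep \<pi> \<mu> \<circ> Gamma_rep \<pi> \<nu>"
    if "\<mu> \<in> complex_measures" "\<nu> \<in> complex_measures" for \<mu> \<nu>
    unfolding Gamma_rep_eq[OF convolution_tight[OF that]] G[OF that(1)] G[OF that(2)]
    by (rule gamma_op_convolution[OF that])
  have contr: "eh_norm UNIV UNIV (Gamma_rep \<pi> \<mu>) \<le> cm_norm \<mu>" if "\<mu> \<in> complex_measures" for \<mu>
    unfolding G[OF that] by (rule gamma_op_eh_norm(2)[OF T[OF that]])
  have M: "Gamma_rep \<pi> ` complex_measures \<subseteq> Mstar \<pi> \<otimes>eh Mstar \<pi>"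
    by (rule image_subsetI) (simp add: G gamma_op_in_Mstar)
  have C: "Gamma_rep \<pi> ` L1_measures \<subseteq> Cstar \<pi> \<otimes>eh Cstar \<pi>"
  proof (rule image_subsetI)
    fix \<mu> :: "'g set \<Rightarrow> complex" assume \<mu>: "\<mu> \<in> L1_measures"
    then have "\<mu> \<in> complex_measures" by (simp add: L1_measures_def)
    then show "Gamma_rep \<pi> \<mu> \<in> Cstar \<pi> \<otimes>eh Cstar \<pi>" by (simp add: G gamma_op_in_Cstar[OF \<mu>])
  qed
  have l1: "Gamma_rep \<pi> ` l1_measures \<subseteq> Dstar \<pi> \<otimes>h Dstar \<pi>"
  proof (rule image_subsetI)
    fix \<mu> :: "'g set \<Rightarrow> complex" assume \<mu>: "\<mu> \<in> l1_measures"
    then have "\<mu> \<in> complex_measures" by (simp add: l1_measures_def)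
    then show "Gamma_rep \<pi> \<mu> \<in> Dstar \<pi> \<otimes>h Dstar \<pi>"
      by (simp add: G gamma_op_in_Dstar norm_approximable_l1[OF \<mu>])
  qed
  have D: "Gamma_rep \<pi> ` complex_measures \<subseteq> Dstar \<pi> \<otimes>h Dstar \<pi>" if "continuous_on UNIV \<pi>"
  proof (rule image_subsetI)
    fix \<mu> :: "'g set \<Rightarrow> complex" assume \<mu>: "\<mu> \<in> complex_measures"
    have "norm_approximable (tv_measure \<mu>)"
      by (rule norm_approximable_continuous[OF that])
        (use T[OF \<mu>] borel_compact in \<open>unfold cm_tight_def, blast\<close>)
    then show "Gamma_rep \<pi> \<mu> \<in> Dstar \<pi> \<otimes>h Dstar \<pi>" by (simp add: G[OF \<mu>] gamma_op_in_Dstar[OF \<mu>])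
  qed
  show ?thesis
    by (intro conjI ballI allI impI M C l1 D add scale conv contr 0[THEN conjunct1] bspec[OF 0[THEN conjunct2]])
qed

end
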